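(* Let $n\ge 2$. There is a constant $C>0$ such that the following holds. Let $F\in L^1(\mathbb{R}^n;\mathbb{R}^n)$ with $\operatorname{div}F\in L^1(\mathbb{R}^n)$. Then the system $(I-\Delta)U=F$ in $\mathbb{R}^n$ admits a unique solution $U$ such that: (i) if $n=2$, then $$\|U\|_{\infty}+\|\nabla U\|_{2}\le C\,(\|F\|_1+\|\operatorname{div}F\|_1);$$ (ii) if $n\ge 3$, then $$\|U\|_{n/(n-2)}+\|\nabla U\|_{n/(n-1)}\le C\,(\|F\|_1+\|\operatorname{div}F\|_1).$$
   Context: $\|\cdot\|_p$ denotes the $L^p(\mathbb{R}^n)$ norm with respect to Lebesgue measure (for vector- or matrix-valued functions, of the Euclidean norm of the values). $\operatorname{div}F$ is taken in the sense of distributions. The operator $I-\Delta$ acts componentwise on the vector field $U:\mathbb{R}^n\to\mathbb{R}^n$, and the equation is understood in the sense of distributions. *)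

theory Defs
  imports "HOL-Analysis.Analysis" "HOL-Probability.Essential_Supremum"
begin

definition partial_deriv :: "'n \<Rightarrow> (real ^ 'n \<Rightarrow> real) \<Rightarrow> real ^ 'n \<Rightarrow> real" where
  "partial_deriv j f x = frechet_derivative f (at x) (axis j 1)"

definition laplacian :: "(real ^ 'n \<Rightarrow> real) \<Rightarrow> real ^ 'n \<Rightarrow> real" where
  "laplacian f x = (\<Sum>j\<in>UNIV. partial_deriv j (partial_deriv j f) x)"

primrec Ck :: "nat \<Rightarrow> (real ^ 'n \<Rightarrow> real) \<Rightarrow> bool" where
  "Ck 0 f \<longleftrightarrow> continuous_on UNIV f"
| "Ck (Suc k) f \<longleftrightarrow> (\<forall>x. f differentiable (at x)) \<and> (\<forall>j. Ck k (partial_deriv j f))"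

definition test_function :: "(real ^ 'n \<Rightarrow> real) \<Rightarrow> bool" where
  "test_function \<phi> \<longleftrightarrow> (\<forall>k. Ck k \<phi>) \<and> compact (closure (support_on UNIV \<phi>))"

definition locally_integrable ::
    "(real ^ 'n \<Rightarrow> 'b :: {banach, second_countable_topology}) \<Rightarrow> bool" where
  "locally_integrable f \<longleftrightarrow> (\<forall>K. compact K \<longrightarrow> set_integrable lebesgue K f)"

text \<open>
  The distributional notions below concern distributions that are represented by locally integrable
  functions. Local integrability is part of each definition: otherwise an equation between
  integrals could hold only because the integral of a non-integrable function is 0.
\<close>

definition has_distr_div :: "(real ^ 'n \<Rightarrow> real ^ 'n) \<Rightarrow> (real ^ 'n \<Rightarrow> real) \<Rightarrow> bool" where
  "has_distr_div F g \<longleftrightarrow> locally_integrable F \<and> locally_integrable g \<and>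
     (\<forall>\<phi>. test_function \<phi> \<longrightarrow>
        (\<integral>x. F x \<bullet> (\<chi> j. partial_deriv j \<phi> x) \<partial>lebesgue) = - (\<integral>x. g x * \<phi> x \<partial>lebesgue))"

text \<open>The entry \<open>G x $ i $ j\<close> of the gradient is the \<open>j\<close>-th partial derivative of the component
  \<open>U $ i\<close>; the norm of \<open>G x\<close> in \<open>real ^ 'n ^ 'n\<close> is the Euclidean (Frobenius) norm.\<close>

definition has_distr_grad :: "(real ^ 'n \<Rightarrow> real ^ 'n) \<Rightarrow> (real ^ 'n \<Rightarrow> real ^ 'n ^ 'n) \<Rightarrow> bool" where
  "has_distr_grad U G \<longleftrightarrow> locally_integrable U \<and> locally_integrable G \<and>
     (\<forall>\<phi>. test_function \<phi> \<longrightarrow> (\<forall>i j.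
        (\<integral>x. U x $ i * partial_deriv j \<phi> x \<partial>lebesgue) = - (\<integral>x. G x $ i $ j * \<phi> x \<partial>lebesgue)))"

definition solves_system :: "(real ^ 'n \<Rightarrow> real ^ 'n) \<Rightarrow> (real ^ 'n \<Rightarrow> real ^ 'n) \<Rightarrow> bool" where
  "solves_system U F \<longleftrightarrow> locally_integrable U \<and> locally_integrable F \<and>
     (\<forall>\<phi>. test_function \<phi> \<longrightarrow> (\<forall>i.
        (\<integral>x. U x $ i * (\<phi> x - laplacian \<phi> x) \<partial>lebesgue) = (\<integral>x. F x $ i * \<phi> x \<partial>lebesgue)))"

text \<open>The case distinction on the value of the integral is needed because \<open>powr\<close> is not available
  on \<^typ>\<open>ennreal\<close>. Exponents are meant to satisfy \<open>1 \<le> p\<close>.\<close>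

definition Lp_norm :: "ennreal \<Rightarrow> (real ^ 'n \<Rightarrow> 'b :: real_normed_vector) \<Rightarrow> ennreal" where
  "Lp_norm p f =
     (if p = \<infinity> then esssup lebesgue (\<lambda>x. ennreal (norm (f x)))
      else let I = (\<integral>\<^sup>+ x. ennreal (norm (f x) powr enn2real p) \<partial>lebesgue)
           in if I = \<infinity> then \<infinity> else ennreal (enn2real I powr (1 / enn2real p)))"

definition in_Lp :: "ennreal \<Rightarrow> (real ^ 'n \<Rightarrow> 'b :: real_normed_vector) \<Rightarrow> bool" where
  "in_Lp p f \<longleftrightarrow> f \<in> borel_measurable lebesgue \<and> Lp_norm p f < \<infinity>"

end

theory Submission
  imports Defs "HOL-Computational_Algebra.Polynomial" "HOL-Probability.Distributions"
begin

text \<open>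
  The solution is \<open>U = G * F\<close> with \<open>G = \<integral> e\<^sup>-\<^sup>s H\<^sub>s ds\<close>, \<open>H\<^sub>s\<close> the heat kernel. By duality the Lebesgue
  estimates amount to bounding \<open>\<integral> e\<^sup>-\<^sup>s |\<integral> F\<^sub>i (\<kappa>\<^sub>s * h)| ds\<close> for \<open>h\<close> in \<open>L\<^sup>p\<close>, where \<open>\<kappa>\<^sub>s\<close> is \<open>H\<^sub>s\<close>
  (with \<open>p = n/2\<close>) or one of its first derivatives (with \<open>p = n\<close>). Instead of singular integrals this uses
  the integrability of \<open>div F\<close>: on a slice \<open>x\<^sub>i = t\<close> the test function \<open>\<kappa>\<^sub>s * h\<close> may
  be frozen in the variable \<open>x\<^sub>i\<close>, and integrating \<open>F\<^sub>i\<close> against a function of the remaining variables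
  costs at most its size times the mass of \<open>div F\<close> plus its tangential gradient times the mass of \<open>F\<close>.
  On the slice, \<open>\<kappa>\<^sub>s * h\<close> is dominated by a power of \<open>s\<close> times the one-dimensional maximal function of
  \<open>t \<mapsto> \<parallel>h(t, \<cdot>)\<parallel>\<^sub>p\<close>; balancing this bound against the trivial one in the integral over \<open>s\<close> gives the
  critical exponent. In the plane, the sup bound follows by testing the divergence against a primitive
  of \<open>H\<^sub>s\<close> in \<open>x\<^sub>i\<close>, since \<open>\<integral> |h\<^sub>s'(u)| ds\<close> is bounded uniformly in \<open>u\<close> for the one-dimensional
  kernel \<open>h\<^sub>s\<close>. Uniqueness is the maximum principle for mollifications of the difference.
\<close>

section \<open>Test functions\<close>

text \<open>The obstacle is the endpoint: for a general integrable \<open>F\<close> the potentials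
  are only of weak type at these exponents, so \<open>div F\<close> has to pay for the difference.
  Let \<open>A t\<close> be the mass of \<open>F $ i\<close> near the slice, \<open>L\<close> a
  bound for both total masses and \<open>a = 1 / (2 * p)\<close>. The trivial bound of a slice is
  \<open>m t * A t\<close>, the one through the divergence
  \<open>m t * L * (1 + 2 * n * s powr (- 1/2))\<close>, both times \<open>s powr (a - 1)\<close>.
  The relation \<open>n / (2 * p) = 1 - \<gamma>\<close> between the time singularity of the kernel
  and the exponent of \<open>h\<close> makes this power the same for both kernels. Integrating the
  smaller bound in \<open>s\<close> leaves \<open>A t powr (1 - 1 / p) * L powr (1 / p)\<close>, and
  Hoelder in \<open>t\<close> against the maximal function returns exactly one power of
  \<open>L\<close>. The condition \<open>p > 1\<close> enters twice, in the maximal theorem and as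
  \<open>a < 1 / 2\<close>. It holds for \<open>p = n\<close> as soon as \<open>n \<ge> 2\<close>,
  but for \<open>p = n / 2\<close> only if \<open>n \<ge> 3\<close>; hence the separate argument in
  the plane. An integrable field has no trace on a given slice, so slices are averaged with a Cauchy
  density of width \<open>e\<close>. All bounds are uniform in \<open>e\<close>, and Fatou removes
  the averaging.\<close>

definition grad :: "(real ^ 'n \<Rightarrow> real) \<Rightarrow> real ^ 'n \<Rightarrow> real ^ 'n" where
  "grad f x = (\<chi> j. partial_deriv j f x)"

lemma has_derivative_grad:
  fixes f :: "real ^ 'n \<Rightarrow> real"
  assumes "f differentiable (at x)"
  shows "(f has_derivative (\<lambda>v. grad f x \<bullet> v)) (at x)"
proof -
  let ?f' = "frechet_derivative f (at x)"
  have d: "(f has_derivative ?f') (at x)"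
    using assms frechet_derivative_works by blast
  then have lin: "linear ?f'"
    by (rule has_derivative_linear)
  have "?f' v = grad f x \<bullet> v" for v
  proof -
    have "?f' v = ?f' (\<Sum>j\<in>UNIV. (v $ j) *\<^sub>R axis j 1)"
      by (simp add: basis_expansion flip: scalar_mult_eq_scaleR)
    also have "\<dots> = (\<Sum>j\<in>UNIV. (v $ j) * ?f' (axis j 1))"
      by (simp add: linear_sum[OF lin] linear_cmul[OF lin])
    also have "\<dots> = grad f x \<bullet> v"
      by (simp add: grad_def partial_deriv_def inner_vec_def mult.commute)
    finally show ?thesis .
  qed
  then have "?f' = (\<lambda>v. grad f x \<bullet> v)" by blast
  then show ?thesis
    using d by simp
qed

lemma grad_unique:
  assumes "(f has_derivative (\<lambda>v. D \<bullet> v)) (at x)"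
  shows "grad f x = D"
  by (simp add: vec_eq_iff grad_def partial_deriv_def inner_axis
      flip: frechet_derivative_at[OF assms])

lemma partial_deriv_grad: "partial_deriv j f x = grad f x $ j"
  by (simp add: grad_def)

lemma partial_deriv_unique:
  assumes "(f has_derivative (\<lambda>v. D \<bullet> v)) (at x)"
  shows "partial_deriv j f x = D $ j"
  by (simp add: partial_deriv_grad grad_unique[OF assms])

lemma Ck_SucD: "Ck (Suc k) f \<Longrightarrow> Ck k f"
proof (induction k arbitrary: f)
  case 0
  then show ?case
    by (auto intro!: continuous_at_imp_continuous_on differentiable_imp_continuous_within)
next
  case (Suc k)
  then show ?case
    by (metis Ck.simps(2))
qed

lemma Ck_continuous: "Ck k f \<Longrightarrow> continuous_on UNIV f"
  by (induction k) (use Ck_SucD in auto)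

lemma Ck_const: "Ck k (\<lambda>x. c)"
proof (induction k arbitrary: c)
  case (Suc k)
  have "partial_deriv j (\<lambda>x::real^'a. c) = (\<lambda>x. 0)" for j
    by (simp add: partial_deriv_def fun_eq_iff)
  with Suc show ?case by simp
qed simp

lemma Ck_add:
  assumes "Ck k f" "Ck k g"
  shows "Ck k (\<lambda>x. f x + g x)"
  using assms
proof (induction k arbitrary: f g)
  case (Suc k)
  have *: "partial_deriv j (\<lambda>x. f x + g x) = (\<lambda>x. partial_deriv j f x + partial_deriv j g x)" for j
  proof
    fix x
    have "((\<lambda>x. f x + g x) has_derivative (\<lambda>v. (grad f x + grad g x) \<bullet> v)) (at x)"
      using Suc.prems
      by (auto intro!: derivative_eq_intros has_derivative_grad simp: inner_add_left)
    from partial_deriv_unique[OF this]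
    show "partial_deriv j (\<lambda>x. f x + g x) x = partial_deriv j f x + partial_deriv j g x"
      by (simp add: grad_def)
  qed
  show ?case
    using Suc by (simp add: *)
qed (simp add: continuous_on_add)

lemma has_derivative_mult_grad:
  assumes "f differentiable (at x)" "g differentiable (at x)"
  shows "((\<lambda>x. f x * g x) has_derivative (\<lambda>v. (f x *\<^sub>R grad g x + g x *\<^sub>R grad f x) \<bullet> v)) (at x)"
  using assms
  by (auto intro!: derivative_eq_intros has_derivative_grad simp: inner_add_left)

lemma partial_deriv_mult:
  assumes "f differentiable (at x)" "g differentiable (at x)"
  shows "partial_deriv j (\<lambda>x. f x * g x) x = f x * partial_deriv j g x + g x * partial_deriv j f x"
  using partial_deriv_unique[OF has_derivative_mult_grad[OF assms]]
  by (simp add: grad_def)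

lemma Ck_mult:
  assumes "Ck k f" "Ck k g"
  shows "Ck k (\<lambda>x. f x * g x)"
  using assms
proof (induction k arbitrary: f g)
  case (Suc k)
  have "partial_deriv j (\<lambda>x. f x * g x) =
      (\<lambda>x. f x * partial_deriv j g x + g x * partial_deriv j f x)" for j
    using Suc.prems by (auto simp: partial_deriv_mult)
  moreover have "Ck k (\<lambda>x. f x * partial_deriv j g x + g x * partial_deriv j f x)" for j
    using Suc.prems Ck_SucD[OF Suc.prems(1)] Ck_SucD[OF Suc.prems(2)]
    by (intro Ck_add Suc.IH) simp_all
  ultimately show ?case
    using Suc.prems by simp
qed (simp add: continuous_on_mult)

lemma Ck_prod:
  assumes "\<And>i. i \<in> I \<Longrightarrow> Ck k (f i)"
  shows "Ck k (\<lambda>x. \<Prod>i\<in>I. f i x)"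
  using assms
  by (induction I rule: infinite_finite_induct) (auto intro: Ck_const Ck_mult)

lemma has_derivative_affine_grad:
  fixes f :: "real ^ 'n \<Rightarrow> real"
  assumes "f differentiable (at (c *\<^sub>R x + a))"
  shows "((\<lambda>x. f (c *\<^sub>R x + a)) has_derivative (\<lambda>v. (c *\<^sub>R grad f (c *\<^sub>R x + a)) \<bullet> v)) (at x)"
proof -
  have "((f \<circ> (\<lambda>x. c *\<^sub>R x + a)) has_derivative (\<lambda>v. grad f (c *\<^sub>R x + a) \<bullet> v) \<circ> (\<lambda>v. c *\<^sub>R v)) (at x)"
    by (rule diff_chain_at) (auto intro!: derivative_eq_intros has_derivative_grad assms)
  then show ?thesis by (simp add: o_def)
qed

lemma partial_deriv_affine:
  fixes f :: "real ^ 'n \<Rightarrow> real"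
  assumes "f differentiable (at (c *\<^sub>R x + a))"
  shows "partial_deriv j (\<lambda>x. f (c *\<^sub>R x + a)) x = c * partial_deriv j f (c *\<^sub>R x + a)"
  using partial_deriv_unique[OF has_derivative_affine_grad[OF assms]] by (simp add: grad_def)

lemma Ck_affine:
  fixes f :: "real ^ 'n \<Rightarrow> real"
  assumes "Ck k f"
  shows "Ck k (\<lambda>x. f (c *\<^sub>R x + a))"
  using assms
proof (induction k arbitrary: f)
  case 0
  then show ?case
    by (auto intro!: continuous_intros intro: continuous_on_compose2)
next
  case (Suc k)
  have "partial_deriv j (\<lambda>x. f (c *\<^sub>R x + a)) = (\<lambda>x. c * partial_deriv j f (c *\<^sub>R x + a))" for j
    using Suc.prems by (auto simp: partial_deriv_affine)
  moreover have "(\<lambda>x. f (c *\<^sub>R x + a)) differentiable (at x)" for x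
    using Suc.prems has_derivative_affine_grad[of f c x a] by (auto simp: differentiable_def)
  ultimately show ?case
    using Suc by (auto intro!: Ck_mult Ck_const)
qed

section \<open>Functions of one coordinate and smooth bumps on boxes\<close>

lemma has_derivative_coord:
  assumes "(e has_real_derivative e') (at (x $ j))"
  shows "((\<lambda>x::real^'n. e (x $ j)) has_derivative (\<lambda>v. (e' *\<^sub>R axis j 1) \<bullet> v)) (at x)"
proof -
  have "((e \<circ> (\<lambda>x. x $ j)) has_derivative (\<lambda>v. e' * v) \<circ> (\<lambda>v::real^'n. v $ j)) (at x)"
    by (rule diff_chain_at)
      (use assms in \<open>auto simp: has_field_derivative_def intro!: bounded_linear_imp_has_derivative bounded_linear_vec_nth\<close>)
  then show ?thesis
    by (simp add: o_def inner_axis')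
qed

text \<open>The whole sequence of derivatives is given at once: a partial derivative of
  \<open>e m (x $ j)\<close> is either 0 or \<open>e (Suc m) (x $ j)\<close>, so the induction on
  \<open>k\<close> has to leave \<open>m\<close> free.\<close>

lemma Ck_coord:
  assumes "\<And>m x. (e m has_real_derivative e (Suc m) x) (at x)"
  shows "Ck k (\<lambda>x::real^'n. e m (x $ j))"
proof (induction k arbitrary: m)
  case 0
  have "continuous_on UNIV (e m)"
    using assms by (meson DERIV_continuous_on has_field_derivative_at_within)
  then show ?case
    by (auto intro!: continuous_intros intro: continuous_on_compose2)
next
  case (Suc k)
  note d = has_derivative_coord[OF assms]
  have "partial_deriv l (\<lambda>x::real^'n. e m (x $ j)) = (\<lambda>x. (if l = j then 1 else 0) * e (Suc m) (x $ j))" for l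
    by (auto simp: partial_deriv_unique[OF d] axis_def)
  moreover have "(\<lambda>x::real^'n. e m (x $ j)) differentiable (at x)" for x
    using d differentiable_def by blast
  ultimately show ?case
    by (auto intro!: Ck_mult Ck_const Suc)
qed

text \<open>A class of functions that contains the standard flat function
  \<open>exp (- 1 / x)\<close>, continued by 0, and is closed under differentiation.\<close>

definition flat_exp :: "real poly \<Rightarrow> real \<Rightarrow> real" where
  "flat_exp q x = (if x > 0 then poly q (1 / x) * exp (- 1 / x) else 0)"

lemma poly_exp_neg_tendsto_0: "((\<lambda>y. poly q y * exp (- y)) \<longlongrightarrow> (0::real)) at_top"
proof -
  have "((\<lambda>y. \<Sum>i\<le>degree q. coeff q i * (y ^ i / exp y)) \<longlongrightarrow> (\<Sum>i\<le>degree q. coeff q i * 0)) at_top"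
    by (intro tendsto_intros tendsto_power_div_exp_0)
  then show ?thesis
    by (simp add: poly_altdef sum_distrib_right exp_minus divide_inverse mult.assoc)
qed

lemma flat_exp_tendsto_0: "(flat_exp q \<longlongrightarrow> 0) (at 0)"
proof -
  have "((\<lambda>x. poly q (1 / x) * exp (- 1 / x)) \<longlongrightarrow> 0) (at_right 0)"
    using filterlim_compose[OF poly_exp_neg_tendsto_0[of q] filterlim_inverse_at_top_right]
    by (simp add: divide_inverse)
  then have "(flat_exp q \<longlongrightarrow> 0) (at_right 0)"
    by (rule Lim_transform_eventually)
      (auto simp: flat_exp_def eventually_at_filter intro!: always_eventually)
  moreover have "(flat_exp q \<longlongrightarrow> 0) (at_left 0)"
    by (rule Lim_transform_eventually[OF tendsto_const])
      (auto simp: flat_exp_def eventually_at_filter intro!: always_eventually)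
  ultimately show ?thesis
    by (simp add: filterlim_at_split)
qed

text \<open>With \<open>y = 1 / x\<close>, the derivative of \<open>q(y) exp (- y)\<close> in
  \<open>x\<close> is \<open>y^2 (q(y) - q'(y)) exp (- y)\<close>, and \<open>[:0, 0, 1:]\<close> is
  \<open>y^2\<close>. At the origin the difference quotient is again in the class, with
  \<open>q\<close> multiplied by \<open>y\<close>, and tends to 0.\<close>

lemma flat_exp_deriv:
  "(flat_exp q has_real_derivative flat_exp ([:0, 0, 1:] * (q - pderiv q)) x) (at x)"
proof -
  consider "x > 0" | "x < 0" | "x = 0" by linarith
  then show ?thesis
  proof cases
    case 1
    have "((\<lambda>x. poly q (1 / x) * exp (- 1 / x)) has_real_derivative
        flat_exp ([:0, 0, 1:] * (q - pderiv q)) x) (at x)"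
      using 1
      by (auto intro!: derivative_eq_intros DERIV_chain'[OF _ poly_DERIV]
          simp: flat_exp_def field_simps power2_eq_square)
    then show ?thesis
      by (rule has_field_derivative_transform_within_open[of _ _ _ "{0<..}"])
        (use 1 in \<open>auto simp: flat_exp_def\<close>)
  next
    case 2
    have "((\<lambda>x. 0) has_real_derivative flat_exp ([:0, 0, 1:] * (q - pderiv q)) x) (at x)"
      using 2 by (auto simp: flat_exp_def)
    then show ?thesis
      by (rule has_field_derivative_transform_within_open[of _ _ _ "{..<0}"])
        (use 2 in \<open>auto simp: flat_exp_def\<close>)
  next
    case 3
    have "(flat_exp q y - flat_exp q 0) / (y - 0) = flat_exp ([:0, 1:] * q) y" for y
      by (auto simp: flat_exp_def)
    then show ?thesis
      using flat_exp_tendsto_0[of "[:0,1:] * q"]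
      by (simp add: 3 has_field_derivative_iff flat_exp_def[of _ 0])
  qed
qed

text \<open>The derivatives of the flat function, listed explicitly in the form that
  \<open>Ck_coord\<close> asks for.\<close>

definition flat_exp_seq :: "nat \<Rightarrow> real \<Rightarrow> real" where
  "flat_exp_seq m = flat_exp (((\<lambda>q. [:0, 0, 1:] * (q - pderiv q)) ^^ m) 1)"

lemma flat_exp_seq_deriv: "(flat_exp_seq m has_real_derivative flat_exp_seq (Suc m) x) (at x)"
  unfolding flat_exp_seq_def using flat_exp_deriv by simp

lemma flat_exp_seq_0: "flat_exp_seq 0 x = (if x > 0 then exp (- 1 / x) else 0)"
  by (simp add: flat_exp_seq_def flat_exp_def)

abbreviation flat :: "real \<Rightarrow> real" where
  "flat \<equiv> flat_exp_seq 0"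

lemma flat_bounds: "0 \<le> flat x" "flat x \<le> 1" "flat x > 0 \<longleftrightarrow> x > 0" "flat x = 0 \<longleftrightarrow> x \<le> 0"
  by (auto simp: flat_exp_seq_0)

lemma flat_affine_derivs:
  "((\<lambda>x. c ^ m * flat_exp_seq m (c * x + a)) has_real_derivative
    c ^ Suc m * flat_exp_seq (Suc m) (c * x + a)) (at x)"
  by (auto intro!: derivative_eq_intros DERIV_chain'[OF _ flat_exp_seq_deriv])

lemma Ck_flat_coord: "Ck k (\<lambda>x::real^'n. flat (c * x $ j + a))"
  using Ck_coord[where e = "\<lambda>m x. c ^ m * flat_exp_seq m (c * x + a)" and m = 0] flat_affine_derivs by simp

text \<open>The steepness \<open>c\<close> does not change where the bump is positive, which is the
  open box, while for \<open>c\<close> tending to infinity its values there tend to 1. One family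
  thus serves for mollifiers, for cutoffs and for approximating indicators of boxes.\<close>

definition box_bump :: "real \<Rightarrow> real ^ 'n \<Rightarrow> real ^ 'n \<Rightarrow> real ^ 'n \<Rightarrow> real" where
  "box_bump c a b x = (\<Prod>j\<in>UNIV. flat (c * x $ j - c * a $ j) * flat (c * b $ j - c * x $ j))"

lemma Ck_box_bump: "Ck k (box_bump c a b)"
proof -
  have "Ck k (\<lambda>x. \<Prod>j\<in>UNIV. flat (c * x $ j + - (c * a $ j)) * flat (- c * x $ j + c * b $ j))"
    by (intro Ck_prod Ck_mult Ck_flat_coord)
  then show ?thesis
    by (simp add: box_bump_def[abs_def] algebra_simps)
qed

lemma box_bump_bounds: "0 \<le> box_bump c a b x" "box_bump c a b x \<le> 1"
  by (auto simp: box_bump_def intro!: prod_nonneg prod_le_1 mult_nonneg_nonneg mult_le_one flat_bounds)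

lemma box_bump_pos_iff: "c > 0 \<Longrightarrow> box_bump c a b x > 0 \<longleftrightarrow> x \<in> box a b"
proof -
  assume c: "c > 0"
  have "box_bump c a b x > 0 \<longleftrightarrow> box_bump c a b x \<noteq> 0"
    using box_bump_bounds(1)[of c a b x] by linarith
  also have "\<dots> \<longleftrightarrow> (\<forall>j. a $ j < x $ j \<and> x $ j < b $ j)"
    using c by (auto simp: box_bump_def flat_bounds not_le)
  finally show ?thesis
    by (simp add: mem_box_cart)
qed

section \<open>Test functions: support, bounds and closure properties\<close>

lemma support_on_UNIV: "support_on UNIV f = {x. f x \<noteq> 0}"
  by (auto simp: support_on_def)

lemma test_functionI:
  assumes "\<And>k. Ck k \<phi>" "\<And>x. \<phi> x \<noteq> 0 \<Longrightarrow> norm x \<le> R"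
  shows "test_function \<phi>"
proof -
  have "bounded (support_on UNIV \<phi>)"
    unfolding support_on_UNIV bounded_iff using assms(2) by blast
  then show ?thesis
    using assms(1) by (simp add: test_function_def)
qed

lemma test_function_support:
  assumes "test_function \<phi>"
  obtains R where "R > 0" "\<And>x. norm x > R \<Longrightarrow> \<phi> x = 0"
proof -
  have "bounded (support_on UNIV \<phi>)"
    using assms by (simp add: test_function_def)
  then obtain R where R: "R > 0" "\<And>x. \<phi> x \<noteq> 0 \<Longrightarrow> norm x \<le> R"
    unfolding support_on_UNIV bounded_pos by auto
  then show ?thesis
    using that[of R] by (meson not_le)
qed

lemma test_function_Ck: "test_function \<phi> \<Longrightarrow> Ck k \<phi>"
  by (simp add: test_function_def)

lemma test_function_differentiable: "test_function \<phi> \<Longrightarrow> \<phi> differentiable (at x)"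
  using test_function_Ck[of \<phi> 1] by simp

lemma test_function_continuous: "test_function \<phi> \<Longrightarrow> continuous_on UNIV \<phi>"
  using test_function_Ck[of \<phi> 0] by simp

lemma partial_deriv_eq_0_outside:
  fixes f :: "real ^ 'n \<Rightarrow> real"
  assumes "\<And>x. norm x > R \<Longrightarrow> f x = 0" "norm x > R"
  shows "partial_deriv j f x = 0"
proof -
  have o: "open {x::real^'n. norm x > R}"
    by (intro open_Collect_less continuous_intros)
  have d: "((\<lambda>x::real^'n. 0::real) has_derivative (\<lambda>v. 0 \<bullet> v)) (at x)"
    by simp
  have "(f has_derivative (\<lambda>v. 0 \<bullet> v)) (at x)"
    by (rule has_derivative_transform_within_open[OF d o]) (use assms in simp_all)
  from partial_deriv_unique[OF this] show ?thesis by simp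
qed

lemma test_function_partial_deriv:
  assumes "test_function \<phi>"
  shows "test_function (partial_deriv j \<phi>)"
proof -
  obtain R where R: "\<And>x. norm x > R \<Longrightarrow> \<phi> x = 0"
    using test_function_support[OF assms] by metis
  show ?thesis
  proof (rule test_functionI)
    show "Ck k (partial_deriv j \<phi>)" for k
      using test_function_Ck[OF assms, of "Suc k"] by simp
    show "norm x \<le> R" if "partial_deriv j \<phi> x \<noteq> 0" for x
      using partial_deriv_eq_0_outside[of R \<phi> x j] R that by (meson not_le)
  qed
qed

lemma test_function_mult:
  assumes "test_function \<phi>" "\<And>k. Ck k f"
  shows "test_function (\<lambda>x. \<phi> x * f x)"
proof -
  obtain R where R: "\<And>x. norm x > R \<Longrightarrow> \<phi> x = 0"
    using test_function_support[OF assms(1)] by metis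
  show ?thesis
  proof (rule test_functionI)
    show "norm x \<le> R" if "\<phi> x * f x \<noteq> 0" for x
      using R[of x] that by (cases "norm x > R") auto
  qed (intro Ck_mult test_function_Ck assms)
qed

lemma test_function_affine:
  fixes \<phi> :: "real ^ 'n \<Rightarrow> real"
  assumes "test_function \<phi>" "c \<noteq> 0"
  shows "test_function (\<lambda>x. \<phi> (c *\<^sub>R x + a))"
proof -
  obtain R where R: "\<And>x. norm x > R \<Longrightarrow> \<phi> x = 0"
    using test_function_support[OF assms(1)] by metis
  show ?thesis
  proof (rule test_functionI)
    show "Ck k (\<lambda>x. \<phi> (c *\<^sub>R x + a))" for k
      using assms by (intro Ck_affine test_function_Ck)
    fix x assume "\<phi> (c *\<^sub>R x + a) \<noteq> 0"
    then have "norm (c *\<^sub>R x + a) \<le> R"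
      using R not_le by blast
    then have "\<bar>c\<bar> * norm x \<le> R + norm a"
      using norm_triangle_ineq2[of "c *\<^sub>R x" "- a"] by simp
    then show "norm x \<le> (R + norm a) / \<bar>c\<bar>"
      using assms(2) by (simp add: field_simps)
  qed
qed

lemma test_function_box_bump:
  assumes "c > 0"
  shows "test_function (box_bump c a b)"
proof -
  obtain R where R: "\<And>x. x \<in> box a b \<Longrightarrow> norm x \<le> R"
    using bounded_box[of a b] unfolding bounded_iff by blast
  show ?thesis
  proof (rule test_functionI)
    show "norm x \<le> R" if "box_bump c a b x \<noteq> 0" for x
      using R box_bump_pos_iff[OF assms, of a b x] box_bump_bounds(1)[of c a b x] that by force
  qed (rule Ck_box_bump)
qed

lemma continuous_compact_support_bounded:
  fixes f :: "'a::euclidean_space \<Rightarrow> 'b::real_normed_vector"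
  assumes "continuous_on UNIV f" "\<And>x. norm x > R \<Longrightarrow> f x = 0"
  obtains B where "B > 0" "\<And>x. norm (f x) \<le> B"
proof -
  have "compact (f ` cball 0 R)"
    by (intro compact_continuous_image continuous_on_subset[OF assms(1)]) auto
  then obtain B where B: "B > 0" "\<And>y. y \<in> f ` cball 0 R \<Longrightarrow> norm y \<le> B"
    using compact_imp_bounded bounded_pos by metis
  have "norm (f x) \<le> B" for x
    using B(1) B(2)[of "f x"] assms(2)[of x] by (cases "norm x > R") auto
  with B(1) that show ?thesis by blast
qed

lemma test_function_bounded:
  assumes "test_function \<phi>"
  obtains B where "B > 0" "\<And>x. \<bar>\<phi> x\<bar> \<le> B"
proof -
  obtain R where R: "\<And>x. norm x > R \<Longrightarrow> \<phi> x = 0"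
    using test_function_support[OF assms] by metis
  show ?thesis
    using continuous_compact_support_bounded[OF test_function_continuous[OF assms] R] that
    by (metis real_norm_def)
qed

lemma test_function_grad_continuous:
  assumes "test_function \<phi>"
  shows "continuous_on UNIV (grad \<phi>)"
  unfolding grad_def[abs_def]
  by (intro continuous_on_vec_lambda test_function_continuous test_function_partial_deriv assms)

lemma test_function_grad_bounded:
  assumes "test_function \<phi>"
  obtains B where "B > 0" "\<And>x. norm (grad \<phi> x) \<le> B"
proof -
  obtain R where R: "\<And>x. norm x > R \<Longrightarrow> \<phi> x = 0"
    using test_function_support[OF assms] by metis
  have "grad \<phi> x = 0" if "norm x > R" for x
    using partial_deriv_eq_0_outside[OF R that] by (simp add: grad_def vec_eq_iff)
  then show ?thesis
    using continuous_compact_support_bounded[OF test_function_grad_continuous[OF assms]] that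
    by metis
qed

lemma test_function_integrable:
  assumes "test_function \<phi>"
  shows "integrable lborel \<phi>"
proof -
  obtain R where R: "\<And>x. norm x > R \<Longrightarrow> \<phi> x = 0"
    using test_function_support[OF assms] by metis
  have "set_integrable lborel (cball 0 R) \<phi>"
    unfolding set_integrable_def
    by (intro borel_integrable_compact continuous_on_subset[OF test_function_continuous[OF assms]]) auto
  moreover have "(\<lambda>x. indicator (cball 0 R) x *\<^sub>R \<phi> x) = \<phi>"
    using R by (auto simp: fun_eq_iff indicator_def)
  ultimately show ?thesis
    by (simp add: set_integrable_def)
qed

section \<open>Convolution and mollification\<close>

text \<open>The sign \<open>c\<close> treats translations and the reflections \<open>x - y\<close>
  of a convolution together.\<close>

lemma lborel_distr_isometry:
  assumes "\<bar>c\<bar> = 1"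
  shows "distr lborel borel (\<lambda>x::'a::euclidean_space. t + c *\<^sub>R x) = lborel"
  using lborel_affine[of c t] assms by (simp add: density_1 split: if_splits)

lemma nn_integral_isometry:
  fixes f :: "'a::euclidean_space \<Rightarrow> ennreal"
  assumes "f \<in> borel_measurable borel" "\<bar>c\<bar> = 1"
  shows "(\<integral>\<^sup>+x. f (t + c *\<^sub>R x) \<partial>lborel) = (\<integral>\<^sup>+x. f x \<partial>lborel)"
  by (subst (2) lborel_distr_isometry[OF assms(2), of t, symmetric])
    (use assms(1) in \<open>simp add: nn_integral_distr\<close>)

lemma integral_isometry:
  fixes f :: "'a::euclidean_space \<Rightarrow> 'b::{banach, second_countable_topology}"
  assumes "f \<in> borel_measurable borel" "\<bar>c\<bar> = 1"
  shows "(\<integral>x. f (t + c *\<^sub>R x) \<partial>lborel) = (\<integral>x. f x \<partial>lborel)"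
  by (subst (2) lborel_distr_isometry[OF assms(2), of t, symmetric])
    (use assms(1) in \<open>simp add: integral_distr\<close>)

lemma integrable_isometry:
  fixes f :: "'a::euclidean_space \<Rightarrow> 'b::{banach, second_countable_topology}"
  assumes "f \<in> borel_measurable borel" "\<bar>c\<bar> = 1"
  shows "integrable lborel (\<lambda>x. f (t + c *\<^sub>R x)) \<longleftrightarrow> integrable lborel f"
  by (subst (2) lborel_distr_isometry[OF assms(2), of t, symmetric])
    (use assms(1) in \<open>simp add: integrable_distr_eq\<close>)

lemma
  fixes f :: "'a::euclidean_space \<Rightarrow> 'b::{banach, second_countable_topology}"
  assumes "f \<in> borel_measurable borel"
  shows integral_shift: "(\<integral>x. f (x + t) \<partial>lborel) = (\<integral>x. f x \<partial>lborel)"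
    and integrable_shift: "integrable lborel (\<lambda>x. f (x + t)) \<longleftrightarrow> integrable lborel f"
  using integral_isometry[OF assms, of 1 t] integrable_isometry[OF assms, of 1 t]
  by (simp_all add: add.commute)

lemma nn_integral_shift:
  fixes f :: "'a::euclidean_space \<Rightarrow> ennreal"
  assumes "f \<in> borel_measurable borel"
  shows "(\<integral>\<^sup>+x. f (x + t) \<partial>lborel) = (\<integral>\<^sup>+x. f x \<partial>lborel)"
  using nn_integral_isometry[OF assms, of 1 t] by (simp add: add.commute)

lemmas
  nn_integral_reflect = nn_integral_isometry[where c = "-1", simplified] and
  integral_reflect = integral_isometry[where c = "-1", simplified] and
  integrable_reflect = integrable_isometry[where c = "-1", simplified]

lemma integrable_pairI:
  fixes f :: "'a::euclidean_space \<Rightarrow> 'b::euclidean_space \<Rightarrow> 'c::{banach, second_countable_topology}"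
  assumes "case_prod f \<in> borel_measurable (lborel \<Otimes>\<^sub>M lborel)"
    and "(\<integral>\<^sup>+x. \<integral>\<^sup>+y. ennreal (norm (f x y)) \<partial>lborel \<partial>lborel) < \<infinity>"
  shows "integrable (lborel \<Otimes>\<^sub>M lborel) (case_prod f)"
proof (rule integrableI_bounded[OF assms(1)])
  have [measurable]: "(\<lambda>p. f (fst p) (snd p)) \<in> borel_measurable (lborel \<Otimes>\<^sub>M lborel)"
    using assms(1) by (simp add: case_prod_beta')
  have "(\<integral>\<^sup>+p. ennreal (norm (case p of (x, y) \<Rightarrow> f x y)) \<partial>(lborel \<Otimes>\<^sub>M lborel)) =
      (\<integral>\<^sup>+x. \<integral>\<^sup>+y. ennreal (norm (f x y)) \<partial>lborel \<partial>lborel)"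
    by (subst lborel.nn_integral_fst[symmetric]) (auto simp: case_prod_beta')
  with assms(2) show "(\<integral>\<^sup>+p. ennreal (norm (case p of (x, y) \<Rightarrow> f x y)) \<partial>(lborel \<Otimes>\<^sub>M lborel)) < \<infinity>"
    by simp
qed

lemma integrable_bounded_mult:
  fixes f g :: "'a \<Rightarrow> real"
  assumes "integrable M f" "g \<in> borel_measurable M" "\<And>x. \<bar>g x\<bar> \<le> B"
  shows "integrable M (\<lambda>x. g x * f x)"
proof (rule Bochner_Integration.integrable_bound[of M "\<lambda>x. B * norm (f x)"])
  show "AE x in M. norm (g x * f x) \<le> norm (B * norm (f x))"
    using assms(3) by (auto simp: abs_mult intro!: mult_mono AE_I2 intro: order_trans[OF _ abs_ge_self])
qed (use assms in auto)

lemma integrable_bounded_mult':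
  fixes f g :: "'a \<Rightarrow> real"
  assumes "integrable M f" "g \<in> borel_measurable M" "\<And>x. \<bar>g x\<bar> \<le> B"
  shows "integrable M (\<lambda>x. f x * g x)"
  using integrable_bounded_mult[OF assms] by (simp add: mult.commute)

lemma has_derivative_imp_borel_measurable:
  fixes f :: "real ^ 'n \<Rightarrow> real"
  assumes "\<And>x. (f has_derivative (\<lambda>v. D x \<bullet> v)) (at x)"
  shows "f \<in> borel_measurable borel"
  by (intro borel_measurable_continuous_onI continuous_at_imp_continuous_on)
    (use assms has_derivative_continuous in blast)

lemma DERIV_along_line:
  fixes f :: "real ^ 'n \<Rightarrow> real"
  assumes "\<And>x. (f has_derivative (\<lambda>v. D x \<bullet> v)) (at x)"
  shows "((\<lambda>t. f (x + t *\<^sub>R v)) has_real_derivative (D (x + t *\<^sub>R v) \<bullet> v)) (at t)"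
proof -
  have 1: "((\<lambda>t. x + t *\<^sub>R v) has_derivative (\<lambda>s. s *\<^sub>R v)) (at t)"
    by (rule has_derivative_eq_rhs, (rule derivative_intros)+) simp
  have "((f \<circ> (\<lambda>t. x + t *\<^sub>R v)) has_derivative
      ((\<lambda>w. D (x + t *\<^sub>R v) \<bullet> w) \<circ> (\<lambda>s. s *\<^sub>R v))) (at t)"
    by (rule diff_chain_at[OF 1 assms])
  then show ?thesis
    by (simp add: o_def has_field_derivative_def mult_commute_abs)
qed

text \<open>The integral of the derivative is the average over \<open>[0, 1]\<close> of translated difference quotients,
  each of which integrates to 0.\<close>

lemma integral_partial_deriv_eq_0:
  fixes f :: "real ^ 'n \<Rightarrow> real"
  assumes d: "\<And>x. (f has_derivative (\<lambda>v. D x \<bullet> v)) (at x)"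
    and cont: "continuous_on UNIV D"
    and int: "integrable lborel f" "integrable lborel (\<lambda>x. D x $ j)"
  shows "(\<integral>x. D x $ j \<partial>lborel) = 0"
proof -
  let ?e = "axis j 1 :: real ^ 'n"
  have [measurable]: "D \<in> borel_measurable borel" "f \<in> borel_measurable borel"
    using cont d by (auto intro: borel_measurable_continuous_onI has_derivative_imp_borel_measurable)
  have comp [measurable]: "(\<lambda>x. D x $ j) \<in> borel_measurable borel"
    by (intro borel_measurable_continuous_onI continuous_intros cont)
  have Dc: "isCont D x" for x
    using cont by (simp add: continuous_on_eq_continuous_at)
  have ftc: "(\<integral>t. (D (x + t *\<^sub>R ?e) $ j) * indicator {0..1} t \<partial>lborel) = f (x + ?e) - f x" for x
  proof -
    have "(\<integral>t. (D (x + t *\<^sub>R ?e) \<bullet> ?e) * indicator {0..1} t \<partial>lborel) =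
        f (x + 1 *\<^sub>R ?e) - f (x + 0 *\<^sub>R ?e)"
    proof (rule integral_FTC_Icc_real)
      show "isCont (\<lambda>t. D (x + t *\<^sub>R ?e) \<bullet> ?e) t" for t
        by (intro continuous_intros isCont_o2[OF _ Dc])
    qed (use DERIV_along_line[OF d] in auto)
    then show ?thesis by (simp add: inner_axis)
  qed
  have sh: "(\<integral>\<^sup>+x. ennreal \<bar>D (x + t *\<^sub>R ?e) $ j\<bar> \<partial>lborel) = (\<integral>\<^sup>+x. ennreal \<bar>D x $ j\<bar> \<partial>lborel)" for t
    using nn_integral_shift[of "\<lambda>x. ennreal \<bar>D x $ j\<bar>" "t *\<^sub>R ?e"] by simp
  have "integrable (lborel \<Otimes>\<^sub>M lborel) (\<lambda>(t, x). (D (x + t *\<^sub>R ?e) $ j) * indicator {0..1::real} t)"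
  proof (rule integrable_pairI)
    show "(\<lambda>(t, x). (D (x + t *\<^sub>R ?e) $ j) * indicator {0..1::real} t) \<in>
        borel_measurable (lborel \<Otimes>\<^sub>M lborel)"
      by measurable
    have "(\<integral>\<^sup>+t. \<integral>\<^sup>+x. ennreal (norm ((D (x + t *\<^sub>R ?e) $ j) * indicator {0..1::real} t)) \<partial>lborel \<partial>lborel)
        = (\<integral>\<^sup>+t. indicator {0..1::real} t * (\<integral>\<^sup>+x. ennreal \<bar>D (x + t *\<^sub>R ?e) $ j\<bar> \<partial>lborel) \<partial>lborel)"
      by (subst nn_integral_cmult[symmetric])
        (auto simp: abs_mult ennreal_mult' mult.commute intro!: nn_integral_cong split: split_indicator)
    also have "\<dots> = (\<integral>\<^sup>+x. ennreal \<bar>D x $ j\<bar> \<partial>lborel)"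
      by (simp add: sh nn_integral_multc)
    also have "\<dots> < \<infinity>"
      using int(2) by (simp add: integrable_iff_bounded)
    finally show "(\<integral>\<^sup>+t. \<integral>\<^sup>+x. ennreal (norm ((D (x + t *\<^sub>R ?e) $ j) * indicator {0..1::real} t)) \<partial>lborel \<partial>lborel) < \<infinity>" .
  qed
  from lborel_pair.Fubini_integral[OF this]
  have "(\<integral>x. (\<integral>t. (D (x + t *\<^sub>R ?e) $ j) * indicator {0..1} t \<partial>lborel) \<partial>lborel) =
      (\<integral>t. (\<integral>x. (D (x + t *\<^sub>R ?e) $ j) * indicator {0..1::real} t \<partial>lborel) \<partial>lborel)" .
  also have "\<dots> = (\<integral>t. (\<integral>x. D x $ j \<partial>lborel) * indicator {0..1::real} t \<partial>lborel)"
    by (simp add: integral_shift[OF comp])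
  also have "\<dots> = (\<integral>x. D x $ j \<partial>lborel)"
    by simp
  finally have "(\<integral>x. D x $ j \<partial>lborel) = (\<integral>x. f (x + ?e) - f x \<partial>lborel)"
    by (simp add: ftc)
  also have "\<dots> = 0"
    using integrable_shift[of f ?e] integral_shift[of f ?e] int(1) by simp
  finally show ?thesis .
qed

section \<open>Differentiation and smoothness of convolutions\<close>

definition conv :: "(real ^ 'n \<Rightarrow> real) \<Rightarrow> (real ^ 'n \<Rightarrow> real) \<Rightarrow> real ^ 'n \<Rightarrow> real" where
  "conv k f x = (\<integral>y. k (x - y) * f y \<partial>lborel)"

lemma conv_commute:
  assumes [measurable]: "k \<in> borel_measurable borel" "f \<in> borel_measurable borel"
  shows "conv k f x = conv f k x"
  using integral_reflect[of "\<lambda>y. k (x - y) * f y" x]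
  by (simp add: conv_def mult.commute)

text \<open>Differentiation under the integral. The bound \<open>B\<close> on the gradient makes
  \<open>k\<close> Lipschitz, so the error of the linear approximation divided by
  \<open>norm h\<close> is at most \<open>2 * B\<close>, and \<open>2 * B * \<bar>f\<bar>\<close>
  dominates. Increments are taken along sequences to apply dominated convergence.\<close>

lemma conv_has_derivative:
  fixes k f :: "real ^ 'n \<Rightarrow> real"
  assumes d: "\<And>x. (k has_derivative (\<lambda>v. D x \<bullet> v)) (at x)"
    and B: "\<And>x. norm (D x) \<le> B" "\<And>x. \<bar>k x\<bar> \<le> B'"
    and D[measurable]: "D \<in> borel_measurable borel"
    and f: "integrable lborel f"
  shows "(conv k f has_derivative (\<lambda>v. (\<chi> j. conv (\<lambda>z. D z $ j) f x) \<bullet> v)) (at x)"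
proof -
  have [measurable]: "k \<in> borel_measurable borel"
    by (rule has_derivative_imp_borel_measurable[OF d])
  have [measurable]: "f \<in> borel_measurable borel" using f by auto
  have D_j [measurable]: "(\<lambda>x. D x $ j) \<in> borel_measurable borel" for j
    by (rule borel_measurable_continuous_on[OF _ D]) (intro continuous_intros)
  have int_k: "integrable lborel (\<lambda>y. k (z - y) * f y)" for z
    by (rule integrable_bounded_mult[OF f, of _ B']) (use B in auto)
  have int_D: "integrable lborel (\<lambda>y. D (z - y) $ j * f y)" for z j
    by (rule integrable_bounded_mult[OF f, of _ B])
      (use order_trans[OF component_le_norm_cart B(1)] in auto)
  have inner_eq: "(\<chi> j. conv (\<lambda>z. D z $ j) f x) \<bullet> v = (\<integral>y. (D (x - y) \<bullet> v) * f y \<partial>lborel)" for v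
  proof -
    have "(\<integral>y. (D (x - y) \<bullet> v) * f y \<partial>lborel) = (\<integral>y. (\<Sum>j\<in>UNIV. v $ j * (D (x - y) $ j * f y)) \<partial>lborel)"
      by (simp add: inner_vec_def sum_distrib_right sum_distrib_left mult_ac)
    also have "\<dots> = (\<Sum>j\<in>UNIV. v $ j * (\<integral>y. D (x - y) $ j * f y \<partial>lborel))"
      by (subst Bochner_Integration.integral_sum) (auto intro: int_D)
    finally show ?thesis
      by (simp add: inner_vec_def conv_def mult.commute)
  qed
  have int_in: "integrable lborel (\<lambda>y. (D (x - y) \<bullet> v) * f y)" for v
  proof (rule integrable_bounded_mult[OF f])
    show "\<bar>D (x - y) \<bullet> v\<bar> \<le> B * norm v" for y
      using Cauchy_Schwarz_ineq2[of "D (x - y)" v] B(1)[of "x - y"]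
      by (meson mult_right_mono norm_ge_zero order_trans)
  qed auto
  have lip: "\<bar>k z - k w\<bar> \<le> B * norm (z - w)" for z w
    using differentiable_bound[of UNIV k "\<lambda>z v. D z \<bullet> v" B z w] d B(1)
    by (force intro!: onorm_le intro: order_trans[OF Cauchy_Schwarz_ineq2] mult_right_mono simp: dist_norm)
  show ?thesis
    unfolding has_derivative_at
  proof (intro conjI)
    show "bounded_linear (\<lambda>v. (\<chi> j. conv (\<lambda>z. D z $ j) f x) \<bullet> v)"
      by (rule bounded_linear_inner_right)
    show "(\<lambda>h. norm (conv k f (x + h) - conv k f x - (\<chi> j. conv (\<lambda>z. D z $ j) f x) \<bullet> h) / norm h) \<midarrow>0\<rightarrow> 0"
      unfolding tendsto_at_iff_sequentially
    proof (intro allI impI)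
      fix h :: "nat \<Rightarrow> real ^ 'n" assume h: "\<forall>i. h i \<in> UNIV - {0}" "h \<longlonglongrightarrow> 0"
      let ?q = "\<lambda>i y. ((k (x + h i - y) - k (x - y) - D (x - y) \<bullet> h i) / norm (h i)) * f y"
      have lim: "(\<lambda>i. \<integral>y. ?q i y \<partial>lborel) \<longlonglongrightarrow> (\<integral>y. 0 \<partial>(lborel :: (real ^ 'n) measure))"
      proof (rule integral_dominated_convergence[where w = "\<lambda>y. 2 * B * \<bar>f y\<bar>"])
        show "integrable lborel (\<lambda>y. 2 * B * \<bar>f y\<bar>)" using f by auto
        show "AE y in lborel. (\<lambda>i. ?q i y) \<longlonglongrightarrow> 0"
        proof (rule AE_I2)
          fix y
          have "(\<lambda>h. norm (k ((x - y) + h) - k (x - y) - D (x - y) \<bullet> h) / norm h) \<midarrow>0\<rightarrow> 0"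
            using d[of "x - y"] by (simp add: has_derivative_at)
          then have "(\<lambda>i. norm (k ((x - y) + h i) - k (x - y) - D (x - y) \<bullet> h i) / norm (h i)) \<longlonglongrightarrow> 0"
            using h by (auto simp: tendsto_at_iff_sequentially o_def)
          then have "(\<lambda>i. (k (x + h i - y) - k (x - y) - D (x - y) \<bullet> h i) / norm (h i)) \<longlonglongrightarrow> 0"
            by (subst tendsto_rabs_zero_iff[symmetric]) (simp add: algebra_simps)
          from tendsto_mult_right[OF this, of "f y"] show "(\<lambda>i. ?q i y) \<longlonglongrightarrow> 0" by simp
        qed
        show "AE y in lborel. norm (?q i y) \<le> 2 * B * \<bar>f y\<bar>" for i
        proof (rule AE_I2)
          fix y
          have "\<bar>k (x + h i - y) - k (x - y) - D (x - y) \<bullet> h i\<bar> \<le> B * norm (h i) + B * norm (h i)"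
            using lip[of "x + h i - y" "x - y"] Cauchy_Schwarz_ineq2[of "D (x - y)" "h i"]
              mult_right_mono[OF B(1)[of "x - y"], of "norm (h i)"]
            by simp
          then have "\<bar>k (x + h i - y) - k (x - y) - D (x - y) \<bullet> h i\<bar> / norm (h i) \<le> 2 * B"
            using h(1) by (simp add: field_simps)
          from mult_right_mono[OF this abs_ge_zero[of "f y"]]
          show "norm (?q i y) \<le> 2 * B * \<bar>f y\<bar>"
            by (simp add: abs_mult)
        qed
      qed auto
      have "(\<integral>y. ?q i y \<partial>lborel) =
          (conv k f (x + h i) - conv k f x - (\<chi> j. conv (\<lambda>z. D z $ j) f x) \<bullet> h i) / norm (h i)" for i
      proof -
        have "?q i = (\<lambda>y. (k (x + h i - y) * f y - k (x - y) * f y - (D (x - y) \<bullet> h i) * f y) / norm (h i))"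
          by (auto simp: algebra_simps diff_divide_distrib add_divide_distrib)
        then show ?thesis
          using int_k int_in by (simp add: conv_def inner_eq[unfolded conv_def])
      qed
      with lim have "(\<lambda>i. (conv k f (x + h i) - conv k f x - (\<chi> j. conv (\<lambda>z. D z $ j) f x) \<bullet> h i) / norm (h i)) \<longlonglongrightarrow> 0"
        by (simp only: integral_zero)
      from tendsto_rabs_zero[OF this]
      show "((\<lambda>h. norm (conv k f (x + h) - conv k f x - (\<chi> j. conv (\<lambda>z. D z $ j) f x) \<bullet> h) / norm h) \<circ> h) \<longlonglongrightarrow> 0"
        by (simp add: o_def)
    qed
  qed
qed

lemma conv_test_has_derivative:
  assumes "test_function r" "integrable lborel f"
  shows "(conv r f has_derivative (\<lambda>v. (\<chi> j. conv (partial_deriv j r) f x) \<bullet> v)) (at x)"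
proof -
  obtain B B' where "\<And>x. norm (grad r x) \<le> B" "\<And>x. \<bar>r x\<bar> \<le> B'"
    using test_function_grad_bounded[OF assms(1)] test_function_bounded[OF assms(1)] by metis
  from conv_has_derivative[OF has_derivative_grad[OF test_function_differentiable[OF assms(1)]] this _ assms(2)]
  show ?thesis
    using test_function_grad_continuous[OF assms(1)]
    by (simp add: borel_measurable_continuous_onI grad_def)
qed

text \<open>A kernel supported in the ball of radius \<open>R\<close> lets the convolution at points
  of norm at most \<open>R'\<close> see \<open>f\<close> only on the ball of radius
  \<open>R + R'\<close>. This carries statements for integrable \<open>f\<close> over to locally
  integrable \<open>f\<close>.\<close>

lemma conv_localize:
  fixes k f :: "real ^ 'n \<Rightarrow> real"
  assumes "\<And>x. norm x > R \<Longrightarrow> k x = 0" "norm x \<le> R'"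
  shows "conv k (\<lambda>y. indicator (cball 0 (R + R')) y * f y) x = conv k f x"
proof -
  have "k (x - y) * (indicator (cball 0 (R + R')) y * f y) = k (x - y) * f y" for y
  proof (cases "norm y > R + R'")
    case True
    then have "norm (x - y) > R"
      using norm_triangle_ineq2[of y x] assms(2) by (simp add: norm_minus_commute)
    then show ?thesis using assms(1) by simp
  qed simp
  then show ?thesis
    by (simp only: conv_def)
qed

lemma conv_test_has_derivative_local:
  fixes f :: "real ^ 'n \<Rightarrow> real"
  assumes r: "test_function r" and f: "\<And>R. integrable lborel (\<lambda>x. indicator (cball 0 R) x * f x)"
  shows "(conv r f has_derivative (\<lambda>v. (\<chi> j. conv (partial_deriv j r) f x) \<bullet> v)) (at x)"
proof -
  obtain R where R: "\<And>x. norm x > R \<Longrightarrow> r x = 0"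
    using test_function_support[OF r] by metis
  have R': "norm x > R \<Longrightarrow> partial_deriv j r x = 0" for j x
    using partial_deriv_eq_0_outside[of R r x j] R by blast
  \<comment> \<open>The margin 1 makes \<open>x\<close> an interior point of the ball on which the
    truncation of \<open>f\<close> is invisible, as the transfer of a derivative requires.\<close>
  define R' where "R' = norm x + 1"
  let ?f = "\<lambda>y. indicator (cball 0 (R + R')) y * f y"
  have d: "(conv r ?f has_derivative (\<lambda>v. (\<chi> j. conv (partial_deriv j r) f x) \<bullet> v)) (at x)"
    using conv_test_has_derivative[OF r f[of "R + R'"], of x] conv_localize[where k = "partial_deriv j r" and R' = R' and x = x and f = f for j, OF R']
    by (simp add: R'_def)
  have o: "open (ball (0::real^'n) R')" "x \<in> ball 0 R'" by (auto simp: R'_def)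
  show ?thesis
    by (rule has_derivative_transform_within_open[OF d o]) (rule conv_localize[OF R], auto)
qed

lemma partial_deriv_conv_test:
  assumes "test_function r" "\<And>R. integrable lborel (\<lambda>x. indicator (cball 0 R) x * f x)"
  shows "partial_deriv j (conv r f) = conv (partial_deriv j r) f"
  using partial_deriv_unique[OF conv_test_has_derivative_local[OF assms]] by (auto simp: fun_eq_iff)

text \<open>All derivatives fall on the test function, so \<open>f\<close> needs no regularity
  beyond local integrability.\<close>

lemma Ck_conv_test:
  assumes "test_function r" "\<And>R. integrable lborel (\<lambda>x. indicator (cball 0 R) x * f x)"
  shows "Ck k (conv r f)"
  using assms(1)
proof (induction k arbitrary: r)
  case 0
  show ?case
    using conv_test_has_derivative_local[OF 0 assms(2)]
    by (auto intro!: continuous_at_imp_continuous_on intro: has_derivative_continuous)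
next
  case (Suc k)
  with Suc.IH[OF test_function_partial_deriv[OF Suc.prems]]
    conv_test_has_derivative_local[OF Suc.prems assms(2)] show ?case
    by (auto simp: differentiable_def partial_deriv_conv_test[OF Suc.prems assms(2)])
qed

lemma integrable_imp_locally:
  fixes f :: "'a::euclidean_space \<Rightarrow> real"
  shows "integrable lborel f \<Longrightarrow> integrable lborel (\<lambda>x. indicator (cball 0 R) x * f x)"
  by (erule integrable_bounded_mult[where B = 1])
    (auto intro!: borel_measurable_indicator split: split_indicator)

lemma conv_eq_0_outside:
  assumes "\<And>x. norm x > R \<Longrightarrow> k x = 0" "\<And>x. norm x > R' \<Longrightarrow> f x = 0" "norm x > R + R'"
  shows "conv k f x = 0"
proof -
  have "k (x - y) * f y = 0" for y
  proof (cases "norm y > R'")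
    case False
    then have "norm (x - y) > R"
      using norm_triangle_ineq2[of x y] assms(3) by simp
    then show ?thesis using assms by simp
  qed (use assms in simp)
  then show ?thesis
    unfolding conv_def by (simp only: integral_zero)
qed

lemma test_function_conv:
  assumes "test_function r" "integrable lborel f" "\<And>x. norm x > R \<Longrightarrow> f x = 0"
  shows "test_function (conv r f)"
proof -
  obtain R' where R': "\<And>x. norm x > R' \<Longrightarrow> r x = 0"
    using test_function_support[OF assms(1)] by metis
  show ?thesis
  proof (rule test_functionI)
    show "norm x \<le> R' + R" if "conv r f x \<noteq> 0" for x
      using conv_eq_0_outside[of R' r R f x] R' assms(3) that by force
  qed (intro Ck_conv_test integrable_imp_locally assms)
qed

section \<open>Mollifiers\<close>

lemma integral_box_bump_pos:
  assumes "c > 0" "\<And>j. a $ j < b $ j"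
  shows "(\<integral>x. box_bump c a b x \<partial>lborel) > 0"
proof -
  have int: "integrable lborel (box_bump c a b)"
    by (intro test_function_integrable test_function_box_bump assms)
  have "(\<integral>x. box_bump c a b x \<partial>lborel) \<noteq> 0"
  proof
    assume "(\<integral>x. box_bump c a b x \<partial>lborel) = 0"
    then have "AE x in lborel. box_bump c a b x = 0"
      using integral_nonneg_eq_0_iff_AE[OF int] box_bump_bounds(1) by (metis AE_I2)
    then have "AE x in lborel. x \<notin> box a b"
      by eventually_elim (use box_bump_pos_iff[OF assms(1), of a b] in force)
    then have "emeasure lborel (box a b) = 0"
      by (subst (asm) AE_iff_measurable[of "box a b"]) auto
    moreover have "emeasure lborel (box a b) > 0"
      using assms(2) by (auto simp: emeasure_lborel_box_eq Basis_vec_def inner_axis intro!: prod_pos less_imp_le)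
    ultimately show False by simp
  qed
  moreover have "(\<integral>x. box_bump c a b x \<partial>lborel) \<ge> 0"
    by (intro integral_nonneg_AE AE_I2 box_bump_bounds)
  ultimately show ?thesis by linarith
qed

text \<open>The supports are cubes of half-width \<open>1 / (k + 1)\<close>; bounding the norm by
  the sum of the coordinates gives the radius with the factor \<open>CARD('n)\<close>.\<close>

lemma mollifier_exists:
  obtains r :: "nat \<Rightarrow> real ^ 'n \<Rightarrow> real"
  where "\<And>k. test_function (r k)" "\<And>k x. 0 \<le> r k x" "\<And>k. (\<integral>x. r k x \<partial>lborel) = 1"
    "\<And>k x. norm x > real CARD('n) / (real k + 1) \<Longrightarrow> r k x = 0"
proof -
  define a :: "nat \<Rightarrow> real ^ 'n" where "a k = (\<chi> j. 1 / (real k + 1))" for k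
  define b where "b k = box_bump 1 (- a k) (a k)" for k
  define I where "I k = (\<integral>x. b k x \<partial>lborel)" for k
  define r where "r k x = b k x * (1 / I k)" for k x
  have tb: "test_function (b k)" for k
    unfolding b_def by (intro test_function_box_bump) simp
  have I: "I k > 0" for k
    unfolding I_def b_def by (rule integral_box_bump_pos) (auto simp: a_def field_simps)
  show ?thesis
  proof (rule that[of r])
    fix k :: nat and x :: "real ^ 'n"
    show "test_function (r k)"
      unfolding r_def[abs_def] by (intro test_function_mult tb Ck_const)
    show "0 \<le> r k x"
      using I[of k] box_bump_bounds(1)[of 1 "- a k" "a k" x] by (simp add: r_def b_def)
    show "(\<integral>x. r k x \<partial>lborel) = 1"
      using I[of k] by (simp add: r_def I_def)
    assume n: "norm x > real CARD('n) / (real k + 1)"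
    have "x \<notin> box (- a k) (a k)"
    proof
      assume x: "x \<in> box (- a k) (a k)"
      have "\<bar>x $ j\<bar> \<le> 1 / (real k + 1)" for j
        using spec[OF x[unfolded mem_box_cart], of j] by (auto simp: a_def abs_le_iff add.commute)
      then have "norm x \<le> (\<Sum>j\<in>(UNIV::'n set). 1 / (real k + 1))"
        by (intro order_trans[OF norm_le_l1_cart] sum_mono) (simp add: add.commute)
      with n show False by (simp add: add.commute)
    qed
    then show "r k x = 0"
      using box_bump_pos_iff[of 1 "- a k" "a k" x] box_bump_bounds(1)[of 1 "- a k" "a k" x]
      by (simp add: r_def b_def less_eq_real_def)
  qed
qed

text \<open>The convolution is an average of \<open>g\<close> with respect to a probability density.
  The support of \<open>r\<close> does not enter, so the heat kernel is covered as well.\<close>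

lemma conv_mollifier_bound:
  assumes "integrable lborel r" "\<And>x. 0 \<le> r x" "(\<integral>x. r x \<partial>lborel) = 1"
    "g \<in> borel_measurable borel" "\<And>x. \<bar>g x\<bar> \<le> B"
  shows "\<bar>conv r g x\<bar> \<le> B"
proof -
  have [measurable]: "r \<in> borel_measurable borel" using assms(1) by auto
  have i1: "integrable lborel (\<lambda>y. r (x - y))"
    using integrable_reflect[of r x] assms(1) by simp
  then have i2: "integrable lborel (\<lambda>y. B * r (x - y))" by simp
  have "\<bar>conv r g x\<bar> \<le> (\<integral>y. B * r (x - y) \<partial>lborel)"
    unfolding conv_def real_norm_def[symmetric]
  proof (rule Bochner_Integration.integral_norm_bound_integral[OF _ i2])
    show "integrable lborel (\<lambda>y. r (x - y) * g y)"
      by (rule integrable_bounded_mult'[OF i1]) (use assms in auto)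
    show "norm (r (x - y) * g y) \<le> B * r (x - y)" for y
      using mult_right_mono[OF assms(5)[of y] assms(2)[of "x - y"]] assms(2)[of "x - y"]
      by (simp add: abs_mult mult.commute)
  qed
  also have "\<dots> = B"
    using integral_reflect[of r x] assms(3) by simp
  finally show ?thesis .
qed

lemma conv_mollifier_tendsto:
  fixes r :: "nat \<Rightarrow> real ^ 'n \<Rightarrow> real"
  assumes r: "\<And>k. integrable lborel (r k)" "\<And>k x. 0 \<le> r k x" "\<And>k. (\<integral>x. r k x \<partial>lborel) = 1"
    "\<And>k x. norm x > c / (real k + 1) \<Longrightarrow> r k x = 0"
    and g: "continuous_on UNIV g" "\<And>x. \<bar>g x\<bar> \<le> B"
  shows "(\<lambda>k. conv (r k) g x) \<longlonglongrightarrow> g x"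
proof (rule metric_LIMSEQ_I)
  fix e :: real assume e: "e > 0"
  have [measurable]: "g \<in> borel_measurable borel" "r k \<in> borel_measurable borel" for k
    using g(1) r(1) by (auto intro: borel_measurable_continuous_onI)
  have "isCont g x" using g(1) by (simp add: continuous_on_eq_continuous_at)
  then obtain d where d: "d > 0" "\<And>y. dist y x < d \<Longrightarrow> dist (g y) (g x) < e / 2"
    unfolding continuous_at_eps_delta using e by (metis half_gt_zero)
  obtain N where N: "c / d < real N" using reals_Archimedean2 by blast
  have "dist (conv (r k) g x) (g x) < e" if "k \<ge> N" for k
  proof -
    have cd: "c / (real k + 1) < d"
    proof -
      have "c / d < real k + 1" using N that by simp
      then show ?thesis using d(1) by (simp add: field_simps)
    qed
    have i: "integrable lborel (\<lambda>z. r k z * (g (x - z) - g x))"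
    proof (rule integrable_bounded_mult'[OF r(1)])
      show "\<bar>g (x - z) - g x\<bar> \<le> 2 * B" for z
        using g(2)[of "x - z"] g(2)[of x] by linarith
    qed auto
    have i': "integrable lborel (\<lambda>z. r k z * g (x - z))"
      by (rule integrable_bounded_mult'[OF r(1)]) (use g(2) in auto)
    have "conv (r k) g x = (\<integral>z. r k z * g (x - z) \<partial>lborel)"
      by (subst conv_commute) (auto simp: conv_def mult.commute)
    moreover have "g x = (\<integral>z. r k z * g x \<partial>lborel)"
      using r(3) by simp
    ultimately have "conv (r k) g x - g x = (\<integral>z. r k z * (g (x - z) - g x) \<partial>lborel)"
      using i' r(1) by (simp add: right_diff_distrib)
    also have "\<bar>\<dots>\<bar> \<le> (\<integral>z. r k z * (e / 2) \<partial>lborel)"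
      unfolding real_norm_def[symmetric]
    proof (rule Bochner_Integration.integral_norm_bound_integral[OF i])
      fix z
      show "norm (r k z * (g (x - z) - g x)) \<le> r k z * (e / 2)"
      proof (cases "norm z > c / (real k + 1)")
        case False
        then have "dist (g (x - z)) (g x) < e / 2"
          using cd by (intro d(2)) (simp add: dist_norm)
        then show ?thesis
          using r(2)[of k z] mult_left_mono[of "\<bar>g (x - z) - g x\<bar>" "e / 2" "r k z"]
          by (simp add: abs_mult dist_real_def)
      qed (use r(4) in simp)
    qed (use r(1) in auto)
    also have "\<dots> = e / 2" using r(3) by simp
    finally show ?thesis
      using e by (simp add: dist_real_def)
  qed
  then show "\<exists>N. \<forall>k\<ge>N. dist (conv (r k) g x) (g x) < e" by blast
qed

text \<open>Integration by parts: the \<open>j\<close>-th derivative of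
  \<open>y \<mapsto> r (x - y) * g y\<close> has integral 0, and the minus sign cancels against the
  one from the reflection. It is stated for bounded \<open>C^1\<close> functions \<open>g\<close>
  with bounded gradient so that it applies to the heat kernel and its derivatives, which have no
  compact support.\<close>

lemma conv_grad_swap:
  fixes r g :: "real ^ 'n \<Rightarrow> real"
  assumes r: "test_function r" and d: "\<And>x. (g has_derivative (\<lambda>v. D x \<bullet> v)) (at x)"
    and D: "continuous_on UNIV D" "\<And>x. norm (D x) \<le> B" and g: "\<And>x. \<bar>g x\<bar> \<le> B'"
  shows "conv (partial_deriv j r) g x = conv r (\<lambda>z. D z $ j) x"
proof -
  have [measurable]: "g \<in> borel_measurable borel"
    by (rule has_derivative_imp_borel_measurable[OF d])
  have [measurable]: "(\<lambda>x. D x $ j) \<in> borel_measurable borel"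
    by (intro borel_measurable_continuous_onI continuous_intros D)
  define rx where "rx y = r (x - y)" for y
  have rx: "rx = (\<lambda>y. r ((-1) *\<^sub>R y + x))" by (auto simp: rx_def)
  have t: "test_function rx"
    unfolding rx by (rule test_function_affine[OF r]) simp
  have tp: "test_function (partial_deriv j rx)" by (rule test_function_partial_deriv[OF t])
  have p: "partial_deriv j rx y = - partial_deriv j r (x - y)" for y
    unfolding rx using test_function_differentiable[OF r] by (subst partial_deriv_affine) auto
  let ?H = "\<lambda>y. rx y *\<^sub>R D y + g y *\<^sub>R grad rx y"
  have i1: "integrable lborel (\<lambda>y. rx y * D y $ j)"
    by (rule integrable_bounded_mult'[OF test_function_integrable[OF t], of _ B])
      (use order_trans[OF component_le_norm_cart D(2)] in auto)
  have i2: "integrable lborel (\<lambda>y. partial_deriv j rx y * g y)"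
    by (rule integrable_bounded_mult'[OF test_function_integrable[OF tp], of _ B']) (use g in auto)
  have "((\<lambda>y. rx y * g y) has_derivative (\<lambda>v. ?H y \<bullet> v)) (at y)" for y
    using has_derivative_mult[OF has_derivative_grad[OF test_function_differentiable[OF t]] d]
    by (rule has_derivative_eq_rhs) (auto simp: inner_add_left)
  moreover have "continuous_on UNIV ?H"
    using d has_derivative_continuous
    by (intro continuous_intros test_function_continuous test_function_grad_continuous t D(1)
        continuous_at_imp_continuous_on ballI) blast
  moreover have "integrable lborel (\<lambda>y. rx y * g y)"
    by (rule integrable_bounded_mult'[OF test_function_integrable[OF t], of _ B']) (use g in auto)
  moreover have H: "(\<lambda>y. ?H y $ j) = (\<lambda>y. rx y * D y $ j + partial_deriv j rx y * g y)"
    by (auto simp: grad_def)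
  moreover have "integrable lborel (\<lambda>y. ?H y $ j)"
    unfolding H using i1 i2 by simp
  ultimately have "(\<integral>y. ?H y $ j \<partial>lborel) = 0"
    by (intro integral_partial_deriv_eq_0[where f = "\<lambda>y. rx y * g y"])
  then have "(\<integral>y. rx y * D y $ j \<partial>lborel) + (\<integral>y. partial_deriv j rx y * g y \<partial>lborel) = 0"
    unfolding H using i1 i2 by simp
  then show ?thesis
    by (simp add: p conv_def rx_def)
qed

section \<open>The divergence identity for bounded \<open>C^1\<close> functions\<close>

lemma integrable_inner_bounded:
  fixes F G :: "'a \<Rightarrow> 'b::euclidean_space"
  assumes F: "integrable M F" and [measurable]: "G \<in> borel_measurable M" and "\<And>x. norm (G x) \<le> B"
  shows "integrable M (\<lambda>x. F x \<bullet> G x)"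
proof (rule Bochner_Integration.integrable_bound[of M "\<lambda>x. B * norm (F x)"])
  show "AE x in M. norm (F x \<bullet> G x) \<le> norm (B * norm (F x))"
  proof (rule AE_I2)
    fix x
    have "\<bar>F x \<bullet> G x\<bar> \<le> norm (F x) * B"
      using Cauchy_Schwarz_ineq2[of "F x" "G x"] mult_left_mono[OF assms(3)[of x] norm_ge_zero[of "F x"]]
      by linarith
    then show "norm (F x \<bullet> G x) \<le> norm (B * norm (F x))"
      by (simp add: mult.commute abs_le_iff order_trans[OF _ abs_ge_self])
  qed
qed (use F in auto)

text \<open>Mollifying \<open>g\<close> gives genuine test functions whose gradients are the
  mollifications of \<open>D\<close>. Both converge pointwise and stay bounded, so dominated
  convergence with the integrable weights \<open>norm (F x)\<close> and
  \<open>\<bar>f x\<bar>\<close> passes to the limit.\<close>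

lemma div_pairing_compact:
  fixes F :: "real ^ 'n \<Rightarrow> real ^ 'n"
  assumes F: "integrable lborel F" and f: "integrable lborel f"
    and test: "\<And>\<phi>. test_function \<phi> \<Longrightarrow> (\<integral>x. F x \<bullet> grad \<phi> x \<partial>lborel) = - (\<integral>x. f x * \<phi> x \<partial>lborel)"
    and d: "\<And>x. (g has_derivative (\<lambda>v. D x \<bullet> v)) (at x)"
    and D: "continuous_on UNIV D" "\<And>x. norm (D x) \<le> B" and g: "\<And>x. \<bar>g x\<bar> \<le> B'"
    and supp: "\<And>x. norm x > R \<Longrightarrow> g x = 0"
  shows "(\<integral>x. F x \<bullet> D x \<partial>lborel) = - (\<integral>x. f x * g x \<partial>lborel)"
proof -
  obtain r :: "nat \<Rightarrow> real ^ 'n \<Rightarrow> real"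
    where r: "\<And>k. test_function (r k)" "\<And>k x. 0 \<le> r k x" "\<And>k. (\<integral>x. r k x \<partial>lborel) = 1"
      "\<And>k x. norm x > real CARD('n) / (real k + 1) \<Longrightarrow> r k x = 0"
    using mollifier_exists by metis
  note ri = test_function_integrable[OF r(1)]
  have cg: "continuous_on UNIV g"
    using d has_derivative_continuous by (blast intro: continuous_at_imp_continuous_on)
  have cD: "continuous_on UNIV (\<lambda>x. D x $ j)" for j
    by (intro continuous_intros D)
  have [measurable]: "g \<in> borel_measurable borel" "D \<in> borel_measurable borel"
      "(\<lambda>x. D x $ j) \<in> borel_measurable borel" "f \<in> borel_measurable borel" "F \<in> borel_measurable borel"
      "r k \<in> borel_measurable borel" for j k
    using F f cg D(1) cD ri by (auto intro: borel_measurable_continuous_onI)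
  have bD: "\<bar>D x $ j\<bar> \<le> B" for x j
    using order_trans[OF component_le_norm_cart D(2)] .
  have gi: "integrable lborel g"
  proof -
    have "integrable lborel (\<lambda>x. indicator (cball 0 R) x *\<^sub>R g x)"
      by (intro borel_integrable_compact continuous_on_subset[OF cg]) auto
    moreover have "(\<lambda>x. indicator (cball 0 R) x *\<^sub>R g x) = g"
      using supp by (auto simp: fun_eq_iff indicator_def)
    ultimately show ?thesis by simp
  qed
  define G where "G k x = (\<chi> j. conv (r k) (\<lambda>z. D z $ j) x)" for k x
  have G: "grad (conv (r k) g) = G k" for k
    by (auto simp: grad_def G_def fun_eq_iff
        partial_deriv_conv_test[OF r(1) integrable_imp_locally[OF gi]] conv_grad_swap[OF r(1) d D g])
  have t: "test_function (conv (r k) g)" for k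
    by (rule test_function_conv[OF r(1) gi supp])
  have Gm [measurable]: "G k \<in> borel_measurable borel" for k
    unfolding G[symmetric] by (intro borel_measurable_continuous_onI test_function_grad_continuous t)
  have [measurable]: "conv (r k) g \<in> borel_measurable borel" for k
    by (intro borel_measurable_continuous_onI test_function_continuous t)
  have "(\<lambda>k. \<integral>x. F x \<bullet> G k x \<partial>lborel) \<longlonglongrightarrow> (\<integral>x. F x \<bullet> D x \<partial>lborel)"
  proof (rule integral_dominated_convergence[where w = "\<lambda>x. norm (F x) * (CARD('n) * B)"])
    show "AE x in lborel. (\<lambda>k. F x \<bullet> G k x) \<longlonglongrightarrow> F x \<bullet> D x"
    proof (intro AE_I2 tendsto_intros)
      show "(\<lambda>k. G k x) \<longlonglongrightarrow> D x" for x
        using conv_mollifier_tendsto[OF ri r(2-4) cD bD]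
        by (intro vec_tendstoI) (simp add: G_def)
    qed
    show "AE x in lborel. norm (F x \<bullet> G k x) \<le> norm (F x) * (CARD('n) * B)" for k
    proof (rule AE_I2)
      fix x
      have "norm (G k x) \<le> (\<Sum>j\<in>(UNIV::'n set). B)"
        using conv_mollifier_bound[OF ri r(2,3) _ bD]
        by (intro order_trans[OF norm_le_l1_cart] sum_mono) (simp add: G_def)
      then show "norm (F x \<bullet> G k x) \<le> norm (F x) * (CARD('n) * B)"
        unfolding real_norm_def
        by (intro order_trans[OF Cauchy_Schwarz_ineq2] mult_left_mono) auto
    qed
  qed (use F in auto)
  moreover have "(\<lambda>k. \<integral>x. f x * conv (r k) g x \<partial>lborel) \<longlonglongrightarrow> (\<integral>x. f x * g x \<partial>lborel)"
  proof (rule integral_dominated_convergence[where w = "\<lambda>x. \<bar>f x\<bar> * B'"])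
    show "AE x in lborel. (\<lambda>k. f x * conv (r k) g x) \<longlonglongrightarrow> f x * g x"
      using conv_mollifier_tendsto[OF ri r(2-4) cg g] by (intro AE_I2 tendsto_intros) 
    show "AE x in lborel. norm (f x * conv (r k) g x) \<le> \<bar>f x\<bar> * B'" for k
      using conv_mollifier_bound[OF ri r(2,3) _ g]
      by (auto simp: abs_mult intro!: AE_I2 mult_left_mono)
  qed (use f in auto)
  moreover have "(\<integral>x. F x \<bullet> G k x \<partial>lborel) = - (\<integral>x. f x * conv (r k) g x \<partial>lborel)" for k
    using test[OF t[of k]] by (simp add: G)
  ultimately show ?thesis
    using LIMSEQ_unique tendsto_minus by (metis (no_types, lifting) ext)
qed

text \<open>Compact support is removed by a dilated cutoff, whose gradient is of order
  \<open>1 / (k + 1)\<close>: the extra term \<open>g * E k\<close> disappears in the limit because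
  \<open>F\<close> is integrable and \<open>g\<close> bounded. The test functions built later,
  products of primitives and heat convolutions, are bounded but not compactly supported.\<close>

lemma div_pairing:
  fixes F :: "real ^ 'n \<Rightarrow> real ^ 'n"
  assumes F: "integrable lborel F" and f: "integrable lborel f"
    and test: "\<And>\<phi>. test_function \<phi> \<Longrightarrow> (\<integral>x. F x \<bullet> grad \<phi> x \<partial>lborel) = - (\<integral>x. f x * \<phi> x \<partial>lborel)"
    and d: "\<And>x. (g has_derivative (\<lambda>v. D x \<bullet> v)) (at x)"
    and D: "continuous_on UNIV D" "\<And>x. norm (D x) \<le> B" and g: "\<And>x. \<bar>g x\<bar> \<le> B'"
  shows "(\<integral>x. F x \<bullet> D x \<partial>lborel) = - (\<integral>x. f x * g x \<partial>lborel)"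
proof -
  define b :: "real ^ 'n \<Rightarrow> real" where "b = box_bump 1 (\<chi> j. - 1) (\<chi> j. 1)"
  have b: "test_function b" unfolding b_def by (intro test_function_box_bump) simp
  have b0: "b 0 > 0"
    unfolding b_def by (subst box_bump_pos_iff) (auto simp: mem_box_cart)
  \<comment> \<open>Dividing by \<open>b 0\<close> normalises the cutoff so that it tends to 1 at
    every point; the summand 0 fits the affine chain rule.\<close>
  define \<chi>' where "\<chi>' k x = b ((1 / real (Suc k)) *\<^sub>R x + 0) / b 0" for k x
  obtain Bb where Bb: "\<And>x. \<bar>b x\<bar> \<le> Bb" using test_function_bounded[OF b] by metis
  obtain Bg where Bg: "Bg > 0" "\<And>x. norm (grad b x) \<le> Bg" using test_function_grad_bounded[OF b] by metis
  define E where "E k x = (1 / (b 0 * real (Suc k))) *\<^sub>R grad b ((1 / real (Suc k)) *\<^sub>R x + 0)" for k x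
  have d\<chi>: "(\<chi>' k has_derivative (\<lambda>v. E k x \<bullet> v)) (at x)" for k x
    unfolding \<chi>'_def E_def
    using b0
    by (intro has_derivative_eq_rhs[OF has_derivative_mult_left[where y = "1 / b 0", simplified,
        OF has_derivative_affine_grad[OF test_function_differentiable[OF b]]]]) (auto simp: field_simps)
  have c\<chi>: "continuous_on UNIV (\<chi>' k)" for k
    using d\<chi> has_derivative_continuous by (blast intro: continuous_at_imp_continuous_on)
  have cE: "continuous_on UNIV (E k)" for k
    unfolding E_def
    by (intro continuous_intros continuous_on_compose2[OF test_function_grad_continuous[OF b]]) auto
  have B\<chi>: "\<bar>\<chi>' k x\<bar> \<le> Bb / b 0" for k x
    using Bb b0 by (auto simp: \<chi>'_def divide_right_mono)
  have BE: "norm (E k x) \<le> (Bg / b 0) / real (Suc k)" for k x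
  proof -
    have "norm (E k x) = norm (grad b ((1 / real (Suc k)) *\<^sub>R x + 0)) / (b 0 * real (Suc k))"
      using b0 by (simp add: E_def)
    also have "\<dots> \<le> Bg / (b 0 * real (Suc k))"
      using b0 Bg(2) by (intro divide_right_mono) auto
    finally show ?thesis by simp
  qed
  have BE': "norm (E k x) \<le> Bg / b 0" for k x
  proof -
    have "Bg / b 0 / real (Suc k) \<le> Bg / b 0 / 1"
      using b0 Bg(1) by (intro divide_left_mono) auto
    then show ?thesis using BE[of k x] by simp
  qed
  have lim\<chi>: "(\<lambda>k. \<chi>' k x) \<longlonglongrightarrow> 1" for x
  proof -
    have "(\<lambda>k. (1 / real (Suc k)) *\<^sub>R x + 0) \<longlonglongrightarrow> 0 *\<^sub>R x + 0"
      by (intro tendsto_intros LIMSEQ_Suc lim_1_over_n)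
    then have "(\<lambda>k. b ((1 / real (Suc k)) *\<^sub>R x + 0)) \<longlonglongrightarrow> b (0 *\<^sub>R x + 0)"
      using continuous_on_tendsto_compose[OF test_function_continuous[OF b]] by auto
    from tendsto_divide[OF this tendsto_const[of "b 0"]] b0 show ?thesis
      by (simp add: \<chi>'_def)
  qed
  have limE: "(\<lambda>k. E k x) \<longlonglongrightarrow> 0" for x
  proof (rule Lim_null_comparison)
    show "\<forall>\<^sub>F k in sequentially. norm (E k x) \<le> (Bg / b 0) / real (Suc k)"
      using BE by simp
    show "(\<lambda>k. Bg / b 0 / real (Suc k)) \<longlonglongrightarrow> 0"
      by (intro LIMSEQ_Suc lim_const_over_n)
  qed
  have B'0: "B' \<ge> 0" "B \<ge> 0"
    using g[of 0] D(2)[of 0] abs_ge_zero norm_ge_zero by (blast intro: order_trans)+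
  have cg: "continuous_on UNIV g"
    using d has_derivative_continuous by (blast intro: continuous_at_imp_continuous_on)
  have [measurable]: "g \<in> borel_measurable borel" "D \<in> borel_measurable borel"
      "f \<in> borel_measurable borel" "F \<in> borel_measurable borel"
      "\<chi>' k \<in> borel_measurable borel" "E k \<in> borel_measurable borel" for k
    using F f cg D(1) c\<chi> cE by (auto intro: borel_measurable_continuous_onI)
  define C where "C = Bb / b 0 * B + B' * (Bg / b 0)"
  let ?G = "\<lambda>k x. \<chi>' k x *\<^sub>R D x + g x *\<^sub>R E k x"
  have BG: "norm (?G k x) \<le> C" for k x
    unfolding C_def
    by (intro order_trans[OF norm_triangle_ineq] add_mono)
      (unfold norm_scaleR, (intro mult_mono B\<chi> D BE' g B'0 order_trans[OF abs_ge_zero B\<chi>] norm_ge_zero)+)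
  have eq: "(\<integral>x. F x \<bullet> ?G k x \<partial>lborel) = - (\<integral>x. f x * (\<chi>' k x * g x) \<partial>lborel)" for k
  proof -
    obtain R where R: "R > 0" "\<And>x. norm x > R \<Longrightarrow> b x = 0"
      using test_function_support[OF b] by metis
    show ?thesis
    proof (rule div_pairing_compact[OF F f test])
      show "((\<lambda>x. \<chi>' k x * g x) has_derivative (\<lambda>v. ?G k x \<bullet> v)) (at x)" for x
        using has_derivative_mult[OF d\<chi> d]
        by (rule has_derivative_eq_rhs) (auto simp: inner_add_left)
      show "continuous_on UNIV (?G k)"
        by (intro continuous_intros c\<chi> D cg cE)
      show "norm (?G k x) \<le> C" for x by (rule BG)
      show "\<bar>\<chi>' k x * g x\<bar> \<le> Bb / b 0 * B'" for x
        unfolding abs_mult by (intro mult_mono B\<chi> g) (auto intro: order_trans[OF abs_ge_zero B\<chi>])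
      show "\<chi>' k x * g x = 0" if "norm x > R * real (Suc k)" for x
        using that R(1) by (simp add: \<chi>'_def R(2) pos_less_divide_eq)
    qed
  qed
  have "(\<lambda>k. \<integral>x. F x \<bullet> ?G k x \<partial>lborel) \<longlonglongrightarrow> (\<integral>x. F x \<bullet> D x \<partial>lborel)"
  proof (rule integral_dominated_convergence[where w = "\<lambda>x. norm (F x) * C"])
    show "AE x in lborel. (\<lambda>k. F x \<bullet> ?G k x) \<longlonglongrightarrow> F x \<bullet> D x"
    proof (rule AE_I2)
      fix x
      have "(\<lambda>k. F x \<bullet> ?G k x) \<longlonglongrightarrow> F x \<bullet> (1 *\<^sub>R D x + g x *\<^sub>R 0)"
        by (intro tendsto_intros lim\<chi> limE)
      then show "(\<lambda>k. F x \<bullet> ?G k x) \<longlonglongrightarrow> F x \<bullet> D x" by simp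
    qed
    show "AE x in lborel. norm (F x \<bullet> ?G k x) \<le> norm (F x) * C" for k
      unfolding real_norm_def using BG
      by (intro AE_I2 order_trans[OF Cauchy_Schwarz_ineq2] mult_left_mono) auto
  qed (use F in auto)
  moreover have "(\<lambda>k. \<integral>x. f x * (\<chi>' k x * g x) \<partial>lborel) \<longlonglongrightarrow> (\<integral>x. f x * g x \<partial>lborel)"
  proof (rule integral_dominated_convergence[where w = "\<lambda>x. \<bar>f x\<bar> * (Bb / b 0 * B')"])
    show "AE x in lborel. (\<lambda>k. f x * (\<chi>' k x * g x)) \<longlonglongrightarrow> f x * g x"
    proof (rule AE_I2)
      fix x
      have "(\<lambda>k. f x * (\<chi>' k x * g x)) \<longlonglongrightarrow> f x * (1 * g x)"
        by (intro tendsto_intros lim\<chi>)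
      then show "(\<lambda>k. f x * (\<chi>' k x * g x)) \<longlonglongrightarrow> f x * g x" by simp
    qed
    show "AE x in lborel. norm (f x * (\<chi>' k x * g x)) \<le> \<bar>f x\<bar> * (Bb / b 0 * B')" for k
      unfolding real_norm_def abs_mult
      by (intro AE_I2 mult_mono B\<chi> g) (auto intro: order_trans[OF abs_ge_zero B\<chi>])
  qed (use f in auto)
  ultimately show ?thesis
    using eq LIMSEQ_unique tendsto_minus by (metis (no_types, lifting) ext)
qed

section \<open>Uniqueness for the Helmholtz equation\<close>

text \<open>The positive and the negative part of \<open>w\<close> are densities of two measures
  that are finite and equal on boxes. Boxes are stable under intersection and generate the Borel
  sets, so the measures agree; then the two parts agree almost everywhere, and two parts of one
  number can agree only if both are 0.\<close>

lemma AE_eq_0_of_box_integrals: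
  fixes w :: "'a::euclidean_space \<Rightarrow> real"
  assumes w [measurable]: "w \<in> borel_measurable borel"
    and int: "\<And>a b. integrable lborel (\<lambda>x. indicator (box a b) x * w x)"
    and 0: "\<And>a b. (\<integral>x. indicator (box a b) x * w x \<partial>lborel) = 0"
  shows "AE x in lborel. w x = 0"
proof -
  let ?p = "\<lambda>x. ennreal (w x)" and ?m = "\<lambda>x. ennreal (- w x)"
  have eq: "emeasure (density lborel ?p) (box a b) = emeasure (density lborel ?m) (box a b)"
    and fin: "emeasure (density lborel ?p) (box a b) \<noteq> \<infinity>" for a b :: 'a
  proof -
    let ?f = "\<lambda>x. indicator (box a b) x * w x"
    have p: "emeasure (density lborel ?p) (box a b) = (\<integral>\<^sup>+x. ennreal (?f x) \<partial>lborel)"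
      by (subst emeasure_density) (auto intro!: nn_integral_cong split: split_indicator)
    have m: "emeasure (density lborel ?m) (box a b) = (\<integral>\<^sup>+x. ennreal (- ?f x) \<partial>lborel)"
      by (subst emeasure_density) (auto intro!: nn_integral_cong split: split_indicator)
    obtain r q where rq: "0 \<le> r" "0 \<le> q" "(\<integral>\<^sup>+x. ennreal (?f x) \<partial>lborel) = ennreal r"
      "(\<integral>\<^sup>+x. ennreal (- ?f x) \<partial>lborel) = ennreal q" "integral\<^sup>L lborel ?f = r - q"
      using int[of a b] by (rule integrableE)
    show "emeasure (density lborel ?p) (box a b) = emeasure (density lborel ?m) (box a b)"
      using rq 0[of a b] by (simp add: p m)
    show "emeasure (density lborel ?p) (box a b) \<noteq> \<infinity>"
      using rq by (simp add: p)
  qed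
  have "density lborel ?p = density lborel ?m"
  proof (rule measure_eqI_generator_eq[where E = "range (\<lambda>(a, b). box a b)" and \<Omega> = UNIV
        and A = "\<lambda>n::nat. box (- real n *\<^sub>R One) (real n *\<^sub>R One)"])
    show "Int_stable (range (\<lambda>(a, b). box a b :: 'a set))"
      by (auto simp: Int_stable_def box_Int_box)
    show "emeasure (density lborel ?p) X = emeasure (density lborel ?m) X"
      if "X \<in> range (\<lambda>(a, b). box a b)" for X
      using that eq by auto
    show "(\<Union>i::nat. box (- real i *\<^sub>R One) (real i *\<^sub>R One)) = (UNIV :: 'a set)"
      using UN_box_eq_UNIV by simp
    show "emeasure (density lborel ?p) (box (- real i *\<^sub>R One) (real i *\<^sub>R One)) \<noteq> \<infinity>" for i
      using fin by simp
    show "sets (density lborel ?p) = sigma_sets UNIV (range (\<lambda>(a, b). box a b :: 'a set))"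
      by (simp add: borel_eq_box)
    show "sets (density lborel ?m) = sigma_sets UNIV (range (\<lambda>(a, b). box a b :: 'a set))"
      by (simp add: borel_eq_box)
  qed auto
  then have "AE x in lborel. ?p x = ?m x"
    by (subst (asm) sigma_finite_measure.density_unique_iff[OF sigma_finite_lborel]) auto
  then show ?thesis
    by eventually_elim (metis (full_types) ennreal_neg ennreal_eq_0_iff linorder_le_cases neg_le_0_iff_le
        antisym neg_0_le_iff_le)
qed

lemma flat_tendsto_1: "t > 0 \<Longrightarrow> (\<lambda>k. flat (real (Suc k) * t)) \<longlonglongrightarrow> 1"
proof -
  assume t: "t > 0"
  have "(\<lambda>k. exp (- (1 / t) / real (Suc k))) \<longlonglongrightarrow> exp 0"
    by (intro tendsto_intros LIMSEQ_Suc lim_const_over_n)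
  moreover have "flat (real (Suc k) * t) = exp (- (1 / t) / real (Suc k))" for k
    using t by (simp add: flat_exp_seq_0 mult.commute del: of_nat_Suc)
  ultimately show ?thesis
    by simp
qed

text \<open>Bumps of growing steepness tend to the indicator of a box and are dominated by it, so
  vanishing against test functions gives vanishing integrals over boxes.\<close>

lemma AE_eq_0_of_test_functions:
  fixes w :: "real ^ 'n \<Rightarrow> real"
  assumes w [measurable]: "w \<in> borel_measurable borel"
    and loc: "\<And>R. integrable lborel (\<lambda>x. indicator (cball 0 R) x * w x)"
    and 0: "\<And>\<phi>. test_function \<phi> \<Longrightarrow> (\<integral>x. w x * \<phi> x \<partial>lborel) = 0"
  shows "AE x in lborel. w x = 0"
proof (rule AE_eq_0_of_box_integrals[OF w])
  fix a b :: "real ^ 'n"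
  obtain R where R: "\<And>x. x \<in> box a b \<Longrightarrow> norm x \<le> R"
    using bounded_box[of a b] unfolding bounded_iff by blast
  let ?f = "\<lambda>x. indicator (box a b) x * w x"
  have "integrable lborel (\<lambda>x. indicator (box a b) x * (indicator (cball 0 R) x * w x))"
    by (rule integrable_bounded_mult[OF loc, where B = 1]) (auto split: split_indicator)
  moreover have "(\<lambda>x. indicator (box a b) x * (indicator (cball 0 R) x * w x)) = ?f"
    using R by (auto simp: indicator_def)
  ultimately show int: "integrable lborel ?f" by simp
  have bm [measurable]: "box_bump (real (Suc k)) a b \<in> borel_measurable borel" for k
    by (intro borel_measurable_continuous_onI test_function_continuous test_function_box_bump) simp
  have "(\<lambda>k. \<integral>x. w x * box_bump (real (Suc k)) a b x \<partial>lborel) \<longlonglongrightarrow> integral\<^sup>L lborel ?f"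
  proof (rule integral_dominated_convergence[where w = "\<lambda>x. \<bar>?f x\<bar>"])
    have out: "box_bump (real (Suc k)) a b x = 0" if "x \<notin> box a b" for k x
      using that box_bump_pos_iff[of "real (Suc k)" a b x] box_bump_bounds(1)[of "real (Suc k)" a b x]
      by (simp add: less_eq_real_def)
    show "AE x in lborel. (\<lambda>k. w x * box_bump (real (Suc k)) a b x) \<longlonglongrightarrow> ?f x"
    proof (rule AE_I2)
      fix x
      show "(\<lambda>k. w x * box_bump (real (Suc k)) a b x) \<longlonglongrightarrow> ?f x"
      proof (cases "x \<in> box a b")
        case True
        then have x: "x $ j - a $ j > 0" "b $ j - x $ j > 0" for j by (auto simp: mem_box_cart)
        have "(\<lambda>k. w x * (\<Prod>j\<in>UNIV. flat (real (Suc k) * (x $ j - a $ j)) *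
            flat (real (Suc k) * (b $ j - x $ j)))) \<longlonglongrightarrow> w x * (\<Prod>j\<in>(UNIV::'n set). 1 * 1)"
          by (intro tendsto_intros flat_tendsto_1 x)
        then show ?thesis using True by (simp add: box_bump_def right_diff_distrib)
      qed (use out in \<open>simp del: of_nat_Suc\<close>)
    qed
    show "AE x in lborel. norm (w x * box_bump (real (Suc k)) a b x) \<le> \<bar>?f x\<bar>" for k
    proof (rule AE_I2)
      fix x
      show "norm (w x * box_bump (real (Suc k)) a b x) \<le> \<bar>?f x\<bar>"
        using mult_left_mono[OF box_bump_bounds(2)[of "real (Suc k)" a b x] abs_ge_zero[of "w x"]]
          box_bump_bounds(1)[of "real (Suc k)" a b x] out[of x k]
        by (cases "x \<in> box a b") (auto simp: abs_mult)
    qed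
  qed (use int bm w in \<open>simp_all del: of_nat_Suc add: borel_measurable_times\<close>)
  moreover have "(\<integral>x. w x * box_bump (real (Suc k)) a b x \<partial>lborel) = 0" for k
    by (rule 0[OF test_function_box_bump]) simp
  ultimately have "(\<lambda>k::nat. 0) \<longlonglongrightarrow> integral\<^sup>L lborel ?f"
    by (simp only:)
  then show "integral\<^sup>L lborel ?f = 0"
    using LIMSEQ_unique tendsto_const by blast
qed

section \<open>The maximum principle\<close>

lemma second_derivative_nonpos_at_max:
  fixes f :: "real \<Rightarrow> real"
  assumes f: "\<And>t. (f has_real_derivative f' t) (at t)" and f': "(f' has_real_derivative c) (at 0)"
    and max: "\<And>t. f t \<le> f 0"
  shows "c \<le> 0"
proof (rule ccontr)
  assume "\<not> c \<le> 0"
  then have "c > 0" by simp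
  from DERIV_pos_inc_right[OF f' this]
  obtain d where d: "d > 0" "\<And>h. h > 0 \<Longrightarrow> h < d \<Longrightarrow> f' 0 < f' h" by auto
  have "f' 0 = 0"
    by (rule DERIV_local_max[OF f zero_less_one]) (use max in auto)
  obtain z where z: "0 < z" "z < d / 2" "f (d / 2) - f 0 = (d / 2 - 0) * f' z"
    using MVT2[of 0 "d / 2" f f'] d(1) f by auto
  have "f' z > 0" using d(2)[of z] z d(1) \<open>f' 0 = 0\<close> by auto
  then have "f (d / 2) > f 0" using z(3) d(1) by (simp add: algebra_simps) (smt (verit) half_gt_zero mult_pos_pos)
  with max[of "d / 2"] show False by simp
qed

text \<open>Maximum principle for \<open>\<Delta>u = u\<close>: compare \<open>u\<close> with the multiple \<open>\<epsilon> (|x|\<^sup>2 + 2n + 1)\<close> of a strict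
  supersolution that tends to infinity.\<close>

lemma bounded_eigen_nonpos:
  fixes u :: "real ^ 'n \<Rightarrow> real"
  assumes C2: "Ck 2 u" and bd: "\<And>x. \<bar>u x\<bar> \<le> M" and eq: "\<And>x. laplacian u x = u x"
  shows "u x \<le> 0"
proof -
  let ?N = "real CARD('n)"
  have du: "u differentiable (at x)" "partial_deriv j u differentiable (at x)" for x j
    using C2 by (auto simp: numeral_2_eq_2)
  have cu: "continuous_on UNIV u"
    using C2 by (rule Ck_continuous)
  have main: "u x \<le> e * (x \<bullet> x + 2 * ?N + 1)" if e: "e > 0" for e x
  proof -
    define v where "v x = u x - e * (x \<bullet> x + 2 * ?N + 1)" for x
    have M0: "M \<ge> 0" using bd[of 0] by linarith
    \<comment> \<open>Beyond this radius the quadratic term exceeds \<open>2 * M\<close>, the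
      largest possible oscillation of \<open>u\<close>, so \<open>v\<close> lies below
      \<open>v 0\<close> there and a maximum over the ball is a global one.\<close>
    define R where "R = sqrt (2 * M / e)"
    have "continuous_on (cball 0 R) v"
      unfolding v_def by (intro continuous_intros continuous_on_subset[OF cu]) auto
    moreover have "0 \<le> R" using M0 e by (simp add: R_def)
    ultimately obtain x0 where x0: "\<And>x. norm x \<le> R \<Longrightarrow> v x \<le> v x0"
      using continuous_attains_sup[of "cball (0::real^'n) R" v] by fastforce
    have max: "v x \<le> v x0" for x
    proof (cases "norm x \<le> R")
      case False
      then have "2 * M / e \<le> (norm x)\<^sup>2"
        using M0 e unfolding R_def by (meson not_le real_sqrt_le_iff real_le_rsqrt sqrt_le_D less_imp_le)
      then have "2 * M \<le> e * (x \<bullet> x)"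
        using e by (simp add: field_simps power2_norm_eq_inner)
      then have "v x \<le> v 0"
        using bd[of x] bd[of 0] by (simp add: v_def algebra_simps)
      also have "v 0 \<le> v x0" using x0[of 0] M0 e by (simp add: R_def)
      finally show ?thesis .
    qed (rule x0)
    have dd: "partial_deriv j (partial_deriv j u) x0 \<le> 2 * e" for j
    proof -
      let ?l = "\<lambda>t. x0 + t *\<^sub>R axis j 1"
      let ?f = "\<lambda>t. v (?l t)"
      let ?f' = "\<lambda>t. partial_deriv j u (?l t) - e * (2 * (x0 $ j + t))"
      have q: "?l t \<bullet> ?l t = x0 \<bullet> x0 + 2 * t * x0 $ j + t\<^sup>2" for t
        by (simp add: inner_add_left inner_add_right inner_axis inner_axis' power2_eq_square algebra_simps
            axis_eq_axis inner_axis_axis)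
      have "((\<lambda>t. u (?l t)) has_real_derivative partial_deriv j u (?l t)) (at t)" for t
        using DERIV_along_line[OF has_derivative_grad[OF du(1)], of x0 "axis j 1" t]
        by (simp add: inner_axis grad_def)
      moreover have "((\<lambda>t. e * (x0 \<bullet> x0 + 2 * t * x0 $ j + t\<^sup>2 + 2 * ?N + 1)) has_real_derivative
          e * (2 * (x0 $ j + t))) (at t)" for t
        by (auto intro!: derivative_eq_intros)
      ultimately have 1: "(?f has_real_derivative ?f' t) (at t)" for t
        unfolding v_def q by (rule DERIV_diff)
      have "((\<lambda>t. partial_deriv j u (?l t)) has_real_derivative
          partial_deriv j (partial_deriv j u) x0) (at 0)"
        using DERIV_along_line[OF has_derivative_grad[OF du(2)[of j]], of x0 "axis j 1" 0]
        by (simp add: inner_axis grad_def)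
      moreover have "((\<lambda>t. e * (2 * (x0 $ j + t))) has_real_derivative 2 * e) (at 0)"
        by (auto intro!: derivative_eq_intros)
      ultimately have 2: "(?f' has_real_derivative (partial_deriv j (partial_deriv j u) x0 - 2 * e)) (at 0)"
        by (intro DERIV_diff)
      have "partial_deriv j (partial_deriv j u) x0 - 2 * e \<le> 0"
        by (rule second_derivative_nonpos_at_max[OF 1 2]) (simp add: max)
      then show ?thesis by simp
    qed
    have "laplacian u x0 \<le> (\<Sum>j\<in>(UNIV::'n set). 2 * e)"
      unfolding laplacian_def by (intro sum_mono dd)
    then have "u x0 \<le> e * (2 * ?N)" by (simp add: eq mult_ac)
    moreover have "e * (2 * ?N) \<le> e * (x0 \<bullet> x0 + 2 * ?N + 1)"
      using e by (intro mult_left_mono) auto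
    ultimately have "v x0 \<le> 0" by (simp add: v_def)
    with max[of x] show ?thesis by (simp add: v_def)
  qed
  have "((\<lambda>e. e * (x \<bullet> x + 2 * ?N + 1)) \<longlongrightarrow> 0 * (x \<bullet> x + 2 * ?N + 1)) (at_right 0)"
    by (intro tendsto_intros)
  then show ?thesis
    by (intro tendsto_lowerbound[where F = "at_right (0::real)" and f = "\<lambda>e. e * (x \<bullet> x + 2 * ?N + 1)"])
      (auto simp: eventually_at_filter intro!: always_eventually main)
qed

lemma laplacian_affine:
  fixes r :: "real ^ 'n \<Rightarrow> real"
  assumes "Ck 2 r"
  shows "laplacian (\<lambda>y. r (c *\<^sub>R y + x)) y = c\<^sup>2 * laplacian r (c *\<^sub>R y + x)"
proof -
  have d: "r differentiable (at z)" "partial_deriv j r differentiable (at z)" for z j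
    using assms by (auto simp: numeral_2_eq_2)
  have "partial_deriv j (\<lambda>y. r (c *\<^sub>R y + x)) = (\<lambda>y. c * partial_deriv j r (c *\<^sub>R y + x))" for j
    using d by (auto simp: partial_deriv_affine)
  moreover have "partial_deriv j (\<lambda>y. c * partial_deriv j r (c *\<^sub>R y + x)) y =
      c * (c * partial_deriv j (partial_deriv j r) (c *\<^sub>R y + x))" for j
  proof -
    have "(\<lambda>y. partial_deriv j r (c *\<^sub>R y + x)) differentiable (at y)"
      using has_derivative_affine_grad[OF d(2)] differentiable_def by blast
    moreover have "partial_deriv j (\<lambda>y. c) y = 0" for y :: "real ^ 'n"
      by (simp add: partial_deriv_def)
    ultimately show ?thesis
      using d by (simp add: partial_deriv_mult partial_deriv_affine)
  qed
  ultimately show ?thesis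
    by (simp add: laplacian_def sum_distrib_left power2_eq_square mult.assoc)
qed

text \<open>Convolution with a test function turns \<open>w\<close> into a smooth solution of
  \<open>\<Delta>u = u\<close>. Domination of \<open>w\<close> by an integrable function plus a
  constant makes that solution bounded, which the maximum principle requires. This form of the bound
  covers \<open>L^q\<close> and bounded solutions alike.\<close>

lemma helmholtz_unique:
  fixes w :: "real ^ 'n \<Rightarrow> real"
  assumes w [measurable]: "w \<in> borel_measurable borel"
    and loc: "\<And>R. integrable lborel (\<lambda>x. indicator (cball 0 R) x * w x)"
    and bound: "\<And>x. \<bar>w x\<bar> \<le> a x + M" "integrable lborel a" "\<And>x. 0 \<le> a x" "0 \<le> M"
    and eq: "\<And>\<phi>. test_function \<phi> \<Longrightarrow> (\<integral>x. w x * (\<phi> x - laplacian \<phi> x) \<partial>lborel) = 0"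
  shows "AE x in lborel. w x = 0"
proof -
  \<comment> \<open>The factor \<open>c = 1\<close> or \<open>c = -1\<close> gives the inequality
    for \<open>w\<close> and for \<open>- w\<close>.\<close>
  have le: "conv r (\<lambda>y. c * w y) x \<le> 0" if r: "test_function r" and c: "\<bar>c\<bar> = 1" for r c x
  proof -
    let ?w = "\<lambda>y. c * w y"
    have locw: "integrable lborel (\<lambda>x. indicator (cball 0 R) x * ?w x)" for R
      using integrable_mult_right[OF loc[of R], of c] by (simp add: mult_ac)
    obtain B where B: "B > 0" "\<And>x. \<bar>r x\<bar> \<le> B" using test_function_bounded[OF r] by metis
    have ri: "integrable lborel (\<lambda>y. r (x - y))" for x
      using integrable_reflect[of r x] test_function_integrable[OF r] by auto
    have [measurable]: "r \<in> borel_measurable borel" using test_function_integrable[OF r] by auto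
    have intw: "integrable lborel (\<lambda>y. s (x - y) * ?w y)" if s: "test_function s" for s x
    proof -
      obtain R where R: "\<And>x. norm x > R \<Longrightarrow> s x = 0" using test_function_support[OF s] by metis
      obtain B where B: "\<And>x. \<bar>s x\<bar> \<le> B" using test_function_bounded[OF s] by metis
      have "integrable lborel (\<lambda>y. s (x - y) * (indicator (cball 0 (R + norm x)) y * ?w y))"
        by (rule integrable_bounded_mult[OF locw, of _ B])
          (use B test_function_integrable[OF s] in auto)
      moreover have "s (x - y) * (indicator (cball 0 (R + norm x)) y * ?w y) = s (x - y) * ?w y" for y
        using R[of "x - y"] norm_triangle_ineq2[of y x]
        by (cases "norm y \<le> R + norm x") (auto simp: norm_minus_commute)
      ultimately show ?thesis by simp
    qed
    \<comment> \<open>The integrable part of \<open>w\<close> is paired with the supremum of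
      \<open>r\<close>, the constant part with the integral of \<open>\<bar>r\<bar>\<close>.\<close>
    let ?M = "B * (\<integral>y. a y \<partial>lborel) + M * (\<integral>y. \<bar>r y\<bar> \<partial>lborel)"
    have u_bd: "\<bar>conv r ?w x\<bar> \<le> ?M" for x
    proof -
      have i: "integrable lborel (\<lambda>y. B * a y + M * \<bar>r (x - y)\<bar>)"
        using bound(2) ri by auto
      have "norm (\<integral>y. r (x - y) * ?w y \<partial>lborel) \<le> (\<integral>y. B * a y + M * \<bar>r (x - y)\<bar> \<partial>lborel)"
      proof (rule Bochner_Integration.integral_norm_bound_integral[OF intw[OF r] i])
        fix y
        have "\<bar>r (x - y)\<bar> * \<bar>w y\<bar> \<le> \<bar>r (x - y)\<bar> * (a y + M)"
          by (intro mult_left_mono bound) auto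
        also have "\<dots> \<le> B * a y + M * \<bar>r (x - y)\<bar>"
          using mult_right_mono[OF B(2)[of "x - y"] bound(3)[of y]] by (simp add: algebra_simps)
        finally show "norm (r (x - y) * ?w y) \<le> B * a y + M * \<bar>r (x - y)\<bar>"
          using c by (simp add: abs_mult)
      qed
      also have "\<dots> = ?M"
        using bound(2) ri integral_reflect[of "\<lambda>y. \<bar>r y\<bar>" x] by simp
      finally show ?thesis by (simp add: conv_def)
    qed
    have "laplacian (conv r ?w) x = conv r ?w x" for x
    proof -
      \<comment> \<open>The weak equation is tested with \<open>y \<mapsto> r (x - y)\<close>; the
        scale \<open>-1\<close> enters the Laplacian squared.\<close>
      define rx where "rx y = r ((-1) *\<^sub>R y + x)" for y
      have t: "test_function rx" unfolding rx_def[abs_def] by (rule test_function_affine[OF r]) simp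
      have lap: "laplacian rx y = laplacian r (x - y)" for y
        unfolding rx_def[abs_def] by (subst laplacian_affine[OF test_function_Ck[OF r]]) simp
      have tj: "test_function (partial_deriv j (partial_deriv j r))" for j
        by (intro test_function_partial_deriv r)
      have "laplacian (conv r ?w) x = (\<Sum>j\<in>UNIV. conv (partial_deriv j (partial_deriv j r)) ?w x)"
        by (simp add: laplacian_def partial_deriv_conv_test[OF _ locw] r test_function_partial_deriv)
      also have "\<dots> = (\<integral>y. laplacian r (x - y) * ?w y \<partial>lborel)"
        unfolding conv_def laplacian_def sum_distrib_right
        by (subst Bochner_Integration.integral_sum) (auto intro!: intw tj simp del: mult_minus_left)
      finally have l: "laplacian (conv r ?w) x = (\<integral>y. laplacian r (x - y) * ?w y \<partial>lborel)" .
      have il: "integrable lborel (\<lambda>y. laplacian r (x - y) * ?w y)"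
        unfolding laplacian_def sum_distrib_right
        by (intro Bochner_Integration.integrable_sum intw tj)
      have "conv r ?w x - laplacian (conv r ?w) x = (\<integral>y. r (x - y) * ?w y - laplacian r (x - y) * ?w y \<partial>lborel)"
        unfolding l using il intw[OF r] by (simp add: conv_def)
      also have "\<dots> = (\<integral>y. c * (w y * (rx y - laplacian rx y)) \<partial>lborel)"
        by (simp add: lap rx_def algebra_simps)
      also have "\<dots> = 0" using eq[OF t] by simp
      finally show ?thesis by simp
    qed
    then show ?thesis
      using bounded_eigen_nonpos[OF Ck_conv_test[OF r locw] u_bd] by blast
  qed
  \<comment> \<open>The pairing with \<open>\<phi>\<close> is the convolution with the reflected
    \<open>\<phi>\<close>, evaluated at 0.\<close>
  have "(\<integral>x. w x * \<phi> x \<partial>lborel) = 0" if \<phi>: "test_function \<phi>" for \<phi>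
  proof -
    have r: "test_function (\<lambda>x. \<phi> ((-1) *\<^sub>R x + 0))" by (rule test_function_affine[OF \<phi>]) simp
    show ?thesis
      using le[OF r, of 1 0] le[OF r, of "-1" 0] by (simp add: conv_def mult.commute)
  qed
  then show ?thesis
    by (rule AE_eq_0_of_test_functions[OF w loc])
qed

section \<open>The one-dimensional maximal function\<close>

text \<open>Only dyadic radii are used: the supremum is then countable, which gives measurability at
  once, and a general radius can be rounded up at the cost of a factor 2.\<close>

definition maximal :: "(real \<Rightarrow> ennreal) \<Rightarrow> real \<Rightarrow> ennreal" where
  "maximal g t = (SUP k::int. (\<integral>\<^sup>+u. g u * indicator (cball t (2 powr k)) u \<partial>lborel) / ennreal (2 * 2 powr k))"

lemma measurable_maximal [measurable]:
  assumes [measurable]: "g \<in> borel_measurable borel"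
  shows "maximal g \<in> borel_measurable borel"
proof -
  have "(\<lambda>t. \<integral>\<^sup>+u. g u * indicator {u. dist t u \<le> 2 powr real_of_int k} u \<partial>lborel) \<in> borel_measurable borel" for k
    by measurable
  then have [measurable]: "(\<lambda>t. \<integral>\<^sup>+u. g u * indicator (cball t (2 powr real_of_int k)) u \<partial>lborel) \<in> borel_measurable borel" for k
    by (simp add: cball_def)
  show ?thesis
    unfolding maximal_def by measurable
qed

lemma ennreal_mult_divide_cancel: "c > 0 \<Longrightarrow> ennreal c * (I / ennreal c) = I"
  by (subst ennreal_times_divide, subst mult.commute, rule ennreal_mult_divide_eq) auto

lemma maximal_average_le:
  "(\<integral>\<^sup>+u. g u * indicator (cball t (2 powr real_of_int k)) u \<partial>lborel) \<le> ennreal (2 * 2 powr k) * maximal g t"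
proof -
  let ?c = "ennreal (2 * 2 powr k)"
  let ?I = "\<integral>\<^sup>+u. g u * indicator (cball t (2 powr real_of_int k)) u \<partial>lborel"
  have "?I = ?c * (?I / ?c)"
    by (simp add: ennreal_mult_divide_cancel)
  also have "\<dots> \<le> ?c * maximal g t"
    unfolding maximal_def by (intro mult_left_mono SUP_upper) auto
  finally show ?thesis .
qed

lemma maximal_gtE:
  assumes "maximal g t > ennreal l" "0 \<le> l"
  obtains k :: int where
    "ennreal (l * (2 * 2 powr k)) < (\<integral>\<^sup>+u. g u * indicator (cball t (2 powr real_of_int k)) u \<partial>lborel)"
proof -
  obtain k :: int where
    k: "ennreal l < (\<integral>\<^sup>+u. g u * indicator (cball t (2 powr k)) u \<partial>lborel) / ennreal (2 * 2 powr k)"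
    using assms(1) unfolding maximal_def by (auto simp: less_SUP_iff)
  let ?c = "ennreal (2 * 2 powr k)"
  let ?I = "\<integral>\<^sup>+u. g u * indicator (cball t (2 powr real_of_int k)) u \<partial>lborel"
  have c: "?c > 0" "?c < top" by auto
  have "?c * ennreal l < ?c * (?I / ?c)"
    using k c by (intro ennreal_mult_strict_left_mono) auto
  also have "?c * (?I / ?c) = ?I"
    by (simp add: ennreal_mult_divide_cancel)
  finally have "ennreal (l * (2 * 2 powr k)) < ?I"
    using assms(2) by (simp add: ennreal_mult mult.commute)
  then show ?thesis by (rule that)
qed

text \<open>Vitali covering: each point of the level set is the centre of an interval on which
  \<open>g\<close> has mass above \<open>l\<close> times its length, and a disjoint subfamily still
  covers after enlargement by the factor 5. Sums over the countable subfamily are integrals over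
  \<open>count_space\<close>, so that they can be exchanged with the integral in \<open>u\<close>;
  disjointness then bounds the inner sum by \<open>g u\<close>.\<close>

lemma maximal_weak_type:
  assumes g [measurable]: "g \<in> borel_measurable borel" and l: "l > 0"
  shows "ennreal l * emeasure lborel {t. maximal g t > ennreal l} \<le> 5 * (\<integral>\<^sup>+u. g u \<partial>lborel)"
proof (cases "(\<integral>\<^sup>+u. g u \<partial>lborel) = \<infinity>")
  case True
  then show ?thesis by (simp add: ennreal_mult_top)
next
  case False
  then obtain I where I: "(\<integral>\<^sup>+u. g u \<partial>lborel) = ennreal I" "I \<ge> 0"
    by (cases "\<integral>\<^sup>+u. g u \<partial>lborel") auto
  define S where "S = {t. maximal g t > ennreal l}"
  have [measurable]: "S \<in> sets borel" unfolding S_def by measurable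
  have [measurable]: "cball t r \<in> sets borel" for t r :: real by simp
  have "\<exists>r>0. ennreal (l * (2 * r)) < (\<integral>\<^sup>+u. g u * indicator (cball t r) u \<partial>lborel)" if "t \<in> S" for t
    using maximal_gtE[of l g t] that l unfolding S_def
    by (metis mem_Collect_eq less_imp_le powr_gt_zero zero_less_numeral zero_neq_numeral)
  then obtain r where r: "\<And>t. t \<in> S \<Longrightarrow> r t > 0"
    "\<And>t. t \<in> S \<Longrightarrow> ennreal (l * (2 * r t)) < (\<integral>\<^sup>+u. g u * indicator (cball t (r t)) u \<partial>lborel)"
    by metis
  \<comment> \<open>The covering lemma needs bounded radii; since every chosen interval carries mass
    more than \<open>l\<close> times its length, the finite total mass bounds them.\<close>
  have rB: "r t \<le> I / (2 * l)" if "t \<in> S" for t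
  proof -
    have "ennreal (l * (2 * r t)) \<le> (\<integral>\<^sup>+u. g u \<partial>lborel)"
      using r(2)[OF that] by (intro order_trans[OF less_imp_le nn_integral_mono]) (auto split: split_indicator)
    then have "l * (2 * r t) \<le> I"
      using I by (simp add: ennreal_le_iff)
    then show ?thesis using l by (simp add: field_simps)
  qed
  obtain C where C: "countable C" "C \<subseteq> S"
    "pairwise (\<lambda>i j. disjnt (cball i (r i)) (cball j (r j))) C"
    "S \<subseteq> (\<Union>i\<in>C. cball i (5 * r i))"
  proof (rule Vitali_covering_lemma_cballs[where S = S and K = S and a = "\<lambda>t. t" and r = r])
    show "S \<subseteq> (\<Union>i\<in>S. cball i (r i))" using r(1) by (force intro: less_imp_le)
    show "0 < r i \<and> r i \<le> I / (2 * l)" if "i \<in> S" for i using r(1) rB that by blast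
  qed
  have "emeasure lborel S = (\<integral>\<^sup>+u. indicator S u \<partial>lborel)"
    by simp
  also have "\<dots> \<le> (\<integral>\<^sup>+u. (\<integral>\<^sup>+i. indicator (cball i (5 * r i)) u \<partial>count_space C) \<partial>lborel)"
  proof (rule nn_integral_mono)
    fix u
    show "indicator S u \<le> (\<integral>\<^sup>+i. indicator (cball i (5 * r i)) u \<partial>count_space C)"
    proof (cases "u \<in> S")
      case True
      then obtain i where i: "i \<in> C" "u \<in> cball i (5 * r i)" using C(4) by blast
      then show ?thesis
        using nn_integral_ge_point[OF i(1), of "\<lambda>i. indicator (cball i (5 * r i)) u"] True by simp
    qed simp
  qed
  also have "\<dots> = (\<integral>\<^sup>+i. emeasure lborel (cball i (5 * r i)) \<partial>count_space C)"
    by (subst nn_integral_count_space_nn_integral[OF C(1)]) (auto intro!: borel_measurable_indicator)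
  also have "\<dots> = (\<integral>\<^sup>+i. ennreal (10 * r i) \<partial>count_space C)"
    using r(1) C(2) by (intro nn_integral_cong) (auto simp: cball_eq_atLeastAtMost less_imp_le subset_iff)
  finally have "ennreal l * emeasure lborel S \<le> ennreal l * (\<integral>\<^sup>+i. ennreal (10 * r i) \<partial>count_space C)"
    by (intro mult_left_mono) auto
  also have "\<dots> = (\<integral>\<^sup>+i. ennreal (10 * r i * l) \<partial>count_space C)"
  proof (subst nn_integral_cmult[symmetric])
    show "(\<integral>\<^sup>+i. ennreal l * ennreal (10 * r i) \<partial>count_space C) = (\<integral>\<^sup>+i. ennreal (10 * r i * l) \<partial>count_space C)"
      using l by (intro nn_integral_cong) (subst ennreal_mult'[symmetric], simp_all add: mult.commute)
  qed auto
  also have "\<dots> \<le> (\<integral>\<^sup>+i. 5 * (\<integral>\<^sup>+u. g u * indicator (cball i (r i)) u \<partial>lborel) \<partial>count_space C)"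
  proof (rule nn_integral_mono)
    fix i assume "i \<in> space (count_space C)"
    then have i: "i \<in> S" using C(2) by auto
    have "ennreal (10 * r i * l) = 5 * ennreal (l * (2 * r i))"
      using l r(1)[OF i] by (subst ennreal_numeral[symmetric], subst ennreal_mult[symmetric]) (auto simp: mult_ac)
    also have "\<dots> \<le> 5 * (\<integral>\<^sup>+u. g u * indicator (cball i (r i)) u \<partial>lborel)"
      using r(2)[OF i] by (intro mult_left_mono) auto
    finally show "ennreal (10 * r i * l) \<le> 5 * (\<integral>\<^sup>+u. g u * indicator (cball i (r i)) u \<partial>lborel)" .
  qed
  also have "\<dots> = 5 * (\<integral>\<^sup>+i. (\<integral>\<^sup>+u. g u * indicator (cball i (r i)) u \<partial>lborel) \<partial>count_space C)"
    by (rule nn_integral_cmult) auto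
  also have "(\<integral>\<^sup>+i. (\<integral>\<^sup>+u. g u * indicator (cball i (r i)) u \<partial>lborel) \<partial>count_space C) =
      (\<integral>\<^sup>+u. (\<integral>\<^sup>+i. g u * indicator (cball i (r i)) u \<partial>count_space C) \<partial>lborel)"
    by (rule nn_integral_count_space_nn_integral[OF C(1), symmetric]) measurable
  also have "\<dots> \<le> (\<integral>\<^sup>+u. g u \<partial>lborel)"
  proof (rule nn_integral_mono)
    fix u
    show "(\<integral>\<^sup>+i. g u * indicator (cball i (r i)) u \<partial>count_space C) \<le> g u"
    proof (cases "\<exists>i\<in>C. u \<in> cball i (r i)")
      case True
      then obtain i where i: "i \<in> C" "u \<in> cball i (r i)" by blast
      have "u \<notin> cball j (r j)" if "j \<in> C" "j \<noteq> i" for j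
        using C(3) i that by (auto simp: pairwise_def disjnt_iff simp del: mem_cball)
      then have "(\<integral>\<^sup>+i. g u * indicator (cball i (r i)) u \<partial>count_space C) =
          (\<Sum>j\<in>{i}. g u * indicator (cball j (r j)) u)"
        using i by (intro nn_integral_count_space') auto
      also have "\<dots> = g u * indicator (cball i (r i)) u"
        by (simp only: sum.insert finite.emptyI empty_iff not_False_eq_True sum.empty add_0_right)
      finally show ?thesis
        using i(2) by simp
    next
      case False
      then have "(\<integral>\<^sup>+i. g u * indicator (cball i (r i)) u \<partial>count_space C) = (\<integral>\<^sup>+i. 0 \<partial>count_space C)"
        by (intro nn_integral_cong) auto
      then show ?thesis by simp
    qed
  qed
  finally show ?thesis
    unfolding S_def by (simp add: mult_left_mono)
qed

lemma nn_integral_powr_from_0: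
  assumes "a > -1" "0 \<le> c"
  shows "(\<integral>\<^sup>+x. ennreal (x powr a) * indicator {0..c} x \<partial>lborel) = ennreal (c powr (a + 1) / (a + 1))"
  by (rule nn_integral_has_integral_lebesgue'[OF _ has_integral_powr_from_0[OF assms]]) simp

lemma nn_integral_powr_to_inf:
  assumes "a < -1" "0 < c"
  shows "(\<integral>\<^sup>+x. ennreal (x powr a) * indicator {c..} x \<partial>lborel) = ennreal (- (c powr (a + 1)) / (a + 1))"
  by (rule nn_integral_has_integral_lebesgue'[OF _ has_integral_powr_to_inf[OF assms]]) simp

lemma maximal_le_bound:
  assumes "\<And>u. g u \<le> ennreal B" "0 \<le> B"
  shows "maximal g t \<le> ennreal B"
  unfolding maximal_def
proof (rule SUP_least)
  fix k :: int
  have "(\<integral>\<^sup>+u. g u * indicator (cball t (2 powr k)) u \<partial>lborel) \<le>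
      (\<integral>\<^sup>+u. ennreal B * indicator (cball t (2 powr k)) u \<partial>lborel)"
    using assms by (intro nn_integral_mono mult_right_mono) auto
  also have "\<dots> = ennreal B * ennreal (2 * 2 powr k)"
    by (simp add: nn_integral_cmult cball_eq_atLeastAtMost)
  finally show "(\<integral>\<^sup>+u. g u * indicator (cball t (2 powr k)) u \<partial>lborel) / ennreal (2 * 2 powr k) \<le> ennreal B"
    by (intro divide_le_posI_ennreal) (auto simp: mult.commute)
qed

text \<open>Where \<open>g\<close> is at most \<open>l / 2\<close> it contributes at most
  \<open>l / 2\<close> to any average, so the part of \<open>g\<close> above that height must
  contribute the remaining \<open>l / 2\<close>.\<close>

lemma maximal_level_set:
  fixes g :: "real \<Rightarrow> real"
  assumes g [measurable]: "g \<in> borel_measurable borel" and l: "l > 0"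
    and M: "maximal (\<lambda>u. ennreal (g u)) t > ennreal l"
  shows "maximal (\<lambda>u. ennreal (g u) * indicator {u. l < 2 * g u} u) t > ennreal (l / 2)"
proof -
  let ?g1 = "\<lambda>u. ennreal (g u) * indicator {u. l < 2 * g u} u"
  obtain k :: int where
    k: "ennreal (l * (2 * 2 powr k)) < (\<integral>\<^sup>+u. ennreal (g u) * indicator (cball t (2 powr real_of_int k)) u \<partial>lborel)"
    using maximal_gtE[OF M] l by auto
  let ?b = "cball t (2 powr real_of_int k)"
  have "(\<integral>\<^sup>+u. ennreal (g u) * indicator ?b u \<partial>lborel) \<le>
      (\<integral>\<^sup>+u. ?g1 u * indicator ?b u + ennreal (l / 2) * indicator ?b u \<partial>lborel)"
    using l by (intro nn_integral_mono) (auto split: split_indicator intro!: ennreal_leI)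
  also have "\<dots> = (\<integral>\<^sup>+u. ?g1 u * indicator ?b u \<partial>lborel) + ennreal (l / 2) * ennreal (2 * 2 powr k)"
    by (simp add: nn_integral_add nn_integral_cmult cball_eq_atLeastAtMost)
  also have "\<dots> \<le> ennreal (2 * 2 powr k) * maximal ?g1 t + ennreal (l / 2) * ennreal (2 * 2 powr k)"
    by (intro add_mono maximal_average_le) auto
  finally have *: "ennreal (l * (2 * 2 powr k)) <
      ennreal (2 * 2 powr k) * maximal ?g1 t + ennreal (l / 2) * ennreal (2 * 2 powr k)"
    using k by simp
  show ?thesis
  proof (rule ccontr)
    assume "\<not> ?thesis"
    then have "maximal ?g1 t \<le> ennreal (l / 2)" by simp
    then have "ennreal (2 * 2 powr k) * maximal ?g1 t + ennreal (l / 2) * ennreal (2 * 2 powr k) \<le>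
        ennreal (2 * 2 powr k) * ennreal (l / 2) + ennreal (l / 2) * ennreal (2 * 2 powr k)"
      by (intro add_mono mult_left_mono) auto
    also have "\<dots> = ennreal (l * (2 * 2 powr k))"
      using l by (simp add: ennreal_mult[symmetric] ennreal_plus[symmetric] del: ennreal_plus)
    finally show False using * by simp
  qed
qed

text \<open>Interpolation by hand: layer cake for the \<open>p\<close>-th power, the weak-type bound
  applied at each level \<open>l\<close> to the part of \<open>g\<close> above \<open>l / 2\<close>,
  then Tonelli. What remains is the integral of \<open>10 * p * g u * l powr (p - 2)\<close> over
  \<open>0 \<le> l \<le> 2 * g u\<close>; it converges because \<open>p > 1\<close> and produces the
  constant.\<close>

lemma maximal_strong_type:
  fixes g :: "real \<Rightarrow> real"
  assumes g [measurable]: "g \<in> borel_measurable borel" and nonneg: "\<And>u. 0 \<le> g u"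
    and bdd: "\<And>u. g u \<le> B" and p: "p > 1"
  shows "(\<integral>\<^sup>+t. ennreal (enn2real (maximal (\<lambda>u. ennreal (g u)) t) powr p) \<partial>lborel) \<le>
    ennreal (10 * p * 2 powr (p - 1) / (p - 1)) * (\<integral>\<^sup>+u. ennreal (g u powr p) \<partial>lborel)"
proof -
  let ?M = "maximal (\<lambda>u. ennreal (g u))"
  define m where "m t = enn2real (?M t)" for t
  have [measurable]: "m \<in> borel_measurable borel" unfolding m_def by measurable
  have B: "B \<ge> 0" using nonneg[of 0] bdd[of 0] by simp
  have "?M t \<le> ennreal B" for t
    by (rule maximal_le_bound) (use bdd B in \<open>auto intro: ennreal_leI\<close>)
  \<comment> \<open>Since \<open>g\<close> is bounded, the maximal function is finite and
    \<open>enn2real\<close> never takes its default value.\<close>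
  then have mM: "ennreal (m t) = ?M t" for t
    unfolding m_def by (metis ennreal_enn2real_if ennreal_less_top infinity_ennreal_def leD top.extremum_strict)
  have m0: "m t \<ge> 0" for t by (simp add: m_def)
  have layer: "ennreal (m t powr p) = (\<integral>\<^sup>+l. ennreal (p * l powr (p - 1)) * indicator {l. 0 < l \<and> l < m t} l \<partial>lborel)" for t
  proof -
    have "ennreal (m t powr p) = ennreal p * ennreal (m t powr p / p)"
      using p by (simp add: ennreal_mult[symmetric])
    also have "\<dots> = ennreal p * (\<integral>\<^sup>+l. ennreal (l powr (p - 1)) * indicator {0..m t} l \<partial>lborel)"
      using nn_integral_powr_from_0[of "p - 1" "m t"] p m0 by simp
    also have "(\<integral>\<^sup>+l. ennreal (l powr (p - 1)) * indicator {0..m t} l \<partial>lborel) =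
        (\<integral>\<^sup>+l. ennreal (l powr (p - 1)) * indicator {l. 0 < l \<and> l < m t} l \<partial>lborel)"
    proof (rule nn_integral_cong_AE)
      show "AE l in lborel. ennreal (l powr (p - 1)) * indicator {0..m t} l =
          ennreal (l powr (p - 1)) * indicator {l. 0 < l \<and> l < m t} l"
        using AE_lborel_singleton[of "m t"] AE_lborel_singleton[of 0]
        by eventually_elim (auto split: split_indicator)
    qed
    finally show ?thesis
      using p by (simp add: nn_integral_cmult[symmetric] ennreal_mult mult.assoc)
  qed
  have level: "emeasure lborel {t. l < m t} \<le> (\<integral>\<^sup>+u. ennreal (10 / l * g u) * indicator {u. l < 2 * g u} u \<partial>lborel)"
    if l: "l > 0" for l
  proof -
    let ?g1 = "\<lambda>u. ennreal (g u) * indicator {u. l < 2 * g u} u"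
    have "{t. l < m t} \<subseteq> {t. maximal ?g1 t > ennreal (l / 2)}"
    proof safe
      fix t assume "l < m t"
      then have "ennreal l < ?M t"
        using l by (subst mM[symmetric]) (simp add: ennreal_less_iff)
      then show "maximal ?g1 t > ennreal (l / 2)"
        by (rule maximal_level_set[OF g l])
    qed
    then have "emeasure lborel {t. l < m t} \<le> emeasure lborel {t. maximal ?g1 t > ennreal (l / 2)}"
      by (intro emeasure_mono) auto
    also have "\<dots> = ennreal (2 / l) * (ennreal (l / 2) * emeasure lborel {t. maximal ?g1 t > ennreal (l / 2)})"
      using l by (simp add: mult.assoc[symmetric] ennreal_mult[symmetric])
    also have "\<dots> \<le> ennreal (2 / l) * (5 * (\<integral>\<^sup>+u. ?g1 u \<partial>lborel))"
      using l by (intro mult_left_mono maximal_weak_type) auto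
    also have "\<dots> = ennreal (10 / l) * (\<integral>\<^sup>+u. ?g1 u \<partial>lborel)"
      using l by (simp add: mult.assoc[symmetric] ennreal_numeral[symmetric] ennreal_mult[symmetric]
          del: ennreal_numeral)
    also have "\<dots> = (\<integral>\<^sup>+u. ennreal (10 / l) * ?g1 u \<partial>lborel)"
      by (rule nn_integral_cmult[symmetric]) measurable
    also have "\<dots> = (\<integral>\<^sup>+u. ennreal (10 / l * g u) * indicator {u. l < 2 * g u} u \<partial>lborel)"
      using l nonneg
      by (intro nn_integral_cong) (auto simp: ennreal_mult[symmetric] split: split_indicator)
    finally show ?thesis .
  qed
  have inner: "(\<integral>\<^sup>+l. ennreal (p * l powr (p - 1)) * indicator {0<..} l * (ennreal (10 / l * g u) * indicator {u. l < 2 * g u} u) \<partial>lborel)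
      \<le> ennreal (10 * p * 2 powr (p - 1) / (p - 1)) * ennreal (g u powr p)" for u
  proof -
    have "(\<integral>\<^sup>+l. ennreal (p * l powr (p - 1)) * indicator {0<..} l * (ennreal (10 / l * g u) * indicator {u. l < 2 * g u} u) \<partial>lborel)
      \<le> (\<integral>\<^sup>+l. ennreal (10 * p * g u) * (ennreal (l powr (p - 2)) * indicator {0..2 * g u} l) \<partial>lborel)"
    proof (rule nn_integral_mono)
      fix l :: real
      have "p * l powr (p - 1) * (10 / l * g u) = 10 * p * g u * l powr (p - 2)" if "l > 0"
        using that powr_diff[of l "p - 1" 1] by (simp add: field_simps)
      then show "ennreal (p * l powr (p - 1)) * indicator {0<..} l * (ennreal (10 / l * g u) * indicator {u. l < 2 * g u} u)
          \<le> ennreal (10 * p * g u) * (ennreal (l powr (p - 2)) * indicator {0..2 * g u} l)"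
        using p nonneg[of u] by (auto split: split_indicator simp: ennreal_mult[symmetric])
    qed
    also have "\<dots> = ennreal (10 * p * g u) * ennreal ((2 * g u) powr (p - 1) / (p - 1))"
      using nn_integral_powr_from_0[of "p - 2" "2 * g u"] p nonneg[of u]
      by (simp add: nn_integral_cmult)
    also have "\<dots> = ennreal (10 * p * 2 powr (p - 1) / (p - 1)) * ennreal (g u powr p)"
    proof -
      have "g u * (2 * g u) powr (p - 1) = 2 powr (p - 1) * g u powr p"
        using nonneg[of u] powr_mult_base[of "g u" "p - 1"] by (simp add: powr_mult mult_ac)
      then show ?thesis
        using p nonneg[of u] by (simp add: ennreal_mult[symmetric] mult_ac)
    qed
    finally show ?thesis .
  qed
  have "(\<integral>\<^sup>+t. ennreal (m t powr p) \<partial>lborel) =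
      (\<integral>\<^sup>+t. \<integral>\<^sup>+l. ennreal (p * l powr (p - 1)) * indicator {l. 0 < l \<and> l < m t} l \<partial>lborel \<partial>lborel)"
    by (simp add: layer)
  also have "\<dots> = (\<integral>\<^sup>+l. \<integral>\<^sup>+t. ennreal (p * l powr (p - 1)) * indicator {l. 0 < l \<and> l < m t} l \<partial>lborel \<partial>lborel)"
    by (rule lborel_pair.Fubini') measurable
  also have "\<dots> = (\<integral>\<^sup>+l. ennreal (p * l powr (p - 1)) * indicator {0<..} l * emeasure lborel {t. l < m t} \<partial>lborel)"
  proof (rule nn_integral_cong)
    fix l :: real
    have "(\<integral>\<^sup>+t. ennreal (p * l powr (p - 1)) * indicator {l. 0 < l \<and> l < m t} l \<partial>lborel) =
        (\<integral>\<^sup>+t. ennreal (p * l powr (p - 1)) * indicator {0<..} l * indicator {t. l < m t} t \<partial>lborel)"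
      by (intro nn_integral_cong) (auto split: split_indicator)
    then show "(\<integral>\<^sup>+t. ennreal (p * l powr (p - 1)) * indicator {l. 0 < l \<and> l < m t} l \<partial>lborel) =
        ennreal (p * l powr (p - 1)) * indicator {0<..} l * emeasure lborel {t. l < m t}"
      by (simp add: nn_integral_cmult)
  qed
  also have "\<dots> \<le> (\<integral>\<^sup>+l. ennreal (p * l powr (p - 1)) * indicator {0<..} l *
      (\<integral>\<^sup>+u. ennreal (10 / l * g u) * indicator {u. l < 2 * g u} u \<partial>lborel) \<partial>lborel)"
    using level by (intro nn_integral_mono) (auto split: split_indicator intro!: mult_left_mono)
  also have "\<dots> = (\<integral>\<^sup>+l. \<integral>\<^sup>+u. ennreal (p * l powr (p - 1)) * indicator {0<..} l *
      (ennreal (10 / l * g u) * indicator {u. l < 2 * g u} u) \<partial>lborel \<partial>lborel)"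
    by (intro nn_integral_cong nn_integral_cmult[symmetric]) measurable
  also have "\<dots> = (\<integral>\<^sup>+u. \<integral>\<^sup>+l. ennreal (p * l powr (p - 1)) * indicator {0<..} l *
      (ennreal (10 / l * g u) * indicator {u. l < 2 * g u} u) \<partial>lborel \<partial>lborel)"
    by (rule lborel_pair.Fubini') measurable
  also have "\<dots> \<le> (\<integral>\<^sup>+u. ennreal (10 * p * 2 powr (p - 1) / (p - 1)) * ennreal (g u powr p) \<partial>lborel)"
    by (intro nn_integral_mono inner)
  also have "\<dots> = ennreal (10 * p * 2 powr (p - 1) / (p - 1)) * (\<integral>\<^sup>+u. ennreal (g u powr p) \<partial>lborel)"
    by (rule nn_integral_cmult) measurable
  finally show ?thesis by (simp add: m_def)
qed

section \<open>The one-dimensional heat kernel and its domination by the maximal function\<close>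

definition gauss1 :: "real \<Rightarrow> real \<Rightarrow> real" where
  "gauss1 s u = exp (- u\<^sup>2 / (4 * s)) / sqrt (4 * pi * s)"

text \<open>A single term of the series suffices, that of the first dyadic ball containing
  \<open>v\<close>. For index \<open>j > 0\<close> one has
  \<open>v\<^sup>2 / (4 * s) \<ge> 4 ^ j / 16\<close>, and \<open>exp (- y) \<le> 1 / y\<close>
  gives the factor \<open>16 * (1 / 4) ^ j\<close>. This decay beats the growth \<open>2 ^ j\<close>
  of the lengths of the balls.\<close>

lemma gauss1_le_dyadic:
  assumes s: "s > 0" and \<rho>: "sqrt s \<le> \<rho>"
  shows "ennreal (gauss1 s v) \<le> (\<Sum>j. ennreal (16 * (1 / 4) ^ j / sqrt s) * indicator (cball 0 (2 ^ j * \<rho>)) v)"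
proof -
  have \<rho>0: "\<rho> > 0" using s \<rho> by (meson less_le_trans real_sqrt_gt_zero)
  obtain n where n: "\<bar>v\<bar> / \<rho> < 2 ^ n" using real_arch_pow[of 2 "\<bar>v\<bar> / \<rho>"] by auto
  define j where "j = (LEAST j. \<bar>v\<bar> \<le> 2 ^ j * \<rho>)"
  have j: "\<bar>v\<bar> \<le> 2 ^ j * \<rho>"
    unfolding j_def by (rule LeastI[of _ n]) (use n \<rho>0 in \<open>simp add: field_simps\<close>)
  have e: "exp (- v\<^sup>2 / (4 * s)) \<le> 16 * (1 / 4) ^ j"
  proof (cases j)
    case (Suc i)
    then have "\<not> \<bar>v\<bar> \<le> 2 ^ i * \<rho>"
      using not_less_Least[of i "\<lambda>j. \<bar>v\<bar> \<le> 2 ^ j * \<rho>"] by (simp add: j_def)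
    then have "2 ^ i * sqrt s < \<bar>v\<bar>"
      using \<rho> by (smt (verit) mult_left_mono zero_le_power)
    then have "(2 ^ i * sqrt s)\<^sup>2 \<le> v\<^sup>2"
      using s by (metis abs_ge_zero abs_le_square_iff abs_of_nonneg less_imp_le mult_nonneg_nonneg
          power2_abs real_sqrt_ge_zero zero_le_numeral zero_le_power)
    then have "4 ^ i * s \<le> v\<^sup>2"
      using s power_mult_distrib[of "2::real" 2 i]
      by (simp add: power_mult_distrib) (simp add: power2_eq_square)
    then have *: "4 ^ i / 4 \<le> v\<^sup>2 / (4 * s)"
      using s by (simp add: field_simps)
    have "v\<^sup>2 / (4 * s) \<le> exp (v\<^sup>2 / (4 * s))"
      using exp_ge_add_one_self[of "v\<^sup>2 / (4 * s)"] by linarith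
    with * have "4 ^ i / 4 \<le> exp (v\<^sup>2 / (4 * s))" by simp
    then have "inverse (exp (v\<^sup>2 / (4 * s))) \<le> inverse (4 ^ i / 4)"
      by (intro le_imp_inverse_le) auto
    then show ?thesis
      by (simp add: Suc exp_minus field_simps power_divide)
  qed (use s in \<open>auto intro: order_trans[of _ 1]\<close>)
  have "sqrt s \<le> sqrt (4 * pi * s)"
    using s pi_ge_two by (intro real_sqrt_le_mono) (simp add: mult_le_cancel_right1)
  then have "gauss1 s v \<le> 16 * (1 / 4) ^ j / sqrt s"
    unfolding gauss1_def using s e by (intro frac_le) auto
  then have "ennreal (gauss1 s v) \<le> (\<Sum>j\<in>{j}. ennreal (16 * (1 / 4) ^ j / sqrt s) * indicator (cball 0 (2 ^ j * \<rho>)) v)"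
    using j by (simp add: ennreal_leI)
  also have "\<dots> \<le> (\<Sum>j. ennreal (16 * (1 / 4) ^ j / sqrt s) * indicator (cball 0 (2 ^ j * \<rho>)) v)"
    by (rule sum_le_suminf) auto
  finally show ?thesis .
qed

text \<open>The weight \<open>16 * (1 / 4) ^ j / sqrt s\<close> times the length
  \<open>2 * 2 ^ j * \<rho>\<close> is at most \<open>64 * (1 / 2) ^ j\<close>, because
  \<open>\<rho> \<le> 2 * sqrt s\<close>; summing over \<open>j\<close> gives 128.\<close>

lemma gauss1_conv_le_maximal:
  assumes g [measurable]: "g \<in> borel_measurable borel" and s: "s > 0"
  shows "(\<integral>\<^sup>+u. ennreal (gauss1 s (t - u)) * g u \<partial>lborel) \<le> 128 * maximal g t"
proof -
  \<comment> \<open>The radius \<open>sqrt s\<close> is rounded up to a power of 2, so that all the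
    balls are among those in the definition of \<open>maximal\<close>.\<close>
  define k where "k = \<lceil>log 2 (sqrt s)\<rceil>"
  let ?\<rho> = "2 powr real_of_int k"
  have s0: "sqrt s > 0" using s by simp
  have "log 2 (sqrt s) \<le> k" "k \<le> log 2 (sqrt s) + 1" unfolding k_def by linarith+
  then have "2 powr (log 2 (sqrt s)) \<le> ?\<rho>" "?\<rho> \<le> 2 powr (log 2 (sqrt s) + 1)"
    by (auto intro: powr_mono)
  moreover have "2 powr log 2 (sqrt s) = sqrt s"
    using s0 by simp
  ultimately have \<rho>: "sqrt s \<le> ?\<rho>" "?\<rho> \<le> 2 * sqrt s"
    unfolding powr_add by simp_all
  have [measurable]: "cball t r \<in> sets borel" for r by simp
  have pow: "2 ^ j * ?\<rho> = 2 powr real_of_int (int j + k)" for j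
    by (simp add: powr_add powr_realpow)
  have "(\<integral>\<^sup>+u. ennreal (gauss1 s (t - u)) * g u \<partial>lborel) \<le>
      (\<integral>\<^sup>+u. (\<Sum>j. ennreal (16 * (1 / 4) ^ j / sqrt s) * indicator (cball 0 (2 ^ j * ?\<rho>)) (t - u)) * g u \<partial>lborel)"
    by (intro nn_integral_mono mult_right_mono gauss1_le_dyadic[OF s \<rho>(1)]) auto
  also have "\<dots> = (\<integral>\<^sup>+u. (\<Sum>j. ennreal (16 * (1 / 4) ^ j / sqrt s) * (g u * indicator (cball t (2 ^ j * ?\<rho>)) u)) \<partial>lborel)"
    by (intro nn_integral_cong, subst ennreal_suminf_multc[symmetric], intro suminf_cong)
      (auto simp: mult_ac dist_real_def split: split_indicator)
  also have "\<dots> = (\<Sum>j. ennreal (16 * (1 / 4) ^ j / sqrt s) * (\<integral>\<^sup>+u. g u * indicator (cball t (2 ^ j * ?\<rho>)) u \<partial>lborel))"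
    by (subst nn_integral_suminf) (auto simp: nn_integral_cmult)
  also have "\<dots> \<le> (\<Sum>j. ennreal (64 * (1 / 2) ^ j) * maximal g t)"
  proof (intro suminf_le allI)
    fix j
    have "ennreal (16 * (1 / 4) ^ j / sqrt s) * (\<integral>\<^sup>+u. g u * indicator (cball t (2 ^ j * ?\<rho>)) u \<partial>lborel) \<le>
        ennreal (16 * (1 / 4) ^ j / sqrt s) * (ennreal (2 * (2 ^ j * ?\<rho>)) * maximal g t)"
      unfolding pow by (intro mult_left_mono maximal_average_le) auto
    also have "\<dots> = ennreal (16 * (1 / 4) ^ j / sqrt s * (2 * (2 ^ j * ?\<rho>))) * maximal g t"
      using s by (simp add: mult.assoc[symmetric] ennreal_mult[symmetric])
    also have "\<dots> \<le> ennreal (64 * (1 / 2) ^ j) * maximal g t"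
    proof (intro mult_right_mono ennreal_leI)
      have "16 * (1 / 4) ^ j / sqrt s * (2 * (2 ^ j * ?\<rho>)) = 32 * (1 / 2) ^ j * (?\<rho> / sqrt s)"
        using power_mult_distrib[of "2::real" 2 j] by (simp add: power_divide field_simps)
      also have "\<dots> \<le> 32 * (1 / 2) ^ j * 2"
        using \<rho>(2) s0 by (intro mult_left_mono) (auto simp: field_simps)
      finally show "16 * (1 / 4) ^ j / sqrt s * (2 * (2 ^ j * ?\<rho>)) \<le> 64 * (1 / 2) ^ j" by simp
    qed auto
    finally show "ennreal (16 * (1 / 4) ^ j / sqrt s) * (\<integral>\<^sup>+u. g u * indicator (cball t (2 ^ j * ?\<rho>)) u \<partial>lborel) \<le>
        ennreal (64 * (1 / 2) ^ j) * maximal g t" .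
  qed auto
  also have "\<dots> = (\<Sum>j. ennreal (64 * (1 / 2) ^ j)) * maximal g t"
    by (rule ennreal_suminf_multc)
  also have "(\<Sum>j. ennreal (64 * (1 / 2) ^ j)) = 128"
  proof -
    have 1: "norm (1 / 2 :: real) < 1" by simp
    have "(\<lambda>j. 64 * (1 / 2 :: real) ^ j) sums (64 * (1 / (1 - 1 / 2)))"
      by (rule sums_mult[OF geometric_sums[OF 1]])
    then have "(\<Sum>j. ennreal (64 * (1 / 2) ^ j)) = ennreal (64 * (1 / (1 - 1 / 2)))"
      by (rule suminf_ennreal_eq[rotated]) simp
    then show ?thesis by simp
  qed
  finally show ?thesis .
qed

lemma borel_measurable_component [measurable (raw)]:
  fixes f :: "'a \<Rightarrow> real ^ 'n"
  assumes [measurable]: "f \<in> borel_measurable M"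
  shows "(\<lambda>x. f x $ j) \<in> borel_measurable M"
proof -
  have "(\<lambda>x. f x \<bullet> axis j 1) \<in> borel_measurable M" by measurable
  then show ?thesis by (simp add: inner_axis)
qed

lemma borel_measurable_vec_lambda:
  fixes f :: "'n::finite \<Rightarrow> 'a \<Rightarrow> real"
  assumes [measurable]: "\<And>j. f j \<in> borel_measurable M"
  shows "(\<lambda>x. \<chi> j. f j x) \<in> borel_measurable M"
proof (subst borel_measurable_euclidean_space, safe)
  fix b :: "real ^ 'n" assume "b \<in> Basis"
  then obtain j where "b = axis j 1" by (auto simp: Basis_vec_def)
  then show "(\<lambda>x. (\<chi> j. f j x) \<bullet> b) \<in> borel_measurable M"
    by (simp add: inner_axis)
qed

lemma prod_Basis_vec:
  fixes f :: "real \<Rightarrow> 'b::comm_monoid_mult"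
  shows "(\<Prod>b\<in>(Basis :: (real ^ 'n) set). f (x \<bullet> b)) = (\<Prod>j\<in>UNIV. f (x $ j))"
proof -
  have B: "(Basis :: (real ^ 'n) set) = (\<lambda>j. axis j 1) ` UNIV"
    by (auto simp: Basis_vec_def)
  show ?thesis
    unfolding B by (subst prod.reindex) (auto simp: inj_on_def axis_eq_axis inner_axis)
qed

lemma gauss1_nonneg: "s > 0 \<Longrightarrow> 0 \<le> gauss1 s u"
  by (simp add: gauss1_def)

lemma nn_integral_gauss1:
  assumes "s > 0"
  shows "(\<integral>\<^sup>+u. ennreal (gauss1 s u) \<partial>lborel) = 1"
proof -
  have "gauss1 s = normal_density 0 (sqrt (2 * s))"
    using assms by (simp add: gauss1_def normal_density_def fun_eq_iff)
  then show ?thesis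
    using assms by (subst nn_integral_eq_integral) auto
qed

section \<open>The heat kernel\<close>

definition heat :: "real \<Rightarrow> real ^ 'n \<Rightarrow> real" where
  "heat s x = exp (- (norm x)\<^sup>2 / (4 * s)) / sqrt (4 * pi * s) ^ CARD('n)"

lemma heat_nonneg: "s > 0 \<Longrightarrow> 0 \<le> heat s x"
  by (simp add: heat_def)

lemma heat_measurable [measurable (raw)]:
  assumes [measurable]: "f \<in> borel_measurable M" "g \<in> borel_measurable M"
  shows "(\<lambda>p. heat (f p) (g p)) \<in> borel_measurable M"
  unfolding heat_def by measurable

lemma heat_eq_prod:
  fixes x :: "real ^ 'n"
  shows "heat s x = (\<Prod>j\<in>UNIV. gauss1 s (x $ j))"
proof -
  have "(\<Sum>j\<in>UNIV. - (x $ j)\<^sup>2 / (4 * s)) = - (norm x)\<^sup>2 / (4 * s)"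
    by (simp add: norm_eq_sqrt_inner inner_vec_def power2_eq_square sum_negf sum_nonneg flip: sum_divide_distrib)
  then show ?thesis
    by (simp add: gauss1_def heat_def prod_dividef exp_sum[symmetric])
qed

lemma nn_integral_heat:
  assumes "s > 0"
  shows "(\<integral>\<^sup>+x. ennreal (heat s (x :: real ^ 'n)) \<partial>lborel) = 1"
proof -
  have [measurable]: "gauss1 s \<in> borel_measurable borel" by (simp add: gauss1_def[abs_def])
  have "(\<integral>\<^sup>+x. ennreal (heat s (x :: real ^ 'n)) \<partial>lborel) =
      (\<integral>\<^sup>+x. (\<Prod>b\<in>Basis. ennreal (gauss1 s ((x :: real ^ 'n) \<bullet> b))) \<partial>lborel)"
    by (simp add: heat_eq_prod prod_Basis_vec gauss1_nonneg[OF assms] prod_ennreal)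
  also have "\<dots> = (\<Prod>b\<in>(Basis :: (real ^ 'n) set). \<integral>\<^sup>+u. ennreal (gauss1 s u) \<partial>lborel)"
    by (rule nn_integral_lborel_prod) simp_all
  finally show ?thesis
    by (simp add: nn_integral_gauss1[OF assms])
qed

lemma integrable_heat: "s > 0 \<Longrightarrow> integrable lborel (heat s)"
  by (rule integrableI_nonneg) (auto simp: nn_integral_heat heat_nonneg)

lemma integral_heat: "s > 0 \<Longrightarrow> (\<integral>x. heat s x \<partial>lborel) = 1"
  using nn_integral_eq_integral[OF integrable_heat, of s] nn_integral_heat[of s]
  by (metis AE_I2 ennreal_eq_1 heat_nonneg)

lemma heat_le:
  fixes x :: "real ^ 'n"
  assumes "s > 0"
  shows "heat s x \<le> 1 / sqrt (4 * pi * s) ^ CARD('n)"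
  unfolding heat_def using assms by (intro divide_right_mono) auto

lemma has_derivative_heat:
  fixes x :: "real ^ 'n"
  assumes "s > 0"
  shows "(heat s has_derivative (\<lambda>v. ((- heat s x / (2 * s)) *\<^sub>R x) \<bullet> v)) (at x)"
proof -
  let ?c = "sqrt (4 * pi * s) ^ CARD('n)"
  have c: "?c \<noteq> 0" using assms by simp
  have 1: "((\<lambda>x::real^'n. x \<bullet> x) has_derivative (\<lambda>v. x \<bullet> v + v \<bullet> x)) (at x)"
    by (rule has_derivative_inner) (rule has_derivative_ident)+
  have 2: "((\<lambda>u. exp (- u / (4 * s)) / ?c) has_real_derivative
      (exp (- (x \<bullet> x) / (4 * s)) * (- 1 / (4 * s)) / ?c)) (at (x \<bullet> x))"
    using c assms by (auto intro!: derivative_eq_intros simp: field_simps)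
  have "(((\<lambda>u. exp (- u / (4 * s)) / ?c) \<circ> (\<lambda>x. x \<bullet> x)) has_derivative
      ((\<lambda>v. (exp (- (x \<bullet> x) / (4 * s)) * (- 1 / (4 * s)) / ?c) * v) \<circ> (\<lambda>v. x \<bullet> v + v \<bullet> x))) (at x)"
    by (rule diff_chain_at[OF 1 2[unfolded has_field_derivative_def]])
  then show ?thesis
    using assms c
    by (simp add: o_def heat_def[abs_def] power2_norm_eq_inner inner_commute field_simps)
qed

definition dheat :: "'n::finite \<Rightarrow> real \<Rightarrow> real ^ 'n \<Rightarrow> real" where
  "dheat j s x = (- heat s x / (2 * s)) * x $ j"

text \<open>The gradient of \<open>dheat j s\<close>, that is, a row of the Hessian of the heat
  kernel.\<close>

definition ddheat :: "'n::finite \<Rightarrow> real \<Rightarrow> real ^ 'n \<Rightarrow> real ^ 'n" where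
  "ddheat j s x = (- heat s x / (2 * s)) *\<^sub>R axis j 1 + (x $ j * heat s x / (4 * s\<^sup>2)) *\<^sub>R x"

lemma has_derivative_dheat:
  fixes x :: "real ^ 'n"
  assumes "s > 0"
  shows "(dheat j s has_derivative (\<lambda>v. ddheat j s x \<bullet> v)) (at x)"
proof -
  have "((\<lambda>x. heat s x * (x $ j)) has_derivative
      (\<lambda>v. heat s x * (v $ j) + (((- heat s x / (2 * s)) *\<^sub>R x) \<bullet> v) * x $ j)) (at x)"
    by (rule has_derivative_mult[OF has_derivative_heat[OF assms]
          bounded_linear_imp_has_derivative[OF bounded_linear_vec_nth]])
  from has_derivative_mult_right[OF this, of "- 1 / (2 * s)"]
  have "((\<lambda>x. - 1 / (2 * s) * (heat s x * (x $ j))) has_derivative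
      (\<lambda>v. ddheat j s x \<bullet> v)) (at x)"
    by (rule has_derivative_eq_rhs)
      (use assms in \<open>auto simp: ddheat_def inner_add_left inner_diff_left inner_axis' power2_eq_square field_simps\<close>)
  then show ?thesis
    by (simp add: dheat_def[abs_def])
qed

lemma continuous_on_heat: "s > 0 \<Longrightarrow> continuous_on UNIV (heat s)"
  using has_derivative_heat has_derivative_continuous by (blast intro: continuous_at_imp_continuous_on)

lemma continuous_on_ddheat: "s > 0 \<Longrightarrow> continuous_on UNIV (ddheat j s)"
  unfolding ddheat_def[abs_def] by (intro continuous_intros continuous_on_heat) auto

lemma dheat_measurable [measurable (raw)]:
  assumes [measurable]: "f \<in> borel_measurable M" "g \<in> borel_measurable M"
  shows "(\<lambda>p. dheat j (f p) (g p)) \<in> borel_measurable M"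
  unfolding dheat_def by measurable

lemma ddheat_measurable [measurable (raw)]:
  assumes [measurable]: "f \<in> borel_measurable M" "g \<in> borel_measurable M"
  shows "(\<lambda>p. ddheat j (f p) (g p)) \<in> borel_measurable M"
  unfolding ddheat_def by measurable

text \<open>Half of the Gaussian decay absorbs the polynomial factors produced by differentiation.\<close>

lemma
  fixes x :: "real ^ 'n"
  assumes s: "s > 0"
  shows heat_le_heat2: "heat s x \<le> 2 ^ CARD('n) * heat (2 * s) x"
    and norm_mult_heat_le: "norm x * heat s x \<le> 9 * sqrt s * 2 ^ CARD('n) * heat (2 * s) x"
    and norm2_mult_heat_le: "(norm x)\<^sup>2 * heat s x \<le> 8 * s * 2 ^ CARD('n) * heat (2 * s) x"
proof -
  let ?n = "CARD('n)"
  \<comment> \<open>Half of the exponent of \<open>heat s x\<close>: the other half is the exponent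
    of \<open>heat (2 * s) x\<close>.\<close>
  define y where "y = (norm x)\<^sup>2 / (8 * s)"
  have y: "y \<ge> 0" "y * exp (- y) \<le> 1"
  proof -
    show "y \<ge> 0" using s by (simp add: y_def)
    have "y \<le> exp y" using exp_ge_add_one_self[of y] by linarith
    then have "y * exp (- y) \<le> exp y * exp (- y)" by (intro mult_right_mono) auto
    then show "y * exp (- y) \<le> 1" by (simp add: exp_minus)
  qed
  have h: "heat s x = sqrt 2 ^ ?n * heat (2 * s) x * exp (- y)"
  proof -
    have "- (norm x)\<^sup>2 / (4 * s) = - (norm x)\<^sup>2 / (4 * (2 * s)) + - y"
      using s by (simp add: y_def field_simps)
    then have "exp (- (norm x)\<^sup>2 / (4 * s)) = exp (- (norm x)\<^sup>2 / (4 * (2 * s))) * exp (- y)"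
      by (simp only: exp_add)
    moreover have "sqrt (4 * pi * (2 * s)) ^ ?n = sqrt 2 ^ ?n * sqrt (4 * pi * s) ^ ?n"
    proof -
      have "4 * pi * (2 * s) = 2 * (4 * pi * s)" by simp
      then show ?thesis by (simp only: real_sqrt_mult power_mult_distrib)
    qed
    ultimately show ?thesis
      using s by (simp add: heat_def field_simps)
  qed
  have "sqrt 2 \<le> 2" by (rule real_le_lsqrt) auto
  then have s2: "sqrt 2 ^ ?n \<le> 2 ^ ?n" by (intro power_mono) auto
  have h2: "0 \<le> heat (2 * s) x" using s by (simp add: heat_nonneg)
  \<comment> \<open>All three bounds reduce to a bound for \<open>c * exp (- y)\<close>. The
    dimensional factor \<open>sqrt 2 ^ n\<close> of the doubled time is rounded up to
    \<open>2 ^ n\<close>.\<close>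
  have key: "c * exp (- y) \<le> d \<Longrightarrow> 0 \<le> d \<Longrightarrow> c * heat s x \<le> d * 2 ^ ?n * heat (2 * s) x" for c d
  proof -
    assume cd: "c * exp (- y) \<le> d" "0 \<le> d"
    have "c * heat s x = c * exp (- y) * (sqrt 2 ^ ?n * heat (2 * s) x)" by (simp add: h mult_ac)
    also have "\<dots> \<le> d * (2 ^ ?n * heat (2 * s) x)"
      using cd h2 s2 by (intro mult_mono mult_right_mono mult_nonneg_nonneg) auto
    finally show ?thesis by (simp add: mult_ac)
  qed
  show "heat s x \<le> 2 ^ CARD('n) * heat (2 * s) x"
    using key[of 1 1] y(1) by simp
  have n2: "(norm x)\<^sup>2 = 8 * s * y" using s by (simp add: y_def)
  show "(norm x)\<^sup>2 * heat s x \<le> 8 * s * 2 ^ CARD('n) * heat (2 * s) x"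
  proof (rule key)
    have "s * (y * exp (- y)) \<le> s * 1" using s y by (intro mult_left_mono) auto
    then show "(norm x)\<^sup>2 * exp (- y) \<le> 8 * s" by (simp add: n2 mult_ac)
  qed (use s in simp)
  show "norm x * heat s x \<le> 9 * sqrt s * 2 ^ CARD('n) * heat (2 * s) x"
  proof (rule key)
    have "norm x = sqrt s * sqrt (8 * y)"
      using s n2 by (metis mult.assoc mult.commute norm_ge_zero real_sqrt_mult real_sqrt_unique)
    \<comment> \<open>Linearising the root lets \<open>y * exp (- y) \<le> 1\<close> be reused; the
      constant 9 is \<open>1 + 8\<close>.\<close>
    moreover have "sqrt (8 * y) \<le> 1 + 8 * y"
      using y(1) by (intro real_le_lsqrt) (auto simp: power2_eq_square algebra_simps)
    ultimately have "norm x \<le> sqrt s * (1 + 8 * y)"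
      using s by (simp add: mult_left_mono)
    then have "norm x * exp (- y) \<le> sqrt s * (1 + 8 * y) * exp (- y)"
      by (intro mult_right_mono) auto
    also have "\<dots> = sqrt s * (exp (- y) + 8 * (y * exp (- y)))" by (simp add: algebra_simps)
    also have "\<dots> \<le> sqrt s * (1 + 8 * 1)"
      using s y by (intro mult_left_mono add_mono) auto
    finally show "norm x * exp (- y) \<le> 9 * sqrt s" by simp
  qed (use s in simp)
qed

text \<open>The constant is rounded up, through 10 in place of 9, so that the kernel, its first and
  its second derivatives all share \<open>5 * 2 ^ CARD('n)\<close>; each use of
  \<open>parabolic_kernel\<close> below has one constant for a kernel and its gradient.\<close>

lemma dheat_bound:
  fixes x :: "real ^ 'n"
  assumes s: "s > 0"
  shows "\<bar>dheat j s x\<bar> \<le> 5 * 2 ^ CARD('n) * s powr (- (1/2)) * heat (2 * s) x"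
proof -
  have p: "s powr (- (1/2)) = sqrt s / s"
    using s by (simp add: powr_minus powr_half_sqrt field_simps)
  have "\<bar>dheat j s x\<bar> = \<bar>x $ j\<bar> * heat s x / (2 * s)"
    using s heat_nonneg[OF s, of x] by (simp add: dheat_def abs_mult)
  also have "\<dots> \<le> norm x * heat s x / (2 * s)"
    using s heat_nonneg[OF s, of x] by (intro divide_right_mono mult_right_mono component_le_norm_cart) auto
  also have "\<dots> \<le> (9 * sqrt s * 2 ^ CARD('n) * heat (2 * s) x) / (2 * s)"
    using s by (intro divide_right_mono norm_mult_heat_le) auto
  also have "\<dots> \<le> (10 * sqrt s * 2 ^ CARD('n) * heat (2 * s) x) / (2 * s)"
    using s heat_nonneg[of "2 * s" x] by (intro divide_right_mono mult_right_mono) auto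
  also have "\<dots> = 5 * 2 ^ CARD('n) * s powr (- (1/2)) * heat (2 * s) x"
    using s by (simp add: p field_simps)
  finally show ?thesis .
qed

lemma grad_heat_bound:
  fixes x :: "real ^ 'n"
  assumes s: "s > 0"
  shows "norm ((- heat s x / (2 * s)) *\<^sub>R x) \<le> 5 * 2 ^ CARD('n) * s powr (- (1/2)) * heat (2 * s) x"
proof -
  have p: "s powr (- (1/2)) = sqrt s / s"
    using s by (simp add: powr_minus powr_half_sqrt field_simps)
  have "norm ((- heat s x / (2 * s)) *\<^sub>R x) = norm x * heat s x / (2 * s)"
    using s heat_nonneg[OF s, of x] by simp
  also have "\<dots> \<le> (9 * sqrt s * 2 ^ CARD('n) * heat (2 * s) x) / (2 * s)"
    using s by (intro divide_right_mono norm_mult_heat_le) auto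
  also have "\<dots> \<le> (10 * sqrt s * 2 ^ CARD('n) * heat (2 * s) x) / (2 * s)"
    using s heat_nonneg[of "2 * s" x] by (intro divide_right_mono mult_right_mono) auto
  also have "\<dots> = 5 * 2 ^ CARD('n) * s powr (- (1/2)) * heat (2 * s) x"
    using s by (simp add: p field_simps)
  finally show ?thesis .
qed

lemma ddheat_bound:
  fixes x :: "real ^ 'n"
  assumes s: "s > 0"
  shows "norm (ddheat j s x) \<le> 5 * 2 ^ CARD('n) * s powr (- 1) * heat (2 * s) x"
proof -
  have p: "s powr (- 1) = 1 / s"
    using s by (simp add: powr_minus field_simps)
  have "norm (ddheat j s x) \<le> norm ((- heat s x / (2 * s)) *\<^sub>R (axis j 1 :: real ^ 'n)) +
      norm ((x $ j * heat s x / (4 * s\<^sup>2)) *\<^sub>R x)"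
    unfolding ddheat_def by (rule norm_triangle_ineq)
  also have "\<dots> = heat s x / (2 * s) + \<bar>x $ j\<bar> * norm x * heat s x / (4 * s\<^sup>2)"
    using s heat_nonneg[OF s, of x] by (simp add: abs_mult norm_axis_1)
  also have "\<bar>x $ j\<bar> * norm x * heat s x / (4 * s\<^sup>2) \<le> norm x * norm x * heat s x / (4 * s\<^sup>2)"
    using s heat_nonneg[OF s, of x] by (intro divide_right_mono mult_right_mono component_le_norm_cart) auto
  also have "norm x * norm x * heat s x / (4 * s\<^sup>2) \<le> 8 * s * 2 ^ CARD('n) * heat (2 * s) x / (4 * s\<^sup>2)"
    using norm2_mult_heat_le[OF s, of x] by (intro divide_right_mono) (auto simp: power2_eq_square)
  also have "heat s x / (2 * s) \<le> 2 ^ CARD('n) * heat (2 * s) x / (2 * s)"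
    using s by (intro divide_right_mono heat_le_heat2) auto
  finally have "norm (ddheat j s x) \<le> 2 ^ CARD('n) * heat (2 * s) x / (2 * s) +
      8 * s * 2 ^ CARD('n) * heat (2 * s) x / (4 * s\<^sup>2)" by simp
  also have "\<dots> = (5 / 2) * (2 ^ CARD('n) * heat (2 * s) x / s)"
    using s by (simp add: power2_eq_square field_simps)
  also have "\<dots> \<le> 5 * (2 ^ CARD('n) * heat (2 * s) x / s)"
    using s heat_nonneg[of "2 * s" x] by (intro mult_right_mono divide_nonneg_pos mult_nonneg_nonneg) auto
  finally show ?thesis using s by (simp add: p mult_ac)
qed

text \<open>Young's inequality for \<open>f / (X + e)\<close> and \<open>g / (Y + e)\<close>, then
  \<open>e\<close> to 0; the positive \<open>e\<close> makes the normalisation possible when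
  \<open>X\<close> or \<open>Y\<close> is 0. Upper bounds \<open>X\<close> and \<open>Y\<close>
  stand in for the norms, which avoids taking roots of extended integrals.\<close>

lemma nn_integral_Hoelder:
  fixes f g :: "'a \<Rightarrow> real"
  assumes [measurable]: "f \<in> borel_measurable M" "g \<in> borel_measurable M"
    and nonneg: "\<And>x. 0 \<le> f x" "\<And>x. 0 \<le> g x"
    and pq: "p > 1" "q > 1" "1 / p + 1 / q = 1"
    and X: "(\<integral>\<^sup>+x. ennreal (f x powr p) \<partial>M) \<le> ennreal (X powr p)" "0 \<le> X"
    and Y: "(\<integral>\<^sup>+x. ennreal (g x powr q) \<partial>M) \<le> ennreal (Y powr q)" "0 \<le> Y"
  shows "(\<integral>\<^sup>+x. ennreal (f x * g x) \<partial>M) \<le> ennreal (X * Y)"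
proof -
  have *: "(\<integral>\<^sup>+x. ennreal (f x * g x) \<partial>M) \<le> ennreal ((X + e) * (Y + e))" if e: "e > 0" for e
  proof -
    let ?X = "X + e" and ?Y = "Y + e"
    have X0: "?X > 0" "?Y > 0" using e X(2) Y(2) by auto
    have "f x * g x \<le> ?X * ?Y * ((f x powr p) / (p * ?X powr p) + (g x powr q) / (q * ?Y powr q))" for x
    proof -
      have "(f x / ?X) * (g x / ?Y) \<le> (f x / ?X) powr p / p + (g x / ?Y) powr q / q"
        using nonneg X0 pq by (intro Youngs_inequality) auto
      also have "\<dots> = (f x powr p) / (p * ?X powr p) + (g x powr q) / (q * ?Y powr q)"
        using nonneg[of x] X0 by (simp add: powr_divide mult.commute)
      finally have "?X * ?Y * ((f x / ?X) * (g x / ?Y)) \<le>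
          ?X * ?Y * ((f x powr p) / (p * ?X powr p) + (g x powr q) / (q * ?Y powr q))"
        using X0 by (intro mult_left_mono) auto
      moreover have "?X * ?Y * ((f x / ?X) * (g x / ?Y)) = f x * g x"
        using X0 by simp
      ultimately show ?thesis by simp
    qed
    then have "(\<integral>\<^sup>+x. ennreal (f x * g x) \<partial>M) \<le>
        (\<integral>\<^sup>+x. ennreal (?X * ?Y / (p * ?X powr p)) * ennreal (f x powr p) +
          ennreal (?X * ?Y / (q * ?Y powr q)) * ennreal (g x powr q) \<partial>M)"
      using X0 pq
      by (intro nn_integral_mono)
        (subst ennreal_mult[symmetric], simp, simp, subst ennreal_mult[symmetric], simp, simp,
          subst ennreal_plus[symmetric], simp, simp, rule ennreal_leI, simp add: distrib_left)
    also have "\<dots> = ennreal (?X * ?Y / (p * ?X powr p)) * (\<integral>\<^sup>+x. ennreal (f x powr p) \<partial>M) +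
          ennreal (?X * ?Y / (q * ?Y powr q)) * (\<integral>\<^sup>+x. ennreal (g x powr q) \<partial>M)"
      by (simp add: nn_integral_add nn_integral_cmult)
    also have "\<dots> \<le> ennreal (?X * ?Y / (p * ?X powr p)) * ennreal (?X powr p) +
          ennreal (?X * ?Y / (q * ?Y powr q)) * ennreal (?Y powr q)"
    proof (intro add_mono mult_left_mono)
      have "ennreal (X powr p) \<le> ennreal (?X powr p)" "ennreal (Y powr q) \<le> ennreal (?Y powr q)"
        using X(2) Y(2) e pq by (auto intro!: ennreal_leI powr_mono2)
      then show "(\<integral>\<^sup>+x. ennreal (f x powr p) \<partial>M) \<le> ennreal (?X powr p)"
        "(\<integral>\<^sup>+x. ennreal (g x powr q) \<partial>M) \<le> ennreal (?Y powr q)"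
        using X(1) Y(1) by (blast intro: order_trans)+
    qed auto
    also have "\<dots> = ennreal (?X * ?Y * (1 / p + 1 / q))"
    proof -
      have "?X * ?Y / (p * ?X powr p) * ?X powr p = ?X * ?Y * (1 / p)"
        "?X * ?Y / (q * ?Y powr q) * ?Y powr q = ?X * ?Y * (1 / q)"
        using X0 by simp_all
      then have "?X * ?Y / (p * ?X powr p) * ?X powr p + ?X * ?Y / (q * ?Y powr q) * ?Y powr q = ?X * ?Y * (1 / p + 1 / q)"
        by (simp only: distrib_left)
      then show ?thesis
        using X0 pq by (simp add: ennreal_mult[symmetric] ennreal_plus[symmetric] del: ennreal_plus)
    qed
    finally show ?thesis using pq(3) by simp
  qed
  have "((\<lambda>e. ennreal ((X + e) * (Y + e))) \<longlongrightarrow> ennreal ((X + 0) * (Y + 0))) (at_right 0)"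
    by (intro tendsto_ennrealI tendsto_intros)
  then show ?thesis
    by (intro tendsto_lowerbound[where F = "at_right (0::real)" and f = "\<lambda>e. ennreal ((X + e) * (Y + e))"])
      (auto simp: eventually_at_filter intro!: always_eventually *)
qed

section \<open>Slices orthogonal to a coordinate axis\<close>

definition upd :: "'n::finite \<Rightarrow> real \<Rightarrow> real ^ 'n \<Rightarrow> real ^ 'n" where
  "upd i t x = x + (t - x $ i) *\<^sub>R axis i 1"

lemma upd_nth: "upd i t x $ j = (if j = i then t else x $ j)"
  by (simp add: upd_def axis_def)

lemma upd_measurable [measurable (raw)]:
  assumes [measurable]: "f \<in> borel_measurable M" "g \<in> borel_measurable M"
  shows "(\<lambda>p. upd i (f p) (g p)) \<in> borel_measurable M"
  unfolding upd_def by measurable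

text \<open>Hyperplanes \<open>x $ i = t\<close> are parametrised by the points of the strip \<open>0 \<le> x $ i \<le> 1\<close> of
  unit width, which avoids a separate \<open>(n - 1)\<close>-dimensional space.\<close>

definition strip :: "'n::finite \<Rightarrow> (real ^ 'n) set" where
  "strip i = {w. 0 \<le> w $ i \<and> w $ i \<le> 1}"

lemma strip_measurable [measurable]: "strip i \<in> sets borel"
  unfolding strip_def by measurable

text \<open>For fixed \<open>w\<close> the point \<open>upd i t w\<close> is a translate of
  \<open>w\<close> along the axis. After shifting \<open>w\<close> back, the translations
  \<open>r\<close> that bring a given point into the strip form an interval of length 1, so every
  point is counted with weight 1.\<close>

lemma nn_integral_slices:
  fixes f :: "real ^ 'n \<Rightarrow> ennreal"
  assumes [measurable]: "f \<in> borel_measurable borel"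
  shows "(\<integral>\<^sup>+x. f x \<partial>lborel) = (\<integral>\<^sup>+t. \<integral>\<^sup>+w. f (upd i t w) * indicator (strip i) w \<partial>lborel \<partial>lborel)"
proof -
  let ?e = "axis i 1 :: real ^ 'n"
  have "(\<integral>\<^sup>+t. \<integral>\<^sup>+w. f (upd i t w) * indicator (strip i) w \<partial>lborel \<partial>lborel) =
      (\<integral>\<^sup>+w. \<integral>\<^sup>+t. f (upd i t w) * indicator (strip i) w \<partial>lborel \<partial>lborel)"
    by (rule lborel_pair.Fubini') measurable
  also have "\<dots> = (\<integral>\<^sup>+w. \<integral>\<^sup>+r. f (w + r *\<^sub>R ?e) * indicator (strip i) w \<partial>lborel \<partial>lborel)"
  proof (rule nn_integral_cong)
    fix w
    show "(\<integral>\<^sup>+t. f (upd i t w) * indicator (strip i) w \<partial>lborel) =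
        (\<integral>\<^sup>+r. f (w + r *\<^sub>R ?e) * indicator (strip i) w \<partial>lborel)"
      using nn_integral_shift[of "\<lambda>r. f (w + r *\<^sub>R ?e) * indicator (strip i) w" "- (w $ i)"]
      by (simp add: upd_def)
  qed
  also have "\<dots> = (\<integral>\<^sup>+r. \<integral>\<^sup>+w. f (w + r *\<^sub>R ?e) * indicator (strip i) w \<partial>lborel \<partial>lborel)"
    by (rule lborel_pair.Fubini') measurable
  also have "\<dots> = (\<integral>\<^sup>+r. \<integral>\<^sup>+w. f w * indicator (strip i) (w - r *\<^sub>R ?e) \<partial>lborel \<partial>lborel)"
  proof (rule nn_integral_cong)
    fix r
    have [measurable]: "(\<lambda>w. f w * indicator (strip i) (w - r *\<^sub>R ?e)) \<in> borel_measurable borel"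
      by measurable
    show "(\<integral>\<^sup>+w. f (w + r *\<^sub>R ?e) * indicator (strip i) w \<partial>lborel) =
        (\<integral>\<^sup>+w. f w * indicator (strip i) (w - r *\<^sub>R ?e) \<partial>lborel)"
      using nn_integral_shift[of "\<lambda>w. f w * indicator (strip i) (w - r *\<^sub>R ?e)" "r *\<^sub>R ?e"] by simp
  qed
  also have "\<dots> = (\<integral>\<^sup>+w. \<integral>\<^sup>+r. f w * indicator (strip i) (w - r *\<^sub>R ?e) \<partial>lborel \<partial>lborel)"
    by (rule lborel_pair.Fubini') measurable
  also have "\<dots> = (\<integral>\<^sup>+w. f w \<partial>lborel)"
  proof (rule nn_integral_cong)
    fix w
    have "indicator (strip i) (w - r *\<^sub>R ?e) = (indicator {w $ i - 1..w $ i} r :: ennreal)" for r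
      by (auto simp: strip_def indicator_def)
    then show "(\<integral>\<^sup>+r. f w * indicator (strip i) (w - r *\<^sub>R ?e) \<partial>lborel) = f w"
      by (simp add: nn_integral_cmult)
  qed
  finally show ?thesis by simp
qed

text \<open>The heat kernel in the \<open>n - 1\<close> variables tangential to the slice, as a
  function that ignores \<open>x $ i\<close>.\<close>

definition heat_rest :: "'n::finite \<Rightarrow> real \<Rightarrow> real ^ 'n \<Rightarrow> real" where
  "heat_rest i s x = (\<Prod>j\<in>UNIV - {i}. gauss1 s (x $ j))"

lemma gauss1_measurable [measurable (raw)]:
  assumes [measurable]: "f \<in> borel_measurable M" "g \<in> borel_measurable M"
  shows "(\<lambda>p. gauss1 (f p) (g p)) \<in> borel_measurable M"
  unfolding gauss1_def by measurable

lemma heat_rest_measurable [measurable (raw)]: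
  assumes [measurable]: "f \<in> borel_measurable M" "g \<in> borel_measurable M"
  shows "(\<lambda>p. heat_rest i (f p) (g p)) \<in> borel_measurable M"
  unfolding heat_rest_def by measurable

lemma heat_rest_nonneg: "s > 0 \<Longrightarrow> 0 \<le> heat_rest i s x"
  unfolding heat_rest_def by (intro prod_nonneg) (auto simp: gauss1_nonneg)

lemma heat_split: "heat s (x - upd i t w) = gauss1 s (x $ i - t) * heat_rest i s (x - w)"
proof -
  have "heat s (x - upd i t w) = gauss1 s (x $ i - t) * (\<Prod>j\<in>UNIV - {i}. gauss1 s ((x - upd i t w) $ j))"
    unfolding heat_eq_prod by (subst prod.remove[of UNIV i]) (auto simp: upd_nth)
  also have "(\<Prod>j\<in>UNIV - {i}. gauss1 s ((x - upd i t w) $ j)) = heat_rest i s (x - w)"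
    unfolding heat_rest_def by (intro prod.cong) (auto simp: upd_nth)
  finally show ?thesis .
qed

lemma heat_rest_le:
  fixes x :: "real ^ 'n"
  assumes s: "s > 0"
  shows "heat_rest i s x \<le> s powr (- ((real CARD('n) - 1) / 2))"
proof -
  have "gauss1 s u \<le> s powr (- (1/2))" for u
  proof -
    have "sqrt s \<le> sqrt (4 * pi * s)"
      using s pi_ge_two by (intro real_sqrt_le_mono) (simp add: mult_le_cancel_right1)
    then have "gauss1 s u \<le> 1 / sqrt s"
      unfolding gauss1_def using s by (intro frac_le) auto
    also have "\<dots> = s powr (- (1/2))"
      using s by (simp add: powr_minus powr_half_sqrt field_simps)
    finally show ?thesis .
  qed
  then have "heat_rest i s x \<le> (\<Prod>j\<in>UNIV - {i}. s powr (- (1/2)))"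
    unfolding heat_rest_def using s by (intro prod_mono) (auto simp: gauss1_nonneg)
  also have "\<dots> = (s powr (- (1/2))) ^ (CARD('n) - 1)"
    by (simp add: card_Diff_singleton)
  also have "\<dots> = s powr (- ((real CARD('n) - 1) / 2))"
    using s by (simp add: powr_realpow[symmetric] powr_powr of_nat_diff Suc_le_eq)
  finally show ?thesis .
qed

text \<open>Slice the unit mass of the full kernel: the tangential integral does not depend on
  \<open>t\<close>, so it factors out, and the remaining Gaussian in \<open>t\<close> has mass
  1.\<close>

lemma nn_integral_heat_rest:
  assumes s: "s > 0"
  shows "(\<integral>\<^sup>+w. ennreal (heat_rest i s (x - w)) * indicator (strip i) w \<partial>lborel) = 1"
proof -
  have [measurable]: "heat s \<in> borel_measurable borel" by measurable
  have "1 = (\<integral>\<^sup>+z. ennreal (heat s (x - z)) \<partial>lborel)"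
    using nn_integral_reflect[of "\<lambda>z. ennreal (heat s z)" x] nn_integral_heat[OF s] by simp
  also have "\<dots> = (\<integral>\<^sup>+t. \<integral>\<^sup>+w. ennreal (heat s (x - upd i t w)) * indicator (strip i) w \<partial>lborel \<partial>lborel)"
    by (rule nn_integral_slices) measurable
  also have "\<dots> = (\<integral>\<^sup>+t. ennreal (gauss1 s (x $ i - t)) *
      (\<integral>\<^sup>+w. ennreal (heat_rest i s (x - w)) * indicator (strip i) w \<partial>lborel) \<partial>lborel)"
    using s by (intro nn_integral_cong, subst nn_integral_cmult[symmetric])
      (auto simp: heat_split ennreal_mult gauss1_nonneg heat_rest_nonneg mult.assoc)
  also have "\<dots> = (\<integral>\<^sup>+t. ennreal (gauss1 s (x $ i - t)) \<partial>lborel) *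
      (\<integral>\<^sup>+w. ennreal (heat_rest i s (x - w)) * indicator (strip i) w \<partial>lborel)"
    by (rule nn_integral_multc) measurable
  also have "(\<integral>\<^sup>+t. ennreal (gauss1 s (x $ i - t)) \<partial>lborel) = 1"
    using nn_integral_reflect[of "\<lambda>u. ennreal (gauss1 s u)" "x $ i"] nn_integral_gauss1[OF s] by simp
  finally show ?thesis by simp
qed

text \<open>Within a slice, Hoelder is applied with the kernel split as
  \<open>k powr (1 / p) * k powr (1 / q)\<close>: the first factor goes with \<open>h\<close> and is
  bounded by its supremum \<open>s powr (- (n - 1) / 2)\<close>, the second contributes the unit
  mass. This yields the power of \<open>s\<close> times \<open>g t\<close>. Across the slices there
  remains a one-dimensional Gaussian average of \<open>g\<close>, which the maximal function
  controls for all \<open>s\<close> at once.\<close>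

lemma heat_conv_slice_bound:
  fixes h :: "real ^ 'n \<Rightarrow> real" and g :: "real \<Rightarrow> real"
  assumes [measurable]: "h \<in> borel_measurable borel" "g \<in> borel_measurable borel"
    and s: "s > 0" and p: "p > 1" and g: "\<And>t. 0 \<le> g t"
    and slice: "\<And>t. (\<integral>\<^sup>+w. ennreal (\<bar>h (upd i t w)\<bar> powr p) * indicator (strip i) w \<partial>lborel) \<le> ennreal (g t powr p)"
  shows "(\<integral>\<^sup>+z. ennreal (heat s (x - z) * \<bar>h z\<bar>) \<partial>lborel) \<le>
    ennreal (128 * s powr (- ((real CARD('n) - 1) / (2 * p)))) * maximal (\<lambda>t. ennreal (g t)) (x $ i)"
proof -
  let ?K = "s powr (- ((real CARD('n) - 1) / 2))"
  let ?K' = "s powr (- ((real CARD('n) - 1) / (2 * p)))"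
  define q where "q = p / (p - 1)"
  have q: "q > 1" "1 / p + 1 / q = 1" using p by (auto simp: q_def field_simps)
  have K': "?K' powr p = ?K" using p by (simp add: powr_powr)
  have inner: "(\<integral>\<^sup>+w. ennreal (heat_rest i s (x - w) * \<bar>h (upd i t w)\<bar>) * indicator (strip i) w \<partial>lborel)
      \<le> ennreal (?K' * g t)" for t
  proof -
    let ?k = "\<lambda>w. heat_rest i s (x - w) * indicator (strip i) w"
    let ?f = "\<lambda>w. ?k w powr (1 / p) * \<bar>h (upd i t w)\<bar>"
    have k0: "0 \<le> ?k w" for w by (intro mult_nonneg_nonneg heat_rest_nonneg s) auto
    have f: "?f w powr p = ?k w * \<bar>h (upd i t w)\<bar> powr p" for w
      using heat_rest_nonneg[OF s, of i "x - w"] p by (simp add: powr_mult powr_powr)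
    have "(\<integral>\<^sup>+w. ennreal (?f w * (?k w powr (1 / q))) \<partial>lborel) \<le> ennreal ((?K' * g t) * 1)"
    proof (rule nn_integral_Hoelder[OF _ _ _ _ p q])
      have "(\<integral>\<^sup>+w. ennreal (?f w powr p) \<partial>lborel) \<le>
          (\<integral>\<^sup>+w. ennreal ?K * (ennreal (\<bar>h (upd i t w)\<bar> powr p) * indicator (strip i) w) \<partial>lborel)"
      proof (rule nn_integral_mono)
        fix w
        show "ennreal (?f w powr p) \<le> ennreal ?K * (ennreal (\<bar>h (upd i t w)\<bar> powr p) * indicator (strip i) w)"
          unfolding f using heat_rest_le[OF s, of i "x - w"]
          by (auto simp: ennreal_mult[symmetric] intro!: ennreal_leI mult_right_mono split: split_indicator)
      qed
      also have "\<dots> = ennreal ?K * (\<integral>\<^sup>+w. ennreal (\<bar>h (upd i t w)\<bar> powr p) * indicator (strip i) w \<partial>lborel)"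
        by (rule nn_integral_cmult) measurable
      also have "\<dots> \<le> ennreal ?K * ennreal (g t powr p)"
        by (intro mult_left_mono slice) auto
      also have "\<dots> = ennreal ((?K' * g t) powr p)"
        using g[of t] by (simp add: powr_mult K' ennreal_mult)
      finally show "(\<integral>\<^sup>+w. ennreal (?f w powr p) \<partial>lborel) \<le> ennreal ((?K' * g t) powr p)" .
      have "(\<integral>\<^sup>+w. ennreal ((?k w powr (1 / q)) powr q) \<partial>lborel) =
          (\<integral>\<^sup>+w. ennreal (heat_rest i s (x - w)) * indicator (strip i) w \<partial>lborel)"
        using q k0 heat_rest_nonneg[OF s]
        by (intro nn_integral_cong) (auto simp: powr_powr split: split_indicator)
      then show "(\<integral>\<^sup>+w. ennreal ((?k w powr (1 / q)) powr q) \<partial>lborel) \<le> ennreal (1 powr q)"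
        by (simp only: nn_integral_heat_rest[OF s] powr_one_eq_one ennreal_1 order_refl)
    qed (use g in auto)
    moreover have "?f w * (?k w powr (1 / q)) = ?k w * \<bar>h (upd i t w)\<bar>" for w
    proof -
      have "?k w powr (1 / p) * ?k w powr (1 / q) = ?k w"
        using k0[of w] q(2) by (simp add: powr_add[symmetric])
      then show ?thesis by (simp add: mult_ac)
    qed
    ultimately have "(\<integral>\<^sup>+w. ennreal (?k w * \<bar>h (upd i t w)\<bar>) \<partial>lborel) \<le> ennreal (?K' * g t)"
      by simp
    also have "(\<integral>\<^sup>+w. ennreal (?k w * \<bar>h (upd i t w)\<bar>) \<partial>lborel) =
        (\<integral>\<^sup>+w. ennreal (heat_rest i s (x - w) * \<bar>h (upd i t w)\<bar>) * indicator (strip i) w \<partial>lborel)"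
      by (intro nn_integral_cong) (auto split: split_indicator)
    finally show ?thesis .
  qed
  have "(\<integral>\<^sup>+z. ennreal (heat s (x - z) * \<bar>h z\<bar>) \<partial>lborel) =
      (\<integral>\<^sup>+t. \<integral>\<^sup>+w. ennreal (heat s (x - upd i t w) * \<bar>h (upd i t w)\<bar>) * indicator (strip i) w \<partial>lborel \<partial>lborel)"
    by (rule nn_integral_slices) measurable
  also have "\<dots> = (\<integral>\<^sup>+t. ennreal (gauss1 s (x $ i - t)) *
      (\<integral>\<^sup>+w. ennreal (heat_rest i s (x - w) * \<bar>h (upd i t w)\<bar>) * indicator (strip i) w \<partial>lborel) \<partial>lborel)"
    using s by (intro nn_integral_cong, subst nn_integral_cmult[symmetric])
      (auto simp: heat_split ennreal_mult gauss1_nonneg heat_rest_nonneg mult.assoc)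
  also have "\<dots> \<le> (\<integral>\<^sup>+t. ennreal (gauss1 s (x $ i - t)) * ennreal (?K' * g t) \<partial>lborel)"
    by (intro nn_integral_mono mult_left_mono inner) auto
  also have "\<dots> = (\<integral>\<^sup>+t. ennreal ?K' * (ennreal (gauss1 s (x $ i - t)) * ennreal (g t)) \<partial>lborel)"
    using g by (intro nn_integral_cong) (simp add: ennreal_mult mult_ac)
  also have "\<dots> = ennreal ?K' * (\<integral>\<^sup>+t. ennreal (gauss1 s (x $ i - t)) * ennreal (g t) \<partial>lborel)"
    by (rule nn_integral_cmult) measurable
  also have "\<dots> \<le> ennreal ?K' * (128 * maximal (\<lambda>t. ennreal (g t)) (x $ i))"
    using s by (intro mult_left_mono gauss1_conv_le_maximal) auto
  also have "\<dots> = ennreal (128 * ?K') * maximal (\<lambda>t. ennreal (g t)) (x $ i)"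
    by (simp add: ennreal_mult mult_ac)
  finally show ?thesis .
qed

text \<open>The majorant is the maximal function of the \<open>L^p\<close> norms \<open>g t\<close>
  of the slices of \<open>h\<close>. The decisive point is that \<open>m\<close> does not depend on
  \<open>s\<close>. Boundedness and bounded support of \<open>h\<close> keep \<open>g\<close>, and
  with it the maximal function, finite everywhere.\<close>

lemma heat_conv_majorant:
  fixes h :: "real ^ 'n \<Rightarrow> real"
  assumes h [measurable]: "h \<in> borel_measurable borel" and B: "\<And>x. \<bar>h x\<bar> \<le> B"
    and supp: "\<And>x. norm x > R \<Longrightarrow> h x = 0" and p: "p > 1"
  obtains m :: "real \<Rightarrow> real" where "m \<in> borel_measurable borel" "\<And>t. 0 \<le> m t"
    "\<And>s x. s > 0 \<Longrightarrow> (\<integral>\<^sup>+z. ennreal (heat s (x - z) * \<bar>h z\<bar>) \<partial>lborel) \<le>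
      ennreal (128 * s powr (- ((real CARD('n) - 1) / (2 * p))) * m (x $ i))"
    "(\<integral>\<^sup>+t. ennreal (m t powr p) \<partial>lborel) \<le>
      ennreal (10 * p * 2 powr (p - 1) / (p - 1)) * (\<integral>\<^sup>+x. ennreal (\<bar>h x\<bar> powr p) \<partial>lborel)"
proof -
  define S where "S t = (\<integral>\<^sup>+w. ennreal (\<bar>h (upd i t w)\<bar> powr p) * indicator (strip i) w \<partial>lborel)" for t
  have [measurable]: "S \<in> borel_measurable borel" unfolding S_def[abs_def] by measurable
  \<comment> \<open>A box containing every point \<open>w\<close> of the strip whose slice point
    lies in the support: the coordinates other than \<open>i\<close> are at most \<open>R\<close> in
    size, and the summand 1 leaves room for \<open>w $ i\<close>, which runs through [0, 1].\<close>
  let ?a = "(\<chi> j. \<bar>R\<bar> + 1) :: real ^ 'n"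
  define V where "V = measure lborel (cbox (- ?a) ?a)"
  have S_le: "S t \<le> ennreal (B powr p * V)" for t
  proof -
    have "S t \<le> (\<integral>\<^sup>+w. ennreal (B powr p) * indicator (cbox (- ?a) ?a) w \<partial>lborel)"
      unfolding S_def
    proof (rule nn_integral_mono)
      fix w :: "real ^ 'n"
      show "ennreal (\<bar>h (upd i t w)\<bar> powr p) * indicator (strip i) w \<le> ennreal (B powr p) * indicator (cbox (- ?a) ?a) w"
      proof (cases "w \<in> strip i \<and> h (upd i t w) \<noteq> 0")
        case True
        then have "norm (upd i t w) \<le> R" using supp not_le by blast
        have "\<bar>w $ j\<bar> \<le> \<bar>R\<bar> + 1" for j
        proof (cases "j = i")
          case False
          then show ?thesis
            using component_le_norm_cart[of "upd i t w" j] \<open>norm (upd i t w) \<le> R\<close> by (simp add: upd_nth)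
        qed (use True in \<open>auto simp: strip_def\<close>)
        then have "w \<in> cbox (- ?a) ?a"
          by (auto simp: mem_box_cart abs_le_iff) (metis minus_le_iff add.commute minus_add_distrib uminus_add_conv_diff)
        then show ?thesis
          using B p True by (auto intro!: ennreal_leI powr_mono2)
      qed (auto split: split_indicator)
    qed
    also have "\<dots> = ennreal (B powr p) * ennreal V"
      unfolding V_def
      by (simp add: nn_integral_cmult emeasure_eq_ennreal_measure less_imp_neq[OF emeasure_lborel_cbox_finite, simplified])
    finally show ?thesis by (simp add: ennreal_mult V_def)
  qed
  define g where "g t = enn2real (S t) powr (1 / p)" for t
  have [measurable]: "g \<in> borel_measurable borel" unfolding g_def[abs_def] by measurable
  have Sfin: "ennreal (enn2real (S t)) = S t" for t
    using S_le[of t] by (metis ennreal_enn2real_if ennreal_neq_top infinity_ennreal_def neq_top_trans)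
  have gS: "ennreal (g t powr p) = S t" for t
    using p Sfin by (simp add: g_def powr_powr)
  have g0: "0 \<le> g t" for t by (simp add: g_def)
  have gB: "g t \<le> (B powr p * V) powr (1 / p)" for t
  proof -
    have "enn2real (S t) \<le> B powr p * V"
      using S_le[of t] by (subst (asm) Sfin[symmetric]) (simp add: V_def ennreal_le_iff)
    then show ?thesis unfolding g_def using p by (intro powr_mono2) auto
  qed
  let ?M = "maximal (\<lambda>t. ennreal (g t))"
  let ?m = "\<lambda>t. enn2real (?M t)"
  have "?M t \<le> ennreal ((B powr p * V) powr (1 / p))" for t
    by (rule maximal_le_bound) (use gB in \<open>auto intro: ennreal_leI\<close>)
  then have M: "ennreal (?m t) = ?M t" for t
    by (metis ennreal_enn2real_if ennreal_neq_top infinity_ennreal_def neq_top_trans)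
  show ?thesis
  proof (rule that[of ?m])
    show "?m \<in> borel_measurable borel" by measurable
    show "0 \<le> ?m t" for t by simp
    show "(\<integral>\<^sup>+z. ennreal (heat s (x - z) * \<bar>h z\<bar>) \<partial>lborel) \<le>
      ennreal (128 * s powr (- ((real CARD('n) - 1) / (2 * p))) * ?m (x $ i))" if s: "s > 0" for s x
      using heat_conv_slice_bound[of h g s p i x] s p g0 gS
      by (simp add: S_def ennreal_mult M)
    have "(\<integral>\<^sup>+t. ennreal (?m t powr p) \<partial>lborel) \<le>
        ennreal (10 * p * 2 powr (p - 1) / (p - 1)) * (\<integral>\<^sup>+u. ennreal (g u powr p) \<partial>lborel)"
      by (rule maximal_strong_type[OF _ g0 gB p]) measurable
    also have "(\<integral>\<^sup>+u. ennreal (g u powr p) \<partial>lborel) = (\<integral>\<^sup>+x. ennreal (\<bar>h x\<bar> powr p) \<partial>lborel)"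
      unfolding gS S_def by (rule nn_integral_slices[symmetric]) measurable
    finally show "(\<integral>\<^sup>+t. ennreal (?m t powr p) \<partial>lborel) \<le>
      ennreal (10 * p * 2 powr (p - 1) / (p - 1)) * (\<integral>\<^sup>+x. ennreal (\<bar>h x\<bar> powr p) \<partial>lborel)" .
  qed
qed

lemma continuous_on_conv:
  fixes k h :: "real ^ 'n \<Rightarrow> real"
  assumes k: "continuous_on UNIV k" "\<And>x. \<bar>k x\<bar> \<le> B" and h: "integrable lborel h"
  shows "continuous_on UNIV (conv k h)"
  unfolding continuous_on_sequentially
proof (intro allI ballI impI)
  fix X :: "nat \<Rightarrow> real ^ 'n" and a assume X: "(\<forall>n. X n \<in> UNIV) \<and> X \<longlonglongrightarrow> a"
  have [measurable]: "k \<in> borel_measurable borel" "h \<in> borel_measurable borel"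
    using k h by (auto intro: borel_measurable_continuous_onI)
  have "(\<lambda>n. \<integral>y. k (X n - y) * h y \<partial>lborel) \<longlonglongrightarrow> (\<integral>y. k (a - y) * h y \<partial>lborel)"
  proof (rule integral_dominated_convergence[where w = "\<lambda>y. B * \<bar>h y\<bar>"])
    show "AE y in lborel. (\<lambda>n. k (X n - y) * h y) \<longlonglongrightarrow> k (a - y) * h y"
    proof (rule AE_I2)
      fix y
      have "(\<lambda>n. X n - y) \<longlonglongrightarrow> a - y" using X by (intro tendsto_intros) simp
      from continuous_on_tendsto_compose[OF k(1) this]
      show "(\<lambda>n. k (X n - y) * h y) \<longlonglongrightarrow> k (a - y) * h y"
        by (intro tendsto_intros) simp
    qed
    show "AE y in lborel. norm (k (X n - y) * h y) \<le> B * \<bar>h y\<bar>" for n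
      using k(2) by (auto simp: abs_mult intro!: AE_I2 mult_right_mono)
  qed (use h in auto)
  then show "(conv k h \<circ> X) \<longlonglongrightarrow> conv k h a"
    by (simp add: conv_def o_def)
qed

lemma conv_le:
  fixes k h :: "real ^ 'n \<Rightarrow> real"
  assumes k: "\<And>x. \<bar>k x\<bar> \<le> B" and h: "integrable lborel h"
  shows "\<bar>conv k h x\<bar> \<le> B * (\<integral>y. \<bar>h y\<bar> \<partial>lborel)"
proof -
  have B: "B \<ge> 0" using k[of 0] by linarith
  have "\<bar>conv k h x\<bar> \<le> (\<integral>y. \<bar>k (x - y) * h y\<bar> \<partial>lborel)"
    unfolding conv_def by (rule integral_abs_bound)
  also have "\<dots> \<le> (\<integral>y. B * \<bar>h y\<bar> \<partial>lborel)"
    using h B k by (intro integral_mono') (auto simp: abs_mult intro!: mult_right_mono)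
  finally show ?thesis by simp
qed

section \<open>The slice estimate\<close>

text \<open>The Cauchy density; its primitive \<open>arctan u / pi\<close> is explicit and
  bounded.\<close>

definition eta :: "real \<Rightarrow> real" where
  "eta u = 1 / (pi * (1 + u\<^sup>2))"

lemma eta_pos: "eta u > 0"
  by (auto simp: eta_def add_pos_nonneg)

lemma eta_measurable [measurable (raw)]:
  assumes [measurable]: "f \<in> borel_measurable M"
  shows "(\<lambda>x. eta (f x)) \<in> borel_measurable M"
  unfolding eta_def by measurable

lemma DERIV_arctan_pi: "((\<lambda>u. arctan u / pi) has_real_derivative eta u) (at u)"
  by (rule DERIV_cong[OF DERIV_cdivide[OF DERIV_arctan]]) (simp add: eta_def divide_inverse)

lemma eta_le: "eta u \<le> 1 / pi"
  unfolding eta_def by (intro frac_le) (auto intro: mult_left_mono simp: add_pos_nonneg)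

lemma nn_integral_eta: "(\<integral>\<^sup>+u. ennreal (eta u) \<partial>lborel) = 1"
proof -
  have half: "(\<integral>\<^sup>+u. ennreal (eta u) * indicator {0..} u \<partial>lborel) = ennreal (1 / 2)"
  proof -
    have "((\<lambda>u. arctan u / pi) \<longlongrightarrow> (pi / 2) / pi) at_top"
      by (intro tendsto_intros tendsto_arctan_at_top) simp
    from nn_integral_FTC_atLeast[OF _ DERIV_arctan_pi _ this, of 0] show ?thesis
      by (simp add: eta_pos less_imp_le)
  qed
  have "(\<integral>\<^sup>+u. ennreal (eta u) \<partial>lborel) =
      (\<integral>\<^sup>+u. ennreal (eta u) * indicator {0..} u + ennreal (eta u) * indicator {..<0} u \<partial>lborel)"
    by (intro nn_integral_cong) (auto split: split_indicator)
  also have "\<dots> = (\<integral>\<^sup>+u. ennreal (eta u) * indicator {0..} u \<partial>lborel) +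
      (\<integral>\<^sup>+u. ennreal (eta u) * indicator {..<0} u \<partial>lborel)"
    by (rule nn_integral_add) measurable
  also have "(\<integral>\<^sup>+u. ennreal (eta u) * indicator {..<0} u \<partial>lborel) =
      (\<integral>\<^sup>+u. ennreal (eta u) * indicator {0<..} u \<partial>lborel)"
    using nn_integral_reflect[of "\<lambda>u. ennreal (eta u) * indicator {0<..} u" 0]
    by (simp add: eta_def indicator_def)
  also have "\<dots> = (\<integral>\<^sup>+u. ennreal (eta u) * indicator {0..} u \<partial>lborel)"
    using AE_lborel_singleton[of "0::real"]
    by (intro nn_integral_cong_AE, eventually_elim) (auto split: split_indicator)
  finally have "(\<integral>\<^sup>+u. ennreal (eta u) \<partial>lborel) = ennreal (1 / 2) + ennreal (1 / 2)"
    by (simp only: half)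
  also have "\<dots> = 1"
    by (subst ennreal_plus[symmetric]) auto
  finally show ?thesis .
qed

lemma integrable_eta: "integrable lborel eta"
  by (rule integrableI_nonneg) (auto simp: nn_integral_eta eta_pos less_imp_le)

lemma integral_eta: "(\<integral>u. eta u \<partial>lborel) = 1"
  using nn_integral_eq_integral[OF integrable_eta] nn_integral_eta
  by (metis (no_types, lifting) AE_I2 ennreal_eq_1 eta_pos less_imp_le)

lemma nn_integral_eta_scaled:
  assumes "e > 0"
  shows "(\<integral>\<^sup>+t. ennreal (eta ((t - a) / e) / e) \<partial>lborel) = 1"
proof -
  have "(\<integral>\<^sup>+t. ennreal (eta ((t - a) / e) / e) \<partial>lborel) = ennreal e * (\<integral>\<^sup>+t. ennreal (eta t / e) \<partial>lborel)"
    using assms by (subst nn_integral_real_affine[where c = e and t = a]) auto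
  also have "\<dots> = (\<integral>\<^sup>+t. ennreal (eta t) \<partial>lborel)"
    using assms by (subst nn_integral_cmult[symmetric]) (auto simp: ennreal_mult[symmetric] eta_pos less_imp_le)
  finally show ?thesis by (simp add: nn_integral_eta)
qed

text \<open>Test the divergence against \<open>N ((t - x $ i) / e) \<psi>(x)\<close>, where \<open>\<psi>\<close> is made independent of
  \<open>x $ i\<close> by freezing \<open>x $ i = t\<close> and \<open>N\<close> is a bounded primitive of \<open>eta\<close>. Only derivatives of
  \<open>\<psi>\<close> along the slice \<open>x $ i = t\<close> appear.\<close>

lemma slab_estimate:
  fixes F :: "real ^ 'n \<Rightarrow> real ^ 'n"
  assumes F: "integrable lborel F" and f: "integrable lborel f"
    and test: "\<And>\<phi>. test_function \<phi> \<Longrightarrow> (\<integral>x. F x \<bullet> grad \<phi> x \<partial>lborel) = - (\<integral>x. f x * \<phi> x \<partial>lborel)"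
    and d: "\<And>x. (\<psi> has_derivative (\<lambda>v. E x \<bullet> v)) (at x)" and E: "continuous_on UNIV E"
    and b: "\<And>x. x $ i = t \<Longrightarrow> \<bar>\<psi> x\<bar> \<le> b" "\<And>x. x $ i = t \<Longrightarrow> norm (E x) \<le> d" and e: "e > 0"
  shows "\<bar>\<integral>x. F x $ i * (eta ((t - x $ i) / e) / e) * \<psi> (upd i t x) \<partial>lborel\<bar> \<le>
    (\<integral>x. norm (F x) \<partial>lborel) * (2 * d) + (\<integral>x. \<bar>f x\<bar> \<partial>lborel) * b"
proof -
  let ?e = "axis i 1 :: real ^ 'n"
  \<comment> \<open>\<open>N\<close> takes values in [0, 1] and its derivative in
    \<open>x $ i\<close> is \<open>- H\<close>. The gradient of \<open>N * \<Psi>\<close> thus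
    contains the averaged slice integrand along the axis \<open>i\<close> and otherwise only
    tangential derivatives with a bounded factor.\<close>
  define N where "N x = 1 / 2 + arctan ((t - x $ i) / e) / pi" for x :: "real ^ 'n"
  define H where "H x = eta ((t - x $ i) / e) / e" for x :: "real ^ 'n"
  \<comment> \<open>The chain rule through \<open>upd i t\<close> deletes the normal component of
    the gradient. Estimating the difference by the triangle inequality costs the factor 2 in front
    of \<open>d\<close>.\<close>
  define E' where "E' x = E (upd i t x) - (E (upd i t x) $ i) *\<^sub>R ?e" for x
  define \<Psi> where "\<Psi> x = \<psi> (upd i t x)" for x
  have u: "upd i t x $ i = t" for x by (simp add: upd_nth)
  have b0: "0 \<le> b" "0 \<le> d"
    using b[OF u[of 0]] abs_ge_zero norm_ge_zero by (blast intro: order_trans)+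
  have N: "0 \<le> N x" "N x \<le> 1" for x
    using arctan_bounded[of "(t - x $ i) / e"] by (auto simp: N_def field_simps)
  have H0: "0 \<le> H x" for x using eta_pos[of "(t - x $ i) / e"] e by (simp add: H_def less_imp_le)
  have H1: "H x \<le> 1 / (pi * e)" for x
    using e divide_right_mono[OF eta_le[of "(t - x $ i) / e"], of e] by (simp add: H_def)
  have dN: "(N has_derivative (\<lambda>v. (- H x *\<^sub>R ?e) \<bullet> v)) (at x)" for x
  proof -
    have "((\<lambda>u. 1 / 2 + arctan ((t - u) / e) / pi) has_real_derivative - H x) (at (x $ i))"
    proof -
      have i: "((\<lambda>u. (t - u) / e) has_real_derivative (- 1 / e)) (at (x $ i))"
        using e by (auto intro!: derivative_eq_intros)
      from DERIV_add[OF DERIV_const[of "1 / 2"] DERIV_chain2[OF DERIV_arctan_pi i]] show ?thesis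
        by (simp add: H_def)
    qed
    from has_derivative_coord[OF this] show ?thesis by (simp add: N_def[abs_def])
  qed
  have d\<Psi>: "(\<Psi> has_derivative (\<lambda>v. E' x \<bullet> v)) (at x)" for x
  proof -
    have 1: "(upd i t has_derivative (\<lambda>v. v - (v $ i) *\<^sub>R ?e)) (at x)"
    proof -
      have "bounded_linear (\<lambda>v::real^'n. v - (v $ i) *\<^sub>R ?e)"
        by (intro bounded_linear_sub bounded_linear_ident bounded_linear_scaleR_const bounded_linear_vec_nth)
      from has_derivative_add[OF bounded_linear_imp_has_derivative[OF this] has_derivative_const[of "t *\<^sub>R ?e"]]
      show ?thesis by (simp add: upd_def[abs_def] algebra_simps)
    qed
    have "((\<psi> \<circ> upd i t) has_derivative ((\<lambda>v. E (upd i t x) \<bullet> v) \<circ> (\<lambda>v. v - (v $ i) *\<^sub>R ?e))) (at x)"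
      by (rule diff_chain_at[OF 1 d])
    moreover have "(\<lambda>v. E (upd i t x) \<bullet> v) \<circ> (\<lambda>v. v - (v $ i) *\<^sub>R ?e) = (\<lambda>v. E' x \<bullet> v)"
      by (simp add: fun_eq_iff E'_def inner_diff_left inner_diff_right inner_axis inner_axis' mult.commute)
    moreover have "\<psi> \<circ> upd i t = \<Psi>" by (simp add: fun_eq_iff \<Psi>_def)
    ultimately show ?thesis by (simp only:)
  qed
  let ?D = "\<lambda>x. N x *\<^sub>R E' x + \<Psi> x *\<^sub>R (- H x *\<^sub>R ?e)"
  have cu: "continuous_on UNIV (upd i t)" unfolding upd_def[abs_def] by (intro continuous_intros)
  have cE': "continuous_on UNIV E'"
    unfolding E'_def[abs_def] by (intro continuous_intros continuous_on_compose2[OF E cu]) auto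
  have cN: "continuous_on UNIV N" and c\<Psi>: "continuous_on UNIV \<Psi>"
    using dN d\<Psi> has_derivative_continuous by (blast intro: continuous_at_imp_continuous_on)+
  have cH: "continuous_on UNIV H"
  proof -
    have "pi * (1 + y\<^sup>2) \<noteq> 0" for y :: real
      by (metis eta_def eta_pos divide_eq_0_iff less_irrefl)
    then show ?thesis
      unfolding H_def[abs_def] eta_def using e by (intro continuous_intros) auto
  qed
  have bE': "norm (E' x) \<le> 2 * d" for x
  proof -
    have "norm (E' x) \<le> norm (E (upd i t x)) + norm ((E (upd i t x) $ i) *\<^sub>R ?e)"
      unfolding E'_def by (rule norm_triangle_ineq4)
    also have "\<dots> \<le> d + d"
      using b(2)[OF u] component_le_norm_cart[of "E (upd i t x)" i] by (auto intro!: add_mono intro: order_trans)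
    finally show ?thesis by simp
  qed
  have b\<Psi>: "\<bar>\<Psi> x\<bar> \<le> b" for x using b(1)[OF u] by (simp add: \<Psi>_def)
  have [measurable]: "N \<in> borel_measurable borel" "H \<in> borel_measurable borel" "\<Psi> \<in> borel_measurable borel"
    "E' \<in> borel_measurable borel" "F \<in> borel_measurable borel" "f \<in> borel_measurable borel"
    using cN cH c\<Psi> cE' F f by (auto intro: borel_measurable_continuous_onI)
  have bD: "norm (?D x) \<le> 2 * d + b * (1 / (pi * e))" for x
  proof -
    have "norm (?D x) \<le> norm (N x *\<^sub>R E' x) + norm (\<Psi> x *\<^sub>R (- H x *\<^sub>R ?e))"
      by (rule norm_triangle_ineq)
    also have "\<dots> \<le> 1 * (2 * d) + b * (1 / (pi * e))"
    proof (rule add_mono)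
      show "norm (N x *\<^sub>R E' x) \<le> 1 * (2 * d)"
        unfolding norm_scaleR using N[of x] bE'[of x] by (intro mult_mono) auto
      have "norm (\<Psi> x *\<^sub>R (- H x *\<^sub>R ?e)) = \<bar>\<Psi> x\<bar> * H x"
        using H0[of x] by (simp add: abs_mult)
      also have "\<dots> \<le> b * (1 / (pi * e))"
        using b\<Psi>[of x] H0[of x] H1[of x] b0 by (intro mult_mono) auto
      finally show "norm (\<Psi> x *\<^sub>R (- H x *\<^sub>R ?e)) \<le> b * (1 / (pi * e))" .
    qed
    finally show ?thesis by simp
  qed
  have eq: "(\<integral>x. F x \<bullet> ?D x \<partial>lborel) = - (\<integral>x. f x * (N x * \<Psi> x) \<partial>lborel)"
  proof (rule div_pairing[OF F f test])
    show "((\<lambda>x. N x * \<Psi> x) has_derivative (\<lambda>v. ?D x \<bullet> v)) (at x)" for x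
      by (rule has_derivative_eq_rhs[OF has_derivative_mult[OF dN d\<Psi>]]) (auto simp: inner_add_left inner_diff_left fun_eq_iff)
    show "continuous_on UNIV ?D"
      by (intro continuous_intros cN cH c\<Psi> cE')
    show "norm (?D x) \<le> 2 * d + b * (1 / (pi * e))" for x by (rule bD)
    show "\<bar>N x * \<Psi> x\<bar> \<le> 1 * b" for x
      unfolding abs_mult using N[of x] b\<Psi>[of x] by (intro mult_mono) auto
  qed
  have i1: "integrable lborel (\<lambda>x. F x \<bullet> (N x *\<^sub>R E' x))"
  proof (rule integrable_inner_bounded[OF F])
    show "norm (N x *\<^sub>R E' x) \<le> 1 * (2 * d)" for x
      unfolding norm_scaleR using N[of x] bE'[of x] by (intro mult_mono) auto
  qed measurable
  have i2: "integrable lborel (\<lambda>x. f x * (N x * \<Psi> x))"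
  proof (rule integrable_bounded_mult'[OF f])
    show "\<bar>N x * \<Psi> x\<bar> \<le> 1 * b" for x
      unfolding abs_mult using N[of x] b\<Psi>[of x] by (intro mult_mono) auto
  qed measurable
  have i3: "integrable lborel (\<lambda>x. F x $ i * H x * \<Psi> x)"
  proof -
    have "integrable lborel (\<lambda>x. F x \<bullet> ((H x * \<Psi> x) *\<^sub>R ?e))"
    proof (rule integrable_inner_bounded[OF F])
      show "norm ((H x * \<Psi> x) *\<^sub>R ?e) \<le> (1 / (pi * e)) * b" for x
        using mult_mono[OF H1[of x] b\<Psi>[of x]] H0[of x] e by (simp add: abs_mult)
    qed measurable
    then show ?thesis by (simp add: inner_axis mult_ac)
  qed
  have "F x \<bullet> ?D x = F x \<bullet> (N x *\<^sub>R E' x) - F x $ i * H x * \<Psi> x" for x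
    by (simp add: inner_add_right inner_diff_right inner_axis mult_ac)
  with eq have "(\<integral>x. F x $ i * H x * \<Psi> x \<partial>lborel) =
      (\<integral>x. F x \<bullet> (N x *\<^sub>R E' x) \<partial>lborel) + (\<integral>x. f x * (N x * \<Psi> x) \<partial>lborel)"
    using i1 i3 by simp
  moreover have "\<bar>\<integral>x. F x \<bullet> (N x *\<^sub>R E' x) \<partial>lborel\<bar> \<le> (\<integral>x. norm (F x) * (2 * d) \<partial>lborel)"
    unfolding real_norm_def[symmetric]
  proof (rule Bochner_Integration.integral_norm_bound_integral[OF i1])
    fix x
    have "norm (N x *\<^sub>R E' x) \<le> 1 * (2 * d)"
      unfolding norm_scaleR using N[of x] bE'[of x] by (intro mult_mono) auto
    then show "norm (F x \<bullet> (N x *\<^sub>R E' x)) \<le> norm (F x) * (2 * d)"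
      unfolding real_norm_def by (intro order_trans[OF Cauchy_Schwarz_ineq2] mult_left_mono) auto
  qed (use F in auto)
  moreover have "\<bar>\<integral>x. f x * (N x * \<Psi> x) \<partial>lborel\<bar> \<le> (\<integral>x. \<bar>f x\<bar> * b \<partial>lborel)"
    unfolding real_norm_def[symmetric]
  proof (rule Bochner_Integration.integral_norm_bound_integral[OF i2])
    fix x
    have "\<bar>N x * \<Psi> x\<bar> \<le> 1 * b"
      unfolding abs_mult using N[of x] b\<Psi>[of x] by (intro mult_mono) auto
    then show "norm (f x * (N x * \<Psi> x)) \<le> norm (f x) * b"
      by (simp add: abs_mult mult_left_mono)
  qed (use f in auto)
  ultimately have "\<bar>\<integral>x. F x $ i * H x * \<Psi> x \<partial>lborel\<bar> \<le>
      (\<integral>x. norm (F x) * (2 * d) \<partial>lborel) + (\<integral>x. \<bar>f x\<bar> * b \<partial>lborel)" by linarith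
  then show ?thesis by (simp add: H_def \<Psi>_def)
qed

text \<open>In the bound through the divergence the term with \<open>div F\<close> has no decay
  beyond \<open>s powr (a - 1)\<close>; the factor \<open>exp (- s)\<close> of the resolvent lends
  it the same \<open>s powr (- 1/2)\<close> that the gradient term has.\<close>

lemma exp_minus_le_powr:
  fixes s :: real
  assumes s: "s > 0"
  shows "exp (- s) \<le> s powr (- (1/2))"
proof -
  have "sqrt s \<le> 1 + s" using s by (intro real_le_lsqrt) (auto simp: power2_eq_square algebra_simps)
  also have "\<dots> \<le> exp s" by (rule exp_ge_add_one_self)
  finally have "inverse (exp s) \<le> inverse (sqrt s)"
    using s by (intro le_imp_inverse_le) auto
  then show ?thesis using s by (simp add: exp_minus powr_minus powr_half_sqrt)
qed

text \<open>The two bounds balance at \<open>s = (\<Lambda> / A)\<^sup>2\<close>.\<close>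

lemma time_integral_bound:
  assumes A: "A \<ge> 0" and L: "L > 0" and a: "0 < a" "a < 1 / 2" and N: "N \<ge> 0"
  shows "(\<integral>\<^sup>+s. ennreal (exp (- s) * s powr (a - 1) * min A (L * (1 + N * s powr (- (1/2))))) * indicator {0<..} s \<partial>lborel)
    \<le> ennreal ((1 + N) * (1 / a + 1 / (1 / 2 - a)) * (A powr (1 - 2 * a) * L powr (2 * a)))"
proof (cases "A = 0")
  case True
  have "min 0 (L * (1 + N * s powr (- (1/2)))) = 0" for s
    using L N by (intro min_absorb1 mult_nonneg_nonneg add_nonneg_nonneg) auto
  then show ?thesis using True by simp
next
  case False
  with A have A: "A > 0" by simp
  define s0 where "s0 = (L / A)\<^sup>2"
  have s0: "s0 > 0" using A L by (simp add: s0_def)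
  \<comment> \<open>The first bound is integrable near 0 because \<open>a > 0\<close>; the second
    has the exponent \<open>a - 3 / 2\<close>, below \<open>-1\<close>, and is integrable at
    infinity because \<open>a < 1 / 2\<close>. They are used below and above
    \<open>s0\<close>.\<close>
  have pt: "exp (- s) * s powr (a - 1) * min A (L * (1 + N * s powr (- (1/2)))) \<le>
      (1 + N) * (s powr (a - 1) * A)" (is ?P1)
    "exp (- s) * s powr (a - 1) * min A (L * (1 + N * s powr (- (1/2)))) \<le>
      (1 + N) * (L * s powr (a - 3 / 2))" (is ?P2) if s: "s > 0" for s
  proof -
    let ?m = "min A (L * (1 + N * s powr (- (1/2))))"
    have m0: "0 \<le> ?m" using A L N by simp
    have "exp (- s) * s powr (a - 1) * ?m \<le> 1 * s powr (a - 1) * A"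
      using s m0 by (intro mult_mono) auto
    also have "\<dots> \<le> (1 + N) * (s powr (a - 1) * A)"
      using N A by (simp add: mult_right_mono algebra_simps)
    finally show ?P1 .
    have "exp (- s) * ?m \<le> exp (- s) * (L * (1 + N * s powr (- (1/2))))"
      by (intro mult_left_mono) auto
    also have "\<dots> = L * (exp (- s) + N * (exp (- s) * s powr (- (1/2))))"
      by (simp add: algebra_simps)
    also have "\<dots> \<le> L * (s powr (- (1/2)) + N * (1 * s powr (- (1/2))))"
      using L N s by (intro mult_left_mono add_mono mult_right_mono exp_minus_le_powr) auto
    finally have "exp (- s) * ?m \<le> (1 + N) * L * s powr (- (1/2))" by (simp add: algebra_simps)
    then have "s powr (a - 1) * (exp (- s) * ?m) \<le> s powr (a - 1) * ((1 + N) * L * s powr (- (1/2)))"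
      by (intro mult_left_mono) auto
    moreover have "s powr (a - 1) * s powr (- (1/2)) = s powr (a - 3 / 2)"
      using s by (simp add: powr_add[symmetric])
    ultimately show ?P2 by (simp add: mult_ac)
  qed
  have "(\<integral>\<^sup>+s. ennreal (exp (- s) * s powr (a - 1) * min A (L * (1 + N * s powr (- (1/2))))) * indicator {0<..} s \<partial>lborel)
    \<le> (\<integral>\<^sup>+s. ennreal ((1 + N) * A) * (ennreal (s powr (a - 1)) * indicator {0..s0} s) +
          ennreal ((1 + N) * L) * (ennreal (s powr (a - 3 / 2)) * indicator {s0..} s) \<partial>lborel)"
  proof (rule nn_integral_mono)
    fix s :: real
    consider "s \<le> 0" | "0 < s" "s \<le> s0" | "s0 < s" "0 < s" by linarith
    then show "ennreal (exp (- s) * s powr (a - 1) * min A (L * (1 + N * s powr (- (1/2))))) * indicator {0<..} s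
      \<le> ennreal ((1 + N) * A) * (ennreal (s powr (a - 1)) * indicator {0..s0} s) +
          ennreal ((1 + N) * L) * (ennreal (s powr (a - 3 / 2)) * indicator {s0..} s)"
    proof cases
      case 2
      then have "ennreal (exp (- s) * s powr (a - 1) * min A (L * (1 + N * s powr (- (1/2))))) * indicator {0<..} s
          \<le> ennreal ((1 + N) * A) * (ennreal (s powr (a - 1)) * indicator {0..s0} s)"
        using pt(1)[of s] N A by (auto simp: ennreal_mult[symmetric] mult_ac intro!: ennreal_leI)
      then show ?thesis by (rule order_trans) simp
    next
      case 3
      then have "ennreal (exp (- s) * s powr (a - 1) * min A (L * (1 + N * s powr (- (1/2))))) * indicator {0<..} s
          \<le> ennreal ((1 + N) * L) * (ennreal (s powr (a - 3 / 2)) * indicator {s0..} s)"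
        using pt(2)[of s] N L by (auto simp: ennreal_mult[symmetric] mult_ac intro!: ennreal_leI)
      then show ?thesis by (rule order_trans) simp
    qed auto
  qed
  also have "\<dots> = ennreal ((1 + N) * A) * ennreal (s0 powr a / a) +
      ennreal ((1 + N) * L) * ennreal (s0 powr (a - 1 / 2) / (1 / 2 - a))"
  proof -
    have "- (s0 powr (a - 3 / 2 + 1)) / (a - 3 / 2 + 1) = s0 powr (a - 1 / 2) / (1 / 2 - a)"
      using minus_divide_divide[of "s0 powr (a - 1 / 2)" "a - 1 / 2"] by simp
    then show ?thesis
      using nn_integral_powr_from_0[of "a - 1" s0] nn_integral_powr_to_inf[of "a - 3 / 2" s0] a s0
      by (simp add: nn_integral_add nn_integral_cmult)
  qed
  also have "\<dots> = ennreal ((1 + N) * (A * s0 powr a) * (1 / a) + (1 + N) * (L * s0 powr (a - 1 / 2)) * (1 / (1 / 2 - a)))"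
    using N A L a by (simp add: ennreal_mult[symmetric] ennreal_plus[symmetric] del: ennreal_plus)
  also have "A * s0 powr a = A powr (1 - 2 * a) * L powr (2 * a)"
  proof -
    have "s0 powr a = (L / A) powr (2 * a)"
      using A L by (simp add: s0_def powr_powr flip: powr_numeral)
    also have "\<dots> = L powr (2 * a) / A powr (2 * a)" using A L by (simp add: powr_divide)
    finally show ?thesis using A by (simp add: powr_diff)
  qed
  also have "L * s0 powr (a - 1 / 2) = A powr (1 - 2 * a) * L powr (2 * a)"
  proof -
    have "s0 powr (a - 1 / 2) = (L / A) powr (2 * a - 1)"
      using A L by (simp add: s0_def powr_powr right_diff_distrib flip: powr_numeral)
    also have "\<dots> = L powr (2 * a - 1) / A powr (2 * a - 1)" using A L by (simp add: powr_divide)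
    also have "\<dots> = (L powr (2 * a) / L) * (A / A powr (2 * a))" using A L by (simp add: powr_diff)
    finally show ?thesis using A L by (simp add: powr_diff)
  qed
  also have "(1 + N) * (A powr (1 - 2 * a) * L powr (2 * a)) * (1 / a) +
      (1 + N) * (A powr (1 - 2 * a) * L powr (2 * a)) * (1 / (1 / 2 - a)) =
      (1 + N) * (1 / a + 1 / (1 / 2 - a)) * (A powr (1 - 2 * a) * L powr (2 * a))"
    by (simp only: distrib_left distrib_right mult_ac)
  finally show ?thesis .
qed

text \<open>No integrability is assumed: a non-integrable function has integral 0, for which the
  inequality is trivial.\<close>

lemma norm_integral_le_nn_integral:
  fixes f :: "'a \<Rightarrow> 'b::{banach, second_countable_topology}"
  shows "ennreal (norm (\<integral>x. f x \<partial>M)) \<le> (\<integral>\<^sup>+x. ennreal (norm (f x)) \<partial>M)"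
  by (cases "integrable M f") (auto simp: integral_norm_bound_ennreal not_integrable_integral_eq)

section \<open>Time-dependent kernels dominated by the heat kernel\<close>

locale time_kernel =
  fixes \<kappa> :: "real \<Rightarrow> real ^ 'n \<Rightarrow> real" and B \<gamma> :: real
  assumes \<kappa>_measurable: "case_prod \<kappa> \<in> borel_measurable (borel \<Otimes>\<^sub>M borel)"
    and \<kappa>_bound: "\<And>s x. s > 0 \<Longrightarrow> \<bar>\<kappa> s x\<bar> \<le> B * s powr (- \<gamma>) * heat (2 * s) x"
    and B_pos: "B > 0" and \<gamma>: "0 \<le> \<gamma>" "\<gamma> < 1"
begin

lemma \<kappa>_measurable' [measurable (raw)]:
  assumes [measurable]: "f \<in> borel_measurable M" "g \<in> borel_measurable M"
  shows "(\<lambda>q. \<kappa> (f q) (g q)) \<in> borel_measurable M"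
  using measurable_compose[OF _ \<kappa>_measurable, of "\<lambda>q. (f q, g q)" M] by simp

end

text \<open>A space derivative costs \<open>s powr (- 1/2)\<close>. The heat kernel has
  \<open>\<gamma> = 0\<close> and \<open>p = n / 2\<close>, its first derivatives have
  \<open>\<gamma> = 1 / 2\<close> and \<open>p = n\<close>. The assumption \<open>scaling\<close>
  makes the total exponent \<open>- \<gamma> - (n - 1) / (2 * p)\<close> equal to
  \<open>1 / (2 * p) - 1\<close>, so that both kernels lead to the same time integral.\<close>

locale parabolic_kernel = time_kernel \<kappa> B \<gamma>
  for \<kappa> :: "real \<Rightarrow> real ^ 'n \<Rightarrow> real" and B \<gamma> :: real +
  fixes D\<kappa> :: "real \<Rightarrow> real ^ 'n \<Rightarrow> real ^ 'n" and p :: real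
  assumes \<kappa>_deriv: "\<And>s x. s > 0 \<Longrightarrow> (\<kappa> s has_derivative (\<lambda>v. D\<kappa> s x \<bullet> v)) (at x)"
    and D\<kappa>_cont: "\<And>s. s > 0 \<Longrightarrow> continuous_on UNIV (D\<kappa> s)"
    and D\<kappa>_bound: "\<And>s x. s > 0 \<Longrightarrow> norm (D\<kappa> s x) \<le> B * s powr (- \<gamma> - 1 / 2) * heat (2 * s) x"
    and p: "p > 1" and scaling: "real CARD('n) / (2 * p) = 1 - \<gamma>"
begin

lemma \<kappa>_cont: "s > 0 \<Longrightarrow> continuous_on UNIV (\<kappa> s)"
  using \<kappa>_deriv has_derivative_continuous by (blast intro: continuous_at_imp_continuous_on)

lemma \<kappa>_sup:
  assumes "s > 0"
  obtains C where "\<And>x. \<bar>\<kappa> s x\<bar> \<le> C" "\<And>x. norm (D\<kappa> s x) \<le> C"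
proof -
  define Q where "Q = 1 / sqrt (4 * pi * (2 * s)) ^ CARD('n)"
  have Q: "heat (2 * s) x \<le> Q" for x :: "real ^ 'n"
    unfolding Q_def by (rule heat_le) (use assms in simp)
  let ?C1 = "B * s powr (- \<gamma>) * Q" and ?C2 = "B * s powr (- \<gamma> - 1 / 2) * Q"
  have "\<bar>\<kappa> s x\<bar> \<le> ?C1" "norm (D\<kappa> s x) \<le> ?C2" for x
    by (rule order_trans[OF \<kappa>_bound[OF assms]] order_trans[OF D\<kappa>_bound[OF assms]],
        rule mult_left_mono[OF Q], use B_pos in simp)+
  then show ?thesis
    by (intro that[of "max ?C1 ?C2"]) (auto simp: le_max_iff_disj)
qed

context
  fixes h :: "real ^ 'n \<Rightarrow> real"
  assumes h: "integrable lborel h"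
begin

definition psi :: "real \<Rightarrow> real ^ 'n \<Rightarrow> real" where
  "psi s x = conv (\<kappa> s) h x"

definition Dpsi :: "real \<Rightarrow> real ^ 'n \<Rightarrow> real ^ 'n" where
  "Dpsi s x = (\<chi> j. conv (\<lambda>z. D\<kappa> s z $ j) h x)"

lemma h_measurable [measurable]: "h \<in> borel_measurable borel"
  using h by auto

lemma psi_measurable [measurable (raw)]:
  assumes [measurable]: "f \<in> borel_measurable M" "g \<in> borel_measurable M"
  shows "(\<lambda>q. psi (f q) (g q)) \<in> borel_measurable M"
  unfolding psi_def conv_def by measurable

lemma D\<kappa>_component_le: "s > 0 \<Longrightarrow> (\<And>x. norm (D\<kappa> s x) \<le> C) \<Longrightarrow> \<bar>D\<kappa> s x $ j\<bar> \<le> C"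
  using component_le_norm_cart order_trans by blast

lemma psi_deriv: "s > 0 \<Longrightarrow> (psi s has_derivative (\<lambda>v. Dpsi s x \<bullet> v)) (at x)"
proof -
  assume s: "s > 0"
  obtain C where C: "\<And>x. \<bar>\<kappa> s x\<bar> \<le> C" "\<And>x. norm (D\<kappa> s x) \<le> C" using \<kappa>_sup[OF s] by metis
  show ?thesis
    unfolding psi_def[abs_def] Dpsi_def[abs_def]
    by (rule conv_has_derivative[OF \<kappa>_deriv[OF s] C(2,1) borel_measurable_continuous_onI[OF D\<kappa>_cont[OF s]] h])
qed

lemma Dpsi_cont:
  assumes s: "s > 0"
  shows "continuous_on UNIV (Dpsi s)"
proof -
  obtain C where C: "\<And>x. norm (D\<kappa> s x) \<le> C" using \<kappa>_sup[OF s] by metis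
  show ?thesis
    unfolding Dpsi_def[abs_def]
    by (intro continuous_on_vec_lambda continuous_on_conv[OF _ D\<kappa>_component_le[OF s C] h])
      (intro continuous_intros D\<kappa>_cont s)
qed

lemma psi_cont: "s > 0 \<Longrightarrow> continuous_on UNIV (psi s)"
  using psi_deriv has_derivative_continuous by (blast intro: continuous_at_imp_continuous_on)

lemma psi_sup:
  assumes "s > 0"
  obtains C where "\<And>x. \<bar>psi s x\<bar> \<le> C"
proof -
  obtain C where C: "\<And>x. \<bar>\<kappa> s x\<bar> \<le> C" using \<kappa>_sup[OF assms] by metis
  show ?thesis
    by (rule that) (unfold psi_def, rule conv_le[OF C h])
qed

lemma conv_le_heat:
  assumes s: "s > 0" and k: "k \<in> borel_measurable borel" "\<And>x. \<bar>k x\<bar> \<le> c * heat (2 * s) x" and c: "c \<ge> 0"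
    and W: "(\<integral>\<^sup>+z. ennreal (heat (2 * s) (x - z) * \<bar>h z\<bar>) \<partial>lborel) \<le> ennreal W" "0 \<le> W"
  shows "\<bar>conv k h x\<bar> \<le> c * W"
proof -
  have [measurable]: "k \<in> borel_measurable borel" by (rule k)
  have "ennreal \<bar>conv k h x\<bar> \<le> (\<integral>\<^sup>+z. ennreal (norm (k (x - z) * h z)) \<partial>lborel)"
    unfolding conv_def real_norm_def[symmetric] by (rule norm_integral_le_nn_integral)
  also have "\<dots> \<le> (\<integral>\<^sup>+z. ennreal c * ennreal (heat (2 * s) (x - z) * \<bar>h z\<bar>) \<partial>lborel)"
    using k(2) c s by (intro nn_integral_mono)
      (auto simp: ennreal_mult[symmetric] heat_nonneg abs_mult mult.assoc[symmetric] intro!: ennreal_leI mult_right_mono)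
  also have "\<dots> = ennreal c * (\<integral>\<^sup>+z. ennreal (heat (2 * s) (x - z) * \<bar>h z\<bar>) \<partial>lborel)"
    by (rule nn_integral_cmult) measurable
  also have "\<dots> \<le> ennreal c * ennreal W" by (intro mult_left_mono W) auto
  finally show ?thesis
    using c W(2) by (simp add: ennreal_mult[symmetric] ennreal_le_iff)
qed

text \<open>The kernel is bounded by the heat kernel at the doubled time, and \<open>m\<close>
  bounds the latter. The exponent of the majorant is not positive, so replacing \<open>2 * s\<close>
  by \<open>s\<close> only enlarges it; \<open>scaling\<close> then collects the powers. The factor
  \<open>CARD('n)\<close> sums the components of the gradient.\<close>

lemma psi_majorant:
  assumes m: "\<And>s x. s > 0 \<Longrightarrow> (\<integral>\<^sup>+z. ennreal (heat s (x - z) * \<bar>h z\<bar>) \<partial>lborel) \<le>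
      ennreal (128 * s powr (- ((real CARD('n) - 1) / (2 * p))) * m (x $ i))" "\<And>t. 0 \<le> m t"
    and s: "s > 0"
  shows "\<bar>psi s x\<bar> \<le> 128 * B * s powr (1 / (2 * p) - 1) * m (x $ i)"
    and "norm (Dpsi s x) \<le> real CARD('n) * (128 * B * s powr (1 / (2 * p) - 1 - 1 / 2) * m (x $ i))"
proof -
  let ?e = "- ((real CARD('n) - 1) / (2 * p))"
  define W where "W = 128 * s powr ?e * m (x $ i)"
  have n1: "real CARD('n) \<ge> 1" by (simp add: Suc_le_eq)
  have e: "?e = 1 / (2 * p) - 1 + \<gamma>"
    using scaling by (simp add: diff_divide_distrib)
  have "?e \<le> 0" using n1 p by simp
  then have "(2 * s) powr ?e \<le> s powr ?e"
    using s by (intro powr_mono2') auto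
  then have W: "(\<integral>\<^sup>+z. ennreal (heat (2 * s) (x - z) * \<bar>h z\<bar>) \<partial>lborel) \<le> ennreal W"
    using s m(2)[of "x $ i"] unfolding W_def
    by (intro order_trans[OF m(1)] ennreal_leI mult_right_mono mult_left_mono) auto
  have W0: "0 \<le> W" using m(2) by (simp add: W_def)
  have "\<bar>psi s x\<bar> \<le> (B * s powr (- \<gamma>)) * W"
    unfolding psi_def using s B_pos
    by (intro conv_le_heat[OF s _ \<kappa>_bound _ W W0] borel_measurable_continuous_onI[OF \<kappa>_cont]) auto
  also have "\<dots> = 128 * B * (s powr (- \<gamma>) * s powr ?e) * m (x $ i)" by (simp add: W_def)
  also have "s powr (- \<gamma>) * s powr ?e = s powr (1 / (2 * p) - 1)"
    unfolding e using s by (simp add: powr_add[symmetric])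
  finally show "\<bar>psi s x\<bar> \<le> 128 * B * s powr (1 / (2 * p) - 1) * m (x $ i)" .
  have "\<bar>Dpsi s x $ j\<bar> \<le> (B * s powr (- \<gamma> - 1 / 2)) * W" for j
  proof -
    have "(\<lambda>z. D\<kappa> s z $ j) \<in> borel_measurable borel"
      by (intro borel_measurable_component borel_measurable_continuous_onI D\<kappa>_cont s)
    moreover have "\<bar>D\<kappa> s z $ j\<bar> \<le> (B * s powr (- \<gamma> - 1 / 2)) * heat (2 * s) z" for z
      by (rule order_trans[OF component_le_norm_cart D\<kappa>_bound[OF s]])
    ultimately have "\<bar>conv (\<lambda>z. D\<kappa> s z $ j) h x\<bar> \<le> (B * s powr (- \<gamma> - 1 / 2)) * W"
      by (rule conv_le_heat[OF s]) (use B_pos W W0 in auto)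
    then show ?thesis by (simp add: Dpsi_def)
  qed
  then have "norm (Dpsi s x) \<le> (\<Sum>j\<in>(UNIV :: 'n set). (B * s powr (- \<gamma> - 1 / 2)) * W)"
    by (intro order_trans[OF norm_le_l1_cart] sum_mono) auto
  also have "\<dots> = real CARD('n) * (128 * B * (s powr (- \<gamma> - 1 / 2) * s powr ?e) * m (x $ i))"
    by (simp add: W_def)
  also have "s powr (- \<gamma> - 1 / 2) * s powr ?e = s powr (1 / (2 * p) - 1 - 1 / 2)"
    unfolding e using s by (simp add: powr_add[symmetric])
  finally show "norm (Dpsi s x) \<le> real CARD('n) * (128 * B * s powr (1 / (2 * p) - 1 - 1 / 2) * m (x $ i))" .
qed

end

end

text \<open>For the conjugate exponent \<open>q\<close> one has \<open>(1 - 1 / p) * q = 1\<close>,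
  so the \<open>q\<close>-th power of the weight is \<open>A\<close> itself.\<close>

lemma Hoelder_conjugate_weight:
  fixes m A :: "real \<Rightarrow> real"
  assumes [measurable]: "m \<in> borel_measurable borel" "A \<in> borel_measurable borel"
    and nonneg: "\<And>t. 0 \<le> m t" "\<And>t. 0 \<le> A t" and p: "p > 1"
    and X: "(\<integral>\<^sup>+t. ennreal (m t powr p) \<partial>lborel) \<le> ennreal (X powr p)" "0 \<le> X"
    and L: "(\<integral>\<^sup>+t. ennreal (A t) \<partial>lborel) \<le> ennreal L" "0 \<le> L"
  shows "(\<integral>\<^sup>+t. ennreal (m t * A t powr (1 - 1 / p)) \<partial>lborel) \<le> ennreal (X * L powr (1 - 1 / p))"
proof -
  define q where "q = p / (p - 1)"
  have q: "q > 1" "1 / p + 1 / q = 1" "(1 - 1 / p) * q = 1" using p by (auto simp: q_def field_simps)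
  show ?thesis
  proof (rule nn_integral_Hoelder[OF _ _ _ _ p q(1,2) X])
    show "(\<integral>\<^sup>+t. ennreal ((A t powr (1 - 1 / p)) powr q) \<partial>lborel) \<le> ennreal ((L powr (1 - 1 / p)) powr q)"
      using L nonneg by (simp add: powr_powr q(3))
  qed (use nonneg in auto)
qed

lemma integrable_component:
  fixes F :: "'a \<Rightarrow> real ^ 'n"
  assumes "integrable M F"
  shows "integrable M (\<lambda>x. F x $ i)"
  using integrable_inner_left[OF assms, of "axis i 1"] by (simp add: inner_axis)

text \<open>The substitution \<open>t = x $ i + e k * u\<close> moves the width from the density
  into the argument of \<open>\<psi>\<close>. Continuity of \<open>\<psi>\<close> gives the limit in
  \<open>u\<close>, and dominated convergence against \<open>G\<close> the limit in
  \<open>x\<close>.\<close>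

lemma mollified_slices_tendsto:
  fixes G :: "real ^ 'n \<Rightarrow> real"
  assumes G: "integrable lborel G" and c: "continuous_on UNIV \<psi>" and b: "\<And>x. \<bar>\<psi> x\<bar> \<le> C"
    and e: "e \<longlonglongrightarrow> 0" "\<And>k. e k > (0::real)"
  shows "(\<lambda>k. \<integral>x. G x * (\<integral>t. eta ((t - x $ i) / e k) / e k * \<psi> (upd i t x) \<partial>lborel) \<partial>lborel)
    \<longlonglongrightarrow> (\<integral>x. G x * \<psi> x \<partial>lborel)"
proof -
  have [measurable]: "\<psi> \<in> borel_measurable borel" "G \<in> borel_measurable borel"
    using c G by (auto intro: borel_measurable_continuous_onI)
  have C: "C \<ge> 0" using b[of 0] by linarith
  have sub: "(\<integral>t. eta ((t - x $ i) / e k) / e k * \<psi> (upd i t x) \<partial>lborel) =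
      (\<integral>u. eta u * \<psi> (x + (e k * u) *\<^sub>R axis i 1) \<partial>lborel)" for x k
    using e(2)[of k]
    by (subst lborel_integral_real_affine[where c = "e k" and t = "x $ i"]) (auto simp: upd_def)
  have inner: "(\<lambda>k. \<integral>u. eta u * \<psi> (x + (e k * u) *\<^sub>R axis i 1) \<partial>lborel) \<longlonglongrightarrow> (\<integral>u. eta u * \<psi> x \<partial>lborel)" for x
  proof (rule integral_dominated_convergence[where w = "\<lambda>u. eta u * C"])
    show "AE u in lborel. (\<lambda>k. eta u * \<psi> (x + (e k * u) *\<^sub>R axis i 1)) \<longlonglongrightarrow> eta u * \<psi> x"
    proof (rule AE_I2)
      fix u
      have "(\<lambda>k. x + (e k * u) *\<^sub>R axis i 1) \<longlonglongrightarrow> x + (0 * u) *\<^sub>R axis i 1"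
        by (intro tendsto_intros e)
      then have "(\<lambda>k. x + (e k * u) *\<^sub>R axis i 1) \<longlonglongrightarrow> x" by simp
      from continuous_on_tendsto_compose[OF c this]
      show "(\<lambda>k. eta u * \<psi> (x + (e k * u) *\<^sub>R axis i 1)) \<longlonglongrightarrow> eta u * \<psi> x"
        by (intro tendsto_intros) simp
    qed
    show "AE u in lborel. norm (eta u * \<psi> (x + (e k * u) *\<^sub>R axis i 1)) \<le> eta u * C" for k
      using b eta_pos by (auto simp: abs_mult abs_of_pos intro!: AE_I2 mult_left_mono less_imp_le)
  qed (use integrable_eta in auto)
  have "(\<lambda>k. \<integral>x. G x * (\<integral>u. eta u * \<psi> (x + (e k * u) *\<^sub>R axis i 1) \<partial>lborel) \<partial>lborel)
    \<longlonglongrightarrow> (\<integral>x. G x * \<psi> x \<partial>lborel)"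
  proof (rule integral_dominated_convergence[where w = "\<lambda>x. \<bar>G x\<bar> * C"])
    show "AE x in lborel. (\<lambda>k. G x * (\<integral>u. eta u * \<psi> (x + (e k * u) *\<^sub>R axis i 1) \<partial>lborel)) \<longlonglongrightarrow> G x * \<psi> x"
      using inner by (intro AE_I2 tendsto_intros) (simp add: integral_eta)
    show "AE x in lborel. norm (G x * (\<integral>u. eta u * \<psi> (x + (e k * u) *\<^sub>R axis i 1) \<partial>lborel)) \<le> \<bar>G x\<bar> * C" for k
    proof (rule AE_I2)
      fix x
      have "norm (\<integral>u. eta u * \<psi> (x + (e k * u) *\<^sub>R axis i 1) \<partial>lborel) \<le> (\<integral>u. eta u * C \<partial>lborel)"
      proof (rule Bochner_Integration.integral_norm_bound_integral)
        show "integrable lborel (\<lambda>u. eta u * \<psi> (x + (e k * u) *\<^sub>R axis i 1))"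
          by (rule integrable_bounded_mult'[OF integrable_eta _ b]) measurable
        show "norm (eta u * \<psi> (x + (e k * u) *\<^sub>R axis i 1)) \<le> eta u * C" for u
          using b eta_pos[of u] by (auto simp: abs_mult abs_of_pos intro!: mult_left_mono less_imp_le)
      qed (use integrable_eta in auto)
      then show "norm (G x * (\<integral>u. eta u * \<psi> (x + (e k * u) *\<^sub>R axis i 1) \<partial>lborel)) \<le> \<bar>G x\<bar> * C"
        by (simp add: abs_mult integral_eta mult_left_mono)
    qed
  qed (use G in auto)
  then show ?thesis by (simp only: sub)
qed

context parabolic_kernel
begin

text \<open>The factor \<open>128 * B\<close> comes from \<open>psi_majorant\<close>, the rest is
  the constant of \<open>time_integral_bound\<close> for \<open>N = 2 * n\<close> and
  \<open>a = 1 / (2 * p)\<close>.\<close>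

definition estimate_const :: real where
  "estimate_const = 128 * B * ((1 + 2 * real CARD('n)) * (1 / (1 / (2 * p)) + 1 / (1 / 2 - 1 / (2 * p))))"

lemma estimate_const_pos: "estimate_const > 0"
proof -
  have "1 / 2 - 1 / (2 * p) > 0" using p by (simp add: field_simps)
  then show ?thesis
    using B_pos p unfolding estimate_const_def
    by (intro mult_pos_pos add_pos_pos divide_pos_pos) auto
qed

text \<open>For given \<open>s\<close> and \<open>t\<close> the averaged slice integral has two
  bounds: the supremum of \<open>psi\<close> on the slice times the mass \<open>A t\<close>, and the
  one from \<open>slab_estimate\<close>. Time is integrated first, at fixed \<open>t\<close>, where
  the two bounds can be balanced; Hoelder in \<open>t\<close> comes afterwards. Nothing on the right
  depends on the width \<open>e\<close>.\<close>

lemma slab_core: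
  fixes F :: "real ^ 'n \<Rightarrow> real ^ 'n" and h :: "real ^ 'n \<Rightarrow> real" and m :: "real \<Rightarrow> real"
  assumes F: "integrable lborel F" and f: "integrable lborel f"
    and test: "\<And>\<phi>. test_function \<phi> \<Longrightarrow> (\<integral>x. F x \<bullet> grad \<phi> x \<partial>lborel) = - (\<integral>x. f x * \<phi> x \<partial>lborel)"
    and L: "(\<integral>x. norm (F x) \<partial>lborel) \<le> L" "(\<integral>x. \<bar>f x\<bar> \<partial>lborel) \<le> L" "L > 0"
    and h: "integrable lborel h"
    and m [measurable]: "m \<in> borel_measurable borel" and m0: "\<And>t. 0 \<le> m t"
    and maj: "\<And>s x. s > 0 \<Longrightarrow> (\<integral>\<^sup>+z. ennreal (heat s (x - z) * \<bar>h z\<bar>) \<partial>lborel) \<le>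
      ennreal (128 * s powr (- ((real CARD('n) - 1) / (2 * p))) * m (x $ i))"
    and X: "(\<integral>\<^sup>+t. ennreal (m t powr p) \<partial>lborel) \<le> ennreal (X powr p)" "0 \<le> X"
    and e: "e > 0"
  shows "(\<integral>\<^sup>+s. \<integral>\<^sup>+t. ennreal (exp (- s) *
      \<bar>\<integral>x. F x $ i * (eta ((t - x $ i) / e) / e) * psi h s (upd i t x) \<partial>lborel\<bar>) * indicator {0<..} s \<partial>lborel \<partial>lborel)
    \<le> ennreal (estimate_const * L * X)"
proof -
  let ?a = "1 / (2 * p)" and ?n = "real CARD('n)"
  let ?I = "\<lambda>s t. \<integral>x. F x $ i * (eta ((t - x $ i) / e) / e) * psi h s (upd i t x) \<partial>lborel"
  have [measurable]: "F \<in> borel_measurable borel" using F by auto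
  \<comment> \<open>The mass of \<open>F $ i\<close> smeared over the slice; its integral over
    \<open>t\<close> is the total mass, since the rescaled density has mass 1.\<close>
  define A where "A t = (\<integral>x. \<bar>F x $ i\<bar> * (eta ((t - x $ i) / e) / e) \<partial>lborel)" for t
  have [measurable]: "A \<in> borel_measurable borel" unfolding A_def[abs_def] by measurable
  have eta_bd: "\<bar>eta u / e\<bar> \<le> 1 / pi / e" for u
    using divide_right_mono[OF eta_le[of u], of e] eta_pos[of u] e by simp
  have iA: "integrable lborel (\<lambda>x. \<bar>F x $ i\<bar> * (eta ((t - x $ i) / e) / e))" for t
    by (rule integrable_bounded_mult'[OF integrable_abs[OF integrable_component[OF F]] _ eta_bd]) measurable
  have A0: "0 \<le> A t" for t
    unfolding A_def using e eta_pos by (intro integral_nonneg_AE AE_I2) (simp add: less_imp_le)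
  have AL: "(\<integral>\<^sup>+t. ennreal (A t) \<partial>lborel) \<le> ennreal L"
  proof -
    have "(\<integral>\<^sup>+t. ennreal (A t) \<partial>lborel) =
        (\<integral>\<^sup>+t. \<integral>\<^sup>+x. ennreal (\<bar>F x $ i\<bar> * (eta ((t - x $ i) / e) / e)) \<partial>lborel \<partial>lborel)"
      unfolding A_def using e eta_pos
      by (intro nn_integral_cong nn_integral_eq_integral[symmetric] iA AE_I2) (simp add: less_imp_le)
    also have "\<dots> = (\<integral>\<^sup>+x. \<integral>\<^sup>+t. ennreal (\<bar>F x $ i\<bar> * (eta ((t - x $ i) / e) / e)) \<partial>lborel \<partial>lborel)"
      by (rule lborel_pair.Fubini') measurable
    also have "\<dots> = (\<integral>\<^sup>+x. ennreal \<bar>F x $ i\<bar> * (\<integral>\<^sup>+t. ennreal (eta ((t - x $ i) / e) / e) \<partial>lborel) \<partial>lborel)"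
      by (intro nn_integral_cong, subst nn_integral_cmult[symmetric])
        (measurable, simp only: ennreal_mult' abs_ge_zero)
    also have "\<dots> = (\<integral>\<^sup>+x. ennreal \<bar>F x $ i\<bar> \<partial>lborel)"
      by (simp add: nn_integral_eta_scaled[OF e])
    also have "\<dots> \<le> (\<integral>\<^sup>+x. ennreal (norm (F x)) \<partial>lborel)"
      by (intro nn_integral_mono ennreal_leI component_le_norm_cart)
    also have "\<dots> = ennreal (\<integral>x. norm (F x) \<partial>lborel)"
      using F by (intro nn_integral_eq_integral) auto
    also have "\<dots> \<le> ennreal L" by (intro ennreal_leI L)
    finally show ?thesis .
  qed
  have key: "\<bar>?I s t\<bar> \<le> 128 * B * s powr (?a - 1) * m t * min (A t) (L * (1 + 2 * ?n * s powr (- (1/2))))"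
    if s: "s > 0" for s t
  proof -
    let ?b = "128 * B * s powr (?a - 1) * m t" and ?d = "?n * (128 * B * s powr (?a - 1 - 1/2) * m t)"
    have b0: "0 \<le> ?b" using B_pos m0[of t] by simp
    have psi_b: "\<bar>psi h s x\<bar> \<le> ?b" "norm (Dpsi h s x) \<le> ?d" if "x $ i = t" for x
      using psi_majorant[OF h maj m0 s, of x] that by auto
    have "\<bar>?I s t\<bar> \<le> (\<integral>x. norm (F x) \<partial>lborel) * (2 * ?d) + (\<integral>x. \<bar>f x\<bar> \<partial>lborel) * ?b"
      by (rule slab_estimate[OF F f test psi_deriv[OF h s] Dpsi_cont[OF h s] psi_b e])
    also have "\<dots> \<le> L * (2 * ?d) + L * ?b"
      using B_pos m0[of t] L by (intro add_mono mult_right_mono) auto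
    also have "?d = ?n * (s powr (- (1/2)) * ?b)"
    proof -
      have "s powr (?a - 1 - 1/2) = s powr (- (1/2)) * s powr (?a - 1)"
        using s by (simp add: powr_add[symmetric])
      then show ?thesis by simp
    qed
    also have "L * (2 * (?n * (s powr (- (1/2)) * ?b))) + L * ?b = ?b * (L * (1 + 2 * ?n * s powr (- (1/2))))"
      by (simp add: algebra_simps)
    finally have 1: "\<bar>?I s t\<bar> \<le> ?b * (L * (1 + 2 * ?n * s powr (- (1/2))))" .
    have "\<bar>?I s t\<bar> \<le> (\<integral>x. \<bar>F x $ i\<bar> * (eta ((t - x $ i) / e) / e) * ?b \<partial>lborel)"
      unfolding real_norm_def[symmetric]
    proof (rule Bochner_Integration.integral_norm_bound_integral)
      have "norm (F x $ i * (eta ((t - x $ i) / e) / e) * psi h s (upd i t x)) \<le>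
          norm (F x $ i) * (eta ((t - x $ i) / e) / e) * ?b" for x
        unfolding norm_mult using psi_b(1)[of "upd i t x"] e eta_pos[of "(t - x $ i) / e"]
        by (intro mult_mono) (auto simp: upd_nth)
      then show "norm (F x $ i * (eta ((t - x $ i) / e) / e) * psi h s (upd i t x)) \<le>
          norm (F x $ i) * (eta ((t - x $ i) / e) / e) * ?b" for x .
      show "integrable lborel (\<lambda>x. norm (F x $ i) * (eta ((t - x $ i) / e) / e) * ?b)"
        unfolding real_norm_def by (rule integrable_mult_left[OF iA])
      show "integrable lborel (\<lambda>x. F x $ i * (eta ((t - x $ i) / e) / e) * psi h s (upd i t x))"
      proof (rule integrable_bounded_mult')
        show "integrable lborel (\<lambda>x. F x $ i * (eta ((t - x $ i) / e) / e))"
          by (rule integrable_bounded_mult'[OF integrable_component[OF F] _ eta_bd]) measurable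
        show "(\<lambda>x. psi h s (upd i t x)) \<in> borel_measurable lborel"
          using psi_measurable[OF h, of "\<lambda>x. s" "lborel" "\<lambda>x. upd i t x"] by measurable
        show "\<bar>psi h s (upd i t x)\<bar> \<le> ?b" for x by (rule psi_b(1)) (simp add: upd_nth)
      qed
    qed
    also have "\<dots> = ?b * A t" by (simp add: A_def mult.commute)
    finally have 2: "\<bar>?I s t\<bar> \<le> ?b * A t" .
    show ?thesis using 1 2 b0 by (simp add: min_def)
  qed
  let ?g = "\<lambda>s t. exp (- s) * s powr (?a - 1) * min (A t) (L * (1 + 2 * ?n * s powr (- (1/2))))"
  have g0: "0 \<le> ?g s t" for s t using A0 L by simp
  have a: "0 < ?a" "?a < 1 / 2" using p by (auto simp: field_simps)
  let ?C = "(1 + 2 * ?n) * (1 / ?a + 1 / (1 / 2 - ?a))"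
  have "(\<integral>\<^sup>+s. \<integral>\<^sup>+t. ennreal (exp (- s) * \<bar>?I s t\<bar>) * indicator {0<..} s \<partial>lborel \<partial>lborel) \<le>
      (\<integral>\<^sup>+s. \<integral>\<^sup>+t. ennreal (128 * B * m t) * (ennreal (?g s t) * indicator {0<..} s) \<partial>lborel \<partial>lborel)"
  proof (intro nn_integral_mono)
    fix s t :: real
    show "ennreal (exp (- s) * \<bar>?I s t\<bar>) * indicator {0<..} s \<le>
        ennreal (128 * B * m t) * (ennreal (?g s t) * indicator {0<..} s)"
    proof (cases "s > 0")
      case True
      have "exp (- s) * \<bar>?I s t\<bar> \<le> 128 * B * m t * ?g s t"
        using mult_left_mono[OF key[OF True, of t], of "exp (- s)"] by (simp add: mult_ac)
      then have "ennreal (exp (- s) * \<bar>?I s t\<bar>) \<le> ennreal (128 * B * m t) * ennreal (?g s t)"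
        using g0[of s t] B_pos m0[of t] by (subst ennreal_mult[symmetric]) (auto intro: ennreal_leI)
      with True show ?thesis by simp
    qed simp
  qed
  also have "\<dots> = (\<integral>\<^sup>+t. \<integral>\<^sup>+s. ennreal (128 * B * m t) * (ennreal (?g s t) * indicator {0<..} s) \<partial>lborel \<partial>lborel)"
    by (rule lborel_pair.Fubini') measurable
  also have "\<dots> = (\<integral>\<^sup>+t. ennreal (128 * B * m t) * (\<integral>\<^sup>+s. ennreal (?g s t) * indicator {0<..} s \<partial>lborel) \<partial>lborel)"
    by (intro nn_integral_cong nn_integral_cmult) measurable
  also have "\<dots> \<le> (\<integral>\<^sup>+t. ennreal (128 * B * m t) * ennreal (?C * (A t powr (1 - 2 * ?a) * L powr (2 * ?a))) \<partial>lborel)"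
    by (intro nn_integral_mono mult_left_mono time_integral_bound A0 L a) auto
  \<comment> \<open>Here \<open>2 * a = 1 / p\<close>: the power \<open>L powr (1 / p)\<close>
    leaves the integral, and Hoelder supplies the missing \<open>L powr (1 - 1 / p)\<close>.\<close>
  also have "\<dots> = (\<integral>\<^sup>+t. ennreal (estimate_const * L powr (1 / p)) * ennreal (m t * A t powr (1 - 1 / p)) \<partial>lborel)"
  proof (rule nn_integral_cong)
    fix t
    have e: "128 * B * m t * (?C * (A t powr (1 - 2 * ?a) * L powr (2 * ?a))) =
        estimate_const * L powr (1 / p) * (m t * A t powr (1 - 1 / p))"
      by (simp add: estimate_const_def mult_ac)
    have "0 \<le> 128 * B * m t" "0 \<le> estimate_const * L powr (1 / p)"
      using B_pos m0[of t] estimate_const_pos by simp_all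
    then show "ennreal (128 * B * m t) * ennreal (?C * (A t powr (1 - 2 * ?a) * L powr (2 * ?a))) =
      ennreal (estimate_const * L powr (1 / p)) * ennreal (m t * A t powr (1 - 1 / p))"
      by (simp only: ennreal_mult'[symmetric] e)
  qed
  also have "\<dots> = ennreal (estimate_const * L powr (1 / p)) * (\<integral>\<^sup>+t. ennreal (m t * A t powr (1 - 1 / p)) \<partial>lborel)"
    by (rule nn_integral_cmult) measurable
  also have "\<dots> \<le> ennreal (estimate_const * L powr (1 / p)) * ennreal (X * L powr (1 - 1 / p))"
    using L by (intro mult_left_mono Hoelder_conjugate_weight m0 A0 p X AL) auto
  also have "\<dots> = ennreal (estimate_const * L * X)"
  proof -
    have "L powr (1 / p) * L powr (1 - 1 / p) = L" using L by (simp add: powr_add[symmetric])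
    then have eq: "estimate_const * L powr (1 / p) * (X * L powr (1 - 1 / p)) = estimate_const * L * X"
      by (metis (no_types, opaque_lifting) mult.assoc mult.left_commute mult.commute)
    have "0 \<le> estimate_const * L powr (1 / p)"
      using estimate_const_pos by simp
    then show ?thesis
      by (simp only: ennreal_mult'[symmetric] eq)
  qed
  finally show ?thesis .
qed

text \<open>Fubini writes the averaged pairing as an integral of slice integrals over
  \<open>t\<close>, to which \<open>slab_core\<close> applies uniformly in the width. The averages
  converge for every \<open>s > 0\<close>, and Fatou in \<open>s\<close> carries the bound
  over.\<close>

lemma pairing_estimate:
  fixes F :: "real ^ 'n \<Rightarrow> real ^ 'n" and h :: "real ^ 'n \<Rightarrow> real" and m :: "real \<Rightarrow> real"
  assumes F: "integrable lborel F" and f: "integrable lborel f"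
    and test: "\<And>\<phi>. test_function \<phi> \<Longrightarrow> (\<integral>x. F x \<bullet> grad \<phi> x \<partial>lborel) = - (\<integral>x. f x * \<phi> x \<partial>lborel)"
    and L: "(\<integral>x. norm (F x) \<partial>lborel) \<le> L" "(\<integral>x. \<bar>f x\<bar> \<partial>lborel) \<le> L" "L > 0"
    and h: "integrable lborel h"
    and m: "m \<in> borel_measurable borel" "\<And>t. 0 \<le> m t"
    and maj: "\<And>s x. s > 0 \<Longrightarrow> (\<integral>\<^sup>+z. ennreal (heat s (x - z) * \<bar>h z\<bar>) \<partial>lborel) \<le>
      ennreal (128 * s powr (- ((real CARD('n) - 1) / (2 * p))) * m (x $ i))"
    and X: "(\<integral>\<^sup>+t. ennreal (m t powr p) \<partial>lborel) \<le> ennreal (X powr p)" "0 \<le> X"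
  shows "(\<integral>\<^sup>+s. ennreal (exp (- s) * \<bar>\<integral>x. F x $ i * psi h s x \<partial>lborel\<bar>) * indicator {0<..} s \<partial>lborel)
    \<le> ennreal (estimate_const * L * X)"
proof -
  define e where "e k = 1 / real (Suc k)" for k
  have e: "e \<longlonglongrightarrow> 0" "e k > 0" for k
    unfolding e_def[abs_def] by (intro LIMSEQ_Suc lim_1_over_n) simp
  have Fm [measurable]: "F \<in> borel_measurable borel" using F by auto
  note psi_m [measurable (raw)] = psi_measurable[OF h]
  define J where "J k s = (\<integral>x. F x $ i * (\<integral>t. eta ((t - x $ i) / e k) / e k * psi h s (upd i t x) \<partial>lborel) \<partial>lborel)" for k s
  have [measurable]: "J k \<in> borel_measurable borel" for k unfolding J_def[abs_def] by measurable
  have lim: "(\<lambda>k. J k s) \<longlonglongrightarrow> (\<integral>x. F x $ i * psi h s x \<partial>lborel)" if s: "s > 0" for s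
  proof -
    obtain C where C: "\<And>x. \<bar>psi h s x\<bar> \<le> C" using psi_sup[OF h s] by metis
    show ?thesis
      unfolding J_def by (rule mollified_slices_tendsto[OF integrable_component[OF F] psi_cont[OF h s] C e])
  qed
  have J_le: "ennreal \<bar>J k s\<bar> \<le> (\<integral>\<^sup>+t. ennreal \<bar>\<integral>x. F x $ i * (eta ((t - x $ i) / e k) / e k) * psi h s (upd i t x) \<partial>lborel\<bar> \<partial>lborel)"
    if s: "s > 0" for s k
  proof -
    obtain C where C: "\<And>x. \<bar>psi h s x\<bar> \<le> C" using psi_sup[OF h s] by metis
    have C0: "C \<ge> 0" using C[of 0] by linarith
    let ?q = "\<lambda>x t. F x $ i * (eta ((t - x $ i) / e k) / e k) * psi h s (upd i t x)"
    have "(\<integral>\<^sup>+x. \<integral>\<^sup>+t. ennreal (norm (?q x t)) \<partial>lborel \<partial>lborel) \<le>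
        (\<integral>\<^sup>+x. \<integral>\<^sup>+t. ennreal (norm (F x) * C) * ennreal (eta ((t - x $ i) / e k) / e k) \<partial>lborel \<partial>lborel)"
    proof (intro nn_integral_mono)
      fix x :: "real ^ 'n" and t :: real
      have "norm (?q x t) \<le> norm (F x) * (eta ((t - x $ i) / e k) / e k) * C"
        unfolding norm_mult using component_le_norm_cart[of "F x" i] C[of "upd i t x"] e(2)[of k] eta_pos[of "(t - x $ i) / e k"]
        by (intro mult_mono) (auto simp: less_imp_le)
      then show "ennreal (norm (?q x t)) \<le> ennreal (norm (F x) * C) * ennreal (eta ((t - x $ i) / e k) / e k)"
        using C0 e(2)[of k] eta_pos[of "(t - x $ i) / e k"]
        by (subst ennreal_mult[symmetric]) (auto intro!: ennreal_leI simp: mult_ac less_imp_le)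
    qed
    also have "\<dots> = (\<integral>\<^sup>+x. ennreal (norm (F x) * C) \<partial>lborel)"
      by (subst nn_integral_cmult) (auto simp: nn_integral_eta_scaled[OF e(2)])
    also have "\<dots> < \<infinity>"
      using F C0 by (subst nn_integral_eq_integral) auto
    finally have "integrable (lborel \<Otimes>\<^sub>M lborel) (\<lambda>(x, t). ?q x t)"
      by (intro integrable_pairI) measurable
    from lborel_pair.Fubini_integral[OF this]
    have "(\<integral>t. (\<integral>x. ?q x t \<partial>lborel) \<partial>lborel) = (\<integral>x. (\<integral>t. ?q x t \<partial>lborel) \<partial>lborel)" .
    also have "\<dots> = J k s" unfolding J_def by (simp add: mult.assoc)
    finally show ?thesis
      using norm_integral_le_nn_integral[of lborel "\<lambda>t. \<integral>x. ?q x t \<partial>lborel"] by simp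
  qed
  have bound: "(\<integral>\<^sup>+s. ennreal (exp (- s) * \<bar>J k s\<bar>) * indicator {0<..} s \<partial>lborel) \<le> ennreal (estimate_const * L * X)" for k
  proof -
    let ?I = "\<lambda>s t. \<integral>x. F x $ i * (eta ((t - x $ i) / e k) / e k) * psi h s (upd i t x) \<partial>lborel"
    have "(\<integral>\<^sup>+s. ennreal (exp (- s) * \<bar>J k s\<bar>) * indicator {0<..} s \<partial>lborel) \<le>
      (\<integral>\<^sup>+s. \<integral>\<^sup>+t. ennreal (exp (- s) * \<bar>?I s t\<bar>) * indicator {0<..} s \<partial>lborel \<partial>lborel)"
    proof (rule nn_integral_mono)
      fix s :: real
      show "ennreal (exp (- s) * \<bar>J k s\<bar>) * indicator {0<..} s \<le>
          (\<integral>\<^sup>+t. ennreal (exp (- s) * \<bar>?I s t\<bar>) * indicator {0<..} s \<partial>lborel)"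
      proof (cases "s > 0")
        case True
        have "ennreal (exp (- s) * \<bar>J k s\<bar>) = ennreal (exp (- s)) * ennreal \<bar>J k s\<bar>"
          by (simp add: ennreal_mult)
        also have "\<dots> \<le> ennreal (exp (- s)) * (\<integral>\<^sup>+t. ennreal \<bar>?I s t\<bar> \<partial>lborel)"
          by (intro mult_left_mono J_le True) auto
        also have "\<dots> = (\<integral>\<^sup>+t. ennreal (exp (- s) * \<bar>?I s t\<bar>) \<partial>lborel)"
          by (subst nn_integral_cmult[symmetric]) (measurable, simp only: ennreal_mult' exp_ge_zero)
        finally show ?thesis using True by simp
      qed simp
    qed
    also have "\<dots> \<le> ennreal (estimate_const * L * X)"
      by (rule slab_core[OF F f test L h m maj X e(2)])
    finally show ?thesis .
  qed
  have "(\<integral>\<^sup>+s. ennreal (exp (- s) * \<bar>\<integral>x. F x $ i * psi h s x \<partial>lborel\<bar>) * indicator {0<..} s \<partial>lborel) =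
      (\<integral>\<^sup>+s. liminf (\<lambda>k. ennreal (exp (- s) * \<bar>J k s\<bar>) * indicator {0<..} s) \<partial>lborel)"
  proof (rule nn_integral_cong)
    fix s :: real
    show "ennreal (exp (- s) * \<bar>\<integral>x. F x $ i * psi h s x \<partial>lborel\<bar>) * indicator {0<..} s =
        liminf (\<lambda>k. ennreal (exp (- s) * \<bar>J k s\<bar>) * indicator {0<..} s)"
    proof (cases "s > 0")
      case True
      have *: "(\<lambda>k. ennreal (exp (- s) * \<bar>J k s\<bar>)) \<longlonglongrightarrow> ennreal (exp (- s) * \<bar>\<integral>x. F x $ i * psi h s x \<partial>lborel\<bar>)"
        by (intro tendsto_ennrealI tendsto_intros lim True)
      show ?thesis
        using True lim_imp_Liminf[OF sequentially_bot *] by simp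
    qed (simp add: Liminf_const)
  qed
  also have "\<dots> \<le> liminf (\<lambda>k. \<integral>\<^sup>+s. ennreal (exp (- s) * \<bar>J k s\<bar>) * indicator {0<..} s \<partial>lborel)"
    by (rule nn_integral_liminf) measurable
  also have "\<dots> \<le> liminf (\<lambda>k::nat. ennreal (estimate_const * L * X))"
    by (intro Liminf_mono always_eventually allI bound)
  also have "\<dots> = ennreal (estimate_const * L * X)" by (simp add: Liminf_const)
  finally show ?thesis .
qed

end

section \<open>Potentials and duality\<close>

context time_kernel
begin

text \<open>The resolvent kernel as a Laplace transform in time at the value 1; for the heat kernel
  this is the Bessel kernel, the fundamental solution of \<open>I - \<Delta>\<close>.\<close>

definition kint :: "real ^ 'n \<Rightarrow> real" where
  "kint x = (\<integral>s. indicator {0<..} s * (exp (- s) * \<kappa> s x) \<partial>lborel)"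

text \<open>The Gamma function at \<open>1 - \<gamma>\<close>, finite because
  \<open>\<gamma> < 1\<close>.\<close>

definition gamma_mass :: ennreal where
  "gamma_mass = (\<integral>\<^sup>+s. ennreal (exp (- s) * s powr (- \<gamma>)) * indicator {0<..} s \<partial>lborel)"

lemma gamma_mass_finite: "gamma_mass < \<infinity>"
proof -
  have "gamma_mass \<le> (\<integral>\<^sup>+s. ennreal (s powr (- \<gamma>)) * indicator {0..1} s + ennreal (exp (- s)) * indicator {0..} s \<partial>lborel)"
    unfolding gamma_mass_def
  proof (rule nn_integral_mono)
    fix s :: real
    consider "s \<le> 0" | "0 < s" "s \<le> 1" | "1 < s" by linarith
    then show "ennreal (exp (- s) * s powr (- \<gamma>)) * indicator {0<..} s \<le>
        ennreal (s powr (- \<gamma>)) * indicator {0..1} s + ennreal (exp (- s)) * indicator {0..} s"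
    proof cases
      case 2
      then have "exp (- s) * s powr (- \<gamma>) \<le> s powr (- \<gamma>)" by (intro mult_left_le_one_le) auto
      then show ?thesis using 2 by (simp add: add_increasing2 ennreal_leI)
    next
      case 3
      then have "s powr (- \<gamma>) \<le> s powr 0" using \<gamma> by (intro powr_mono) auto
      then have "exp (- s) * s powr (- \<gamma>) \<le> exp (- s)" using 3 by (intro mult_right_le_one_le) auto
      then show ?thesis using 3 by (auto intro: ennreal_leI)
    qed auto
  qed
  also have "\<dots> = (\<integral>\<^sup>+s. ennreal (s powr (- \<gamma>)) * indicator {0..1} s \<partial>lborel) +
      (\<integral>\<^sup>+s. ennreal (exp (- s)) * indicator {0..} s \<partial>lborel)"
    by (rule nn_integral_add) measurable
  also have "(\<integral>\<^sup>+s. ennreal (s powr (- \<gamma>)) * indicator {0..1} s \<partial>lborel) = ennreal (1 powr (- \<gamma> + 1) / (- \<gamma> + 1))"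
    using \<gamma> by (intro nn_integral_powr_from_0) auto
  also have "(\<integral>\<^sup>+s. ennreal (exp (- s)) * indicator {0..} s \<partial>lborel) = ennreal (0 - - exp (- 0))"
  proof (rule nn_integral_FTC_atLeast)
    show "((\<lambda>s::real. - exp (- s)) \<longlongrightarrow> 0) at_top"
      using tendsto_minus[OF filterlim_compose[OF exp_at_bot filterlim_uminus_at_bot_at_top]] by simp
  qed (auto intro!: derivative_eq_intros)
  finally show ?thesis by (simp add: le_less_trans ennreal_add_less_top)
qed

text \<open>Absolute convergence in time and space, from the unit mass of the heat kernel at time
  \<open>2 * s\<close>. The later interchanges of integrals for \<open>kint\<close> and
  \<open>potential\<close> rest on it.\<close>

lemma space_time_mass:
  assumes [measurable]: "g \<in> borel_measurable borel" and g: "\<And>x. \<bar>g x\<bar> \<le> M"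
  shows "(\<integral>\<^sup>+s. \<integral>\<^sup>+x. ennreal \<bar>indicator {0<..} s * (exp (- s) * \<kappa> s (y - x)) * g x\<bar> \<partial>lborel \<partial>lborel)
    \<le> ennreal (B * M) * gamma_mass"
proof -
  have M: "M \<ge> 0" using g[of 0] by linarith
  have "(\<integral>\<^sup>+s. \<integral>\<^sup>+x. ennreal \<bar>indicator {0<..} s * (exp (- s) * \<kappa> s (y - x)) * g x\<bar> \<partial>lborel \<partial>lborel) \<le>
      (\<integral>\<^sup>+s. ennreal (B * M) * (ennreal (exp (- s) * s powr (- \<gamma>)) * indicator {0<..} s) \<partial>lborel)"
  proof (rule nn_integral_mono)
    fix s :: real
    show "(\<integral>\<^sup>+x. ennreal \<bar>indicator {0<..} s * (exp (- s) * \<kappa> s (y - x)) * g x\<bar> \<partial>lborel) \<le>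
        ennreal (B * M) * (ennreal (exp (- s) * s powr (- \<gamma>)) * indicator {0<..} s)"
    proof (cases "s > 0")
      case s: True
      have "(\<integral>\<^sup>+x. ennreal \<bar>indicator {0<..} s * (exp (- s) * \<kappa> s (y - x)) * g x\<bar> \<partial>lborel) \<le>
          (\<integral>\<^sup>+x. ennreal (B * M * (exp (- s) * s powr (- \<gamma>))) * ennreal (heat (2 * s) (y - x)) \<partial>lborel)"
      proof (rule nn_integral_mono)
        fix x
        have "exp (- s) * \<bar>\<kappa> s (y - x)\<bar> * \<bar>g x\<bar> \<le> exp (- s) * (B * s powr (- \<gamma>) * heat (2 * s) (y - x)) * M"
          using \<kappa>_bound[OF s, of "y - x"] g[of x] s B_pos by (intro mult_mono) (auto simp: heat_nonneg)
        then show "ennreal \<bar>indicator {0<..} s * (exp (- s) * \<kappa> s (y - x)) * g x\<bar> \<le>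
            ennreal (B * M * (exp (- s) * s powr (- \<gamma>))) * ennreal (heat (2 * s) (y - x))"
          using s B_pos M
          by (subst ennreal_mult[symmetric]) (auto simp: abs_mult mult_ac heat_nonneg intro!: ennreal_leI)
      qed
      also have "\<dots> = ennreal (B * M * (exp (- s) * s powr (- \<gamma>))) * (\<integral>\<^sup>+x. ennreal (heat (2 * s) (y - x)) \<partial>lborel)"
        by (rule nn_integral_cmult) measurable
      also have "(\<integral>\<^sup>+x. ennreal (heat (2 * s) (y - x)) \<partial>lborel) = 1"
        using nn_integral_reflect[of "\<lambda>z. ennreal (heat (2 * s) z)" y] nn_integral_heat[of "2 * s"] s by simp
      finally show ?thesis
        using s B_pos M by (simp add: ennreal_mult)
    qed simp
  qed
  also have "\<dots> = ennreal (B * M) * gamma_mass"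
    unfolding gamma_mass_def by (rule nn_integral_cmult) measurable
  finally show ?thesis .
qed

lemma kint_measurable [measurable (raw)]:
  assumes [measurable]: "f \<in> borel_measurable M"
  shows "(\<lambda>q. kint (f q)) \<in> borel_measurable M"
  unfolding kint_def by measurable

lemma integrable_space_time:
  assumes [measurable]: "g \<in> borel_measurable borel" and g: "\<And>x. \<bar>g x\<bar> \<le> M"
  shows "integrable (lborel \<Otimes>\<^sub>M lborel) (\<lambda>(s, x). indicator {0<..} s * (exp (- s) * \<kappa> s (y - x)) * g x)"
proof (rule integrable_pairI)
  show "(\<integral>\<^sup>+s. \<integral>\<^sup>+x. ennreal (norm (indicator {0<..} s * (exp (- s) * \<kappa> s (y - x)) * g x)) \<partial>lborel \<partial>lborel) < \<infinity>"
    using le_less_trans[OF space_time_mass[OF assms, of y]] gamma_mass_finite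
    by (simp add: ennreal_mult_less_top)
qed measurable

lemma conv_kint:
  assumes [measurable]: "g \<in> borel_measurable borel" and g: "\<And>x. \<bar>g x\<bar> \<le> M"
  shows "conv kint g y = (\<integral>s. indicator {0<..} s * (exp (- s) * conv (\<kappa> s) g y) \<partial>lborel)"
proof -
  have "conv kint g y = (\<integral>x. (\<integral>s. indicator {0<..} s * (exp (- s) * \<kappa> s (y - x)) * g x \<partial>lborel) \<partial>lborel)"
    by (simp add: conv_def kint_def)
  also have "\<dots> = (\<integral>s. (\<integral>x. indicator {0<..} s * (exp (- s) * \<kappa> s (y - x)) * g x \<partial>lborel) \<partial>lborel)"
    by (rule lborel_pair.Fubini_integral[OF integrable_space_time[OF assms]])
  finally show ?thesis
    by (simp add: conv_def mult.assoc)
qed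

lemma integrable_kint: "integrable lborel kint"
proof -
  have "integrable lborel (\<lambda>x. \<integral>s. indicator {0<..} s * (exp (- s) * \<kappa> s (0 - x)) * 1 \<partial>lborel)"
    by (rule lborel_pair.integrable_snd[OF integrable_space_time[of "\<lambda>x. 1" 1 0]]) auto
  then have "integrable lborel (\<lambda>x. kint (0 - x))" by (simp add: kint_def)
  then show ?thesis using integrable_reflect[of kint 0] by simp
qed

text \<open>The convolution with the reflected kernel, that is, the adjoint of \<open>conv kint\<close>.\<close>

definition potential :: "(real ^ 'n \<Rightarrow> real) \<Rightarrow> real ^ 'n \<Rightarrow> real" where
  "potential G x = (\<integral>y. kint (y - x) * G y \<partial>lborel)"

lemma potential_measurable [measurable]:
  assumes [measurable]: "G \<in> borel_measurable borel"
  shows "potential G \<in> borel_measurable borel"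
  unfolding potential_def[abs_def] by measurable

lemma integrable_pair_potential:
  assumes G: "integrable lborel G" and [measurable]: "g \<in> borel_measurable borel" and g: "\<And>x. \<bar>g x\<bar> \<le> M"
  shows "integrable (lborel \<Otimes>\<^sub>M lborel) (\<lambda>(y, x). kint (y - x) * G y * g x)"
proof (rule integrable_pairI)
  have [measurable]: "G \<in> borel_measurable borel" using G by auto
  show "(\<lambda>(y, x). kint (y - x) * G y * g x) \<in> borel_measurable (lborel \<Otimes>\<^sub>M lborel)" by measurable
  have M: "M \<ge> 0" using g[of 0] by linarith
  have "(\<integral>\<^sup>+y. \<integral>\<^sup>+x. ennreal (norm (kint (y - x) * G y * g x)) \<partial>lborel \<partial>lborel) \<le>
      (\<integral>\<^sup>+y. \<integral>\<^sup>+x. ennreal (M * \<bar>G y\<bar>) * ennreal \<bar>kint (y - x)\<bar> \<partial>lborel \<partial>lborel)"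
  proof (intro nn_integral_mono)
    fix y x
    have "\<bar>kint (y - x)\<bar> * \<bar>G y\<bar> * \<bar>g x\<bar> \<le> \<bar>kint (y - x)\<bar> * \<bar>G y\<bar> * M"
      using g[of x] by (intro mult_left_mono) auto
    then show "ennreal (norm (kint (y - x) * G y * g x)) \<le> ennreal (M * \<bar>G y\<bar>) * ennreal \<bar>kint (y - x)\<bar>"
      using M by (subst ennreal_mult[symmetric]) (auto simp: abs_mult mult_ac intro!: ennreal_leI)
  qed
  also have "\<dots> = (\<integral>\<^sup>+y. ennreal (M * \<bar>G y\<bar>) * (\<integral>\<^sup>+x. ennreal \<bar>kint x\<bar> \<partial>lborel) \<partial>lborel)"
  proof (rule nn_integral_cong)
    fix y
    have "(\<integral>\<^sup>+x. ennreal \<bar>kint (y - x)\<bar> \<partial>lborel) = (\<integral>\<^sup>+x. ennreal \<bar>kint x\<bar> \<partial>lborel)"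
      using nn_integral_reflect[of "\<lambda>z. ennreal \<bar>kint z\<bar>" y] by simp
    then show "(\<integral>\<^sup>+x. ennreal (M * \<bar>G y\<bar>) * ennreal \<bar>kint (y - x)\<bar> \<partial>lborel) =
        ennreal (M * \<bar>G y\<bar>) * (\<integral>\<^sup>+x. ennreal \<bar>kint x\<bar> \<partial>lborel)"
      by (subst nn_integral_cmult) auto
  qed
  also have "\<dots> = (\<integral>\<^sup>+y. ennreal (M * \<bar>G y\<bar>) \<partial>lborel) * (\<integral>\<^sup>+x. ennreal \<bar>kint x\<bar> \<partial>lborel)"
    by (rule nn_integral_multc) measurable
  also have "\<dots> < \<infinity>"
  proof -
    have "(\<integral>\<^sup>+y. ennreal (M * \<bar>G y\<bar>) \<partial>lborel) < \<infinity>"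
      using G M by (subst nn_integral_eq_integral) auto
    moreover have "(\<integral>\<^sup>+x. ennreal \<bar>kint x\<bar> \<partial>lborel) < \<infinity>"
      using integrable_kint by (simp add: integrable_iff_bounded)
    ultimately show ?thesis by (simp add: ennreal_mult_less_top)
  qed
  finally show "(\<integral>\<^sup>+y. \<integral>\<^sup>+x. ennreal (norm (kint (y - x) * G y * g x)) \<partial>lborel \<partial>lborel) < \<infinity>" .
qed

lemma integrable_potential: "integrable lborel G \<Longrightarrow> integrable lborel (potential G)"
  using lborel_pair.integrable_snd[OF integrable_pair_potential[of G "\<lambda>x. 1" 1]]
  by (simp add: potential_def[abs_def])

lemma integral_potential_mult:
  assumes G: "integrable lborel G" and g: "g \<in> borel_measurable borel" "\<And>x. \<bar>g x\<bar> \<le> M"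
  shows "(\<integral>x. potential G x * g x \<partial>lborel) = (\<integral>y. G y * conv kint g y \<partial>lborel)"
proof -
  have "(\<integral>x. potential G x * g x \<partial>lborel) = (\<integral>x. (\<integral>y. kint (y - x) * G y * g x \<partial>lborel) \<partial>lborel)"
    by (simp add: potential_def)
  also have "\<dots> = (\<integral>y. (\<integral>x. kint (y - x) * G y * g x \<partial>lborel) \<partial>lborel)"
    by (rule lborel_pair.Fubini_integral[OF integrable_pair_potential[OF assms]])
  also have "\<dots> = (\<integral>y. G y * conv kint g y \<partial>lborel)"
  proof (rule Bochner_Integration.integral_cong[OF refl])
    fix y
    show "(\<integral>x. kint (y - x) * G y * g x \<partial>lborel) = G y * conv kint g y"
      unfolding conv_def integral_mult_right_zero[symmetric]
      by (intro Bochner_Integration.integral_cong) auto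
  qed
  finally show ?thesis .
qed

text \<open>The time integral is brought outermost. Absolute values are then taken only after the
  integration in space, which keeps the cancellation that the divergence of the field
  provides.\<close>

lemma integral_potential_time:
  assumes G: "integrable lborel G" and [measurable]: "g \<in> borel_measurable borel" and g: "\<And>x. \<bar>g x\<bar> \<le> M"
  shows "(\<integral>x. potential G x * g x \<partial>lborel) =
    (\<integral>s. indicator {0<..} s * (exp (- s) * (\<integral>y. G y * conv (\<kappa> s) g y \<partial>lborel)) \<partial>lborel)"
proof -
  have [measurable]: "G \<in> borel_measurable borel" using G by auto
  have [measurable]: "(\<lambda>q. conv (\<kappa> (fst q)) g (snd q)) \<in> borel_measurable (borel \<Otimes>\<^sub>M borel)"
    unfolding conv_def by measurable
  have "integrable (lborel \<Otimes>\<^sub>M lborel) (\<lambda>(y, s). G y * (indicator {0<..} s * (exp (- s) * conv (\<kappa> s) g y)))"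
  proof (rule integrable_pairI)
    show "(\<lambda>(y, s). G y * (indicator {0<..} s * (exp (- s) * conv (\<kappa> s) g y))) \<in>
        borel_measurable (lborel \<Otimes>\<^sub>M lborel)"
      unfolding conv_def by measurable
    have "(\<integral>\<^sup>+y. \<integral>\<^sup>+s. ennreal (norm (G y * (indicator {0<..} s * (exp (- s) * conv (\<kappa> s) g y)))) \<partial>lborel \<partial>lborel) \<le>
        (\<integral>\<^sup>+y. ennreal \<bar>G y\<bar> * (ennreal (B * M) * gamma_mass) \<partial>lborel)"
    proof (rule nn_integral_mono)
      fix y
      have "(\<integral>\<^sup>+s. ennreal (norm (G y * (indicator {0<..} s * (exp (- s) * conv (\<kappa> s) g y)))) \<partial>lborel) \<le>
          (\<integral>\<^sup>+s. ennreal \<bar>G y\<bar> * (\<integral>\<^sup>+x. ennreal \<bar>indicator {0<..} s * (exp (- s) * \<kappa> s (y - x)) * g x\<bar> \<partial>lborel) \<partial>lborel)"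
      proof (rule nn_integral_mono)
        fix s :: real
        have "indicator {0<..} s * (exp (- s) * conv (\<kappa> s) g y) =
            (\<integral>x. indicator {0<..} s * (exp (- s) * \<kappa> s (y - x)) * g x \<partial>lborel)"
          by (simp add: conv_def mult.assoc)
        then have "ennreal \<bar>indicator {0<..} s * (exp (- s) * conv (\<kappa> s) g y)\<bar> \<le>
            (\<integral>\<^sup>+x. ennreal \<bar>indicator {0<..} s * (exp (- s) * \<kappa> s (y - x)) * g x\<bar> \<partial>lborel)"
          using norm_integral_le_nn_integral[of lborel "\<lambda>x. indicator {0<..} s * (exp (- s) * \<kappa> s (y - x)) * g x"]
          by (simp only: real_norm_def)
        then show "ennreal (norm (G y * (indicator {0<..} s * (exp (- s) * conv (\<kappa> s) g y)))) \<le>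
            ennreal \<bar>G y\<bar> * (\<integral>\<^sup>+x. ennreal \<bar>indicator {0<..} s * (exp (- s) * \<kappa> s (y - x)) * g x\<bar> \<partial>lborel)"
          unfolding real_norm_def abs_mult[of "G y"] by (subst ennreal_mult) (auto intro: mult_left_mono)
      qed
      also have "\<dots> = ennreal \<bar>G y\<bar> * (\<integral>\<^sup>+s. \<integral>\<^sup>+x. ennreal \<bar>indicator {0<..} s * (exp (- s) * \<kappa> s (y - x)) * g x\<bar> \<partial>lborel \<partial>lborel)"
        by (rule nn_integral_cmult) measurable
      also have "\<dots> \<le> ennreal \<bar>G y\<bar> * (ennreal (B * M) * gamma_mass)"
        by (intro mult_left_mono space_time_mass g) auto
      finally show "(\<integral>\<^sup>+s. ennreal (norm (G y * (indicator {0<..} s * (exp (- s) * conv (\<kappa> s) g y)))) \<partial>lborel) \<le>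
          ennreal \<bar>G y\<bar> * (ennreal (B * M) * gamma_mass)" .
    qed
    also have "\<dots> = (\<integral>\<^sup>+y. ennreal \<bar>G y\<bar> \<partial>lborel) * (ennreal (B * M) * gamma_mass)"
      by (rule nn_integral_multc) measurable
    also have "\<dots> < \<infinity>"
      using G gamma_mass_finite by (simp add: integrable_iff_bounded ennreal_mult_less_top)
    finally show "(\<integral>\<^sup>+y. \<integral>\<^sup>+s. ennreal (norm (G y * (indicator {0<..} s * (exp (- s) * conv (\<kappa> s) g y)))) \<partial>lborel \<partial>lborel) < \<infinity>" .
  qed
  from lborel_pair.Fubini_integral[OF this]
  have "(\<integral>s. (\<integral>y. G y * (indicator {0<..} s * (exp (- s) * conv (\<kappa> s) g y)) \<partial>lborel) \<partial>lborel) =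
      (\<integral>y. (\<integral>s. G y * (indicator {0<..} s * (exp (- s) * conv (\<kappa> s) g y)) \<partial>lborel) \<partial>lborel)" .
  also have "\<dots> = (\<integral>y. G y * conv kint g y \<partial>lborel)"
    by (simp add: conv_kint[OF _ g])
  finally show ?thesis
    by (simp add: integral_potential_mult[OF G _ g] mult.left_commute[of "G _"])
qed

end

text \<open>The extremal choice is \<open>h = sgn v * \<bar>v\<bar> powr (q - 1)\<close>, for which
  both \<open>v * h\<close> and \<open>\<bar>h\<bar> powr p\<close> equal
  \<open>\<bar>v\<bar> powr q\<close>. It is cut off to the set \<open>S k\<close> where
  \<open>x\<close> and \<open>v\<close> are bounded by \<open>k\<close>: this makes \<open>h\<close>
  admissible and its integral finite beforehand. Fatou removes the cutoff.\<close>

lemma Lq_bound_by_duality: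
  fixes v :: "real ^ 'n \<Rightarrow> real"
  assumes v [measurable]: "v \<in> borel_measurable borel"
    and pq: "p > 1" "q > 1" "1 / p + 1 / q = 1" and C: "C \<ge> 0"
    and dual: "\<And>h R M X. h \<in> borel_measurable borel \<Longrightarrow> (\<And>x. \<bar>h x\<bar> \<le> M) \<Longrightarrow> (\<And>x. norm x > R \<Longrightarrow> h x = 0) \<Longrightarrow>
      (\<integral>\<^sup>+x. ennreal (\<bar>h x\<bar> powr p) \<partial>lborel) \<le> ennreal (X powr p) \<Longrightarrow> X \<ge> 0 \<Longrightarrow>
      \<bar>\<integral>x. v x * h x \<partial>lborel\<bar> \<le> C * X"
  shows "(\<integral>\<^sup>+x. ennreal (\<bar>v x\<bar> powr q) \<partial>lborel) \<le> ennreal (C powr q)"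
proof -
  define S where "S k = {x :: real ^ 'n. norm x \<le> real k \<and> \<bar>v x\<bar> \<le> real k}" for k :: nat
  have [measurable]: "S k \<in> sets borel" for k unfolding S_def by measurable
  have qp: "(q - 1) * p = q" using pq by (simp add: field_simps)
  have step: "(\<integral>\<^sup>+x. ennreal (\<bar>v x\<bar> powr q) * indicator (S k) x \<partial>lborel) \<le> ennreal (C powr q)" for k
  proof -
    let ?g = "\<lambda>x. \<bar>v x\<bar> powr q * indicator (S k) x"
    let ?h = "\<lambda>x. sgn (v x) * \<bar>v x\<bar> powr (q - 1) * indicator (S k) x"
    have "integrable lborel (\<lambda>x. indicator (cball (0 :: real ^ 'n) (real k)) x *\<^sub>R (1 :: real))"
      by (intro borel_integrable_compact continuous_intros) auto
    then have "integrable lborel (\<lambda>x. real k powr q * indicator (cball (0 :: real ^ 'n) (real k)) x)" by simp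
    then have ig: "integrable lborel ?g"
      by (rule Bochner_Integration.integrable_bound)
        (use pq in \<open>auto simp: S_def intro!: AE_I2 powr_mono2 split: split_indicator\<close>)
    define Y where "Y = (\<integral>x. ?g x \<partial>lborel)"
    have Y0: "Y \<ge> 0" unfolding Y_def by (intro integral_nonneg_AE AE_I2) auto
    have Yn: "(\<integral>\<^sup>+x. ennreal (?g x) \<partial>lborel) = ennreal Y"
      unfolding Y_def by (intro nn_integral_eq_integral ig AE_I2) auto
    have vh: "v x * ?h x = ?g x" for x
    proof (cases "v x = 0")
      case False
      have "v x * sgn (v x) = \<bar>v x\<bar>" by (simp add: abs_sgn)
      moreover have "\<bar>v x\<bar> * \<bar>v x\<bar> powr (q - 1) = \<bar>v x\<bar> powr q"
        using False by (simp add: powr_diff)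
      ultimately show ?thesis by (metis mult.assoc)
    qed simp
    have hp: "\<bar>?h x\<bar> powr p = ?g x" for x
      using pq qp by (cases "v x = 0") (auto simp: abs_mult abs_sgn_eq powr_powr split: split_indicator)
    have "\<bar>\<integral>x. v x * ?h x \<partial>lborel\<bar> \<le> C * (Y powr (1 / p))"
    proof (rule dual)
      show "\<bar>?h x\<bar> \<le> real k powr (q - 1)" for x
        using pq by (auto simp: abs_mult abs_sgn_eq S_def intro!: powr_mono2 split: split_indicator)
      show "?h x = 0" if "norm x > real k" for x using that by (simp add: S_def)
      show "(\<integral>\<^sup>+x. ennreal (\<bar>?h x\<bar> powr p) \<partial>lborel) \<le> ennreal ((Y powr (1 / p)) powr p)"
        unfolding hp Yn using Y0 pq by (simp add: powr_powr)
    qed auto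
    then have *: "Y \<le> C * Y powr (1 / p)" unfolding vh Y_def[symmetric] using Y0 by simp
    \<comment> \<open>Since \<open>Y\<close> is finite, \<open>Y powr (1 / p)\<close> can be divided
      out, leaving \<open>Y powr (1 / q) \<le> C\<close>.\<close>
    have "Y \<le> C powr q"
    proof (cases "Y = 0")
      case False
      with Y0 have Y: "Y > 0" by simp
      have "1 / q + 1 / p = 1" using pq(3) by simp
      then have "Y powr (1 / q) * Y powr (1 / p) = Y"
        using Y by (simp add: powr_add[symmetric])
      then have "Y powr (1 / q) = Y / Y powr (1 / p)"
        using Y by (simp add: field_simps)
      also have "\<dots> \<le> C" using * Y by (simp add: field_simps)
      finally have "(Y powr (1 / q)) powr q \<le> C powr q"
        using pq by (intro powr_mono2) auto
      then show ?thesis using Y pq by (simp add: powr_powr)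
    qed (use C in simp)
    moreover have "(\<integral>\<^sup>+x. ennreal (\<bar>v x\<bar> powr q) * indicator (S k) x \<partial>lborel) = (\<integral>\<^sup>+x. ennreal (?g x) \<partial>lborel)"
      by (intro nn_integral_cong) (auto split: split_indicator)
    ultimately show ?thesis using Yn by (simp add: ennreal_leI)
  qed
  have "(\<integral>\<^sup>+x. ennreal (\<bar>v x\<bar> powr q) \<partial>lborel) =
      (\<integral>\<^sup>+x. liminf (\<lambda>k. ennreal (\<bar>v x\<bar> powr q) * indicator (S k) x) \<partial>lborel)"
  proof (rule nn_integral_cong)
    fix x
    obtain N where N: "max (norm x) \<bar>v x\<bar> \<le> real N" using real_arch_simple by blast
    have "\<forall>\<^sub>F k in sequentially. ennreal (\<bar>v x\<bar> powr q) * indicator (S k) x = ennreal (\<bar>v x\<bar> powr q)"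
      using N by (intro eventually_sequentiallyI[of N]) (auto simp: S_def)
    then have "(\<lambda>k. ennreal (\<bar>v x\<bar> powr q) * indicator (S k) x) \<longlonglongrightarrow> ennreal (\<bar>v x\<bar> powr q)"
      by (rule tendsto_eventually)
    from lim_imp_Liminf[OF sequentially_bot this]
    show "ennreal (\<bar>v x\<bar> powr q) = liminf (\<lambda>k. ennreal (\<bar>v x\<bar> powr q) * indicator (S k) x)" ..
  qed
  also have "\<dots> \<le> liminf (\<lambda>k. \<integral>\<^sup>+x. ennreal (\<bar>v x\<bar> powr q) * indicator (S k) x \<partial>lborel)"
    by (rule nn_integral_liminf) measurable
  also have "\<dots> \<le> liminf (\<lambda>k::nat. ennreal (C powr q))"
    by (intro Liminf_mono always_eventually allI step)
  also have "\<dots> = ennreal (C powr q)" by (simp add: Liminf_const)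
  finally show ?thesis .
qed

context parabolic_kernel
begin

lemma potential_Lq_bound:
  assumes q: "q > 1" "1 / p + 1 / q = 1"
  obtains C where "C > 0"
    "\<And>(F :: real ^ 'n \<Rightarrow> real ^ 'n) f L i. integrable lborel F \<Longrightarrow> integrable lborel f \<Longrightarrow>
      (\<And>\<phi>. test_function \<phi> \<Longrightarrow> (\<integral>x. F x \<bullet> grad \<phi> x \<partial>lborel) = - (\<integral>x. f x * \<phi> x \<partial>lborel)) \<Longrightarrow>
      (\<integral>x. norm (F x) \<partial>lborel) \<le> L \<Longrightarrow> (\<integral>x. \<bar>f x\<bar> \<partial>lborel) \<le> L \<Longrightarrow> L > 0 \<Longrightarrow>
      (\<integral>\<^sup>+x. ennreal (\<bar>potential (\<lambda>y. F y $ i) x\<bar> powr q) \<partial>lborel) \<le> ennreal ((C * L) powr q)"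
proof -
  \<comment> \<open>The constant of the maximal theorem for \<open>p\<close>-th powers; its
    \<open>p\<close>-th root enters \<open>C\<close>.\<close>
  define Cm where "Cm = 10 * p * 2 powr (p - 1) / (p - 1)"
  have Cm: "Cm > 0" using p by (simp add: Cm_def)
  define C where "C = estimate_const * Cm powr (1 / p)"
  show ?thesis
  proof (rule that[of C])
    show "C > 0" using estimate_const_pos Cm by (simp add: C_def)
    fix F :: "real ^ 'n \<Rightarrow> real ^ 'n" and f L i
    assume F: "integrable lborel F" and f: "integrable lborel f"
      and test: "\<And>\<phi>. test_function \<phi> \<Longrightarrow> (\<integral>x. F x \<bullet> grad \<phi> x \<partial>lborel) = - (\<integral>x. f x * \<phi> x \<partial>lborel)"
      and L: "(\<integral>x. norm (F x) \<partial>lborel) \<le> L" "(\<integral>x. \<bar>f x\<bar> \<partial>lborel) \<le> L" "L > 0"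
    have Fi: "integrable lborel (\<lambda>y. F y $ i)" by (rule integrable_component[OF F])
    show "(\<integral>\<^sup>+x. ennreal (\<bar>potential (\<lambda>y. F y $ i) x\<bar> powr q) \<partial>lborel) \<le> ennreal ((C * L) powr q)"
    proof (rule Lq_bound_by_duality[OF _ p q])
      show "potential (\<lambda>y. F y $ i) \<in> borel_measurable borel" using Fi by (intro potential_measurable) auto
      show "0 \<le> C * L" using \<open>C > 0\<close> L by simp
      fix h :: "real ^ 'n \<Rightarrow> real" and R M X :: real
      assume h: "h \<in> borel_measurable borel" "\<And>x. \<bar>h x\<bar> \<le> M" "\<And>x. norm x > R \<Longrightarrow> h x = 0"
        and X: "(\<integral>\<^sup>+x. ennreal (\<bar>h x\<bar> powr p) \<partial>lborel) \<le> ennreal (X powr p)" "X \<ge> 0"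
      obtain m where m: "m \<in> borel_measurable borel" "\<And>t. 0 \<le> m t"
        "\<And>s x. s > 0 \<Longrightarrow> (\<integral>\<^sup>+z. ennreal (heat s (x - z) * \<bar>h z\<bar>) \<partial>lborel) \<le>
          ennreal (128 * s powr (- ((real CARD('n) - 1) / (2 * p))) * m (x $ i))"
        "(\<integral>\<^sup>+t. ennreal (m t powr p) \<partial>lborel) \<le> ennreal Cm * (\<integral>\<^sup>+x. ennreal (\<bar>h x\<bar> powr p) \<partial>lborel)"
      proof (rule heat_conv_majorant[where i = i and h = h and B = M and R = R and p = p, folded Cm_def])
        show "h x = 0" if "R < norm x" for x by (rule h(3)[OF that])
      qed (rule h p that; assumption?)+
      have hi: "integrable lborel h"
      proof -
        have "integrable lborel (\<lambda>x. indicator (cball (0 :: real ^ 'n) R) x *\<^sub>R (1 :: real))"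
          by (intro borel_integrable_compact continuous_intros) auto
        then have 1: "integrable lborel (\<lambda>x. indicator (cball (0 :: real ^ 'n) R) x * M)" by simp
        have 2: "norm (h x) \<le> norm (indicator (cball 0 R) x * M)" for x
          using h(2)[of x] h(3)[of x] by (cases "norm x \<le> R") (auto intro: order_trans[OF _ abs_ge_self])
        show ?thesis
          by (rule Bochner_Integration.integrable_bound[OF 1 _ AE_I2[OF 2]]) (use h(1) in simp)
      qed
      have Xm: "(\<integral>\<^sup>+t. ennreal (m t powr p) \<partial>lborel) \<le> ennreal ((Cm powr (1 / p) * X) powr p)"
      proof -
        have "(\<integral>\<^sup>+t. ennreal (m t powr p) \<partial>lborel) \<le> ennreal Cm * ennreal (X powr p)"
          using m(4) X(1) by (meson mult_left_mono order_trans zero_le)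
        also have "\<dots> = ennreal ((Cm powr (1 / p) * X) powr p)"
          using Cm p X(2) by (simp add: powr_mult powr_powr ennreal_mult)
        finally show ?thesis .
      qed
      have est: "(\<integral>\<^sup>+s. ennreal (exp (- s) * \<bar>\<integral>x. F x $ i * psi h s x \<partial>lborel\<bar>) * indicator {0<..} s \<partial>lborel)
          \<le> ennreal (estimate_const * L * (Cm powr (1 / p) * X))"
        using X(2) by (intro pairing_estimate[OF F f test L hi m(1-3) Xm]) auto
      have "ennreal \<bar>\<integral>x. potential (\<lambda>y. F y $ i) x * h x \<partial>lborel\<bar> =
          ennreal (norm (\<integral>s. indicator {0<..} s * (exp (- s) * (\<integral>y. F y $ i * conv (\<kappa> s) h y \<partial>lborel)) \<partial>lborel))"
        using integral_potential_time[OF Fi h(1,2)] by simp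
      also have "\<dots> \<le> (\<integral>\<^sup>+s. ennreal (norm (indicator {0<..} s * (exp (- s) * (\<integral>y. F y $ i * conv (\<kappa> s) h y \<partial>lborel)))) \<partial>lborel)"
        by (rule norm_integral_le_nn_integral)
      also have "\<dots> = (\<integral>\<^sup>+s. ennreal (exp (- s) * \<bar>\<integral>x. F x $ i * psi h s x \<partial>lborel\<bar>) * indicator {0<..} s \<partial>lborel)"
        by (intro nn_integral_cong) (auto simp: psi_def[OF hi] abs_mult split: split_indicator)
      also note est
      finally show "\<bar>\<integral>x. potential (\<lambda>y. F y $ i) x * h x \<partial>lborel\<bar> \<le> C * L * X"
        using estimate_const_pos L X(2) by (simp add: ennreal_le_iff C_def mult_ac)
    qed
  qed
qed

end

text \<open>The constant is the one that the gradient of the heat kernel requires, so that the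
  interpretation as \<open>parabolic_kernel\<close> can use the same parameters.\<close>

interpretation heat: time_kernel "heat :: real \<Rightarrow> real ^ 'n \<Rightarrow> real" "5 * 2 ^ CARD('n)" 0
proof
  show "case_prod heat \<in> borel_measurable (borel \<Otimes>\<^sub>M borel)" by measurable
  show "\<bar>heat s x\<bar> \<le> 5 * 2 ^ CARD('n) * s powr (- 0) * heat (2 * s) x" if "s > 0" for s and x :: "real ^ 'n"
  proof -
    have "\<bar>heat s x\<bar> \<le> 1 * (2 ^ CARD('n) * heat (2 * s) x)"
      using heat_le_heat2[OF that, of x] heat_nonneg[OF that, of x] by simp
    also have "\<dots> \<le> 5 * (2 ^ CARD('n) * heat (2 * s) x)"
      using heat_nonneg[of "2 * s" x] that by (intro mult_right_mono) auto
    finally show ?thesis using that by simp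
  qed
qed auto

text \<open>The minus sign is due to \<open>potential\<close>, which evaluates its kernel at
  \<open>y - x\<close>: a derivative in \<open>x\<close> reverses the sign.\<close>

interpretation dheat: time_kernel "\<lambda>s x. - dheat j s x" "5 * 2 ^ CARD('n)" "1 / 2" for j :: "'n::finite"
proof
  show "(\<lambda>(s, x). - dheat j s x) \<in> borel_measurable (borel \<Otimes>\<^sub>M borel)" by measurable
  show "\<bar>- dheat j s x\<bar> \<le> 5 * 2 ^ CARD('n) * s powr (- (1 / 2)) * heat (2 * s) x" if "s > 0" for s and x :: "real ^ 'n"
    using dheat_bound[OF that, of j x] by simp
qed auto

section \<open>Moving derivatives from test functions to the heat kernel\<close>

lemma conv_uminus: "conv (\<lambda>x. - k x) g y = - conv k g y"
  by (simp add: conv_def)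

lemma conv_heat_partial_deriv:
  fixes \<phi> :: "real ^ 'n \<Rightarrow> real"
  assumes \<phi>: "test_function \<phi>" and s: "s > 0"
  shows "conv (heat s) (partial_deriv j \<phi>) y = conv (dheat j s) \<phi> y"
proof -
  define Q where "Q = 1 / sqrt (4 * pi * (2 * s)) ^ CARD('n)"
  have Q: "heat (2 * s) x \<le> Q" for x :: "real ^ 'n"
    unfolding Q_def by (rule heat_le) (use s in simp)
  have [measurable]: "\<phi> \<in> borel_measurable borel" "partial_deriv j \<phi> \<in> borel_measurable borel"
    by (intro borel_measurable_continuous_onI test_function_continuous test_function_partial_deriv \<phi>)+
  have "conv (heat s) (partial_deriv j \<phi>) y = conv (partial_deriv j \<phi>) (heat s) y"
    by (rule conv_commute) measurable
  also have "\<dots> = conv \<phi> (\<lambda>z. ((- heat s z / (2 * s)) *\<^sub>R z) $ j) y"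
  proof (rule conv_grad_swap[OF \<phi> has_derivative_heat[OF s]])
    show "continuous_on UNIV (\<lambda>x :: real ^ 'n. (- heat s x / (2 * s)) *\<^sub>R x)"
      using s by (intro continuous_intros continuous_on_heat) auto
    show "norm ((- heat s x / (2 * s)) *\<^sub>R x) \<le> 5 * 2 ^ CARD('n) * s powr (- (1/2)) * Q" for x :: "real ^ 'n"
      by (rule order_trans[OF grad_heat_bound[OF s] mult_left_mono[OF Q]]) simp
    show "\<bar>heat s x\<bar> \<le> 1 / sqrt (4 * pi * s) ^ CARD('n)" for x :: "real ^ 'n"
      using heat_le[OF s, of x] heat_nonneg[OF s, of x] by simp
  qed
  also have "(\<lambda>z. ((- heat s z / (2 * s)) *\<^sub>R z) $ j) = dheat j s"
    by (simp add: dheat_def fun_eq_iff)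
  also have "conv \<phi> (dheat j s) y = conv (dheat j s) \<phi> y"
    by (rule conv_commute) measurable
  finally show ?thesis .
qed

lemma conv_dheat_partial_deriv:
  fixes \<phi> :: "real ^ 'n \<Rightarrow> real"
  assumes \<phi>: "test_function \<phi>" and s: "s > 0"
  shows "conv (dheat j s) (partial_deriv j \<phi>) y = conv (\<lambda>z. ddheat j s z $ j) \<phi> y"
proof -
  define Q where "Q = 1 / sqrt (4 * pi * (2 * s)) ^ CARD('n)"
  have Q: "heat (2 * s) x \<le> Q" for x :: "real ^ 'n"
    unfolding Q_def by (rule heat_le) (use s in simp)
  have [measurable]: "\<phi> \<in> borel_measurable borel" "partial_deriv j \<phi> \<in> borel_measurable borel"
    by (intro borel_measurable_continuous_onI test_function_continuous test_function_partial_deriv \<phi>)+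
  have "conv (dheat j s) (partial_deriv j \<phi>) y = conv (partial_deriv j \<phi>) (dheat j s) y"
    by (rule conv_commute) measurable
  also have "\<dots> = conv \<phi> (\<lambda>z. ddheat j s z $ j) y"
  proof (rule conv_grad_swap[OF \<phi> has_derivative_dheat[OF s] continuous_on_ddheat[OF s]])
    show "norm (ddheat j s x) \<le> 5 * 2 ^ CARD('n) * s powr (- 1) * Q" for x :: "real ^ 'n"
      by (rule order_trans[OF ddheat_bound[OF s] mult_left_mono[OF Q]]) simp
    show "\<bar>dheat j s x\<bar> \<le> 5 * 2 ^ CARD('n) * s powr (- (1/2)) * Q" for x :: "real ^ 'n"
      by (rule order_trans[OF dheat_bound[OF s] mult_left_mono[OF Q]]) simp
  qed
  also have "\<dots> = conv (\<lambda>z. ddheat j s z $ j) \<phi> y"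
    by (rule conv_commute) measurable
  finally show ?thesis .
qed

section \<open>The resolvent identity\<close>

text \<open>The time derivative of the heat kernel, and by \<open>sheat_eq_sum\<close> also its
  Laplacian: the heat equation in one name.\<close>

definition sheat :: "real \<Rightarrow> real ^ 'n \<Rightarrow> real" where
  "sheat s x = ((norm x)\<^sup>2 / (4 * s\<^sup>2) - real CARD('n) / (2 * s)) * heat s x"

lemma sheat_measurable [measurable (raw)]:
  assumes [measurable]: "f \<in> borel_measurable M" "g \<in> borel_measurable M"
  shows "(\<lambda>p. sheat (f p) (g p)) \<in> borel_measurable M"
  unfolding sheat_def by measurable

lemma sheat_eq_sum: "sheat s x = (\<Sum>j\<in>UNIV. ddheat j s x $ j)"
proof -
  have "(norm x)\<^sup>2 = (\<Sum>j\<in>UNIV. (x $ j)\<^sup>2)"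
    by (simp add: norm_eq_sqrt_inner inner_vec_def power2_eq_square sum_nonneg)
  moreover have "ddheat j s x $ j = (x $ j)\<^sup>2 * (heat s x / (4 * s\<^sup>2)) - heat s x / (2 * s)" for j
    by (simp add: ddheat_def power2_eq_square)
  ultimately show ?thesis
    by (simp add: sheat_def sum_subtractf sum_distrib_right sum_divide_distrib left_diff_distrib)
qed

lemma sheat_bound:
  fixes x :: "real ^ 'n"
  assumes s: "s > 0"
  shows "\<bar>sheat s x\<bar> \<le> real CARD('n) * (5 * 2 ^ CARD('n) * s powr (- 1) * heat (2 * s) x)"
proof -
  have "\<bar>sheat s x\<bar> \<le> (\<Sum>j\<in>(UNIV::'n set). \<bar>ddheat j s x $ j\<bar>)"
    unfolding sheat_eq_sum by (rule sum_abs)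
  also have "\<dots> \<le> (\<Sum>j\<in>(UNIV::'n set). 5 * 2 ^ CARD('n) * s powr (- 1) * heat (2 * s) x)"
    by (intro sum_mono order_trans[OF component_le_norm_cart ddheat_bound[OF s]])
  finally show ?thesis by simp
qed

lemma heat_time_deriv:
  fixes x :: "real ^ 'n"
  assumes s: "s > 0"
  shows "((\<lambda>s. exp (- s) * heat s x) has_real_derivative exp (- s) * (sheat s x - heat s x)) (at s)"
proof -
  let ?n = "real CARD('n)"
  \<comment> \<open>The kernel as a single exponential, with the power of
    \<open>sqrt (4 * pi * s)\<close> turned into a logarithm, so that only the exponent has to be
    differentiated.\<close>
  let ?g = "\<lambda>s. exp (- s - (norm x)\<^sup>2 / (4 * s) - (?n / 2) * ln (4 * pi * s))"
  have eq: "?g s = exp (- s) * heat s x" if "s > 0" for s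
  proof -
    have "exp ((?n / 2) * ln (4 * pi * s)) = sqrt (4 * pi * s) ^ CARD('n)"
    proof -
      have "exp ((?n / 2) * ln (4 * pi * s)) = (exp (ln (4 * pi * s) / 2)) ^ CARD('n)"
        by (simp add: exp_of_nat_mult[symmetric])
      also have "exp (ln (4 * pi * s) / 2) = sqrt (4 * pi * s)"
        using that by (simp add: powr_half_sqrt[symmetric] powr_def)
      finally show ?thesis .
    qed
    moreover have "exp (u - v - w) = exp u * exp (- v) / exp w" for u v w :: real
      by (simp add: exp_diff exp_minus divide_inverse)
    ultimately show ?thesis by (simp only: heat_def) simp
  qed
  have 1: "((\<lambda>s. (norm x)\<^sup>2 / (4 * s)) has_real_derivative - ((norm x)\<^sup>2 / (4 * s\<^sup>2))) (at s)"
    using s by (auto intro!: derivative_eq_intros simp: power2_eq_square)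
  have 2: "((\<lambda>s. (?n / 2) * ln (4 * pi * s)) has_real_derivative ?n / (2 * s)) (at s)"
    using s by (auto intro!: derivative_eq_intros)
  have "((\<lambda>s. - s - (norm x)\<^sup>2 / (4 * s) - (?n / 2) * ln (4 * pi * s)) has_real_derivative
      (- 1 - - ((norm x)\<^sup>2 / (4 * s\<^sup>2)) - ?n / (2 * s))) (at s)"
    by (intro DERIV_diff 1 2 DERIV_minus DERIV_ident)
  from DERIV_fun_exp[OF this]
  have "(?g has_real_derivative ?g s * (- 1 + (norm x)\<^sup>2 / (4 * s\<^sup>2) - ?n / (2 * s))) (at s)"
    by simp
  then have "((\<lambda>s. exp (- s) * heat s x) has_real_derivative
      ?g s * (- 1 + (norm x)\<^sup>2 / (4 * s\<^sup>2) - ?n / (2 * s))) (at s)"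
    by (rule has_field_derivative_transform_within_open[of _ _ _ "{0<..}"]) (use s eq in auto)
  moreover have "?g s * (- 1 + (norm x)\<^sup>2 / (4 * s\<^sup>2) - ?n / (2 * s)) = exp (- s) * (sheat s x - heat s x)"
    unfolding eq[OF s] sheat_def by (simp add: algebra_simps)
  ultimately show ?thesis by simp
qed

lemma conv_heat_le:
  fixes g :: "real ^ 'n \<Rightarrow> real"
  assumes "s > 0" "g \<in> borel_measurable borel" "\<And>x. \<bar>g x\<bar> \<le> M"
  shows "\<bar>conv (heat s) g y\<bar> \<le> M"
  by (rule conv_mollifier_bound[OF integrable_heat[OF assms(1)] heat_nonneg[OF assms(1)] integral_heat[OF assms(1)] assms(2,3)])

lemma conv_heat_laplacian:
  fixes \<phi> :: "real ^ 'n \<Rightarrow> real"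
  assumes \<phi>: "test_function \<phi>" and s: "s > 0"
  shows "conv (sheat s) \<phi> y = conv (heat s) (laplacian \<phi>) y"
proof -
  define Q where "Q = 1 / sqrt (4 * pi * (2 * s)) ^ CARD('n)"
  have Q: "heat (2 * s) x \<le> Q" for x :: "real ^ 'n"
    unfolding Q_def by (rule heat_le) (use s in simp)
  have tj: "test_function (partial_deriv j \<phi>)" "test_function (partial_deriv j (partial_deriv j \<phi>))" for j
    by (intro test_function_partial_deriv \<phi>)+
  have i1: "integrable lborel (\<lambda>z. ddheat j s (y - z) $ j * \<phi> z)" for j
  proof (rule integrable_bounded_mult[OF test_function_integrable[OF \<phi>]])
    show "\<bar>ddheat j s (y - z) $ j\<bar> \<le> 5 * 2 ^ CARD('n) * s powr (- 1) * Q" for z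
      by (rule order_trans[OF component_le_norm_cart order_trans[OF ddheat_bound[OF s] mult_left_mono[OF Q]]]) simp
  qed measurable
  have i2: "integrable lborel (\<lambda>z. heat s (y - z) * partial_deriv j (partial_deriv j \<phi>) z)" for j
  proof (rule integrable_bounded_mult[OF test_function_integrable[OF tj(2)]])
    show "\<bar>heat s (y - z)\<bar> \<le> 1 / sqrt (4 * pi * s) ^ CARD('n)" for z
      using heat_le[OF s, of "y - z"] heat_nonneg[OF s, of "y - z"] by simp
  qed measurable
  have "conv (sheat s) \<phi> y = (\<Sum>j\<in>UNIV. conv (\<lambda>z. ddheat j s z $ j) \<phi> y)"
    unfolding conv_def sheat_eq_sum sum_distrib_right
    by (rule Bochner_Integration.integral_sum) (rule i1)
  also have "\<dots> = (\<Sum>j\<in>UNIV. conv (heat s) (partial_deriv j (partial_deriv j \<phi>)) y)"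
    using conv_dheat_partial_deriv[OF \<phi> s] conv_heat_partial_deriv[OF tj(1) s] by simp
  also have "\<dots> = conv (heat s) (laplacian \<phi>) y"
    unfolding conv_def laplacian_def sum_distrib_left
    by (rule Bochner_Integration.integral_sum[symmetric]) (rule i2)
  finally show ?thesis .
qed

lemma laplacian_test_function:
  fixes \<phi> :: "real ^ 'n \<Rightarrow> real"
  assumes \<phi>: "test_function \<phi>"
  obtains M where "laplacian \<phi> \<in> borel_measurable borel" "\<And>x. \<bar>laplacian \<phi> x\<bar> \<le> M" "integrable lborel (laplacian \<phi>)"
proof -
  have tj: "test_function (partial_deriv j (partial_deriv j \<phi>))" for j
    by (intro test_function_partial_deriv \<phi>)
  have "\<exists>b. \<forall>x. \<bar>partial_deriv j (partial_deriv j \<phi>) x\<bar> \<le> b" for j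
    using test_function_bounded[OF tj] by metis
  then obtain b where b: "\<And>j x. \<bar>partial_deriv j (partial_deriv j \<phi>) x\<bar> \<le> b j"
    by metis
  show ?thesis
  proof (rule that[of "sum b UNIV"])
    show "\<bar>laplacian \<phi> x\<bar> \<le> sum b UNIV" for x
      unfolding laplacian_def by (intro order_trans[OF sum_abs] sum_mono b)
    show "integrable lborel (laplacian \<phi>)"
      unfolding laplacian_def[abs_def] by (intro Bochner_Integration.integrable_sum test_function_integrable tj)
    then show "laplacian \<phi> \<in> borel_measurable borel" by auto
  qed
qed

text \<open>The time derivative of \<open>exp (- s)\<close> times the heat flow of
  \<open>\<phi>\<close> is \<open>- exp (- s)\<close> times the heat flow of
  \<open>\<phi> - \<Delta>\<phi>\<close>. The fundamental theorem is applied to the kernel for fixed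
  \<open>z\<close>, and Fubini exchanges time and space; the lower limit \<open>a > 0\<close> keeps
  the singularity \<open>1 / s\<close> of the time derivative away.\<close>

lemma heat_evolution:
  fixes \<phi> :: "real ^ 'n \<Rightarrow> real"
  assumes \<phi>: "test_function \<phi>" and ab: "0 < a" "a \<le> b"
  shows "exp (- b) * conv (heat b) \<phi> y - exp (- a) * conv (heat a) \<phi> y =
    - (\<integral>s. indicator {a..b} s * (exp (- s) * conv (heat s) (\<lambda>x. \<phi> x - laplacian \<phi> x) y) \<partial>lborel)"
proof -
  obtain M where M: "M > 0" "\<And>x. \<bar>\<phi> x\<bar> \<le> M" using test_function_bounded[OF \<phi>] by metis
  have [measurable]: "\<phi> \<in> borel_measurable borel" using test_function_integrable[OF \<phi>] by auto
  let ?Q = "\<lambda>z s. exp (- s) * (sheat s z - heat s z) * indicator {a..b} s * \<phi> (y - z)"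
  have ftc: "(\<integral>s. ?Q z s \<partial>lborel) = (exp (- b) * heat b z - exp (- a) * heat a z) * \<phi> (y - z)" for z
  proof -
    have "(\<integral>s. exp (- s) * (sheat s z - heat s z) * indicator {a..b} s \<partial>lborel) = exp (- b) * heat b z - exp (- a) * heat a z"
    proof (rule integral_FTC_Icc_real[OF ab(2)])
      show "((\<lambda>s. exp (- s) * heat s z) has_real_derivative exp (- s) * (sheat s z - heat s z)) (at s)"
        if "a \<le> s" "s \<le> b" for s
        by (rule heat_time_deriv) (use that ab in simp)
      show "isCont (\<lambda>s. exp (- s) * (sheat s z - heat s z)) s" if "a \<le> s" "s \<le> b" for s
        unfolding sheat_def heat_def using that ab by (intro continuous_intros) auto
    qed
    then show ?thesis by simp
  qed
  \<comment> \<open>The bound of \<open>sheat\<close> with \<open>s\<close> replaced by its smallest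
    value \<open>a\<close>, plus the bound of \<open>heat\<close>, both relative to the kernel at
    the doubled time, times the supremum of \<open>\<phi>\<close>.\<close>
  define c where "c = (real CARD('n) * (5 * 2 ^ CARD('n) * a powr (- 1)) + 2 ^ CARD('n)) * M"
  have c: "c \<ge> 0" using M by (simp add: c_def)
  have Q_le: "\<bar>?Q z s\<bar> \<le> c * heat (2 * s) z * indicator {a..b} s" for z s
  proof (cases "s \<in> {a..b}")
    case True
    then have s: "s > 0" "a \<le> s" using ab by auto
    have h: "0 \<le> heat (2 * s) z" using s by (simp add: heat_nonneg)
    have "s powr (- 1) \<le> a powr (- 1)" using s ab by (intro powr_mono2') auto
    then have "real CARD('n) * (5 * 2 ^ CARD('n) * s powr (- 1) * heat (2 * s) z) \<le>
        real CARD('n) * (5 * 2 ^ CARD('n) * a powr (- 1) * heat (2 * s) z)"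
      using h by (intro mult_left_mono mult_right_mono) auto
    with sheat_bound[OF s(1), of z] heat_le_heat2[OF s(1), of z] heat_nonneg[OF s(1), of z]
    have 1: "\<bar>sheat s z - heat s z\<bar> \<le> (real CARD('n) * (5 * 2 ^ CARD('n) * a powr (- 1)) + 2 ^ CARD('n)) * heat (2 * s) z"
      by (simp add: algebra_simps)
    have "exp (- s) * \<bar>sheat s z - heat s z\<bar> * \<bar>\<phi> (y - z)\<bar> \<le>
        1 * ((real CARD('n) * (5 * 2 ^ CARD('n) * a powr (- 1)) + 2 ^ CARD('n)) * heat (2 * s) z) * M"
      using s h M by (intro mult_mono 1) auto
    then show ?thesis using True by (simp add: abs_mult c_def mult_ac)
  qed simp
  have Qi: "integrable (lborel \<Otimes>\<^sub>M lborel) (\<lambda>(s, z). ?Q z s)"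
  proof (rule integrable_pairI)
    have "(\<integral>\<^sup>+s. \<integral>\<^sup>+z. ennreal (norm (?Q z s)) \<partial>lborel \<partial>lborel) \<le>
        (\<integral>\<^sup>+s. ennreal c * indicator {a..b} s \<partial>lborel)"
    proof (rule nn_integral_mono)
      fix s
      show "(\<integral>\<^sup>+z. ennreal (norm (?Q z s)) \<partial>lborel) \<le> ennreal c * indicator {a..b} s"
      proof (cases "s \<in> {a..b}")
        case True
        then have s: "2 * s > 0" using ab by auto
        have "(\<integral>\<^sup>+z. ennreal (norm (?Q z s)) \<partial>lborel) \<le> (\<integral>\<^sup>+(z :: real ^ 'n). ennreal c * ennreal (heat (2 * s) z) \<partial>lborel)"
          using Q_le[where s = s] True c
          by (intro nn_integral_mono) (simp add: ennreal_mult'[symmetric] ennreal_leI)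
        also have "\<dots> = ennreal c"
          by (subst nn_integral_cmult) (auto simp: nn_integral_heat[OF s])
        finally show ?thesis using True by simp
      qed simp
    qed
    also have "\<dots> < \<infinity>"
      using ab by (simp add: nn_integral_cmult ennreal_mult_less_top)
    finally show "(\<integral>\<^sup>+s. \<integral>\<^sup>+z. ennreal (norm (?Q z s)) \<partial>lborel \<partial>lborel) < \<infinity>" .
  qed measurable
  have ih: "integrable lborel (\<lambda>z. heat s z * \<phi> (y - z))" if "s > 0" for s
    by (rule integrable_bounded_mult'[OF integrable_heat[OF that] _ M(2)]) measurable
  have ch: "(\<integral>z. heat s z * \<phi> (y - z) \<partial>lborel) = conv (heat s) \<phi> y" for s
    using conv_commute[of "heat s" \<phi> y] by (simp add: conv_def mult.commute)
  obtain LB where LB: "laplacian \<phi> \<in> borel_measurable borel" "integrable lborel (laplacian \<phi>)"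
    using laplacian_test_function[OF \<phi>] by metis
  have inner: "(\<integral>z. ?Q z s \<partial>lborel) = - (indicator {a..b} s * (exp (- s) * conv (heat s) (\<lambda>x. \<phi> x - laplacian \<phi> x) y))" for s
  proof (cases "s \<in> {a..b}")
    case True
    then have s: "s > 0" using ab by auto
    have ish: "integrable lborel (\<lambda>z. sheat s z * \<phi> (y - z))"
    proof (rule Bochner_Integration.integrable_bound)
      show "integrable lborel (\<lambda>z :: real ^ 'n. real CARD('n) * (5 * 2 ^ CARD('n) * s powr (- 1)) * M * heat (2 * s) z)"
        using integrable_heat[of "2 * s"] s by (intro integrable_mult_right) auto
      show "AE z in lborel. norm (sheat s z * \<phi> (y - z)) \<le>
          norm (real CARD('n) * (5 * 2 ^ CARD('n) * s powr (- 1)) * M * heat (2 * s) z)"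
      proof (rule AE_I2)
        fix z
        have "\<bar>sheat s z\<bar> * \<bar>\<phi> (y - z)\<bar> \<le> real CARD('n) * (5 * 2 ^ CARD('n) * s powr (- 1) * heat (2 * s) z) * M"
          using s M by (intro mult_mono sheat_bound) (auto simp: heat_nonneg)
        then show "norm (sheat s z * \<phi> (y - z)) \<le>
          norm (real CARD('n) * (5 * 2 ^ CARD('n) * s powr (- 1)) * M * heat (2 * s) z)"
          using M(1) heat_nonneg[of "2 * s" z] s by (simp add: abs_mult mult_ac)
      qed
    qed measurable
    have "(\<integral>z. sheat s z * \<phi> (y - z) \<partial>lborel) = conv (sheat s) \<phi> y"
      using conv_commute[of "sheat s" \<phi> y] by (simp add: conv_def mult.commute)
    also have "\<dots> = conv (heat s) (laplacian \<phi>) y" by (rule conv_heat_laplacian[OF \<phi> s])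
    finally have sh: "(\<integral>z. sheat s z * \<phi> (y - z) \<partial>lborel) = conv (heat s) (laplacian \<phi>) y" .
    have Q: "?Q z s = exp (- s) * (sheat s z * \<phi> (y - z) - heat s z * \<phi> (y - z))" for z
      using True by (simp add: algebra_simps)
    have "(\<integral>z. ?Q z s \<partial>lborel) = exp (- s) * (conv (heat s) (laplacian \<phi>) y - conv (heat s) \<phi> y)"
      unfolding Q using ish ih[OF s] by (simp add: ch sh)
    also have "conv (heat s) (laplacian \<phi>) y - conv (heat s) \<phi> y = - conv (heat s) (\<lambda>x. \<phi> x - laplacian \<phi> x) y"
    proof -
      have b: "\<bar>heat s (y - z)\<bar> \<le> 1 / sqrt (4 * pi * s) ^ CARD('n)" for z
        using heat_le[OF s, of "y - z"] heat_nonneg[OF s, of "y - z"] by simp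
      have "integrable lborel (\<lambda>z. heat s (y - z) * \<phi> z)" "integrable lborel (\<lambda>z. heat s (y - z) * laplacian \<phi> z)"
        by (rule integrable_bounded_mult[OF _ _ b], rule test_function_integrable[OF \<phi>] LB, measurable)+
      then show ?thesis by (simp add: conv_def right_diff_distrib)
    qed
    finally show ?thesis using True by simp
  qed simp
  have "(\<integral>z. (\<integral>s. ?Q z s \<partial>lborel) \<partial>lborel) = (\<integral>s. (\<integral>z. ?Q z s \<partial>lborel) \<partial>lborel)"
    by (rule lborel_pair.Fubini_integral[OF Qi])
  also have "(\<integral>z. (\<integral>s. ?Q z s \<partial>lborel) \<partial>lborel) = exp (- b) * conv (heat b) \<phi> y - exp (- a) * conv (heat a) \<phi> y"
  proof -
    have "b > 0" using ab by simp
    have "(\<integral>z. (\<integral>s. ?Q z s \<partial>lborel) \<partial>lborel) =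
        (\<integral>z. exp (- b) * (heat b z * \<phi> (y - z)) - exp (- a) * (heat a z * \<phi> (y - z)) \<partial>lborel)"
      unfolding ftc by (simp add: algebra_simps)
    then show ?thesis using ih[OF \<open>b > 0\<close>] ih[OF ab(1)] by (simp add: ch)
  qed
  finally show ?thesis by (simp add: inner)
qed

text \<open>Since \<open>\<phi>\<close> is Lipschitz, the error is at most the Lipschitz constant
  times the first moment of the kernel, which is of order \<open>sqrt s\<close>.\<close>

lemma conv_heat_tendsto:
  fixes \<phi> :: "real ^ 'n \<Rightarrow> real"
  assumes \<phi>: "test_function \<phi>"
  shows "(\<lambda>k. conv (heat (1 / real (Suc k))) \<phi> y) \<longlonglongrightarrow> \<phi> y"
proof -
  obtain B where B: "B > 0" "\<And>x. norm (grad \<phi> x) \<le> B" using test_function_grad_bounded[OF \<phi>] by metis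
  obtain M where M: "M > 0" "\<And>x. \<bar>\<phi> x\<bar> \<le> M" using test_function_bounded[OF \<phi>] by metis
  have [measurable]: "\<phi> \<in> borel_measurable borel" using test_function_integrable[OF \<phi>] by auto
  have lip: "\<bar>\<phi> (y - z) - \<phi> y\<bar> \<le> B * norm z" for z
  proof -
    have "norm (\<phi> (y - z) - \<phi> y) \<le> B * norm ((y - z) - y)"
    proof (rule differentiable_bound[of UNIV \<phi> "\<lambda>z v. grad \<phi> z \<bullet> v"])
      show "(\<phi> has_derivative (\<lambda>v. grad \<phi> x \<bullet> v)) (at x within UNIV)" for x
        using has_derivative_grad[OF test_function_differentiable[OF \<phi>]] by simp
      show "onorm (\<lambda>v. grad \<phi> x \<bullet> v) \<le> B" for x
        using B(2)[of x] by (intro onorm_le order_trans[OF Cauchy_Schwarz_ineq2[folded real_norm_def]] mult_right_mono) auto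
    qed auto
    then show ?thesis by simp
  qed
  define C where "C = B * (9 * 2 ^ CARD('n))"
  have est: "\<bar>conv (heat s) \<phi> y - \<phi> y\<bar> \<le> C * sqrt s" if s: "s > 0" for s
  proof -
    have i1: "integrable lborel (\<lambda>z. heat s z * \<phi> (y - z))"
      by (rule integrable_bounded_mult'[OF integrable_heat[OF s] _ M(2)]) measurable
    have i2: "integrable lborel (\<lambda>z :: real ^ 'n. heat s z * \<phi> y)"
      by (intro integrable_mult_left integrable_heat s)
    have "conv (heat s) \<phi> y = (\<integral>z. heat s z * \<phi> (y - z) \<partial>lborel)"
      using conv_commute[of "heat s" \<phi> y] by (simp add: conv_def mult.commute)
    moreover have "\<phi> y = (\<integral>(z :: real ^ 'n). heat s z * \<phi> y \<partial>lborel)"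
      by (simp add: integral_heat[OF s])
    ultimately have "conv (heat s) \<phi> y - \<phi> y = (\<integral>z. heat s z * \<phi> (y - z) - heat s z * \<phi> y \<partial>lborel)"
      using i1 i2 by simp
    also have "\<bar>\<dots>\<bar> \<le> (\<integral>(z :: real ^ 'n). C * sqrt s * heat (2 * s) z \<partial>lborel)"
      unfolding real_norm_def[symmetric]
    proof (rule Bochner_Integration.integral_norm_bound_integral)
      show "integrable lborel (\<lambda>z. heat s z * \<phi> (y - z) - heat s z * \<phi> y)" using i1 i2 by simp
      show "integrable lborel (\<lambda>z :: real ^ 'n. C * sqrt s * heat (2 * s) z)"
        using integrable_heat[of "2 * s"] s by (intro integrable_mult_right) auto
      fix z
      have "norm (heat s z * \<phi> (y - z) - heat s z * \<phi> y) = heat s z * \<bar>\<phi> (y - z) - \<phi> y\<bar>"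
        using heat_nonneg[OF s, of z] by (simp add: right_diff_distrib[symmetric] abs_mult)
      also have "\<dots> \<le> heat s z * (B * norm z)"
        by (intro mult_left_mono lip heat_nonneg s)
      also have "\<dots> = B * (norm z * heat s z)" by simp
      also have "\<dots> \<le> B * (9 * sqrt s * 2 ^ CARD('n) * heat (2 * s) z)"
        using B by (intro mult_left_mono norm_mult_heat_le s) auto
      finally show "norm (heat s z * \<phi> (y - z) - heat s z * \<phi> y) \<le> C * sqrt s * heat (2 * s) z"
        by (simp add: C_def mult_ac)
    qed
    also have "\<dots> = C * sqrt s"
      using s by (simp add: integral_heat)
    finally show ?thesis .
  qed
  have "(\<lambda>k. conv (heat (1 / real (Suc k))) \<phi> y - \<phi> y) \<longlonglongrightarrow> 0"
  proof (rule Lim_null_comparison)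
    show "\<forall>\<^sub>F k in sequentially. norm (conv (heat (1 / real (Suc k))) \<phi> y - \<phi> y) \<le> C * sqrt (1 / real (Suc k))"
      using est by (intro always_eventually allI) (simp del: of_nat_Suc)
    have "(\<lambda>k. C * sqrt (1 / real (Suc k))) \<longlonglongrightarrow> C * sqrt 0"
      by (intro tendsto_intros LIMSEQ_Suc lim_1_over_n)
    then show "(\<lambda>k. C * sqrt (1 / real (Suc k))) \<longlonglongrightarrow> 0" by simp
  qed
  then show ?thesis by (simp add: LIM_zero_iff)
qed

text \<open>The resolvent identity by telescoping in time: the flow at the early end tends to
  \<open>\<phi> y\<close>, while at the late end \<open>exp (- s)\<close> annihilates the bounded
  flow.\<close>

lemma conv_kint_helmholtz:
  fixes \<phi> :: "real ^ 'n \<Rightarrow> real"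
  assumes \<phi>: "test_function \<phi>"
  shows "conv heat.kint (\<lambda>x. \<phi> x - laplacian \<phi> x) y = \<phi> y"
proof -
  let ?g = "\<lambda>x. \<phi> x - laplacian \<phi> x"
  obtain M where M: "M > 0" "\<And>x. \<bar>\<phi> x\<bar> \<le> M" using test_function_bounded[OF \<phi>] by metis
  have \<phi>m [measurable]: "\<phi> \<in> borel_measurable borel" using test_function_integrable[OF \<phi>] by auto
  obtain LB where LB: "laplacian \<phi> \<in> borel_measurable borel" "\<And>x. \<bar>laplacian \<phi> x\<bar> \<le> LB"
    using laplacian_test_function[OF \<phi>] by metis
  have gm [measurable]: "?g \<in> borel_measurable borel" using LB(1) by measurable
  have gb: "\<bar>?g x\<bar> \<le> M + LB" for x using M(2)[of x] LB(2)[of x] by linarith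
  have [measurable]: "(\<lambda>s. conv (heat s) ?g y) \<in> borel_measurable borel"
    unfolding conv_def by measurable
  let ?w = "\<lambda>s. exp (- s) * conv (heat s) ?g y"
  \<comment> \<open>The intervals from \<open>1 / (k + 1)\<close> to \<open>k + 1\<close> exhaust
    the half-line and have a positive left end, as \<open>heat_evolution\<close> requires.\<close>
  let ?a = "\<lambda>k. 1 / real (Suc k)" and ?b = "\<lambda>k. real (Suc k)"
  have ab: "0 < ?a k" "?a k \<le> ?b k" for k by (auto simp: field_simps)
  have "(\<lambda>k. \<integral>s. indicator {?a k..?b k} s * ?w s \<partial>lborel) \<longlonglongrightarrow> (\<integral>s. indicator {0<..} s * ?w s \<partial>lborel)"
  proof (rule integral_dominated_convergence[where w = "\<lambda>s. indicator {0..} s * exp (- s) * (M + LB)"])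
    have "(\<integral>\<^sup>+s. ennreal (exp (- s)) * indicator {0..} s \<partial>lborel) = ennreal (0 - - exp (- 0))"
    proof (rule nn_integral_FTC_atLeast)
      show "((\<lambda>s::real. - exp (- s)) \<longlongrightarrow> 0) at_top"
        using tendsto_minus[OF filterlim_compose[OF exp_at_bot filterlim_uminus_at_bot_at_top]] by simp
    qed (auto intro!: derivative_eq_intros)
    moreover have "(\<integral>\<^sup>+s. ennreal (indicator {0..} s * exp (- s)) \<partial>lborel) = (\<integral>\<^sup>+s. ennreal (exp (- s)) * indicator {0..} s \<partial>lborel)"
      by (intro nn_integral_cong) (auto split: split_indicator)
    ultimately have "integrable lborel (\<lambda>s::real. indicator {0..} s * exp (- s))"
      by (intro integrableI_nonneg) auto
    then show "integrable lborel (\<lambda>s::real. indicator {0..} s * exp (- s) * (M + LB))" by simp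
    show "AE s in lborel. (\<lambda>k. indicator {?a k..?b k} s * ?w s) \<longlonglongrightarrow> indicator {0<..} s * ?w s"
    proof (rule AE_I2)
      fix s :: real
      show "(\<lambda>k. indicator {?a k..?b k} s * ?w s) \<longlonglongrightarrow> indicator {0<..} s * ?w s"
      proof (cases "s > 0")
        case True
        obtain N where N: "max (1 / s) s \<le> real N" using real_arch_simple by blast
        have "indicator {?a k..?b k} s * ?w s = indicator {0<..} s * ?w s" if "k \<ge> N" for k
        proof -
          have "1 / s \<le> real (Suc k)" "s \<le> real (Suc k)" using N that by auto
          then show ?thesis using True by (simp add: field_simps del: of_nat_Suc)
        qed
        then show ?thesis
          by (intro tendsto_eventually eventually_sequentiallyI[of N]) blast
      next
        case False
        then have "\<not> ?a k \<le> s" for k using ab(1)[of k] by linarith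
        then show ?thesis using False by (simp del: of_nat_Suc)
      qed
    qed
    show "AE s in lborel. norm (indicator {?a k..?b k} s * ?w s) \<le> indicator {0..} s * exp (- s) * (M + LB)" for k
    proof (rule AE_I2)
      fix s :: real
      show "norm (indicator {?a k..?b k} s * ?w s) \<le> indicator {0..} s * exp (- s) * (M + LB)"
      proof (cases "s \<in> {?a k..?b k}")
        case True
        then have "?a k \<le> s" by (simp only: atLeastAtMost_iff)
        with ab(1)[of k] have "s > 0" by (rule less_le_trans)
        then show ?thesis
          using conv_heat_le[OF _ gm gb, of s y] True by (simp add: abs_mult mult_left_mono del: of_nat_Suc)
      next
        case False
        moreover have "M + LB \<ge> 0" using gb[of 0] by linarith
        ultimately show ?thesis by (simp del: of_nat_Suc)
      qed
    qed
  qed measurable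
  then have 1: "(\<lambda>k. - (exp (- ?b k) * conv (heat (?b k)) \<phi> y - exp (- ?a k) * conv (heat (?a k)) \<phi> y))
      \<longlonglongrightarrow> (\<integral>s. indicator {0<..} s * ?w s \<partial>lborel)"
    by (simp only: heat_evolution[OF \<phi> ab] minus_minus)
  have "(\<lambda>k. exp (- ?b k) * conv (heat (?b k)) \<phi> y) \<longlonglongrightarrow> 0"
  proof (rule Lim_null_comparison)
    show "\<forall>\<^sub>F k in sequentially. norm (exp (- ?b k) * conv (heat (?b k)) \<phi> y) \<le> exp (- ?b k) * M"
      using conv_heat_le[OF _ \<phi>m M(2)]
      by (intro always_eventually allI) (simp add: abs_mult mult_left_mono del: of_nat_Suc)
    have "(\<lambda>k. exp (- ?b k)) \<longlonglongrightarrow> 0"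
      by (rule filterlim_compose[OF exp_at_bot filterlim_compose[OF filterlim_uminus_at_bot_at_top
            filterlim_compose[OF filterlim_real_sequentially filterlim_Suc]]])
    from tendsto_mult_left_zero[OF this] show "(\<lambda>k. exp (- ?b k) * M) \<longlonglongrightarrow> 0" .
  qed
  moreover have "(\<lambda>k. exp (- ?a k) * conv (heat (?a k)) \<phi> y) \<longlonglongrightarrow> exp (- 0) * \<phi> y"
    by (intro tendsto_intros conv_heat_tendsto[OF \<phi>] LIMSEQ_Suc[OF lim_1_over_n])
  ultimately have "(\<lambda>k. - (exp (- ?b k) * conv (heat (?b k)) \<phi> y - exp (- ?a k) * conv (heat (?a k)) \<phi> y))
      \<longlonglongrightarrow> - (0 - exp (- 0) * \<phi> y)"
    by (intro tendsto_minus tendsto_diff)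
  from LIMSEQ_unique[OF 1 this] show ?thesis
    using heat.conv_kint[OF gm gb] by simp
qed

text \<open>At each time the derivative passes to the kernel. The minus sign appears because
  \<open>dheat.kint\<close> is built from \<open>- dheat\<close>.\<close>

lemma conv_kint_partial_deriv:
  fixes \<phi> :: "real ^ 'n \<Rightarrow> real"
  assumes \<phi>: "test_function \<phi>"
  shows "conv heat.kint (partial_deriv j \<phi>) y = - conv (dheat.kint j) \<phi> y"
proof -
  obtain M where M: "\<And>x. \<bar>\<phi> x\<bar> \<le> M" using test_function_bounded[OF \<phi>] by metis
  obtain M' where M': "\<And>x. \<bar>partial_deriv j \<phi> x\<bar> \<le> M'"
    using test_function_bounded[OF test_function_partial_deriv[OF \<phi>]] by metis
  have m: "\<phi> \<in> borel_measurable borel" "partial_deriv j \<phi> \<in> borel_measurable borel"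
    by (intro borel_measurable_continuous_onI test_function_continuous test_function_partial_deriv \<phi>)+
  have "indicator {0<..} s * (exp (- s) * conv (heat s) (partial_deriv j \<phi>) y) =
      - (indicator {0<..} s * (exp (- s) * conv (\<lambda>x. - dheat j s x) \<phi> y))" for s :: real
    by (cases "s > 0") (simp_all add: conv_uminus conv_heat_partial_deriv[OF \<phi>])
  then show ?thesis
    unfolding heat.conv_kint[OF m(2) M'] dheat.conv_kint[OF m(1) M] by simp
qed

text \<open>Tonelli makes the absolute integral in \<open>y\<close> and \<open>s\<close> finite only
  after integration in \<open>x\<close>, hence for almost every \<open>x\<close>. This pointwise
  form is needed for the sup bound, which is proved without duality.\<close>

lemma AE_potential_heat:
  assumes G: "integrable lborel G"
  shows "AE x in lborel. heat.potential G x =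
    (\<integral>s. indicator {0<..} s * (exp (- s) * (\<integral>y. heat s (y - x) * G y \<partial>lborel)) \<partial>lborel)"
proof -
  have [measurable]: "G \<in> borel_measurable borel" using G by auto
  let ?q = "\<lambda>x y s. indicator {0<..} s * (exp (- s) * heat s (y - x)) * G y"
  have "(\<integral>\<^sup>+x. \<integral>\<^sup>+y. \<integral>\<^sup>+s. ennreal (norm (?q x y s)) \<partial>lborel \<partial>lborel \<partial>lborel) =
      (\<integral>\<^sup>+y. \<integral>\<^sup>+x. \<integral>\<^sup>+s. ennreal (norm (?q x y s)) \<partial>lborel \<partial>lborel \<partial>lborel)"
    by (rule lborel_pair.Fubini') measurable
  also have "\<dots> = (\<integral>\<^sup>+y. \<integral>\<^sup>+s. \<integral>\<^sup>+x. ennreal (norm (?q x y s)) \<partial>lborel \<partial>lborel \<partial>lborel)"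
    by (intro nn_integral_cong lborel_pair.Fubini') measurable
  also have "\<dots> \<le> (\<integral>\<^sup>+y. ennreal \<bar>G y\<bar> * (ennreal (5 * 2 ^ CARD('a) * 1) * heat.gamma_mass) \<partial>lborel)"
  proof (rule nn_integral_mono)
    fix y :: "real ^ 'a"
    have "(\<integral>\<^sup>+s. \<integral>\<^sup>+x. ennreal (norm (?q x y s)) \<partial>lborel \<partial>lborel) =
        (\<integral>\<^sup>+s. \<integral>\<^sup>+x. ennreal \<bar>G y\<bar> * ennreal \<bar>indicator {0<..} s * (exp (- s) * heat s (y - x)) * 1\<bar> \<partial>lborel \<partial>lborel)"
      by (intro nn_integral_cong) (simp add: abs_mult ennreal_mult'[symmetric] mult_ac)
    also have "\<dots> = ennreal \<bar>G y\<bar> *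
        (\<integral>\<^sup>+s. \<integral>\<^sup>+x. ennreal \<bar>indicator {0<..} s * (exp (- s) * heat s (y - x)) * 1\<bar> \<partial>lborel \<partial>lborel)"
      by (simp add: nn_integral_cmult)
    also have "\<dots> \<le> ennreal \<bar>G y\<bar> * (ennreal (5 * 2 ^ CARD('a) * 1) * heat.gamma_mass)"
      by (intro mult_left_mono heat.space_time_mass) auto
    finally show "(\<integral>\<^sup>+s. \<integral>\<^sup>+x. ennreal (norm (?q x y s)) \<partial>lborel \<partial>lborel) \<le>
        ennreal \<bar>G y\<bar> * (ennreal (5 * 2 ^ CARD('a) * 1) * heat.gamma_mass)" .
  qed
  also have "\<dots> = (\<integral>\<^sup>+y. ennreal \<bar>G y\<bar> \<partial>lborel) * (ennreal (5 * 2 ^ CARD('a) * 1) * heat.gamma_mass)"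
    by (rule nn_integral_multc) measurable
  also have "\<dots> < \<infinity>"
    using G heat.gamma_mass_finite by (simp add: integrable_iff_bounded ennreal_mult_less_top)
  finally have fin: "(\<integral>\<^sup>+x. \<integral>\<^sup>+y. \<integral>\<^sup>+s. ennreal (norm (?q x y s)) \<partial>lborel \<partial>lborel \<partial>lborel) < \<infinity>" .
  have "(\<lambda>x. \<integral>\<^sup>+y. \<integral>\<^sup>+s. ennreal (norm (?q x y s)) \<partial>lborel \<partial>lborel) \<in> borel_measurable lborel"
    by measurable
  from nn_integral_PInf_AE[OF this] fin
  have "AE x in lborel. (\<integral>\<^sup>+y. \<integral>\<^sup>+s. ennreal (norm (?q x y s)) \<partial>lborel \<partial>lborel) \<noteq> \<infinity>"
    by simp
  then show ?thesis
  proof eventually_elim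
    fix x
    assume x: "(\<integral>\<^sup>+y. \<integral>\<^sup>+s. ennreal (norm (?q x y s)) \<partial>lborel \<partial>lborel) \<noteq> \<infinity>"
    have "integrable (lborel \<Otimes>\<^sub>M lborel) (\<lambda>(y, s). ?q x y s)"
    proof (rule integrable_pairI)
      show "(\<integral>\<^sup>+y. \<integral>\<^sup>+s. ennreal (norm (?q x y s)) \<partial>lborel \<partial>lborel) < \<infinity>"
        using x by (simp add: less_top)
    qed measurable
    from lborel_pair.Fubini_integral[OF this]
    have "(\<integral>s. (\<integral>y. ?q x y s \<partial>lborel) \<partial>lborel) = (\<integral>y. (\<integral>s. ?q x y s \<partial>lborel) \<partial>lborel)" .
    moreover have "(\<integral>s. ?q x y s \<partial>lborel) = heat.kint (y - x) * G y" for y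
      by (simp add: heat.kint_def)
    ultimately show "heat.potential G x =
        (\<integral>s. indicator {0<..} s * (exp (- s) * (\<integral>y. heat s (y - x) * G y \<partial>lborel)) \<partial>lborel)"
      by (simp add: heat.potential_def mult.assoc)
  qed
qed

section \<open>The sup bound in the plane\<close>

lemma gauss1_primitive:
  assumes s: "s > 0"
  obtains N where "\<And>u. (N has_real_derivative gauss1 s u) (at u)" "\<And>u. \<bar>N u\<bar> \<le> 1"
proof -
  have c: "isCont (gauss1 s) u" for u
    unfolding gauss1_def[abs_def] using s by (intro continuous_intros) auto
  have "\<exists>F. \<forall>u :: real. -\<infinity> < ereal u \<longrightarrow> ereal u < \<infinity> \<longrightarrow> (F has_vector_derivative gauss1 s u) (at u)"
    by (rule einterval_antiderivative) (use c in auto)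
  then obtain F where F: "\<And>u. (F has_real_derivative gauss1 s u) (at u)"
    by (auto simp: has_real_derivative_iff_has_vector_derivative)
  have m [measurable]: "gauss1 s \<in> borel_measurable borel" by measurable
  have le: "\<bar>F v - F u\<bar> \<le> 1" if "u \<le> v" for u v
  proof -
    have "ennreal (F v - F u) = (\<integral>\<^sup>+x. ennreal (gauss1 s x) * indicator {u..v} x \<partial>lborel)"
      using nn_integral_FTC_Icc[of "gauss1 s" u v F] F gauss1_nonneg[OF s] that by simp
    also have "\<dots> \<le> (\<integral>\<^sup>+x. ennreal (gauss1 s x) \<partial>lborel)"
      by (intro nn_integral_mono) (auto split: split_indicator)
    finally have "F v - F u \<le> 1" by (simp add: nn_integral_gauss1[OF s])
    moreover have "F u \<le> F v"
      by (rule DERIV_nonneg_imp_nondecreasing[OF that]) (use F gauss1_nonneg[OF s] in blast)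
    ultimately show ?thesis by simp
  qed
  show ?thesis
  proof (rule that[of "\<lambda>u. F u - F 0"])
    show "((\<lambda>u. F u - F 0) has_real_derivative gauss1 s u) (at u)" for u
      using DERIV_diff[OF F DERIV_const[of "F 0"]] by simp
    show "\<bar>F u - F 0\<bar> \<le> 1" for u
      using le[of 0 u] le[of u 0] by (cases "u \<ge> 0") auto
  qed
qed

definition dgauss1 :: "real \<Rightarrow> real \<Rightarrow> real" where
  "dgauss1 s u = - u / (2 * s) * gauss1 s u"

lemma dgauss1_measurable [measurable (raw)]:
  assumes [measurable]: "f \<in> borel_measurable M" "g \<in> borel_measurable M"
  shows "(\<lambda>p. dgauss1 (f p) (g p)) \<in> borel_measurable M"
  unfolding dgauss1_def by measurable

lemma gauss1_deriv:
  assumes s: "s > 0"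
  shows "(gauss1 s has_real_derivative dgauss1 s u) (at u)"
proof -
  have "((\<lambda>u. - u\<^sup>2 / (4 * s)) has_real_derivative - u / (2 * s)) (at u)"
    using s by (auto intro!: derivative_eq_intros simp: field_simps)
  from DERIV_cdivide[OF DERIV_fun_exp[OF this], of "sqrt (4 * pi * s)"] show ?thesis
    by (simp add: gauss1_def[abs_def] dgauss1_def mult.commute)
qed

lemma gauss1_le_powr:
  assumes s: "s > 0"
  shows "gauss1 s u \<le> s powr (- (1/2))"
proof -
  have "sqrt s \<le> sqrt (4 * pi * s)"
    using s pi_ge_two by (intro real_sqrt_le_mono) (simp add: mult_le_cancel_right1)
  then have "gauss1 s u \<le> 1 / sqrt s"
    unfolding gauss1_def using s by (intro frac_le) auto
  also have "\<dots> = s powr (- (1/2))"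
    using s by (simp add: powr_minus powr_half_sqrt field_simps)
  finally show ?thesis .
qed

text \<open>The first bound drops the exponential and is the good one for large \<open>s\<close>;
  the second uses \<open>exp (- y) \<le> 1 / y\<close> with \<open>y = u\<^sup>2 / (4 * s)\<close>
  and is the good one for small \<open>s\<close>.\<close>

lemma abs_dgauss1_le:
  assumes s: "s > 0"
  shows "\<bar>dgauss1 s u\<bar> \<le> \<bar>u\<bar> * s powr (- (3/2))"
    and "u \<noteq> 0 \<Longrightarrow> \<bar>dgauss1 s u\<bar> \<le> 2 / \<bar>u\<bar> * s powr (- (1/2))"
proof -
  have p: "s powr (- (3/2)) = s powr (- (1/2)) / s"
    using s powr_diff[of s "- (1/2)" 1] by simp
  have a: "\<bar>dgauss1 s u\<bar> = \<bar>u\<bar> / (2 * s) * gauss1 s u"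
    using s gauss1_nonneg[OF s, of u] by (simp add: dgauss1_def abs_mult)
  have "\<bar>u\<bar> / (2 * s) * gauss1 s u \<le> \<bar>u\<bar> / s * s powr (- (1/2))"
    using s gauss1_le_powr[OF s, of u] gauss1_nonneg[OF s, of u] by (intro mult_mono frac_le) auto
  then show "\<bar>dgauss1 s u\<bar> \<le> \<bar>u\<bar> * s powr (- (3/2))" by (simp add: a p)
  assume u: "u \<noteq> 0"
  define y where "y = u\<^sup>2 / (4 * s)"
  have y: "y > 0" using s u by (simp add: y_def)
  have "y \<le> exp y" using exp_ge_add_one_self[of y] by linarith
  then have "exp (- y) \<le> 1 / y" using y by (simp add: exp_minus field_simps)
  moreover have "gauss1 s u = exp (- y) / sqrt (4 * pi * s)" by (simp add: gauss1_def y_def)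
  ultimately have "gauss1 s u \<le> (1 / y) / sqrt s"
  proof -
    have "sqrt s \<le> sqrt (4 * pi * s)"
      using s pi_ge_two by (intro real_sqrt_le_mono) (simp add: mult_le_cancel_right1)
    then have "exp (- y) / sqrt (4 * pi * s) \<le> (1 / y) / sqrt s"
      using s y \<open>exp (- y) \<le> 1 / y\<close> by (intro frac_le) auto
    then show ?thesis using \<open>gauss1 s u = _\<close> by simp
  qed
  also have "\<dots> = 4 * s / u\<^sup>2 * s powr (- (1/2))"
    using s by (simp add: y_def powr_minus powr_half_sqrt field_simps)
  finally have "\<bar>dgauss1 s u\<bar> \<le> \<bar>u\<bar> / (2 * s) * (4 * s / u\<^sup>2 * s powr (- (1/2)))"
    unfolding a using s by (intro mult_left_mono) auto
  also have "\<dots> = 2 / \<bar>u\<bar> * s powr (- (1/2))"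
    using s u by (simp add: power2_eq_square abs_if field_simps)
  finally show "\<bar>dgauss1 s u\<bar> \<le> 2 / \<bar>u\<bar> * s powr (- (1/2))" .
qed

text \<open>By scaling this integral does not depend on \<open>u \<noteq> 0\<close>; this is what makes \<open>U\<close> bounded in the plane.\<close>

lemma nn_integral_dgauss1_time:
  "(\<integral>\<^sup>+s. ennreal \<bar>dgauss1 s u\<bar> * indicator {0<..} s \<partial>lborel) \<le> 6"
proof (cases "u = 0")
  case False
  \<comment> \<open>The bounds of \<open>dgauss1\<close> change roles at this time; the part below
    contributes 4, the part above 2.\<close>
  let ?a = "u\<^sup>2"
  have a: "?a > 0" using False by simp
  have "(\<integral>\<^sup>+s. ennreal \<bar>dgauss1 s u\<bar> * indicator {0<..} s \<partial>lborel) \<le>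
      (\<integral>\<^sup>+s. ennreal (2 / \<bar>u\<bar>) * (ennreal (s powr (- (1/2))) * indicator {0..?a} s) +
        ennreal \<bar>u\<bar> * (ennreal (s powr (- (3/2))) * indicator {?a..} s) \<partial>lborel)"
  proof (rule nn_integral_mono)
    fix s :: real
    consider "s \<le> 0" | "0 < s" "s \<le> ?a" | "?a < s" "0 < s" by linarith
    then show "ennreal \<bar>dgauss1 s u\<bar> * indicator {0<..} s \<le>
        ennreal (2 / \<bar>u\<bar>) * (ennreal (s powr (- (1/2))) * indicator {0..?a} s) +
        ennreal \<bar>u\<bar> * (ennreal (s powr (- (3/2))) * indicator {?a..} s)"
    proof cases
      case 2
      then have "ennreal \<bar>dgauss1 s u\<bar> * indicator {0<..} s \<le>
          ennreal (2 / \<bar>u\<bar>) * (ennreal (s powr (- (1/2))) * indicator {0..?a} s)"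
        using abs_dgauss1_le(2)[of s u] False by (auto simp: ennreal_mult[symmetric] intro!: ennreal_leI)
      then show ?thesis by (rule order_trans) simp
    next
      case 3
      then have "ennreal \<bar>dgauss1 s u\<bar> * indicator {0<..} s \<le>
          ennreal \<bar>u\<bar> * (ennreal (s powr (- (3/2))) * indicator {?a..} s)"
        using abs_dgauss1_le(1)[of s u] by (auto simp: ennreal_mult[symmetric] intro!: ennreal_leI)
      then show ?thesis by (rule order_trans) simp
    qed auto
  qed
  also have "\<dots> = ennreal (2 / \<bar>u\<bar>) * ennreal (?a powr (1/2) / (1/2)) + ennreal \<bar>u\<bar> * ennreal (2 * ?a powr (- (1/2)))"
    using nn_integral_powr_from_0[of "- (1/2)" ?a] nn_integral_powr_to_inf[of "- (3/2)" ?a] a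
    by (simp add: nn_integral_add nn_integral_cmult mult.commute)
  also have "\<dots> = ennreal (2 / \<bar>u\<bar>) * ennreal (\<bar>u\<bar> / (1/2)) + ennreal \<bar>u\<bar> * ennreal (2 * (1 / \<bar>u\<bar>))"
  proof -
    have 1: "?a powr (1/2) = \<bar>u\<bar>" using a powr_half_sqrt[of ?a] by simp
    have "?a powr (- (1/2)) = 1 / \<bar>u\<bar>"
      unfolding powr_minus 1 by (rule inverse_eq_divide)
    then show ?thesis by (simp only: 1)
  qed
  also have "\<dots> = ennreal 6"
    using False by (simp add: ennreal_mult[symmetric] ennreal_plus[symmetric] del: ennreal_plus ennreal_numeral)
  finally show ?thesis by simp
qed (simp add: dgauss1_def)

text \<open>With two coordinates the kernel is a product \<open>P' * Q\<close> of Gaussians, and the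
  gradient of \<open>P * Q\<close> has just two terms: the kernel along the axis \<open>i\<close>
  and \<open>P * Q'\<close> along the axis \<open>j\<close>. Hence the pairing of
  \<open>F $ i\<close> with the kernel becomes one of \<open>F $ j\<close> with
  \<open>P * Q'\<close> and one of \<open>f\<close> with \<open>P * Q\<close>, where
  \<open>\<bar>P\<bar> \<le> 1\<close>.\<close>

lemma planar_heat_pairing:
  fixes F :: "real ^ 'n \<Rightarrow> real ^ 'n"
  assumes F: "integrable lborel F" and f: "integrable lborel f"
    and test: "\<And>\<phi>. test_function \<phi> \<Longrightarrow> (\<integral>x. F x \<bullet> grad \<phi> x \<partial>lborel) = - (\<integral>x. f x * \<phi> x \<partial>lborel)"
    and ij: "(UNIV :: 'n set) = {i, j}" "i \<noteq> j" and s: "s > 0"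
  shows "\<bar>\<integral>y. heat s (y - x) * F y $ i \<partial>lborel\<bar> \<le>
    (\<integral>y. norm (F y) * \<bar>dgauss1 s (y $ j - x $ j)\<bar> \<partial>lborel) + (\<integral>y. \<bar>f y\<bar> * gauss1 s (y $ j - x $ j) \<partial>lborel)"
proof -
  obtain N where N: "\<And>u. (N has_real_derivative gauss1 s u) (at u)" "\<And>u. \<bar>N u\<bar> \<le> 1"
    using gauss1_primitive[OF s] by metis
  let ?c = "s powr (- (1/2))"
  have g: "0 \<le> gauss1 s u" "gauss1 s u \<le> ?c" for u using gauss1_nonneg[OF s] gauss1_le_powr[OF s] by auto
  \<comment> \<open>A bound uniform in \<open>u\<close> at fixed \<open>s\<close>, by switching
    between the two estimates at \<open>\<bar>u\<bar> = 1\<close>. Its size does not matter: it only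
    qualifies \<open>P * Q\<close> for \<open>div_pairing\<close>.\<close>
  have dg: "\<bar>dgauss1 s u\<bar> \<le> 2 * s powr (- (1/2)) + s powr (- (3/2))" for u
  proof (cases "\<bar>u\<bar> \<le> 1")
    case True
    then have "\<bar>u\<bar> * s powr (- (3/2)) \<le> 1 * s powr (- (3/2))" by (intro mult_right_mono) auto
    then have "\<bar>dgauss1 s u\<bar> \<le> s powr (- (3/2))" using abs_dgauss1_le(1)[OF s, of u] by simp
    then show ?thesis by (rule order_trans) simp
  next
    case False
    then have "2 / \<bar>u\<bar> * s powr (- (1/2)) \<le> 2 * s powr (- (1/2))"
      by (intro mult_right_mono) (auto simp: field_simps)
    moreover have "\<bar>dgauss1 s u\<bar> \<le> 2 / \<bar>u\<bar> * s powr (- (1/2))" using False by (intro abs_dgauss1_le(2)[OF s]) auto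
    ultimately show ?thesis by (simp add: add_increasing2)
  qed
  define c' where "c' = 2 * s powr (- (1/2)) + s powr (- (3/2))"
  have c0: "0 \<le> ?c" "0 \<le> c'" by (auto simp: c'_def)
  have shift: "((\<lambda>u. k (u - a)) has_real_derivative k' (u - a)) (at u)"
    if "\<And>u. (k has_real_derivative k' u) (at u)" for k k' and a u :: real
    using DERIV_chain2[OF that[of "u - a"] DERIV_diff[OF DERIV_ident DERIV_const[of a]]] by simp
  define P where "P y = N (y $ i - x $ i)" for y :: "real ^ 'n"
  define Q where "Q y = gauss1 s (y $ j - x $ j)" for y :: "real ^ 'n"
  define P' where "P' y = gauss1 s (y $ i - x $ i)" for y :: "real ^ 'n"
  define Q' where "Q' y = dgauss1 s (y $ j - x $ j)" for y :: "real ^ 'n"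
  have dP: "(P has_derivative (\<lambda>v. (P' y *\<^sub>R axis i 1) \<bullet> v)) (at y)" for y
    unfolding P_def[abs_def] P'_def by (rule has_derivative_coord[OF shift[OF N(1)]])
  have dQ: "(Q has_derivative (\<lambda>v. (Q' y *\<^sub>R axis j 1) \<bullet> v)) (at y)" for y
    unfolding Q_def[abs_def] Q'_def by (rule has_derivative_coord[OF shift[OF gauss1_deriv[OF s]]])
  have cg: "continuous_on UNIV (gauss1 s)"
    using gauss1_deriv[OF s] by (meson DERIV_continuous_on has_field_derivative_at_within)
  have cdg: "continuous_on UNIV (dgauss1 s)"
    unfolding dgauss1_def[abs_def] using s by (intro continuous_intros cg) auto
  have cP: "continuous_on UNIV P" and cQ: "continuous_on UNIV Q"
    using dP dQ has_derivative_continuous by (blast intro: continuous_at_imp_continuous_on)+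
  have cP': "continuous_on UNIV P'" and cQ': "continuous_on UNIV Q'"
    unfolding P'_def[abs_def] Q'_def[abs_def]
    by (auto intro!: continuous_on_compose2[OF cg] continuous_on_compose2[OF cdg] continuous_intros)
  let ?D = "\<lambda>y. P y *\<^sub>R (Q' y *\<^sub>R axis j 1) + Q y *\<^sub>R (P' y *\<^sub>R axis i 1) :: real ^ 'n"
  have b: "\<bar>P y\<bar> \<le> 1" "\<bar>Q y\<bar> \<le> ?c" "\<bar>P' y\<bar> \<le> ?c" "\<bar>Q' y\<bar> \<le> c'" for y
    using N(2) g dg by (auto simp: P_def Q_def P'_def Q'_def c'_def)
  have pQ: "\<bar>P y * Q y\<bar> \<le> 1 * ?c" "\<bar>P y * Q' y\<bar> \<le> 1 * c'" "\<bar>Q y * P' y\<bar> \<le> ?c * ?c" for y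
    unfolding abs_mult by (intro mult_mono b c0 abs_ge_zero zero_le_one)+
  have [measurable]: "P \<in> borel_measurable borel" "Q \<in> borel_measurable borel" "P' \<in> borel_measurable borel"
     "Q' \<in> borel_measurable borel" "F \<in> borel_measurable borel" "f \<in> borel_measurable borel"
    using cP cQ cP' cQ' F f by (auto intro: borel_measurable_continuous_onI)
  have eq: "(\<integral>y. F y \<bullet> ?D y \<partial>lborel) = - (\<integral>y. f y * (P y * Q y) \<partial>lborel)"
  proof (rule div_pairing[OF F f test])
    show "((\<lambda>y. P y * Q y) has_derivative (\<lambda>v. ?D y \<bullet> v)) (at y)" for y
      by (rule has_derivative_eq_rhs[OF has_derivative_mult[OF dP dQ]]) (auto simp: inner_add_left fun_eq_iff)
    show "continuous_on UNIV ?D" by (intro continuous_intros cP cQ cP' cQ')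
    show "norm (?D y) \<le> 1 * c' + ?c * ?c" for y
      using pQ(2,3)[of y] by (intro order_trans[OF norm_triangle_ineq] add_mono) (auto simp: abs_mult)
    show "\<bar>P y * Q y\<bar> \<le> 1 * ?c" for y by (rule pQ)
  qed
  have h: "heat s (y - x) = P' y * Q y" for y
    unfolding heat_eq_prod ij(1) using ij(2) by (simp add: P'_def Q_def)
  have Fk: "integrable lborel (\<lambda>y. F y $ k)" for k by (rule integrable_component[OF F])
  have i1: "integrable lborel (\<lambda>y. F y $ j * (P y * Q' y))"
    by (rule integrable_bounded_mult'[OF Fk _ pQ(2)]) measurable
  have i2: "integrable lborel (\<lambda>y. F y $ i * (Q y * P' y))"
    by (rule integrable_bounded_mult'[OF Fk _ pQ(3)]) measurable
  have i3: "integrable lborel (\<lambda>y. f y * (P y * Q y))"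
    by (rule integrable_bounded_mult'[OF f _ pQ(1)]) measurable
  have "F y \<bullet> ?D y = F y $ j * (P y * Q' y) + F y $ i * (Q y * P' y)" for y
    by (simp add: inner_add_right inner_axis mult_ac)
  with eq have "(\<integral>y. F y $ i * (Q y * P' y) \<partial>lborel) =
      - (\<integral>y. F y $ j * (P y * Q' y) \<partial>lborel) - (\<integral>y. f y * (P y * Q y) \<partial>lborel)"
    using i1 i2 by simp
  moreover have "\<bar>\<integral>y. F y $ j * (P y * Q' y) \<partial>lborel\<bar> \<le> (\<integral>y. norm (F y) * \<bar>Q' y\<bar> \<partial>lborel)"
    unfolding real_norm_def[symmetric]
  proof (rule Bochner_Integration.integral_norm_bound_integral[OF i1])
    show "integrable lborel (\<lambda>y. norm (F y) * norm (Q' y))"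
      by (rule integrable_bounded_mult'[OF integrable_norm[OF F], of _ c']) (use b(4) in auto)
    show "norm (F y $ j * (P y * Q' y)) \<le> norm (F y) * norm (Q' y)" for y
    proof -
      have "\<bar>F y $ j\<bar> * (\<bar>P y\<bar> * \<bar>Q' y\<bar>) \<le> norm (F y) * (1 * \<bar>Q' y\<bar>)"
        using b(1)[of y] component_le_norm_cart[of "F y" j] by (intro mult_mono) auto
      then show ?thesis by (simp add: abs_mult)
    qed
  qed
  moreover have "\<bar>\<integral>y. f y * (P y * Q y) \<partial>lborel\<bar> \<le> (\<integral>y. norm (f y) * Q y \<partial>lborel)"
    unfolding real_norm_def[symmetric]
  proof (rule Bochner_Integration.integral_norm_bound_integral[OF i3])
    show "integrable lborel (\<lambda>y. norm (f y) * Q y)"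
      by (rule integrable_bounded_mult'[OF integrable_norm[OF f] _ b(2)]) measurable
    show "norm (f y * (P y * Q y)) \<le> norm (f y) * Q y" for y
    proof -
      have "\<bar>f y\<bar> * (\<bar>P y\<bar> * \<bar>Q y\<bar>) \<le> \<bar>f y\<bar> * (1 * Q y)"
        using b(1)[of y] g(1) by (intro mult_mono) (auto simp: Q_def)
      then show ?thesis by (simp add: abs_mult)
    qed
  qed
  ultimately have le: "\<bar>\<integral>y. F y $ i * (Q y * P' y) \<partial>lborel\<bar> \<le> (\<integral>y. norm (F y) * \<bar>Q' y\<bar> \<partial>lborel) + (\<integral>y. \<bar>f y\<bar> * Q y \<partial>lborel)"
    by simp
  have "heat s (y - x) * F y $ i = F y $ i * (Q y * P' y)" for y by (simp add: h)
  then show ?thesis using le by (simp only: Q_def[symmetric] Q'_def[symmetric])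
qed

lemma planar_sup_bound:
  assumes n: "CARD('n) = 2"
  obtains C where "C > 0"
    "\<And>(F :: real ^ 'n \<Rightarrow> real ^ 'n) f L i. integrable lborel F \<Longrightarrow> integrable lborel f \<Longrightarrow>
      (\<And>\<phi>. test_function \<phi> \<Longrightarrow> (\<integral>x. F x \<bullet> grad \<phi> x \<partial>lborel) = - (\<integral>x. f x * \<phi> x \<partial>lborel)) \<Longrightarrow>
      (\<integral>x. norm (F x) \<partial>lborel) \<le> L \<Longrightarrow> (\<integral>x. \<bar>f x\<bar> \<partial>lborel) \<le> L \<Longrightarrow>
      AE x in lborel. \<bar>heat.potential (\<lambda>y. F y $ i) x\<bar> \<le> C * L"
proof -
  \<comment> \<open>The time integral belonging to the divergence term; together with the 6 of
    \<open>nn_integral_dgauss1_time\<close> it makes up the constant.\<close>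
  define K where "K = enn2real (\<integral>\<^sup>+s. ennreal (exp (- s) * s powr (- (1 / 2))) * indicator {0<..} s \<partial>lborel)"
  have K: "(\<integral>\<^sup>+s. ennreal (exp (- s) * s powr (- (1 / 2))) * indicator {0<..} s \<partial>lborel) = ennreal K"
    using dheat.gamma_mass_finite unfolding K_def dheat.gamma_mass_def by (simp add: less_top)
  show ?thesis
  proof (rule that[of "6 + K"])
    show "6 + K > 0" by (simp add: K_def add_pos_nonneg)
    fix F :: "real ^ 'n \<Rightarrow> real ^ 'n" and f L i
    assume F: "integrable lborel F" and f: "integrable lborel f"
      and test: "\<And>\<phi>. test_function \<phi> \<Longrightarrow> (\<integral>x. F x \<bullet> grad \<phi> x \<partial>lborel) = - (\<integral>x. f x * \<phi> x \<partial>lborel)"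
      and L: "(\<integral>x. norm (F x) \<partial>lborel) \<le> L" "(\<integral>x. \<bar>f x\<bar> \<partial>lborel) \<le> L"
    have [measurable]: "F \<in> borel_measurable borel" "f \<in> borel_measurable borel" using F f by auto
    have "0 \<le> (\<integral>x. \<bar>f x\<bar> \<partial>lborel)" by (intro integral_nonneg_AE) auto
    from order_trans[OF this L(2)] have L0: "L \<ge> 0" .
    obtain j where ij: "(UNIV :: 'n set) = {i, j}" "i \<noteq> j"
    proof -
      have "card (UNIV - {i}) = 1" using n by (simp add: card_Diff_singleton)
      then obtain j where "UNIV - {i} = {j}" by (meson card_1_singletonE)
      then show ?thesis using that[of j] by blast
    qed
    have K0: "K \<ge> 0" by (simp add: K_def)
    show "AE x in lborel. \<bar>heat.potential (\<lambda>y. F y $ i) x\<bar> \<le> (6 + K) * L"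
      using AE_potential_heat[OF integrable_component[OF F, of i]]
    proof eventually_elim
      fix x
      assume eq: "heat.potential (\<lambda>y. F y $ i) x =
        (\<integral>s. indicator {0<..} s * (exp (- s) * (\<integral>y. heat s (y - x) * F y $ i \<partial>lborel)) \<partial>lborel)"
      let ?A = "\<lambda>s y. ennreal (norm (F y)) * (ennreal \<bar>dgauss1 s (y $ j - x $ j)\<bar> * indicator {0<..} s)"
      let ?B = "\<lambda>s y. ennreal \<bar>f y\<bar> * (ennreal (exp (- s) * gauss1 s (y $ j - x $ j)) * indicator {0<..} s)"
      have "ennreal \<bar>heat.potential (\<lambda>y. F y $ i) x\<bar> \<le>
          (\<integral>\<^sup>+s. ennreal (norm (indicator {0<..} s * (exp (- s) * (\<integral>y. heat s (y - x) * F y $ i \<partial>lborel)))) \<partial>lborel)"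
        unfolding eq real_norm_def[symmetric] by (rule norm_integral_le_nn_integral)
      also have "\<dots> \<le> (\<integral>\<^sup>+s. (\<integral>\<^sup>+y. ?A s y \<partial>lborel) + (\<integral>\<^sup>+y. ?B s y \<partial>lborel) \<partial>lborel)"
      proof (rule nn_integral_mono)
        fix s :: real
        show "ennreal (norm (indicator {0<..} s * (exp (- s) * (\<integral>y. heat s (y - x) * F y $ i \<partial>lborel)))) \<le>
            (\<integral>\<^sup>+y. ?A s y \<partial>lborel) + (\<integral>\<^sup>+y. ?B s y \<partial>lborel)"
        proof (cases "s > 0")
          case s: True
          let ?a = "\<integral>y. norm (F y) * \<bar>dgauss1 s (y $ j - x $ j)\<bar> \<partial>lborel"
          let ?b = "\<integral>y. \<bar>f y\<bar> * gauss1 s (y $ j - x $ j) \<partial>lborel"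
          have a0: "0 \<le> ?a" "0 \<le> ?b"
            using gauss1_nonneg[OF s] by (auto intro!: integral_nonneg_AE)
          have "exp (- s) * \<bar>\<integral>y. heat s (y - x) * F y $ i \<partial>lborel\<bar> \<le> exp (- s) * (?a + ?b)"
            by (intro mult_left_mono planar_heat_pairing[OF F f test ij s]) auto
          \<comment> \<open>The term with \<open>dgauss1\<close> converges in time by itself. The
            term with \<open>gauss1\<close> decays only like \<open>s powr (- 1/2)\<close> and has
            to keep the factor \<open>exp (- s)\<close>.\<close>
          also have "\<dots> \<le> ?a + exp (- s) * ?b"
            using s a0 by (simp add: distrib_left mult_left_le_one_le)
          finally have "ennreal (norm (indicator {0<..} s * (exp (- s) * (\<integral>y. heat s (y - x) * F y $ i \<partial>lborel)))) \<le>
              ennreal ?a + ennreal (exp (- s) * ?b)"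
            using s a0 by (simp add: abs_mult ennreal_plus[symmetric] ennreal_leI del: ennreal_plus)
          also have "\<dots> \<le> (\<integral>\<^sup>+y. ?A s y \<partial>lborel) + (\<integral>\<^sup>+y. ?B s y \<partial>lborel)"
          proof (rule add_mono)
            have "ennreal ?a = ennreal (norm ?a)" using a0 by simp
            also have "\<dots> \<le> (\<integral>\<^sup>+y. ennreal (norm (norm (F y) * \<bar>dgauss1 s (y $ j - x $ j)\<bar>)) \<partial>lborel)"
              by (rule norm_integral_le_nn_integral)
            also have "\<dots> = (\<integral>\<^sup>+y. ?A s y \<partial>lborel)"
              using s by (intro nn_integral_cong) (simp add: abs_mult ennreal_mult)
            finally show "ennreal ?a \<le> (\<integral>\<^sup>+y. ?A s y \<partial>lborel)" .
            have eq_b: "exp (- s) * ?b = (\<integral>y. \<bar>f y\<bar> * (exp (- s) * gauss1 s (y $ j - x $ j)) \<partial>lborel)"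
              by (subst integral_mult_right_zero[symmetric]) (simp add: mult.left_commute)
            have "0 \<le> exp (- s) * ?b" using a0(2) by simp
            then have "ennreal (exp (- s) * ?b) = ennreal (norm (exp (- s) * ?b))"
              by (simp only: real_norm_def abs_of_nonneg)
            also have "\<dots> = ennreal (norm (\<integral>y. \<bar>f y\<bar> * (exp (- s) * gauss1 s (y $ j - x $ j)) \<partial>lborel))"
              by (simp only: eq_b)
            also have "\<dots> \<le> (\<integral>\<^sup>+y. ennreal (norm (\<bar>f y\<bar> * (exp (- s) * gauss1 s (y $ j - x $ j)))) \<partial>lborel)"
              by (rule norm_integral_le_nn_integral)
            also have "\<dots> = (\<integral>\<^sup>+y. ?B s y \<partial>lborel)"
              using s gauss1_nonneg[OF s] by (intro nn_integral_cong) (simp add: abs_mult ennreal_mult)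
            finally show "ennreal (exp (- s) * ?b) \<le> (\<integral>\<^sup>+y. ?B s y \<partial>lborel)" .
          qed
          finally show ?thesis .
        qed simp
      qed
      also have "\<dots> = (\<integral>\<^sup>+s. \<integral>\<^sup>+y. ?A s y \<partial>lborel \<partial>lborel) + (\<integral>\<^sup>+s. \<integral>\<^sup>+y. ?B s y \<partial>lborel \<partial>lborel)"
        by (rule nn_integral_add) measurable
      also have "(\<integral>\<^sup>+s. \<integral>\<^sup>+y. ?A s y \<partial>lborel \<partial>lborel) = (\<integral>\<^sup>+y. \<integral>\<^sup>+s. ?A s y \<partial>lborel \<partial>lborel)"
        by (rule lborel_pair.Fubini') measurable
      also have "(\<integral>\<^sup>+s. \<integral>\<^sup>+y. ?B s y \<partial>lborel \<partial>lborel) = (\<integral>\<^sup>+y. \<integral>\<^sup>+s. ?B s y \<partial>lborel \<partial>lborel)"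
        by (rule lborel_pair.Fubini') measurable
      also have "(\<integral>\<^sup>+y. \<integral>\<^sup>+s. ?A s y \<partial>lborel \<partial>lborel) \<le> (\<integral>\<^sup>+y. ennreal (norm (F y)) * 6 \<partial>lborel)"
      proof (rule nn_integral_mono)
        fix y
        have "(\<integral>\<^sup>+s. ?A s y \<partial>lborel) = ennreal (norm (F y)) * (\<integral>\<^sup>+s. ennreal \<bar>dgauss1 s (y $ j - x $ j)\<bar> * indicator {0<..} s \<partial>lborel)"
          by (rule nn_integral_cmult) measurable
        also have "\<dots> \<le> ennreal (norm (F y)) * 6"
          by (intro mult_left_mono nn_integral_dgauss1_time) auto
        finally show "(\<integral>\<^sup>+s. ?A s y \<partial>lborel) \<le> ennreal (norm (F y)) * 6" .
      qed
      also have "(\<integral>\<^sup>+y. ennreal (norm (F y)) * 6 \<partial>lborel) = ennreal (\<integral>y. norm (F y) \<partial>lborel) * 6"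
        using F by (simp add: nn_integral_multc nn_integral_eq_integral)
      also have "(\<integral>\<^sup>+y. \<integral>\<^sup>+s. ?B s y \<partial>lborel \<partial>lborel) \<le> (\<integral>\<^sup>+y. ennreal \<bar>f y\<bar> * ennreal K \<partial>lborel)"
      proof (rule nn_integral_mono)
        fix y
        have "(\<integral>\<^sup>+s. ?B s y \<partial>lborel) = ennreal \<bar>f y\<bar> * (\<integral>\<^sup>+s. ennreal (exp (- s) * gauss1 s (y $ j - x $ j)) * indicator {0<..} s \<partial>lborel)"
          by (rule nn_integral_cmult) measurable
        also have "\<dots> \<le> ennreal \<bar>f y\<bar> * ennreal K"
          unfolding K[symmetric]
          by (intro mult_left_mono nn_integral_mono)
            (auto split: split_indicator intro!: ennreal_leI mult_left_mono gauss1_le_powr)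
        finally show "(\<integral>\<^sup>+s. ?B s y \<partial>lborel) \<le> ennreal \<bar>f y\<bar> * ennreal K" .
      qed
      also have "(\<integral>\<^sup>+y. ennreal \<bar>f y\<bar> * ennreal K \<partial>lborel) = ennreal (\<integral>y. \<bar>f y\<bar> \<partial>lborel) * ennreal K"
        using f by (simp add: nn_integral_multc nn_integral_eq_integral)
      also have "ennreal (\<integral>y. norm (F y) \<partial>lborel) * 6 + ennreal (\<integral>y. \<bar>f y\<bar> \<partial>lborel) * ennreal K \<le> ennreal L * 6 + ennreal L * ennreal K"
        by (intro add_mono mult_right_mono ennreal_leI L) auto
      also have "\<dots> = ennreal ((6 + K) * L)"
      proof -
        have "ennreal L * 6 = ennreal (L * 6)" using L0 by (simp add: ennreal_mult)
        then show ?thesis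
          using L0 K0 by (simp add: ennreal_mult[symmetric] ennreal_plus[symmetric] algebra_simps del: ennreal_plus)
      qed
      finally show "\<bar>heat.potential (\<lambda>y. F y $ i) x\<bar> \<le> (6 + K) * L"
        using L0 K0 by (simp add: ennreal_le_iff)
    qed
  qed
qed

section \<open>The system\<close>

lemma borel_imp_lebesgue_measurable:
  "f \<in> borel_measurable borel \<Longrightarrow> f \<in> borel_measurable lebesgue"
  by (simp add: measurable_completion)

lemma integral_lebesgue_eq_lborel:
  fixes f f' :: "'a::euclidean_space \<Rightarrow> 'b::{banach, second_countable_topology}"
  assumes "f \<in> borel_measurable lebesgue" "f' \<in> borel_measurable borel" "AE x in lebesgue. f x = f' x"
  shows "(\<integral>x. f x \<partial>lebesgue) = (\<integral>x. f' x \<partial>lborel)"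
proof -
  have "(\<integral>x. f x \<partial>lebesgue) = (\<integral>x. f' x \<partial>lebesgue)"
    by (rule integral_cong_AE[OF assms(1) borel_imp_lebesgue_measurable[OF assms(2)] assms(3)])
  also have "\<dots> = (\<integral>x. f' x \<partial>lborel)"
    by (rule integral_completion) (simp add: assms)
  finally show ?thesis .
qed

lemma borel_representative_real:
  fixes f :: "'a::euclidean_space \<Rightarrow> real"
  assumes "f \<in> borel_measurable lebesgue"
  obtains f' where "f' \<in> borel_measurable borel" "AE x in lebesgue. f x = f' x"
  using completion_ex_borel_measurable_real[OF assms] by (auto dest: AE_completion)

lemma borel_representative_vec:
  fixes F :: "'a::euclidean_space \<Rightarrow> real ^ 'm"
  assumes F: "F \<in> borel_measurable lebesgue"
  obtains F' where "F' \<in> borel_measurable borel" "AE x in lebesgue. F x = F' x"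
proof -
  have "\<exists>g. g \<in> borel_measurable borel \<and> (AE x in lebesgue. F x $ i = g x)" for i
    using borel_representative_real[OF borel_measurable_component[OF F, of i]] by metis
  then obtain g where g: "\<And>i. g i \<in> borel_measurable borel" "\<And>i. AE x in lebesgue. F x $ i = g i x"
    by metis
  have "AE x in lebesgue. \<forall>i\<in>UNIV. F x $ i = g i x"
    by (rule AE_finite_allI) (simp_all add: g)
  then have "AE x in lebesgue. F x = (\<chi> i. g i x)" by eventually_elim (simp add: vec_eq_iff)
  then show ?thesis using that[OF borel_measurable_vec_lambda[of g, OF g(1)]] by blast
qed

lemma nn_integral_powr_lebesgue:
  fixes f f' :: "real ^ 'n \<Rightarrow> 'b :: {banach, second_countable_topology}"
  assumes "AE x in lebesgue. f x = f' x"
  shows "(\<integral>\<^sup>+x. ennreal (norm (f x) powr p) \<partial>lebesgue) = (\<integral>\<^sup>+x. ennreal (norm (f' x) powr p) \<partial>lborel)"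
proof -
  have "(\<integral>\<^sup>+x. ennreal (norm (f x) powr p) \<partial>lebesgue) = (\<integral>\<^sup>+x. ennreal (norm (f' x) powr p) \<partial>lebesgue)"
    by (rule nn_integral_cong_AE) (use assms in eventually_elim, simp)
  then show ?thesis by (simp add: nn_integral_completion)
qed

lemma in_L1_representative:
  fixes f f' :: "real ^ 'n \<Rightarrow> 'b :: {banach, second_countable_topology}"
  assumes f: "in_Lp 1 f" and f': "f' \<in> borel_measurable borel" "AE x in lebesgue. f x = f' x"
  shows "integrable lborel f'" "Lp_norm 1 f = ennreal (\<integral>x. norm (f' x) \<partial>lborel)"
proof -
  have I: "(\<integral>\<^sup>+x. ennreal (norm (f x) powr enn2real 1) \<partial>lebesgue) = (\<integral>\<^sup>+x. ennreal (norm (f' x)) \<partial>lborel)"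
    using nn_integral_powr_lebesgue[OF f'(2), of 1] by simp
  have fin: "(\<integral>\<^sup>+x. ennreal (norm (f' x)) \<partial>lborel) < \<infinity>"
    using f unfolding in_Lp_def Lp_norm_def I Let_def by (auto simp: less_top split: if_splits)
  show i: "integrable lborel f'" by (rule integrableI_bounded) (use f' fin in auto)
  have "Lp_norm 1 f = (\<integral>\<^sup>+x. ennreal (norm (f' x)) \<partial>lborel)"
    unfolding Lp_norm_def I Let_def using fin by (simp add: less_top)
  also have "\<dots> = ennreal (\<integral>x. norm (f' x) \<partial>lborel)"
    by (rule nn_integral_eq_integral) (use i in auto)
  finally show "Lp_norm 1 f = ennreal (\<integral>x. norm (f' x) \<partial>lborel)" .
qed

lemma Lp_norm_le:
  fixes f :: "real ^ 'n \<Rightarrow> 'b :: real_normed_vector"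
  assumes "p \<ge> 1" "X \<ge> 0" and I: "(\<integral>\<^sup>+x. ennreal (norm (f x) powr p) \<partial>lborel) \<le> ennreal (X powr p)"
  shows "Lp_norm (ennreal p) f \<le> ennreal X"
proof -
  let ?I = "\<integral>\<^sup>+x. ennreal (norm (f x) powr p) \<partial>lborel"
  have fin: "?I \<noteq> \<infinity>" using I by (auto simp: top_unique)
  have "enn2real ?I \<le> X powr p" by (rule enn2real_leI[OF _ I]) simp
  then have "enn2real ?I powr (1 / p) \<le> (X powr p) powr (1 / p)"
    using assms by (intro powr_mono2) auto
  also have "\<dots> = X" using assms by (simp add: powr_powr)
  finally show ?thesis
    using fin assms unfolding Lp_norm_def Let_def nn_integral_completion by (auto intro: ennreal_leI)
qed

lemma in_Lp_powr_integrable: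
  fixes f f' :: "real ^ 'n \<Rightarrow> 'b :: {banach, second_countable_topology}"
  assumes f: "in_Lp (ennreal p) f" and f': "f' \<in> borel_measurable borel" "AE x in lebesgue. f x = f' x"
    and p: "p \<ge> 0"
  shows "integrable lborel (\<lambda>x. norm (f' x) powr p)"
proof (rule integrableI_bounded)
  show "(\<lambda>x. norm (f' x) powr p) \<in> borel_measurable lborel" using f'(1) by measurable
  show "(\<integral>\<^sup>+x. ennreal (norm (norm (f' x) powr p)) \<partial>lborel) < \<infinity>"
    using f p unfolding in_Lp_def Lp_norm_def Let_def
    by (auto simp: less_top nn_integral_powr_lebesgue[OF f'(2)] split: if_splits)
qed

text \<open>A substitute for Minkowski: the sum is at most \<open>card I\<close> times its largest
  term, and the power of that term is at most the sum of all powers. The second factor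
  \<open>card I\<close> stems from this sum and is absorbed by
  \<open>card I \<le> card I powr p\<close>.\<close>

lemma nn_integral_powr_sum_le:
  fixes f :: "real ^ 'n \<Rightarrow> 'b :: real_normed_vector" and g :: "'k \<Rightarrow> real ^ 'n \<Rightarrow> real"
  assumes I: "finite I" "I \<noteq> {}" and p: "p \<ge> 1" and K: "K \<ge> 0"
    and f: "\<And>x. norm (f x) \<le> (\<Sum>k\<in>I. \<bar>g k x\<bar>)"
    and g [measurable]: "\<And>k. k \<in> I \<Longrightarrow> g k \<in> borel_measurable borel"
    and le: "\<And>k. k \<in> I \<Longrightarrow> (\<integral>\<^sup>+x. ennreal (\<bar>g k x\<bar> powr p) \<partial>lborel) \<le> ennreal (K powr p)"
  shows "(\<integral>\<^sup>+x. ennreal (norm (f x) powr p) \<partial>lborel) \<le> ennreal (((real (card I))\<^sup>2 * K) powr p)"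
proof -
  let ?c = "real (card I)"
  have c1: "?c \<ge> 1" using I by (simp add: Suc_le_eq card_gt_0_iff)
  have pt: "norm (f x) powr p \<le> ?c powr p * (\<Sum>k\<in>I. \<bar>g k x\<bar> powr p)" for x
  proof -
    have "Max ((\<lambda>k. \<bar>g k x\<bar>) ` I) \<in> (\<lambda>k. \<bar>g k x\<bar>) ` I" using I by (intro Max_in) auto
    then obtain m where m: "m \<in> I" "\<bar>g m x\<bar> = Max ((\<lambda>k. \<bar>g k x\<bar>) ` I)" by auto
    have max: "\<bar>g k x\<bar> \<le> \<bar>g m x\<bar>" if "k \<in> I" for k using I that by (simp add: m(2))
    have "norm (f x) \<le> ?c * \<bar>g m x\<bar>"
      using order_trans[OF f sum_bounded_above[of I "\<lambda>k. \<bar>g k x\<bar>" "\<bar>g m x\<bar>"]] max by simp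
    then have "norm (f x) powr p \<le> (?c * \<bar>g m x\<bar>) powr p" using p by (intro powr_mono2) auto
    also have "\<dots> = ?c powr p * \<bar>g m x\<bar> powr p" by (simp add: powr_mult)
    also have "\<dots> \<le> ?c powr p * (\<Sum>k\<in>I. \<bar>g k x\<bar> powr p)"
      using m(1) I(1) by (intro mult_left_mono member_le_sum) auto
    finally show ?thesis .
  qed
  have "(\<integral>\<^sup>+x. ennreal (norm (f x) powr p) \<partial>lborel) \<le>
      (\<integral>\<^sup>+x. ennreal (?c powr p) * (\<Sum>k\<in>I. ennreal (\<bar>g k x\<bar> powr p)) \<partial>lborel)"
    using pt by (intro nn_integral_mono) (simp add: sum_ennreal ennreal_mult'[symmetric] sum_nonneg ennreal_leI)
  also have "\<dots> = ennreal (?c powr p) * (\<Sum>k\<in>I. \<integral>\<^sup>+x. ennreal (\<bar>g k x\<bar> powr p) \<partial>lborel)"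
    by (subst nn_integral_cmult) (auto simp: nn_integral_sum simp del: sum_ennreal)
  also have "\<dots> \<le> ennreal (?c powr p) * (\<Sum>k\<in>I. ennreal (K powr p))"
    by (intro mult_left_mono sum_mono le) auto
  also have "\<dots> = ennreal (?c powr p * (?c * K powr p))"
    by (simp add: ennreal_mult' ennreal_of_nat_eq_real_of_nat)
  also have "\<dots> \<le> ennreal ((?c\<^sup>2 * K) powr p)"
  proof (rule ennreal_leI)
    have "?c \<le> ?c powr p" using powr_mono[of 1 p ?c] p c1 by simp
    then have "?c powr p * (?c * K powr p) \<le> ?c powr p * (?c powr p * K powr p)"
      by (intro mult_left_mono mult_right_mono) auto
    then show "?c powr p * (?c * K powr p) \<le> (?c\<^sup>2 * K) powr p"
      using K by (simp add: powr_mult power2_eq_square mult_ac)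
  qed
  finally show ?thesis .
qed

lemma norm_vec_le_sum: "norm (v :: 'a::real_normed_vector ^ 'n) \<le> (\<Sum>i\<in>UNIV. norm (v $ i))"
  unfolding norm_vec_def by (rule L2_set_le_sum) simp

text \<open>The entries may lie in any Euclidean space, so two applications cover matrix-valued
  functions.\<close>

lemma integrable_vec_lambda:
  fixes f :: "'n::finite \<Rightarrow> 'a \<Rightarrow> 'b::euclidean_space"
  assumes "\<And>i. integrable M (f i)"
  shows "integrable M (\<lambda>x. \<chi> i. f i x)"
proof -
  have bl: "bounded_linear (axis i :: 'b \<Rightarrow> 'b ^ 'n)" for i
  proof (rule bounded_linear_intro[where K = 1])
    show "norm (axis i v :: 'b ^ 'n) \<le> norm v * 1" for v
      using norm_vec_le_sum[of "axis i v :: 'b ^ 'n"] by (simp add: axis_def if_distrib[of norm] cong: if_cong)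
  qed (auto simp: vec_eq_iff axis_def)
  have "(\<lambda>x. \<chi> i. f i x) = (\<lambda>x. \<Sum>i\<in>UNIV. axis i (f i x))"
    by (auto simp: fun_eq_iff vec_eq_iff axis_def)
  then show ?thesis
    using integrable_bounded_linear[OF bl assms] by simp
qed

lemma integrable_lborel_imp_locally_integrable:
  fixes f :: "real ^ 'n \<Rightarrow> 'b :: {banach, second_countable_topology}"
  assumes "integrable lborel f"
  shows "locally_integrable f"
  unfolding locally_integrable_def
proof (intro allI impI)
  fix K :: "(real ^ 'n) set" assume "compact K"
  then have "K \<in> sets lebesgue" by (simp add: borel_compact)
  moreover have "integrable lebesgue f" using assms integrable_completion[of f lborel] by auto
  ultimately show "set_integrable lebesgue K f"
    unfolding set_integrable_def by (rule integrable_mult_indicator)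
qed

text \<open>The data after passage to Borel representatives, with one number \<open>L\<close>
  bounding both masses.\<close>

definition div_bounded :: "(real ^ 'n \<Rightarrow> real ^ 'n) \<Rightarrow> (real ^ 'n \<Rightarrow> real) \<Rightarrow> real \<Rightarrow> bool" where
  "div_bounded F f L \<longleftrightarrow> integrable lborel F \<and> integrable lborel f \<and>
     (\<forall>\<phi>. test_function \<phi> \<longrightarrow> (\<integral>x. F x \<bullet> grad \<phi> x \<partial>lborel) = - (\<integral>x. f x * \<phi> x \<partial>lborel)) \<and>
     (\<integral>x. norm (F x) \<partial>lborel) \<le> L \<and> (\<integral>x. \<bar>f x\<bar> \<partial>lborel) \<le> L"

lemma div_bounded_nonneg:
  assumes "div_bounded F f L"
  shows "0 \<le> L"
proof -
  have "0 \<le> (\<integral>x. norm (F x) \<partial>lborel)" by (intro integral_nonneg_AE) auto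
  also have "\<dots> \<le> L" using assms by (simp add: div_bounded_def)
  finally show ?thesis .
qed

context parabolic_kernel
begin

text \<open>Only the degenerate case is added to \<open>potential_Lq_bound\<close>: if
  \<open>L\<close> is not positive then \<open>F\<close> vanishes almost everywhere, and so do its
  potentials.\<close>

lemma potential_Lq_bound':
  assumes q: "q > 1" "1 / p + 1 / q = 1"
  obtains C where "C > 0"
    "\<And>(F :: real ^ 'n \<Rightarrow> real ^ 'n) f L i. div_bounded F f L \<Longrightarrow>
      (\<integral>\<^sup>+x. ennreal (\<bar>potential (\<lambda>y. F y $ i) x\<bar> powr q) \<partial>lborel) \<le> ennreal ((C * L) powr q)"
proof -
  obtain C where C: "C > 0"
    "\<And>(F :: real ^ 'n \<Rightarrow> real ^ 'n) f L i. integrable lborel F \<Longrightarrow> integrable lborel f \<Longrightarrow>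
      (\<And>\<phi>. test_function \<phi> \<Longrightarrow> (\<integral>x. F x \<bullet> grad \<phi> x \<partial>lborel) = - (\<integral>x. f x * \<phi> x \<partial>lborel)) \<Longrightarrow>
      (\<integral>x. norm (F x) \<partial>lborel) \<le> L \<Longrightarrow> (\<integral>x. \<bar>f x\<bar> \<partial>lborel) \<le> L \<Longrightarrow> L > 0 \<Longrightarrow>
      (\<integral>\<^sup>+x. ennreal (\<bar>potential (\<lambda>y. F y $ i) x\<bar> powr q) \<partial>lborel) \<le> ennreal ((C * L) powr q)"
    using potential_Lq_bound[OF q] by blast
  show ?thesis
  proof (rule that[OF C(1)])
    fix F :: "real ^ 'n \<Rightarrow> real ^ 'n" and f L i
    assume "div_bounded F f L"
    then have F: "integrable lborel F" and f: "integrable lborel f"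
      and test: "\<And>\<phi>. test_function \<phi> \<Longrightarrow> (\<integral>x. F x \<bullet> grad \<phi> x \<partial>lborel) = - (\<integral>x. f x * \<phi> x \<partial>lborel)"
      and L: "(\<integral>x. norm (F x) \<partial>lborel) \<le> L" "(\<integral>x. \<bar>f x\<bar> \<partial>lborel) \<le> L"
      by (simp_all add: div_bounded_def)
    show "(\<integral>\<^sup>+x. ennreal (\<bar>potential (\<lambda>y. F y $ i) x\<bar> powr q) \<partial>lborel) \<le> ennreal ((C * L) powr q)"
    proof (cases "L > 0")
      case True
      then show ?thesis using C(2)[OF F f test L] by blast
    next
      case False
      have "0 \<le> (\<integral>x. norm (F x) \<partial>lborel)" by (intro integral_nonneg_AE) auto
      with False L(1) have "(\<integral>x. norm (F x) \<partial>lborel) = 0" by linarith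
      then have F0: "AE x in lborel. F x = 0"
        using integral_nonneg_eq_0_iff_AE[OF integrable_norm[OF F]] by simp
      have [measurable]: "F \<in> borel_measurable borel" using F by auto
      have "potential (\<lambda>y. F y $ i) x = 0" for x
        unfolding potential_def using F0 by (intro integral_eq_zero_AE) auto
      then show ?thesis using q by simp
    qed
  qed
qed

end

section \<open>The equation against test functions, and uniqueness\<close>

lemma test_function_helmholtz:
  fixes \<phi> :: "real ^ 'n \<Rightarrow> real"
  assumes \<phi>: "test_function \<phi>"
  obtains B R where "(\<lambda>x. \<phi> x - laplacian \<phi> x) \<in> borel_measurable borel"
    "\<And>x. \<bar>\<phi> x - laplacian \<phi> x\<bar> \<le> B" "\<And>x. norm x > R \<Longrightarrow> \<phi> x - laplacian \<phi> x = 0"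
proof -
  obtain M where M: "\<And>x. \<bar>\<phi> x\<bar> \<le> M" using test_function_bounded[OF \<phi>] by metis
  obtain M' where M': "laplacian \<phi> \<in> borel_measurable borel" "\<And>x. \<bar>laplacian \<phi> x\<bar> \<le> M'"
    using laplacian_test_function[OF \<phi>] by metis
  obtain R where R: "\<And>x. norm x > R \<Longrightarrow> \<phi> x = 0" using test_function_support[OF \<phi>] by metis
  have "\<phi> \<in> borel_measurable borel" using test_function_integrable[OF \<phi>] by auto
  then have "(\<lambda>x. \<phi> x - laplacian \<phi> x) \<in> borel_measurable borel" using M'(1) by simp
  moreover have "\<bar>\<phi> x - laplacian \<phi> x\<bar> \<le> M + M'" for x using M[of x] M'(2)[of x] by linarith
  moreover have "\<phi> x - laplacian \<phi> x = 0" if "norm x > R" for x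
  proof -
    have "partial_deriv j (partial_deriv j \<phi>) x = 0" for j
      by (rule partial_deriv_eq_0_outside[OF partial_deriv_eq_0_outside[OF R] that])
    then show ?thesis using R[OF that] by (simp add: laplacian_def)
  qed
  ultimately show ?thesis using that by blast
qed

text \<open>Each component of the difference solves the homogeneous equation. The known solution
  \<open>U\<close> is integrable and \<open>V'\<close> is bounded by an integrable function plus a
  constant, so the difference falls under \<open>helmholtz_unique\<close>.\<close>

lemma solves_system_unique:
  fixes U V V' F :: "real ^ 'n \<Rightarrow> real ^ 'n"
  assumes U: "solves_system U F" "integrable lborel U"
    and V: "solves_system V F" "V \<in> borel_measurable lebesgue"
    and V' [measurable]: "V' \<in> borel_measurable borel" and VV': "AE x in lebesgue. V x = V' x"
    and a: "integrable lborel a" "\<And>x. 0 \<le> a x" and M: "0 \<le> M" and bound: "\<And>x. norm (V' x) \<le> a x + M"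
  shows "AE x in lebesgue. V x = U x"
proof -
  have [measurable]: "U \<in> borel_measurable borel" "a \<in> borel_measurable borel" using U a by auto
  have le: "\<bar>V' x $ i - U x $ i\<bar> \<le> (a x + norm (U x)) + M" for x i
    using component_le_norm_cart[of "V' x" i] component_le_norm_cart[of "U x" i] bound[of x] by linarith
  have locb: "integrable lborel (\<lambda>x. indicator (cball 0 R) x * V' x $ i)" for R i
  proof (rule Bochner_Integration.integrable_bound)
    have "emeasure lborel (cball (0 :: real ^ 'n) R) < \<infinity>" by (intro emeasure_lborel_cball_finite)
    then show "integrable lborel (\<lambda>x. a x + indicator (cball (0 :: real ^ 'n) R) x * M)"
      by (intro Bochner_Integration.integrable_add a integrable_mult_left integrable_real_indicator) auto
    show "AE x in lborel. norm (indicator (cball 0 R) x * V' x $ i) \<le> norm (a x + indicator (cball 0 R) x * M)"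
    proof (rule AE_I2)
      fix x :: "real ^ 'n"
      show "norm (indicator (cball 0 R) x * V' x $ i) \<le> norm (a x + indicator (cball 0 R) x * M)"
        using component_le_norm_cart[of "V' x" i] bound[of x] a(2)[of x] M by (auto split: split_indicator)
    qed
    show "(\<lambda>x. indicator (cball 0 R) x * V' x $ i) \<in> borel_measurable lborel"
      by (intro borel_measurable_times borel_measurable_component) (auto intro!: borel_measurable_indicator)
  qed
  have "AE x in lborel. V' x $ i - U x $ i = 0" for i
  proof (rule helmholtz_unique)
    show "(\<lambda>x. V' x $ i - U x $ i) \<in> borel_measurable borel"
      by (intro borel_measurable_diff borel_measurable_component) auto
    show "integrable lborel (\<lambda>x. indicator (cball 0 R) x * (V' x $ i - U x $ i))" for R
      unfolding right_diff_distrib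
      by (intro Bochner_Integration.integrable_diff locb integrable_imp_locally integrable_component U)
    show "\<bar>V' x $ i - U x $ i\<bar> \<le> (a x + norm (U x)) + M" for x by (rule le)
    show "integrable lborel (\<lambda>x. a x + norm (U x))" using a U by auto
    show "0 \<le> a x + norm (U x)" for x using a(2)[of x] by simp
    show "0 \<le> M" by (rule M)
    fix \<phi> :: "real ^ 'n \<Rightarrow> real" assume \<phi>: "test_function \<phi>"
    let ?g = "\<lambda>x. \<phi> x - laplacian \<phi> x"
    obtain B R where g: "?g \<in> borel_measurable borel" "\<And>x. \<bar>?g x\<bar> \<le> B" "\<And>x. norm x > R \<Longrightarrow> ?g x = 0"
      using test_function_helmholtz[OF \<phi>] by blast
    have ind: "(indicator (cball 0 R) x * V' x $ i) * ?g x = V' x $ i * ?g x" for x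
      using g(3)[of x] by (cases "norm x > R") (auto split: split_indicator)
    have iV: "integrable lborel (\<lambda>x. V' x $ i * ?g x)"
      using integrable_bounded_mult'[OF locb[of R i], of ?g B] g by (simp add: ind)
    have iU: "integrable lborel (\<lambda>x. U x $ i * ?g x)"
      using integrable_bounded_mult'[OF integrable_component[OF U(2), of i], of ?g B] g by simp
    have mg: "?g \<in> borel_measurable lebesgue" by (rule borel_imp_lebesgue_measurable[OF g(1)])
    have "(\<integral>x. V' x $ i * ?g x \<partial>lborel) = (\<integral>x. V x $ i * ?g x \<partial>lebesgue)"
    proof (rule integral_lebesgue_eq_lborel[symmetric])
      show "(\<lambda>x. V x $ i * ?g x) \<in> borel_measurable lebesgue"
        by (rule borel_measurable_times[OF borel_measurable_component[OF V(2)] mg])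
      show "(\<lambda>x. V' x $ i * ?g x) \<in> borel_measurable borel"
        by (rule borel_measurable_times[OF borel_measurable_component[OF V'] g(1)])
      show "AE x in lebesgue. V x $ i * ?g x = V' x $ i * ?g x"
        using VV' by eventually_elim simp
    qed
    also have "\<dots> = (\<integral>x. U x $ i * ?g x \<partial>lebesgue)"
      using V(1) U(1) \<phi> unfolding solves_system_def by simp
    also have "\<dots> = (\<integral>x. U x $ i * ?g x \<partial>lborel)"
      by (rule integral_completion) (use iU in auto)
    finally show "(\<integral>x. (V' x $ i - U x $ i) * ?g x \<partial>lborel) = 0"
      unfolding left_diff_distrib by (simp add: Bochner_Integration.integral_diff[OF iV iU])
  qed
  then have "AE x in lborel. \<forall>i\<in>UNIV. V' x $ i - U x $ i = 0"
    by (intro AE_finite_allI) auto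
  then have "AE x in lebesgue. \<forall>i\<in>UNIV. V' x $ i - U x $ i = 0" by (rule AE_completion)
  with VV' show ?thesis by eventually_elim (simp add: vec_eq_iff)
qed

text \<open>As \<open>q \<ge> 1\<close>, the norm is at most its \<open>q\<close>-th power plus 1: a
  function in \<open>L^q\<close> is bounded by an integrable function plus a constant.\<close>

lemma solves_system_unique_Lp:
  fixes U V F :: "real ^ 'n \<Rightarrow> real ^ 'n"
  assumes U: "solves_system U F" "integrable lborel U"
    and V: "solves_system V F" "in_Lp (ennreal q) V" and q: "q \<ge> 1"
  shows "AE x in lebesgue. V x = U x"
proof -
  have m: "V \<in> borel_measurable lebesgue" using V(2) by (simp add: in_Lp_def)
  obtain V' where V': "V' \<in> borel_measurable borel" "AE x in lebesgue. V x = V' x"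
    using borel_representative_vec[OF m] by blast
  show ?thesis
  proof (rule solves_system_unique[OF U V(1) m V', of "\<lambda>x. norm (V' x) powr q" 1])
    show "integrable lborel (\<lambda>x. norm (V' x) powr q)"
      using in_Lp_powr_integrable[OF V(2) V'] q by simp
    show "norm (V' x) \<le> norm (V' x) powr q + 1" for x
    proof (cases "norm (V' x) \<le> 1")
      case False
      then show ?thesis using powr_mono[of 1 q "norm (V' x)"] q by simp
    qed (simp add: add_increasing)
  qed auto
qed

lemma solves_system_unique_Linf:
  fixes U V F :: "real ^ 'n \<Rightarrow> real ^ 'n"
  assumes U: "solves_system U F" "integrable lborel U"
    and V: "solves_system V F" "in_Lp \<infinity> V"
  shows "AE x in lebesgue. V x = U x"
proof -
  have m: "V \<in> borel_measurable lebesgue" using V(2) by (simp add: in_Lp_def)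
  obtain V' where V': "V' \<in> borel_measurable borel" "AE x in lebesgue. V x = V' x"
    using borel_representative_vec[OF m] by blast
  let ?E = "esssup lebesgue (\<lambda>x. ennreal (norm (V x)))"
  define M where "M = enn2real ?E"
  have "?E < \<infinity>" using V(2) by (simp add: in_Lp_def Lp_norm_def)
  then have E: "?E = ennreal M" by (simp add: M_def)
  have M0: "0 \<le> M" by (simp add: M_def)
  have "AE x in lebesgue. ennreal (norm (V x)) \<le> ?E" by (rule esssup_AE)
  then have Vle: "AE x in lebesgue. norm (V x) \<le> M"
    unfolding E by eventually_elim (use M0 in \<open>simp add: ennreal_le_iff\<close>)
  \<comment> \<open>The Borel representative may exceed the essential supremum on a null set; it is
    reset to 0 there so that the bound holds at every point.\<close>
  define W where "W x = (if norm (V' x) \<le> M then V' x else 0)" for x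
  have W: "W \<in> borel_measurable borel" unfolding W_def[abs_def] using V'(1) by measurable
  have VW: "AE x in lebesgue. V x = W x"
    using V'(2) Vle by eventually_elim (simp add: W_def)
  show ?thesis
    by (rule solves_system_unique[OF U V(1) m W VW, of "\<lambda>x. 0" M]) (auto simp: W_def M0)
qed

section \<open>The solution, its gradient and their estimates\<close>

definition helmholtz_solution :: "(real ^ 'n \<Rightarrow> real ^ 'n) \<Rightarrow> real ^ 'n \<Rightarrow> real ^ 'n" where
  "helmholtz_solution F x = (\<chi> i. heat.potential (\<lambda>y. F y $ i) x)"

definition helmholtz_gradient :: "(real ^ 'n \<Rightarrow> real ^ 'n) \<Rightarrow> real ^ 'n \<Rightarrow> real ^ 'n ^ 'n" where
  "helmholtz_gradient F x = (\<chi> i j. dheat.potential j (\<lambda>y. F y $ i) x)"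

lemma integrable_helmholtz_solution:
  "integrable lborel F \<Longrightarrow> integrable lborel (helmholtz_solution F)"
  unfolding helmholtz_solution_def[abs_def]
  by (intro integrable_vec_lambda heat.integrable_potential integrable_component)

lemma integrable_helmholtz_gradient:
  "integrable lborel F \<Longrightarrow> integrable lborel (helmholtz_gradient F)"
  unfolding helmholtz_gradient_def[abs_def]
  by (intro integrable_vec_lambda dheat.integrable_potential integrable_component)

text \<open>Transposition moves the resolvent kernel onto \<open>\<phi> - \<Delta>\<phi>\<close>,
  where the resolvent identity returns \<open>\<phi>\<close>.\<close>

lemma solves_system_helmholtz_solution:
  fixes F F' :: "real ^ 'n \<Rightarrow> real ^ 'n"
  assumes F: "locally_integrable F" "F \<in> borel_measurable lebesgue"
    and F': "integrable lborel F'" "AE x in lebesgue. F x = F' x"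
  shows "solves_system (helmholtz_solution F') F"
  unfolding solves_system_def
proof (intro conjI allI impI)
  let ?U = "helmholtz_solution F'"
  have U: "integrable lborel ?U" by (rule integrable_helmholtz_solution[OF F'(1)])
  show "locally_integrable ?U" by (rule integrable_lborel_imp_locally_integrable[OF U])
  show "locally_integrable F" by fact
  have [measurable]: "F' \<in> borel_measurable borel" "?U \<in> borel_measurable borel" using F' U by auto
  fix \<phi> :: "real ^ 'n \<Rightarrow> real" and i :: 'n assume \<phi>: "test_function \<phi>"
  obtain B R where g: "(\<lambda>x. \<phi> x - laplacian \<phi> x) \<in> borel_measurable borel"
    "\<And>x. \<bar>\<phi> x - laplacian \<phi> x\<bar> \<le> B" "\<And>x. norm x > R \<Longrightarrow> \<phi> x - laplacian \<phi> x = 0"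
    using test_function_helmholtz[OF \<phi>] by blast
  have \<phi>m: "\<phi> \<in> borel_measurable borel" using test_function_integrable[OF \<phi>] by auto
  have "(\<integral>x. ?U x $ i * (\<phi> x - laplacian \<phi> x) \<partial>lebesgue) = (\<integral>x. ?U x $ i * (\<phi> x - laplacian \<phi> x) \<partial>lborel)"
    proof (rule integral_completion)
    show "(\<lambda>x. ?U x $ i * (\<phi> x - laplacian \<phi> x)) \<in> borel_measurable lborel"
      using borel_measurable_times[OF borel_measurable_component[of ?U borel i] g(1)] by simp
  qed
  also have "\<dots> = (\<integral>x. heat.potential (\<lambda>y. F' y $ i) x * (\<phi> x - laplacian \<phi> x) \<partial>lborel)"
    by (simp add: helmholtz_solution_def)
  also have "\<dots> = (\<integral>y. F' y $ i * conv heat.kint (\<lambda>x. \<phi> x - laplacian \<phi> x) y \<partial>lborel)"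
    by (rule heat.integral_potential_mult[OF integrable_component[OF F'(1)] g(1,2)])
  also have "\<dots> = (\<integral>y. F' y $ i * \<phi> y \<partial>lborel)" by (simp add: conv_kint_helmholtz[OF \<phi>])
  also have "\<dots> = (\<integral>x. F x $ i * \<phi> x \<partial>lebesgue)"
  proof (rule integral_lebesgue_eq_lborel[symmetric])
    show "(\<lambda>x. F x $ i * \<phi> x) \<in> borel_measurable lebesgue"
      by (rule borel_measurable_times[OF borel_measurable_component[OF F(2)] borel_imp_lebesgue_measurable[OF \<phi>m]])
    show "(\<lambda>x. F' x $ i * \<phi> x) \<in> borel_measurable borel"
      by (rule borel_measurable_times[OF borel_measurable_component \<phi>m]) simp
    show "AE x in lebesgue. F x $ i * \<phi> x = F' x $ i * \<phi> x" using F'(2) by eventually_elim simp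
  qed
  finally show "(\<integral>x. ?U x $ i * (\<phi> x - laplacian \<phi> x) \<partial>lebesgue) = (\<integral>x. F x $ i * \<phi> x \<partial>lebesgue)" .
qed

text \<open>The derivative is moved through the transposed kernel at the level of test functions, so
  the singular kernel is never differentiated pointwise.\<close>

lemma has_distr_grad_helmholtz_solution:
  fixes F :: "real ^ 'n \<Rightarrow> real ^ 'n"
  assumes F: "integrable lborel F"
  shows "has_distr_grad (helmholtz_solution F) (helmholtz_gradient F)"
  unfolding has_distr_grad_def
proof (intro conjI allI impI)
  let ?U = "helmholtz_solution F" and ?G = "helmholtz_gradient F"
  have U: "integrable lborel ?U" and G: "integrable lborel ?G"
    by (rule integrable_helmholtz_solution[OF F], rule integrable_helmholtz_gradient[OF F])
  show "locally_integrable ?U" "locally_integrable ?G"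
    by (rule integrable_lborel_imp_locally_integrable, fact)+
  have [measurable]: "?U \<in> borel_measurable borel" using U by auto
  fix \<phi> :: "real ^ 'n \<Rightarrow> real" and i j :: 'n assume \<phi>: "test_function \<phi>"
  have \<phi>j: "test_function (partial_deriv j \<phi>)" by (rule test_function_partial_deriv[OF \<phi>])
  obtain B where B: "\<And>x. \<bar>\<phi> x\<bar> \<le> B" using test_function_bounded[OF \<phi>] by metis
  obtain B' where B': "\<And>x. \<bar>partial_deriv j \<phi> x\<bar> \<le> B'" using test_function_bounded[OF \<phi>j] by metis
  have m: "\<phi> \<in> borel_measurable borel" "partial_deriv j \<phi> \<in> borel_measurable borel"
    using test_function_integrable[OF \<phi>] test_function_integrable[OF \<phi>j] by auto
  have Gm: "(\<lambda>x. ?G x $ i $ j) \<in> borel_measurable borel"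
    using dheat.integrable_potential[OF integrable_component[OF F, of i], of j]
    by (simp add: helmholtz_gradient_def borel_measurable_integrable)
  have "(\<integral>x. ?U x $ i * partial_deriv j \<phi> x \<partial>lebesgue) = (\<integral>x. ?U x $ i * partial_deriv j \<phi> x \<partial>lborel)"
    proof (rule integral_completion)
    show "(\<lambda>x. ?U x $ i * partial_deriv j \<phi> x) \<in> borel_measurable lborel"
      using borel_measurable_times[OF borel_measurable_component[of ?U borel i] m(2)] by simp
  qed
  also have "\<dots> = (\<integral>x. heat.potential (\<lambda>y. F y $ i) x * partial_deriv j \<phi> x \<partial>lborel)"
    by (simp add: helmholtz_solution_def)
  also have "\<dots> = (\<integral>y. F y $ i * conv heat.kint (partial_deriv j \<phi>) y \<partial>lborel)"
    by (rule heat.integral_potential_mult[OF integrable_component[OF F] m(2) B'])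
  also have "\<dots> = - (\<integral>y. F y $ i * conv (dheat.kint j) \<phi> y \<partial>lborel)"
    by (simp add: conv_kint_partial_deriv[OF \<phi>])
  also have "(\<integral>y. F y $ i * conv (dheat.kint j) \<phi> y \<partial>lborel) =
      (\<integral>x. dheat.potential j (\<lambda>y. F y $ i) x * \<phi> x \<partial>lborel)"
    by (rule dheat.integral_potential_mult[OF integrable_component[OF F] m(1) B, symmetric])
  also have "\<dots> = (\<integral>x. ?G x $ i $ j * \<phi> x \<partial>lborel)"
    by (simp add: helmholtz_gradient_def)
  also have "\<dots> = (\<integral>x. ?G x $ i $ j * \<phi> x \<partial>lebesgue)"
    by (rule integral_completion[symmetric]) (use Gm m in auto)
  finally show "(\<integral>x. ?U x $ i * partial_deriv j \<phi> x \<partial>lebesgue) = - (\<integral>x. ?G x $ i $ j * \<phi> x \<partial>lebesgue)" .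
qed

text \<open>The dual exponent is \<open>p = n / 2\<close>, which exceeds 1 exactly when
  \<open>n \<ge> 3\<close>; its conjugate is \<open>n / (n - 2)\<close>.\<close>

lemma heat_potential_Lq_bound:
  assumes n: "CARD('n::finite) \<ge> 3"
  obtains C where "C > 0"
    "\<And>(F :: real ^ 'n \<Rightarrow> real ^ 'n) f L i. div_bounded F f L \<Longrightarrow>
      (\<integral>\<^sup>+x. ennreal (\<bar>heat.potential (\<lambda>y. F y $ i) x\<bar> powr (real CARD('n) / (real CARD('n) - 2))) \<partial>lborel)
        \<le> ennreal ((C * L) powr (real CARD('n) / (real CARD('n) - 2)))"
proof -
  interpret H: parabolic_kernel "heat :: real \<Rightarrow> real ^ 'n \<Rightarrow> real" "5 * 2 ^ CARD('n)" 0
    "\<lambda>s x. (- heat s x / (2 * s)) *\<^sub>R x" "real CARD('n) / 2"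
  proof
    show "(heat s has_derivative (\<lambda>v. ((- heat s x / (2 * s)) *\<^sub>R x) \<bullet> v)) (at x)" if "s > 0" for s and x :: "real ^ 'n"
      by (rule has_derivative_heat[OF that])
    show "continuous_on UNIV (\<lambda>x :: real ^ 'n. (- heat s x / (2 * s)) *\<^sub>R x)" if "s > 0" for s
      by (intro continuous_intros continuous_on_heat that) (use that in auto)
    show "norm ((- heat s x / (2 * s)) *\<^sub>R x) \<le> 5 * 2 ^ CARD('n) * s powr (- 0 - 1 / 2) * heat (2 * s) x"
      if "s > 0" for s and x :: "real ^ 'n"
      using grad_heat_bound[OF that, of x] by simp
  qed (use n in auto)
  let ?q = "real CARD('n) / (real CARD('n) - 2)"
  have q: "?q > 1" "1 / (real CARD('n) / 2) + 1 / ?q = 1" using n by (auto simp: field_simps)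
  show ?thesis
    using H.potential_Lq_bound'[OF q] that by blast
qed

text \<open>With \<open>\<gamma> = 1 / 2\<close> the scaling relation forces \<open>p = n\<close>,
  whose conjugate is \<open>n / (n - 1)\<close>; this includes the plane.\<close>

lemma dheat_potential_Lq_bound:
  fixes j :: "'n::finite"
  assumes n: "CARD('n) \<ge> 2"
  obtains C where "C > 0"
    "\<And>(F :: real ^ 'n \<Rightarrow> real ^ 'n) f L i. div_bounded F f L \<Longrightarrow>
      (\<integral>\<^sup>+x. ennreal (\<bar>dheat.potential j (\<lambda>y. F y $ i) x\<bar> powr (real CARD('n) / (real CARD('n) - 1))) \<partial>lborel)
        \<le> ennreal ((C * L) powr (real CARD('n) / (real CARD('n) - 1)))"
proof -
  interpret D: parabolic_kernel "\<lambda>s (x :: real ^ 'n). - dheat j s x" "5 * 2 ^ CARD('n)" "1 / 2"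
    "\<lambda>s x. - ddheat j s x" "real CARD('n)"
  proof
    show "((\<lambda>x. - dheat j s x) has_derivative (\<lambda>v. (- ddheat j s x) \<bullet> v)) (at x)" if "s > 0" for s and x :: "real ^ 'n"
      using has_derivative_minus[OF has_derivative_dheat[OF that, of j x]] by (simp only: inner_minus_left)
    show "continuous_on UNIV (\<lambda>x :: real ^ 'n. - ddheat j s x)" if "s > 0" for s
      by (intro continuous_intros continuous_on_ddheat that)
    show "norm (- ddheat j s x) \<le> 5 * 2 ^ CARD('n) * s powr (- (1 / 2) - 1 / 2) * heat (2 * s) x"
      if "s > 0" for s and x :: "real ^ 'n"
      using ddheat_bound[OF that, of j x] by simp
  qed (use n in auto)
  let ?q = "real CARD('n) / (real CARD('n) - 1)"
  have q: "?q > 1" "1 / real CARD('n) + 1 / ?q = 1" using n by (auto simp: field_simps)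
  show ?thesis
    using D.potential_Lq_bound'[OF q] that by blast
qed

lemma Lp_norm_helmholtz_solution_le:
  assumes n: "CARD('n::finite) \<ge> 3"
  obtains C where "C > 0"
    "\<And>(F :: real ^ 'n \<Rightarrow> real ^ 'n) f L. div_bounded F f L \<Longrightarrow>
      Lp_norm (ennreal (real CARD('n) / (real CARD('n) - 2))) (helmholtz_solution F) \<le> ennreal (C * L)"
proof -
  let ?q = "real CARD('n) / (real CARD('n) - 2)"
  obtain C where C: "C > 0"
    "\<And>(F :: real ^ 'n \<Rightarrow> real ^ 'n) f L i. div_bounded F f L \<Longrightarrow>
      (\<integral>\<^sup>+x. ennreal (\<bar>heat.potential (\<lambda>y. F y $ i) x\<bar> powr ?q) \<partial>lborel) \<le> ennreal ((C * L) powr ?q)"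
    using heat_potential_Lq_bound[OF n] by blast
  have q: "?q \<ge> 1" using n by (simp add: field_simps)
  show ?thesis
  proof (rule that[of "(real CARD('n))\<^sup>2 * C"])
    show "(real CARD('n))\<^sup>2 * C > 0" using C(1) by simp
    fix F :: "real ^ 'n \<Rightarrow> real ^ 'n" and f L
    assume Ff: "div_bounded F f L"
    then have F: "integrable lborel F" by (simp add: div_bounded_def)
    have L: "0 \<le> L" by (rule div_bounded_nonneg[OF Ff])
    have "(\<integral>\<^sup>+x. ennreal (norm (helmholtz_solution F x) powr ?q) \<partial>lborel) \<le>
        ennreal (((real (card (UNIV :: 'n set)))\<^sup>2 * (C * L)) powr ?q)"
    proof (rule nn_integral_powr_sum_le[where g = "\<lambda>i. heat.potential (\<lambda>y. F y $ i)"])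
      show "norm (helmholtz_solution F x) \<le> (\<Sum>i\<in>UNIV. \<bar>heat.potential (\<lambda>y. F y $ i) x\<bar>)" for x
        using norm_vec_le_sum[of "helmholtz_solution F x"] by (simp add: helmholtz_solution_def)
      show "heat.potential (\<lambda>y. F y $ i) \<in> borel_measurable borel" for i
        using heat.integrable_potential[OF integrable_component[OF F, of i]] by auto
      show "(\<integral>\<^sup>+x. ennreal (\<bar>heat.potential (\<lambda>y. F y $ i) x\<bar> powr ?q) \<partial>lborel) \<le> ennreal ((C * L) powr ?q)" for i
        by (rule C(2)[OF Ff])
    qed (use q C(1) L in auto)
    then show "Lp_norm (ennreal ?q) (helmholtz_solution F) \<le> ennreal ((real CARD('n))\<^sup>2 * C * L)"
      using q C(1) L by (intro Lp_norm_le) (auto simp: mult.assoc)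
  qed
qed

lemma Lp_norm_helmholtz_gradient_le:
  assumes n: "CARD('n::finite) \<ge> 2"
  obtains C where "C > 0"
    "\<And>(F :: real ^ 'n \<Rightarrow> real ^ 'n) f L. div_bounded F f L \<Longrightarrow>
      Lp_norm (ennreal (real CARD('n) / (real CARD('n) - 1))) (helmholtz_gradient F) \<le> ennreal (C * L)"
proof -
  let ?q = "real CARD('n) / (real CARD('n) - 1)"
  define bnd where "bnd j C \<longleftrightarrow> (\<forall>(F :: real ^ 'n \<Rightarrow> real ^ 'n) f L i. div_bounded F f L \<longrightarrow>
      (\<integral>\<^sup>+x. ennreal (\<bar>dheat.potential j (\<lambda>y. F y $ i) x\<bar> powr ?q) \<partial>lborel) \<le> ennreal ((C * L) powr ?q))" for j C
  have "\<exists>C. C > 0 \<and> bnd j C" for j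
  proof (rule dheat_potential_Lq_bound[OF n, of j])
    fix C :: real
    assume "C > 0" and C: "\<And>(F :: real ^ 'n \<Rightarrow> real ^ 'n) f L i. div_bounded F f L \<Longrightarrow>
      (\<integral>\<^sup>+x. ennreal (\<bar>dheat.potential j (\<lambda>y. F y $ i) x\<bar> powr ?q) \<partial>lborel) \<le> ennreal ((C * L) powr ?q)"
    have "bnd j C" unfolding bnd_def by (intro allI impI C)
    with \<open>C > 0\<close> show ?thesis by blast
  qed
  then obtain C where all: "\<And>j. C j > 0 \<and> bnd j (C j)" by metis
  then have C: "\<And>j. C j > 0"
    "\<And>(F :: real ^ 'n \<Rightarrow> real ^ 'n) f L i j. div_bounded F f L \<Longrightarrow>
      (\<integral>\<^sup>+x. ennreal (\<bar>dheat.potential j (\<lambda>y. F y $ i) x\<bar> powr ?q) \<partial>lborel) \<le> ennreal ((C j * L) powr ?q)"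
    unfolding bnd_def by blast+
  \<comment> \<open>Each direction \<open>j\<close> has its own kernel and hence its own constant;
    the sum dominates all of them.\<close>
  define D where "D = (\<Sum>j\<in>UNIV. C j)"
  have CD: "C j \<le> D" for j unfolding D_def using C(1) by (intro member_le_sum) (auto intro: less_imp_le)
  have D0: "D > 0" using order.strict_trans2[OF C(1) CD] .
  have q: "?q \<ge> 1" using n by (simp add: field_simps)
  show ?thesis
  proof (rule that[of "(real (card (UNIV :: ('n \<times> 'n) set)))\<^sup>2 * D"])
    show "(real (card (UNIV :: ('n \<times> 'n) set)))\<^sup>2 * D > 0" using D0 by simp
    fix F :: "real ^ 'n \<Rightarrow> real ^ 'n" and f L
    assume Ff: "div_bounded F f L"
    then have F: "integrable lborel F" by (simp add: div_bounded_def)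
    have L: "0 \<le> L" by (rule div_bounded_nonneg[OF Ff])
    have "(\<integral>\<^sup>+x. ennreal (norm (helmholtz_gradient F x) powr ?q) \<partial>lborel) \<le>
        ennreal (((real (card (UNIV :: ('n \<times> 'n) set)))\<^sup>2 * (D * L)) powr ?q)"
    proof (rule nn_integral_powr_sum_le[where g = "\<lambda>k. dheat.potential (snd k) (\<lambda>y. F y $ fst k)"])
      fix x
      have "norm (helmholtz_gradient F x) \<le> (\<Sum>i\<in>UNIV. \<Sum>j\<in>UNIV. norm (helmholtz_gradient F x $ i $ j))"
        by (rule order_trans[OF norm_vec_le_sum sum_mono[OF norm_vec_le_sum]])
      also have "\<dots> = (\<Sum>k\<in>UNIV \<times> UNIV. \<bar>dheat.potential (snd k) (\<lambda>y. F y $ fst k) x\<bar>)"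
        by (simp add: sum.cartesian_product helmholtz_gradient_def case_prod_beta del: UNIV_Times_UNIV)
      finally show "norm (helmholtz_gradient F x) \<le> (\<Sum>k\<in>UNIV. \<bar>dheat.potential (snd k) (\<lambda>y. F y $ fst k) x\<bar>)"
        by simp
    next
      fix k :: "'n \<times> 'n"
      show "dheat.potential (snd k) (\<lambda>y. F y $ fst k) \<in> borel_measurable borel"
        using dheat.integrable_potential[OF integrable_component[OF F, of "fst k"], of "snd k"] by auto
      have "(\<integral>\<^sup>+x. ennreal (\<bar>dheat.potential (snd k) (\<lambda>y. F y $ fst k) x\<bar> powr ?q) \<partial>lborel)
          \<le> ennreal ((C (snd k) * L) powr ?q)"
        by (rule C(2)[OF Ff])
      also have "\<dots> \<le> ennreal ((D * L) powr ?q)"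
        using q L C(1)[of "snd k"] by (intro ennreal_leI powr_mono2 mult_right_mono CD) auto
      finally show "(\<integral>\<^sup>+x. ennreal (\<bar>dheat.potential (snd k) (\<lambda>y. F y $ fst k) x\<bar> powr ?q) \<partial>lborel)
          \<le> ennreal ((D * L) powr ?q)" .
    qed (use q D0 L in auto)
    then show "Lp_norm (ennreal ?q) (helmholtz_gradient F) \<le>
        ennreal ((real (card (UNIV :: ('n \<times> 'n) set)))\<^sup>2 * D * L)"
      using q D0 L by (intro Lp_norm_le) (auto simp: mult.assoc)
  qed
qed

lemma esssup_helmholtz_solution_le:
  assumes n: "CARD('n::finite) = 2"
  obtains C where "C > 0"
    "\<And>(F :: real ^ 'n \<Rightarrow> real ^ 'n) f L. div_bounded F f L \<Longrightarrow>
      Lp_norm \<infinity> (helmholtz_solution F) \<le> ennreal (C * L)"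
proof -
  obtain C where C: "C > 0"
    "\<And>(F :: real ^ 'n \<Rightarrow> real ^ 'n) f L i. div_bounded F f L \<Longrightarrow>
      AE x in lborel. \<bar>heat.potential (\<lambda>y. F y $ i) x\<bar> \<le> C * L"
  proof (rule planar_sup_bound[OF n])
    fix C :: real
    assume C0: "C > 0" and C: "\<And>(F :: real ^ 'n \<Rightarrow> real ^ 'n) f L i. integrable lborel F \<Longrightarrow> integrable lborel f \<Longrightarrow>
      (\<And>\<phi>. test_function \<phi> \<Longrightarrow> (\<integral>x. F x \<bullet> grad \<phi> x \<partial>lborel) = - (\<integral>x. f x * \<phi> x \<partial>lborel)) \<Longrightarrow>
      (\<integral>x. norm (F x) \<partial>lborel) \<le> L \<Longrightarrow> (\<integral>x. \<bar>f x\<bar> \<partial>lborel) \<le> L \<Longrightarrow>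
      AE x in lborel. \<bar>heat.potential (\<lambda>y. F y $ i) x\<bar> \<le> C * L"
    show ?thesis
    proof (rule that[OF C0])
      fix F :: "real ^ 'n \<Rightarrow> real ^ 'n" and f L i
      assume Ff: "div_bounded F f L"
      show "AE x in lborel. \<bar>heat.potential (\<lambda>y. F y $ i) x\<bar> \<le> C * L"
        by (rule C[of F f]) (use Ff in \<open>simp_all add: div_bounded_def\<close>)
    qed
  qed
  show ?thesis
  \<comment> \<open>The factor 2 is the number of components, since the norm is bounded by their
    sum.\<close>
  proof (rule that[of "2 * C"])
    show "2 * C > 0" using C(1) by simp
    fix F :: "real ^ 'n \<Rightarrow> real ^ 'n" and f L
    assume Ff: "div_bounded F f L"
    then have F: "integrable lborel F" by (simp add: div_bounded_def)
    have "AE x in lborel. \<forall>i\<in>UNIV. \<bar>heat.potential (\<lambda>y. F y $ i) x\<bar> \<le> C * L"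
      by (intro AE_finite_allI C(2)[OF Ff]) auto
    then have "AE x in lborel. ennreal (norm (helmholtz_solution F x)) \<le> ennreal (2 * C * L)"
    proof eventually_elim
      fix x assume x: "\<forall>i\<in>UNIV. \<bar>heat.potential (\<lambda>y. F y $ i) x\<bar> \<le> C * L"
      have "norm (helmholtz_solution F x) \<le> (\<Sum>i\<in>UNIV. \<bar>heat.potential (\<lambda>y. F y $ i) x\<bar>)"
        using norm_vec_le_sum[of "helmholtz_solution F x"] by (simp add: helmholtz_solution_def)
      also have "\<dots> \<le> of_nat CARD('n) * (C * L)" by (rule sum_bounded_above) (use x in auto)
      finally show "ennreal (norm (helmholtz_solution F x)) \<le> ennreal (2 * C * L)"
        using n by (intro ennreal_leI) (simp add: mult.assoc)
    qed
    then have ae: "AE x in lebesgue. ennreal (norm (helmholtz_solution F x)) \<le> ennreal (2 * C * L)"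
      by (rule AE_completion)
    have "helmholtz_solution F \<in> borel_measurable borel" using integrable_helmholtz_solution[OF F] by auto
    then have "helmholtz_solution F \<in> borel_measurable lebesgue" by (rule borel_imp_lebesgue_measurable)
    then have "(\<lambda>x. ennreal (norm (helmholtz_solution F x))) \<in> borel_measurable lebesgue" by measurable
    from esssup_I[OF this ae] show "Lp_norm \<infinity> (helmholtz_solution F) \<le> ennreal (2 * C * L)"
      by (simp add: Lp_norm_def)
  qed
qed

text \<open>\<open>L\<close> is taken to be the sum of the two norms: it bounds each of them, and an
  estimate in terms of \<open>L\<close> is already the required one.\<close>

lemma L1_data:
  fixes F :: "real ^ 'n \<Rightarrow> real ^ 'n" and divF :: "real ^ 'n \<Rightarrow> real"
  assumes F: "in_Lp 1 F" and d: "has_distr_div F divF" and f: "in_Lp 1 divF"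
  obtains F' f' L where "div_bounded F' f' L" "AE x in lebesgue. F x = F' x" "Lp_norm 1 F + Lp_norm 1 divF = ennreal L"
proof -
  have m: "F \<in> borel_measurable lebesgue" "divF \<in> borel_measurable lebesgue"
    using F f by (simp_all add: in_Lp_def)
  obtain F' where F': "F' \<in> borel_measurable borel" "AE x in lebesgue. F x = F' x"
    using borel_representative_vec[OF m(1)] by blast
  obtain f' where f': "f' \<in> borel_measurable borel" "AE x in lebesgue. divF x = f' x"
    using borel_representative_real[OF m(2)] by blast
  have "0 \<le> (\<integral>x. norm (F' x) \<partial>lborel)" "0 \<le> (\<integral>x. norm (f' x) \<partial>lborel)"
    by (intro integral_nonneg_AE; simp)+
  then have N: "(\<integral>x. norm (F' x) \<partial>lborel) \<le> (\<integral>x. norm (F' x) \<partial>lborel) + (\<integral>x. norm (f' x) \<partial>lborel)"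
    "(\<integral>x. \<bar>f' x\<bar> \<partial>lborel) \<le> (\<integral>x. norm (F' x) \<partial>lborel) + (\<integral>x. norm (f' x) \<partial>lborel)"
    "Lp_norm 1 F + Lp_norm 1 divF = ennreal ((\<integral>x. norm (F' x) \<partial>lborel) + (\<integral>x. norm (f' x) \<partial>lborel))"
    by (simp_all add: in_L1_representative(2)[OF F F'] in_L1_representative(2)[OF f f'] ennreal_plus)
  have pair: "(\<integral>x. F' x \<bullet> grad \<phi> x \<partial>lborel) = - (\<integral>x. f' x * \<phi> x \<partial>lborel)"
    if \<phi>: "test_function \<phi>" for \<phi>
  proof -
    have \<phi>m: "\<phi> \<in> borel_measurable borel" using test_function_integrable[OF \<phi>] by auto
    have gm: "grad \<phi> \<in> borel_measurable borel"
      by (rule borel_measurable_continuous_onI[OF test_function_grad_continuous[OF \<phi>]])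
    have "(\<integral>x. F' x \<bullet> grad \<phi> x \<partial>lborel) = (\<integral>x. F x \<bullet> grad \<phi> x \<partial>lebesgue)"
    proof (rule integral_lebesgue_eq_lborel[symmetric])
      show "(\<lambda>x. F x \<bullet> grad \<phi> x) \<in> borel_measurable lebesgue"
        by (rule borel_measurable_inner[OF m(1) borel_imp_lebesgue_measurable[OF gm]])
      show "(\<lambda>x. F' x \<bullet> grad \<phi> x) \<in> borel_measurable borel"
        by (rule borel_measurable_inner[OF F'(1) gm])
      show "AE x in lebesgue. F x \<bullet> grad \<phi> x = F' x \<bullet> grad \<phi> x" using F'(2) by eventually_elim simp
    qed
    also have "\<dots> = - (\<integral>x. divF x * \<phi> x \<partial>lebesgue)"
      using d \<phi> unfolding has_distr_div_def grad_def by blast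
    also have "(\<integral>x. divF x * \<phi> x \<partial>lebesgue) = (\<integral>x. f' x * \<phi> x \<partial>lborel)"
    proof (rule integral_lebesgue_eq_lborel)
      show "(\<lambda>x. divF x * \<phi> x) \<in> borel_measurable lebesgue"
        by (rule borel_measurable_times[OF m(2) borel_imp_lebesgue_measurable[OF \<phi>m]])
      show "(\<lambda>x. f' x * \<phi> x) \<in> borel_measurable borel"
        by (rule borel_measurable_times[OF f'(1) \<phi>m])
      show "AE x in lebesgue. divF x * \<phi> x = f' x * \<phi> x" using f'(2) by eventually_elim simp
    qed
    finally show ?thesis .
  qed
  have "div_bounded F' f' ((\<integral>x. norm (F' x) \<partial>lborel) + (\<integral>x. norm (f' x) \<partial>lborel))"
    unfolding div_bounded_def
    by (intro conjI allI impI in_L1_representative(1)[OF F F'] in_L1_representative(1)[OF f f'] pair N(1,2))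
  from that[OF this F'(2) N(3)] show ?thesis .
qed

lemma in_LpI:
  fixes f :: "real ^ 'n \<Rightarrow> 'b :: {banach, second_countable_topology}"
  assumes "integrable lborel f" "Lp_norm p f \<le> ennreal K"
  shows "in_Lp p f"
  using assms borel_imp_lebesgue_measurable[of f] order.strict_trans1[OF assms(2) ennreal_less_top]
  by (auto simp: in_Lp_def)

theorem theorem1p6:
  assumes "CARD('n :: finite) \<ge> 2"
  shows "\<exists>C :: real. C > 0 \<and>
    (\<forall>(F :: real ^ 'n \<Rightarrow> real ^ 'n) (divF :: real ^ 'n \<Rightarrow> real).
       in_Lp 1 F \<and> has_distr_div F divF \<and> in_Lp 1 divF \<longrightarrow>
       (CARD('n) = 2 \<longrightarrow>
         (\<exists>U DU. solves_system U F \<and> has_distr_grad U DU \<and>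
            in_Lp \<infinity> U \<and> in_Lp 2 DU \<and>
            Lp_norm \<infinity> U + Lp_norm 2 DU \<le> ennreal C * (Lp_norm 1 F + Lp_norm 1 divF) \<and>
            (\<forall>V DV. solves_system V F \<and> has_distr_grad V DV \<and>
               in_Lp \<infinity> V \<and> in_Lp 2 DV \<longrightarrow> (AE x in lebesgue. V x = U x)))) \<and>
       (CARD('n) \<ge> 3 \<longrightarrow>
         (let n = real CARD('n); q = ennreal (n / (n - 2)); r = ennreal (n / (n - 1)) in
          \<exists>U DU. solves_system U F \<and> has_distr_grad U DU \<and>
            in_Lp q U \<and> in_Lp r DU \<and>
            Lp_norm q U + Lp_norm r DU \<le> ennreal C * (Lp_norm 1 F + Lp_norm 1 divF) \<and>
            (\<forall>V DV. solves_system V F \<and> has_distr_grad V DV \<and>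
               in_Lp q V \<and> in_Lp r DV \<longrightarrow> (AE x in lebesgue. V x = U x)))))"
proof -
  let ?n = "real CARD('n)"
  \<comment> \<open>A single exponent for both cases, so that existence, estimate and uniqueness are
    argued once.\<close>
  define p where "p = (if CARD('n) = 2 then \<infinity> else ennreal (?n / (?n - 2)))"
  obtain C1 where C1: "C1 > 0"
    "\<And>(F :: real ^ 'n \<Rightarrow> real ^ 'n) f L. div_bounded F f L \<Longrightarrow>
      Lp_norm p (helmholtz_solution F) \<le> ennreal (C1 * L)"
  proof (cases "CARD('n) = 2")
    case True
    then have p: "p = \<infinity>" by (simp add: p_def)
    show ?thesis using esssup_helmholtz_solution_le[OF True] that unfolding p by blast
  next
    case False
    then have p: "p = ennreal (?n / (?n - 2))" and n: "CARD('n) \<ge> 3" using assms by (simp_all add: p_def)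
    show ?thesis using Lp_norm_helmholtz_solution_le[OF n] that unfolding p by blast
  qed
  obtain C2 where C2: "C2 > 0"
    "\<And>(F :: real ^ 'n \<Rightarrow> real ^ 'n) f L. div_bounded F f L \<Longrightarrow>
      Lp_norm (ennreal (?n / (?n - 1))) (helmholtz_gradient F) \<le> ennreal (C2 * L)"
    using Lp_norm_helmholtz_gradient_le[OF assms] by blast
  have main: "\<exists>U DU. solves_system U F \<and> has_distr_grad U DU \<and>
      in_Lp p U \<and> in_Lp (ennreal (?n / (?n - 1))) DU \<and>
      Lp_norm p U + Lp_norm (ennreal (?n / (?n - 1))) DU \<le> ennreal (C1 + C2) * (Lp_norm 1 F + Lp_norm 1 divF) \<and>
      (\<forall>V DV. solves_system V F \<and> has_distr_grad V DV \<and> in_Lp p V \<and>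
        in_Lp (ennreal (?n / (?n - 1))) DV \<longrightarrow> (AE x in lebesgue. V x = U x))"
    if F: "in_Lp 1 F" and d: "has_distr_div F divF" and f: "in_Lp 1 divF"
    for F :: "real ^ 'n \<Rightarrow> real ^ 'n" and divF
  proof -
    obtain F' f' L where Ff: "div_bounded F' f' L" and ae: "AE x in lebesgue. F x = F' x"
      and LL: "Lp_norm 1 F + Lp_norm 1 divF = ennreal L"
      using L1_data[OF F d f] by metis
    have F': "integrable lborel F'" using Ff by (simp add: div_bounded_def)
    have L: "0 \<le> L" by (rule div_bounded_nonneg[OF Ff])
    let ?U = "helmholtz_solution F'" and ?G = "helmholtz_gradient F'"
    have bU: "Lp_norm p ?U \<le> ennreal (C1 * L)" by (rule C1(2)[OF Ff])
    have bG: "Lp_norm (ennreal (?n / (?n - 1))) ?G \<le> ennreal (C2 * L)" by (rule C2(2)[OF Ff])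
    have sU: "solves_system ?U F"
      using solves_system_helmholtz_solution[OF _ _ F' ae] F d by (simp add: in_Lp_def has_distr_div_def)
    have iU: "integrable lborel ?U" by (rule integrable_helmholtz_solution[OF F'])
    have "Lp_norm p ?U + Lp_norm (ennreal (?n / (?n - 1))) ?G \<le> ennreal (C1 * L) + ennreal (C2 * L)"
      by (rule add_mono[OF bU bG])
    also have "\<dots> = ennreal (C1 + C2) * ennreal L"
      using C1(1) C2(1) L by (simp add: ennreal_mult'[symmetric] ennreal_plus[symmetric] distrib_right del: ennreal_plus)
    finally have le: "Lp_norm p ?U + Lp_norm (ennreal (?n / (?n - 1))) ?G \<le>
        ennreal (C1 + C2) * (Lp_norm 1 F + Lp_norm 1 divF)" by (simp only: LL)
    have uniq: "AE x in lebesgue. V x = ?U x" if V: "solves_system V F" "in_Lp p V" for V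
    proof (cases "CARD('n) = 2")
      case True
      then have "in_Lp \<infinity> V" using V(2) by (simp add: p_def)
      then show ?thesis by (rule solves_system_unique_Linf[OF sU iU V(1)])
    next
      case False
      then have "in_Lp (ennreal (?n / (?n - 2))) V" using V(2) by (simp add: p_def)
      then show ?thesis
        by (rule solves_system_unique_Lp[OF sU iU V(1)]) (use False assms in \<open>simp add: field_simps\<close>)
    qed
    have "in_Lp p ?U" "in_Lp (ennreal (?n / (?n - 1))) ?G"
      by (rule in_LpI[OF iU bU], rule in_LpI[OF integrable_helmholtz_gradient[OF F'] bG])
    with sU le uniq has_distr_grad_helmholtz_solution[OF F'] show ?thesis by blast
  qed
  \<comment> \<open>For \<open>n = 2\<close> the gradient exponent \<open>n / (n - 1)\<close> is 2,
    so the general gradient bound also serves the plane.\<close>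
  have p2: "p = \<infinity>" "ennreal (?n / (?n - 1)) = 2" if "CARD('n) = 2" using that by (simp_all add: p_def)
  have p3: "p = ennreal (?n / (?n - 2))" if "CARD('n) \<ge> 3" using that by (simp add: p_def)
  show ?thesis
  proof (intro exI[of _ "C1 + C2"] conjI allI impI, goal_cases)
    case 1
    show ?case using C1(1) C2(1) by simp
  next
    case (2 F divF)
    then have "in_Lp 1 F" "has_distr_div F divF" "in_Lp 1 divF" by blast+
    from main[OF this] show ?case unfolding p2[OF 2(2)] .
  next
    case (3 F divF)
    then have "in_Lp 1 F" "has_distr_div F divF" "in_Lp 1 divF" by blast+
    from main[OF this] show ?case unfolding p3[OF 3(2)] Let_def .
  qed
qed

end
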